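(* Let $(Q,I)$ be a graded gentle quiver, where $Q$ is neither a loop with a single vertex nor the Kronecker quiver, and let $A=kQ/I$ be its associated graded gentle algebra, which is neither assumed to be homologically smooth nor proper. Choose any spanning tree $T$ of $Q$ and any complete set of representatives $\mathcal P^c$ (resp. $\mathcal Q^c$) of all rotation classes of complete anti-paths (resp. complete paths) in $(Q,I)$. Then for every $n\ge0$ and every $d\in\mathbb Z$, the following elements constitute a $k$-linear (Schauder) basis of $\mathrm{HH}^{n,d}(A,A)$: (1) the unit $\sum_{x\in Q_0}(x,x)$, if $(n,d)=(0,0)$; (2) all elements of the form $\mathcal N^s(p)$, $p\in\mathcal P^c$, $s\in\{0,1\}$, such that $(n,d)=(l(p)+s,-|p|)$ and where $\omega(p)\in2\mathbb Z+s$ or $\operatorname{char}k=2$; (3) all elements of the form $\mathcal N^s(q)$, $q\in\mathcal Q^c$, $s\in\{0,1\}$, such that $(n,d)=(s,|q|)$ and where $\omega(q)\in2\mathbb Z+s$ or $\operatorname{char}k=2$; (4) all elements of the form $(u,u_\odot)$, where $u$ is a maximal anti-path with $u_\odot\ne\emptyset$, and $(n,d)=(l(u),|u_\odot|-|u|)$; (5) all elements of the form $(s(u),u)$, where $u$ is a closed maximal path of $A$ and $(n,d)=(0,|u|)$; (6) all elements of the form $(\alpha,\alpha)$, $\alpha\in Q_1\setminus T_1$, such that $(n,d)=(1,0)$.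
   Context: Graded gentle algebras. $k$ is a field. For a finite quiver $Q$ with vertices $Q_0$, arrows $Q_1$ and source/target maps $s,t$, arrows are composed from right to left: $\beta\alpha$ is a path if $s(\beta)=t(\alpha)$. A path $p=\alpha_1\cdots\alpha_l$ has length $l(p)=l$, $t(p)=t(\alpha_1)$, $s(p)=s(\alpha_l)$; trivial paths have length $0$ and the trivial path at a vertex $x$ is also denoted $x$. A graded gentle quiver $(Q,I)$ is a finite quiver whose arrows are graded by integers, with an ideal $I\subseteq kQ$ generated by paths of length 2 such that: every vertex is the source of at most two and the target of at most two arrows; for every arrow $\alpha$ there is at most one arrow $\beta$ with $s(\beta)=t(\alpha)$, $\beta\alpha\in I$, at most one $\beta$ with $s(\beta)=t(\alpha)$, $\beta\alpha\notin I$, at most one arrow $\gamma$ with $t(\gamma)=s(\alpha)$, $\alpha\gamma\in I$, and at most one $\gamma$ with $t(\gamma)=s(\alpha)$, $\alpha\gamma\notin I$. $|q|$ is the degree of a path $q$. $A$ is homologically smooth if the diagonal bimodule is compact in the derived category of dg bimodules, and proper if it is finite-dimensional. The Kronecker quiver has two vertices and two parallel arrows. Paths and anti-paths. A path $\alpha_1\cdots\alpha_l$ in $Q$ is an anti-path (resp. a path of $A$) if $l=0$ or $\alpha_i\alpha_{i+1}\in I$ (resp. $\notin I$) for all $1\le i<l$. An anti-path (resp. path of $A$) $p$ with $l\ge1$ is complete if $s(p)=t(p)$ and $\alpha_l\alpha_1\in I$ (resp. $\notin I$); powers of complete (anti-)paths are again complete. The rotation of $p$ is $\operatorname{rot}(p)=\alpha_2\cdots\alpha_l\alpha_1$,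 rotation classes are the classes of the equivalence relation generated by $p\sim\operatorname{rot}(p)$, and the period of $p$ is the least $r\ge1$ with $\operatorname{rot}^r(p)=p$. An anti-path (path of $A$) is maximal if it is not properly contained in a longer one. For a maximal anti-path $u$ there is at most one path $u_\odot$ of $A$ with $s(u_\odot)=s(u)$, $t(u_\odot)=t(u)$ whose first and last arrows differ from the first and last arrows of $u$, respectively; write $u_\odot=\emptyset$ if there is none. For a complete anti-path $p$ put $\omega(p)=|p|-l(p)$ and for a complete path $q$ put $\omega(q)=-|q|$. Hochschild cohomology. $C^{n,d}(A)$ is the space of $k$-linear maps $A^{\otimes n}\to A$ homogeneous of degree $d$, with Hochschild differential $C^{n,d}(A)\to C^{n+1,d}(A)$; $\mathrm{HH}^{n,d}(A,A)$ is its cohomology at $C^{n,d}(A)$. It is computed by the Bardzell complex $C_{\mathcal P}(A)$: $\mathcal P_n$ is the set of anti-paths of length $n$, and $C^{n,d}_{\mathcal P}(A)$ has as basis the pairs $(p,q)$ with $p\in\mathcal P_n$, $q\notin I$ a path, $s(p)=s(q)$, $t(p)=t(q)$, $|q|-|p|=d$, with differential $$d(p,q)=(-1)^{d}\Big(\sum_\alpha(-1)^{d|\alpha|}(\alpha p,\alpha q)-\sum_\beta(-1)^n(p\beta,q\beta)\Big),$$ where $\alpha$ (resp. $\beta$) runs over arrows with $\alpha p\in\mathcal P_{n+1}$, $\alpha q\notin I$ (resp. $p\beta\in\mathcal P_{n+1}$, $q\beta\notin I$). For a complete anti-path $p=\alpha_1\cdots\alpha_n$ of period $r$: $$\mathcal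 N^0(p)=\sum_{i=0}^{r-1}(-1)^{in+|p||\alpha_1\cdots\alpha_i|}\big(\operatorname{rot}^i(p),s(\operatorname{rot}^i(p))\big),\qquad\mathcal N^1(p)=(\alpha_np,\alpha_n).$$ For a complete path $q=\beta_1\cdots\beta_n$ of period $r$: $$\mathcal N^0(q)=\sum_{i=0}^{r-1}(-1)^{|q||\beta_1\cdots\beta_i|}\big(s(\operatorname{rot}^i(q)),\operatorname{rot}^i(q)\big),\qquad\mathcal N^1(q)=(\beta_n,\beta_nq).$$ "Schauder" refers to possibly infinite linear combinations: $\mathrm{HH}^i(A,A)=\prod_{n+d=i}\mathrm{HH}^{n,d}(A,A)$ is a product, topologised by the subspaces of elements with vanishing components for $n<j$.
   Formalization: In (2) and (3) the condition "ω ∈ 2ℤ+s or char k = 2" is replaced by "ω even or char k = 2" for both s = 0 and s = 1; as printed the claim fails, e.g. for the oriented 2-cycle with I = 0, degrees 0 and char k = 0, where HH^{1,0} is infinite-dimensional. *)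

theory Defs
  imports Complex_Main "HOL-Library.Poly_Mapping" "HOL-Library.Function_Algebras"
begin

section \<open>Graded gentle quivers\<close>

text \<open>
  A pair \<open>(\<beta>, \<alpha>)\<close> in \<open>relations\<close> stands for the path \<open>\<beta>\<alpha>\<close> (first \<open>\<alpha>\<close>, then \<open>\<beta>\<close>); the ideal \<open>I\<close>
  is generated by these paths of length 2.
\<close>

record ('v, 'a) graded_quiver =
  vertices :: "'v set"
  arrows :: "'a set"
  source :: "'a \<Rightarrow> 'v"
  target :: "'a \<Rightarrow> 'v"
  degree :: "'a \<Rightarrow> int"
  relations :: "('a \<times> 'a) set"

definition graded_gentle_quiver :: "('v, 'a) graded_quiver \<Rightarrow> bool" where
  "graded_gentle_quiver Q \<longleftrightarrow>
     finite (vertices Q) \<and> finite (arrows Q) \<and>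
     source Q ` arrows Q \<subseteq> vertices Q \<and> target Q ` arrows Q \<subseteq> vertices Q \<and>
     relations Q \<subseteq> {(\<beta>, \<alpha>). \<beta> \<in> arrows Q \<and> \<alpha> \<in> arrows Q \<and> source Q \<beta> = target Q \<alpha>} \<and>
     (\<forall>x \<in> vertices Q. card {\<alpha> \<in> arrows Q. source Q \<alpha> = x} \<le> 2 \<and>
                      card {\<alpha> \<in> arrows Q. target Q \<alpha> = x} \<le> 2) \<and>
     (\<forall>\<alpha> \<in> arrows Q.
        card {\<beta> \<in> arrows Q. source Q \<beta> = target Q \<alpha> \<and> (\<beta>, \<alpha>) \<in> relations Q} \<le> 1 \<and>
        card {\<beta> \<in> arrows Q. source Q \<beta> = target Q \<alpha> \<and> (\<beta>, \<alpha>) \<notin> relations Q} \<le> 1 \<and>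
        card {\<gamma> \<in> arrows Q. target Q \<gamma> = source Q \<alpha> \<and> (\<alpha>, \<gamma>) \<in> relations Q} \<le> 1 \<and>
        card {\<gamma> \<in> arrows Q. target Q \<gamma> = source Q \<alpha> \<and> (\<alpha>, \<gamma>) \<notin> relations Q} \<le> 1)"

definition one_vertex_loop :: "('v, 'a) graded_quiver \<Rightarrow> bool" where
  "one_vertex_loop Q \<longleftrightarrow> card (vertices Q) = 1 \<and> card (arrows Q) = 1"

definition kronecker_quiver :: "('v, 'a) graded_quiver \<Rightarrow> bool" where
  "kronecker_quiver Q \<longleftrightarrow>
     (\<exists>x y \<alpha> \<beta>. x \<noteq> y \<and> \<alpha> \<noteq> \<beta> \<and> vertices Q = {x, y} \<and> arrows Q = {\<alpha>, \<beta>} \<and>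
        source Q \<alpha> = x \<and> source Q \<beta> = x \<and> target Q \<alpha> = y \<and> target Q \<beta> = y)"

text \<open>Walks in the underlying undirected graph: every arrow may be traversed in both directions.\<close>

fun undirected_walk :: "('v, 'a) graded_quiver \<Rightarrow> 'v \<Rightarrow> 'a list \<Rightarrow> 'v \<Rightarrow> bool" where
  "undirected_walk Q x [] y \<longleftrightarrow> x = y"
| "undirected_walk Q x (\<alpha> # as) y \<longleftrightarrow>
     source Q \<alpha> = x \<and> undirected_walk Q (target Q \<alpha>) as y \<or>
     target Q \<alpha> = x \<and> undirected_walk Q (source Q \<alpha>) as y"

text \<open>A spanning tree is given by its set of arrows; it is connected and has no undirected cycle.\<close>

definition spanning_tree :: "('v, 'a) graded_quiver \<Rightarrow> 'a set \<Rightarrow> bool" where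
  "spanning_tree Q T \<longleftrightarrow>
     T \<subseteq> arrows Q \<and> vertices Q \<noteq> {} \<and>
     (\<forall>x \<in> vertices Q. \<forall>y \<in> vertices Q. \<exists>as. set as \<subseteq> T \<and> undirected_walk Q x as y) \<and>
     \<not> (\<exists>x as. as \<noteq> [] \<and> distinct as \<and> set as \<subseteq> T \<and> undirected_walk Q x as x)"

section \<open>Paths and anti-paths\<close>

text \<open>
  The path \<open>\<alpha>\<^sub>1\<dots>\<alpha>\<^sub>l\<close>, composed from right to left, is the pair of its source and the list
  \<open>[\<alpha>\<^sub>1, \<dots>, \<alpha>\<^sub>l]\<close>; the trivial path at \<open>x\<close> is \<open>(x, [])\<close>.
\<close>

type_synonym ('v, 'a) path = "'v \<times> 'a list"

definition is_path :: "('v, 'a) graded_quiver \<Rightarrow> ('v, 'a) path \<Rightarrow> bool" where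
  "is_path Q p \<longleftrightarrow> fst p \<in> vertices Q \<and> set (snd p) \<subseteq> arrows Q \<and>
     successively (\<lambda>\<alpha> \<beta>. source Q \<alpha> = target Q \<beta>) (snd p) \<and>
     (snd p \<noteq> [] \<longrightarrow> source Q (last (snd p)) = fst p)"

definition psource :: "('v, 'a) path \<Rightarrow> 'v" where
  "psource p = fst p"

definition ptarget :: "('v, 'a) graded_quiver \<Rightarrow> ('v, 'a) path \<Rightarrow> 'v" where
  "ptarget Q p = (if snd p = [] then fst p else target Q (hd (snd p)))"

definition plength :: "('v, 'a) path \<Rightarrow> nat" where
  "plength p = length (snd p)"

definition pdegree :: "('v, 'a) graded_quiver \<Rightarrow> ('v, 'a) path \<Rightarrow> int" where
  "pdegree Q p = (\<Sum>\<alpha>\<leftarrow>snd p. degree Q \<alpha>)"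

definition trivial :: "'v \<Rightarrow> ('v, 'a) path" where
  "trivial x = (x, [])"

definition arrow_path :: "('v, 'a) graded_quiver \<Rightarrow> 'a \<Rightarrow> ('v, 'a) path" where
  "arrow_path Q \<alpha> = (source Q \<alpha>, [\<alpha>])"

definition composable :: "('v, 'a) graded_quiver \<Rightarrow> ('v, 'a) path \<Rightarrow> ('v, 'a) path \<Rightarrow> bool" where
  "composable Q p q \<longleftrightarrow> psource p = ptarget Q q"

definition pcomp :: "('v, 'a) path \<Rightarrow> ('v, 'a) path \<Rightarrow> ('v, 'a) path" where
  "pcomp p q = (psource q, snd p @ snd q)"

definition parallel :: "('v, 'a) graded_quiver \<Rightarrow> ('v, 'a) path \<Rightarrow> ('v, 'a) path \<Rightarrow> bool" where
  "parallel Q p q \<longleftrightarrow> psource p = psource q \<and> ptarget Q p = ptarget Q q"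

definition anti_path :: "('v, 'a) graded_quiver \<Rightarrow> ('v, 'a) path \<Rightarrow> bool" where
  "anti_path Q p \<longleftrightarrow> is_path Q p \<and> successively (\<lambda>\<alpha> \<beta>. (\<alpha>, \<beta>) \<in> relations Q) (snd p)"

definition path_of_A :: "('v, 'a) graded_quiver \<Rightarrow> ('v, 'a) path \<Rightarrow> bool" where
  "path_of_A Q p \<longleftrightarrow> is_path Q p \<and> successively (\<lambda>\<alpha> \<beta>. (\<alpha>, \<beta>) \<notin> relations Q) (snd p)"

definition complete_anti_path :: "('v, 'a) graded_quiver \<Rightarrow> ('v, 'a) path \<Rightarrow> bool" where
  "complete_anti_path Q p \<longleftrightarrow> anti_path Q p \<and> plength p \<ge> 1 \<and> psource p = ptarget Q p \<and>
     (last (snd p), hd (snd p)) \<in> relations Q"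

definition complete_path :: "('v, 'a) graded_quiver \<Rightarrow> ('v, 'a) path \<Rightarrow> bool" where
  "complete_path Q p \<longleftrightarrow> path_of_A Q p \<and> plength p \<ge> 1 \<and> psource p = ptarget Q p \<and>
     (last (snd p), hd (snd p)) \<notin> relations Q"

definition maximal_anti_path :: "('v, 'a) graded_quiver \<Rightarrow> ('v, 'a) path \<Rightarrow> bool" where
  "maximal_anti_path Q u \<longleftrightarrow> anti_path Q u \<and>
     (\<forall>p q. composable Q p u \<and> composable Q u q \<and> anti_path Q (pcomp p (pcomp u q)) \<longrightarrow>
        pcomp p (pcomp u q) = u)"

definition maximal_path :: "('v, 'a) graded_quiver \<Rightarrow> ('v, 'a) path \<Rightarrow> bool" where
  "maximal_path Q u \<longleftrightarrow> path_of_A Q u \<and>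
     (\<forall>p q. composable Q p u \<and> composable Q u q \<and> path_of_A Q (pcomp p (pcomp u q)) \<longrightarrow>
        pcomp p (pcomp u q) = u)"

text \<open>
  \<open>odot Q u q\<close> says \<open>u\<^sub>\<odot> = q\<close>. A trivial path has no first and no last arrow, so that \<open>q\<close> may be trivial
  (as for a loop \<open>u\<close> whose square is not in \<open>I\<close>).
\<close>

definition odot :: "('v, 'a) graded_quiver \<Rightarrow> ('v, 'a) path \<Rightarrow> ('v, 'a) path \<Rightarrow> bool" where
  "odot Q u q \<longleftrightarrow> path_of_A Q q \<and> parallel Q q u \<and>
     (snd q \<noteq> [] \<and> snd u \<noteq> [] \<longrightarrow> hd (snd q) \<noteq> hd (snd u) \<and> last (snd q) \<noteq> last (snd u))"

text \<open>Rotation is only meant for closed paths of positive length.\<close>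

definition rot :: "('v, 'a) graded_quiver \<Rightarrow> ('v, 'a) path \<Rightarrow> ('v, 'a) path" where
  "rot Q p = (if snd p = [] then p else (source Q (hd (snd p)), rotate1 (snd p)))"

definition period :: "('v, 'a) graded_quiver \<Rightarrow> ('v, 'a) path \<Rightarrow> nat" where
  "period Q p = (LEAST r. r \<ge> 1 \<and> (rot Q ^^ r) p = p)"

definition rotation_representatives ::
  "('v, 'a) graded_quiver \<Rightarrow> ('v, 'a) path set \<Rightarrow> ('v, 'a) path set \<Rightarrow> bool" where
  "rotation_representatives Q S R \<longleftrightarrow>
     R \<subseteq> S \<and> (\<forall>p \<in> S. \<exists>!r. r \<in> R \<and> equivclp (\<lambda>p q. p \<in> S \<and> q = rot Q p) p r)"

definition omega_anti :: "('v, 'a) graded_quiver \<Rightarrow> ('v, 'a) path \<Rightarrow> int" where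
  "omega_anti Q p = pdegree Q p - int (plength p)"

definition omega_path :: "('v, 'a) graded_quiver \<Rightarrow> ('v, 'a) path \<Rightarrow> int" where
  "omega_path Q q = - pdegree Q q"

section \<open>The algebra of a graded gentle quiver\<close>

definition smult :: "'k::field \<Rightarrow> ('b \<Rightarrow>\<^sub>0 'k) \<Rightarrow> ('b \<Rightarrow>\<^sub>0 'k)" where
  "smult c f = Poly_Mapping.map ((*) c) f"

definition path_algebra :: "('v, 'a) graded_quiver \<Rightarrow> (('v, 'a) path \<Rightarrow>\<^sub>0 'k::field) set" where
  "path_algebra Q = {f. \<forall>p \<in> Poly_Mapping.keys f. is_path Q p}"

definition path_mult :: "('v, 'a) graded_quiver \<Rightarrow> (('v, 'a) path \<Rightarrow>\<^sub>0 'k::field) \<Rightarrow>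
    (('v, 'a) path \<Rightarrow>\<^sub>0 'k) \<Rightarrow> (('v, 'a) path \<Rightarrow>\<^sub>0 'k)" where
  "path_mult Q f g =
     (\<Sum>p \<in> Poly_Mapping.keys f. \<Sum>q \<in> Poly_Mapping.keys g.
        if composable Q p q
        then Poly_Mapping.single (pcomp p q) (Poly_Mapping.lookup f p * Poly_Mapping.lookup g q)
        else 0)"

inductive_set ideal_I :: "('v, 'a) graded_quiver \<Rightarrow> (('v, 'a) path \<Rightarrow>\<^sub>0 'k::field) set"
  for Q :: "('v, 'a) graded_quiver" where
  zero: "0 \<in> ideal_I Q"
| gen: "(\<beta>, \<alpha>) \<in> relations Q \<Longrightarrow> f \<in> path_algebra Q \<Longrightarrow> g \<in> path_algebra Q \<Longrightarrow>
    path_mult Q f (path_mult Q (Poly_Mapping.single (source Q \<alpha>, [\<beta>, \<alpha>]) 1) g) \<in> ideal_I Q"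
| add: "f \<in> ideal_I Q \<Longrightarrow> g \<in> ideal_I Q \<Longrightarrow> f + g \<in> ideal_I Q"

text \<open>
  \<open>A = kQ/I\<close> is realised on the \<open>k\<close>-basis of paths not in \<open>I\<close>: \<open>reduce\<close> sends an element of \<open>kQ\<close> to the
  unique element congruent to it modulo \<open>I\<close> in the span of these paths. See the lemmas
  \<open>reduce_path_mult\<close> and \<open>reduce_eq_0_iff\<close> below.
\<close>

definition reduce :: "('v, 'a) graded_quiver \<Rightarrow> (('v, 'a) path \<Rightarrow>\<^sub>0 'k::field) \<Rightarrow>
    (('v, 'a) path \<Rightarrow>\<^sub>0 'k)" where
  "reduce Q f =
     (\<Sum>p \<in> {p \<in> Poly_Mapping.keys f. path_of_A Q p}. Poly_Mapping.single p (Poly_Mapping.lookup f p))"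

definition alg :: "('v, 'a) graded_quiver \<Rightarrow> (('v, 'a) path \<Rightarrow>\<^sub>0 'k::field) set" where
  "alg Q = {f. \<forall>p \<in> Poly_Mapping.keys f. path_of_A Q p}"

definition alg_mult :: "('v, 'a) graded_quiver \<Rightarrow> (('v, 'a) path \<Rightarrow>\<^sub>0 'k::field) \<Rightarrow>
    (('v, 'a) path \<Rightarrow>\<^sub>0 'k) \<Rightarrow> (('v, 'a) path \<Rightarrow>\<^sub>0 'k)" where
  "alg_mult Q f g = reduce Q (path_mult Q f g)"

definition alg_degree :: "('v, 'a) graded_quiver \<Rightarrow> int \<Rightarrow> (('v, 'a) path \<Rightarrow>\<^sub>0 'k::field) set" where
  "alg_degree Q e = {f \<in> alg Q. \<forall>p \<in> Poly_Mapping.keys f. pdegree Q p = e}"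

lemma lookup_reduce:
  "Poly_Mapping.lookup (reduce Q f) p = (if path_of_A Q p then Poly_Mapping.lookup f p else 0)"
proof -
  have "Poly_Mapping.lookup (reduce Q f) p =
      (\<Sum>q \<in> {q \<in> Poly_Mapping.keys f. path_of_A Q q}. if q = p then Poly_Mapping.lookup f q else 0)"
    unfolding reduce_def by (auto simp: lookup_sum lookup_single when_def intro!: sum.cong)
  also have "\<dots> = (if path_of_A Q p then Poly_Mapping.lookup f p else 0)"
    by (auto simp: sum.delta in_keys_iff)
  finally show ?thesis .
qed

lemma lookup_path_mult:
  assumes "finite F" "Poly_Mapping.keys f \<subseteq> F" "finite G" "Poly_Mapping.keys g \<subseteq> G"
  shows "Poly_Mapping.lookup (path_mult Q f g) r =
    (\<Sum>p\<in>F. \<Sum>q\<in>G. if composable Q p q \<and> pcomp p q = r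
       then Poly_Mapping.lookup f p * Poly_Mapping.lookup g q else 0)"
proof -
  let ?h = "\<lambda>p q. if composable Q p q \<and> pcomp p q = r
       then Poly_Mapping.lookup f p * Poly_Mapping.lookup g q else 0"
  have "Poly_Mapping.lookup (path_mult Q f g) r =
    (\<Sum>p\<in>Poly_Mapping.keys f. \<Sum>q\<in>Poly_Mapping.keys g. ?h p q)"
    unfolding path_mult_def lookup_sum
    by (intro sum.cong refl) (auto simp: lookup_single when_def)
  also have "\<dots> = (\<Sum>p\<in>Poly_Mapping.keys f. \<Sum>q\<in>G. ?h p q)"
    using assms by (intro sum.cong refl sum.mono_neutral_left) (auto simp: in_keys_iff)
  also have "\<dots> = (\<Sum>p\<in>F. \<Sum>q\<in>G. ?h p q)"
    using assms by (intro sum.mono_neutral_left) (auto simp: in_keys_iff intro!: sum.neutral)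
  finally show ?thesis .
qed

lemma path_of_A_factors:
  assumes "path_of_A Q (pcomp p q)" "is_path Q p" "is_path Q q"
  shows "path_of_A Q p \<and> path_of_A Q q"
  using assms by (auto simp: path_of_A_def pcomp_def successively_append_iff)

theorem reduce_path_mult:
  fixes f g :: "('v, 'a) path \<Rightarrow>\<^sub>0 'k::field"
  assumes "f \<in> path_algebra Q" "g \<in> path_algebra Q"
  shows "reduce Q (path_mult Q f g) = alg_mult Q (reduce Q f) (reduce Q g)"
proof (rule poly_mapping_eqI)
  fix r
  let ?F = "Poly_Mapping.keys f" and ?G = "Poly_Mapping.keys g"
  have sub: "Poly_Mapping.keys (reduce Q h) \<subseteq> Poly_Mapping.keys h" for h :: "('v, 'a) path \<Rightarrow>\<^sub>0 'k"
    by (auto simp: in_keys_iff lookup_reduce split: if_splits)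
  show "Poly_Mapping.lookup (reduce Q (path_mult Q f g)) r =
        Poly_Mapping.lookup (alg_mult Q (reduce Q f) (reduce Q g)) r"
  proof (cases "path_of_A Q r")
    case True
    have "path_of_A Q p \<and> path_of_A Q q" if "pcomp p q = r" "p \<in> ?F" "q \<in> ?G" for p q
      using path_of_A_factors[of Q p q] that True assms by (auto simp: path_algebra_def)
    then have "(\<Sum>p\<in>?F. \<Sum>q\<in>?G. if composable Q p q \<and> pcomp p q = r
          then Poly_Mapping.lookup f p * Poly_Mapping.lookup g q else 0) =
        (\<Sum>p\<in>?F. \<Sum>q\<in>?G. if composable Q p q \<and> pcomp p q = r
          then Poly_Mapping.lookup (reduce Q f) p * Poly_Mapping.lookup (reduce Q g) q else 0)"
      by (intro sum.cong refl) (auto simp: lookup_reduce)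
    then show ?thesis
      using True lookup_path_mult[of ?F f ?G g Q r]
        lookup_path_mult[of ?F "reduce Q f" ?G "reduce Q g" Q r] sub[of f] sub[of g]
      by (simp add: alg_mult_def lookup_reduce)
  next
    case False
    then show ?thesis by (simp add: alg_mult_def lookup_reduce)
  qed
qed

lemma reduce_add: "reduce Q (f + g) = reduce Q f + reduce Q g"
  by (rule poly_mapping_eqI) (simp add: lookup_reduce lookup_add)

lemma path_mult_single:
  "path_mult Q (Poly_Mapping.single p a) (Poly_Mapping.single q b) =
     (if composable Q p q then Poly_Mapping.single (pcomp p q) (a * b) else 0)"
  by (auto simp: path_mult_def)

lemma keys_path_mult:
  assumes "r \<in> Poly_Mapping.keys (path_mult Q f g)"
  obtains p q where "p \<in> Poly_Mapping.keys f" "q \<in> Poly_Mapping.keys g" "r = pcomp p q"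
proof -
  have "(\<Sum>p\<in>Poly_Mapping.keys f. \<Sum>q\<in>Poly_Mapping.keys g.
      if composable Q p q \<and> pcomp p q = r
      then Poly_Mapping.lookup f p * Poly_Mapping.lookup g q else 0) \<noteq> 0"
    using assms lookup_path_mult[OF finite_keys order_refl finite_keys order_refl, of Q f g r]
    by (simp add: in_keys_iff)
  then obtain p where p: "p \<in> Poly_Mapping.keys f" "(\<Sum>q\<in>Poly_Mapping.keys g.
      if composable Q p q \<and> pcomp p q = r
      then Poly_Mapping.lookup f p * Poly_Mapping.lookup g q else 0) \<noteq> 0"
    by (rule sum.not_neutral_contains_not_neutral)
  from p(2) obtain q where "q \<in> Poly_Mapping.keys g" "pcomp p q = r"
    by (rule sum.not_neutral_contains_not_neutral) (auto split: if_splits)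
  with p(1) that show thesis by blast
qed

lemma not_path_of_A_single_in_ideal:
  fixes c :: "'k::field"
  assumes "is_path Q p" "\<not> path_of_A Q p" "graded_gentle_quiver Q"
  shows "Poly_Mapping.single p c \<in> ideal_I Q"
proof -
  have "\<exists>xs \<beta> \<alpha> ys. w = xs @ \<beta> # \<alpha> # ys \<and> (\<beta>, \<alpha>) \<in> relations Q"
    if "\<not> successively (\<lambda>\<alpha> \<beta>. (\<alpha>, \<beta>) \<notin> relations Q) w" for w
    using that
  proof (induction w rule: induct_list012)
    case (3 x y zs)
    show ?case
    proof (cases "(x, y) \<in> relations Q")
      case True
      then show ?thesis by (metis append_Nil)
    next
      case False
      with 3 show ?thesis by (metis append_Cons successively.simps(3))
    qed
  qed auto
  moreover have "\<not> successively (\<lambda>\<alpha> \<beta>. (\<alpha>, \<beta>) \<notin> relations Q) (snd p)"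
    using assms by (simp add: path_of_A_def)
  ultimately obtain xs \<beta> \<alpha> ys
    where w: "snd p = xs @ \<beta> # \<alpha> # ys" "(\<beta>, \<alpha>) \<in> relations Q"
    by blast
  let ?l = "(source Q \<beta>, [\<beta>, \<alpha>])"
  define p1 where "p1 = (target Q \<beta>, xs)"
  define p2 where "p2 = (fst p, ys)"
  have tgt: "source Q \<alpha> = ptarget Q p2"
    using assms(1) w(1)
    by (cases ys) (auto simp: is_path_def p2_def ptarget_def successively_append_iff)
  have c2: "composable Q (source Q \<alpha>, [\<beta>, \<alpha>]) p2"
    using tgt by (simp add: composable_def psource_def)
  have c1: "composable Q p1 (pcomp (source Q \<alpha>, [\<beta>, \<alpha>]) p2)"
    by (simp add: composable_def psource_def p1_def pcomp_def ptarget_def)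
  have p: "pcomp p1 (pcomp (source Q \<alpha>, [\<beta>, \<alpha>]) p2) = p"
    using w(1) by (cases p) (simp add: pcomp_def p1_def p2_def psource_def)
  have "target Q \<beta> \<in> vertices Q"
    using assms(1,3) w(1) by (auto simp: is_path_def graded_gentle_quiver_def)
  then have i1: "is_path Q p1"
    using assms(1) w(1) by (auto simp: is_path_def p1_def successively_append_iff)
  have i2: "is_path Q p2"
    using assms(1) w(1)
    by (auto simp: is_path_def p2_def successively_append_iff successively_Cons)
  have "path_mult Q (Poly_Mapping.single p1 c)
      (path_mult Q (Poly_Mapping.single (source Q \<alpha>, [\<beta>, \<alpha>]) 1) (Poly_Mapping.single p2 1)) =
      Poly_Mapping.single p c"
    using c1 c2 p by (simp add: path_mult_single)
  moreover have "Poly_Mapping.single p1 c \<in> path_algebra Q"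
      "(Poly_Mapping.single p2 1 :: _ \<Rightarrow>\<^sub>0 'k) \<in> path_algebra Q"
    using i1 i2 by (auto simp: path_algebra_def)
  ultimately show ?thesis
    using ideal_I.gen[OF w(2)] by metis
qed

theorem reduce_eq_0_iff:
  fixes f :: "('v, 'a) path \<Rightarrow>\<^sub>0 'k::field"
  assumes "graded_gentle_quiver Q" "f \<in> path_algebra Q"
  shows "reduce Q f = 0 \<longleftrightarrow> f \<in> ideal_I Q"
proof
  assume "f \<in> ideal_I Q"
  then show "reduce Q f = 0"
  proof induction
    case zero
    show ?case by (simp add: reduce_def)
  next
    case (gen \<beta> \<alpha> f g)
    have "\<not> path_of_A Q r" if r: "r \<in> Poly_Mapping.keys
      (path_mult Q f (path_mult Q (Poly_Mapping.single (source Q \<alpha>, [\<beta>, \<alpha>]) 1) g))" for r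
    proof -
      obtain p s where "s \<in> Poly_Mapping.keys
          (path_mult Q (Poly_Mapping.single (source Q \<alpha>, [\<beta>, \<alpha>]) 1) g)" and rp: "r = pcomp p s"
        using r by (rule keys_path_mult)
      then obtain q where "s = pcomp (source Q \<alpha>, [\<beta>, \<alpha>]) q"
        by (elim keys_path_mult) auto
      with rp gen show ?thesis
        by (auto simp: path_of_A_def pcomp_def successively_append_iff)
    qed
    then show ?case
      by (intro poly_mapping_eqI) (auto simp: lookup_reduce in_keys_iff)
  next
    case (add f g)
    then show ?case by (simp add: reduce_add)
  qed
next
  assume 0: "reduce Q f = 0"
  have not_path: "\<not> path_of_A Q p" if "p \<in> Poly_Mapping.keys f" for p
    using arg_cong[OF 0, of "\<lambda>g. Poly_Mapping.lookup g p"] that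
    by (auto simp: lookup_reduce in_keys_iff split: if_splits)
  have sum: "(\<Sum>p\<in>S. h p) \<in> ideal_I Q" if "finite S" "\<And>p. p \<in> S \<Longrightarrow> h p \<in> ideal_I Q"
    for S and h :: "_ \<Rightarrow> ('v, 'a) path \<Rightarrow>\<^sub>0 'k"
    using that by (induction S rule: finite_induct) (auto intro: ideal_I.intros)
  have "f = (\<Sum>p \<in> Poly_Mapping.keys f. Poly_Mapping.single p (Poly_Mapping.lookup f p))"
    by (rule poly_mapping_eqI) (simp add: lookup_sum lookup_single when_def in_keys_iff)
  also have "\<dots> \<in> ideal_I Q"
    using assms not_path
    by (intro sum not_path_of_A_single_in_ideal) (auto simp: path_algebra_def)
  finally show "f \<in> ideal_I Q" .
qed

section \<open>Hochschild cohomology\<close>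

text \<open>
  \<open>C\<^sup>n\<^sup>,\<^sup>d(A)\<close>: a \<open>k\<close>-linear map from the \<open>n\<close>-fold tensor power of \<open>A\<close> to \<open>A\<close> is given by an \<open>n\<close>-linear map
  on lists of length \<open>n\<close>, extended by \<open>0\<close> to all other arguments.
\<close>

definition hoch_cochains ::
  "('v, 'a) graded_quiver \<Rightarrow> nat \<Rightarrow> int \<Rightarrow>
    ((('v, 'a) path \<Rightarrow>\<^sub>0 'k::field) list \<Rightarrow> (('v, 'a) path \<Rightarrow>\<^sub>0 'k)) set" where
  "hoch_cochains Q n d = {\<phi>.
     (\<forall>xs. \<phi> xs \<in> alg Q) \<and>
     (\<forall>xs. \<not> (length xs = n \<and> set xs \<subseteq> alg Q) \<longrightarrow> \<phi> xs = 0) \<and>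
     (\<forall>xs i x y. length xs = n \<and> set xs \<subseteq> alg Q \<and> i < n \<and> x \<in> alg Q \<and> y \<in> alg Q \<longrightarrow>
        \<phi> (xs[i := x + y]) = \<phi> (xs[i := x]) + \<phi> (xs[i := y])) \<and>
     (\<forall>xs i c x. length xs = n \<and> set xs \<subseteq> alg Q \<and> i < n \<and> x \<in> alg Q \<longrightarrow>
        \<phi> (xs[i := smult c x]) = smult c (\<phi> (xs[i := x]))) \<and>
     (\<forall>xs es. length xs = n \<and> list_all2 (\<lambda>x e. x \<in> alg_degree Q e) xs es \<longrightarrow>
        \<phi> xs \<in> alg_degree Q (sum_list es + d))}"

text \<open>
  \<open>koszul_sign Q d\<close> multiplies a homogeneous element \<open>a\<close> by \<open>(-1)\<^bsup>d|a|\<^esup>\<close>, the sign of moving a map of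
  degree \<open>d\<close> past \<open>a\<close>. The Hochschild differential is normalised by a global sign \<open>(-1)\<^sup>d\<close>, as is the
  differential of the Bardzell complex.
\<close>

definition koszul_sign :: "('v, 'a) graded_quiver \<Rightarrow> int \<Rightarrow> (('v, 'a) path \<Rightarrow>\<^sub>0 'k::field) \<Rightarrow>
    (('v, 'a) path \<Rightarrow>\<^sub>0 'k)" where
  "koszul_sign Q d f = (\<Sum>p \<in> Poly_Mapping.keys f.
     Poly_Mapping.single p ((-1) powi (d * pdegree Q p) * Poly_Mapping.lookup f p))"

definition hoch_diff ::
  "('v, 'a) graded_quiver \<Rightarrow> nat \<Rightarrow> int \<Rightarrow>
    ((('v, 'a) path \<Rightarrow>\<^sub>0 'k::field) list \<Rightarrow> (('v, 'a) path \<Rightarrow>\<^sub>0 'k)) \<Rightarrow>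
    ((('v, 'a) path \<Rightarrow>\<^sub>0 'k) list \<Rightarrow> (('v, 'a) path \<Rightarrow>\<^sub>0 'k))" where
  "hoch_diff Q n d \<phi> = (\<lambda>xs.
     if length xs = Suc n \<and> set xs \<subseteq> alg Q
     then smult ((-1) powi d)
       (alg_mult Q (koszul_sign Q d (hd xs)) (\<phi> (tl xs))
        + (\<Sum>i = 1..n. smult ((-1) ^ i)
             (\<phi> (take (i - 1) xs @ [alg_mult Q (xs ! (i - 1)) (xs ! i)] @ drop (i + 1) xs)))
        + smult ((-1) ^ (n + 1)) (alg_mult Q (\<phi> (butlast xs)) (last xs)))
     else 0)"

definition hoch_cocycles ::
  "('v, 'a) graded_quiver \<Rightarrow> nat \<Rightarrow> int \<Rightarrow>
    ((('v, 'a) path \<Rightarrow>\<^sub>0 'k::field) list \<Rightarrow> (('v, 'a) path \<Rightarrow>\<^sub>0 'k)) set" where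
  "hoch_cocycles Q n d = {\<phi> \<in> hoch_cochains Q n d. hoch_diff Q n d \<phi> = 0}"

definition hoch_coboundaries ::
  "('v, 'a) graded_quiver \<Rightarrow> nat \<Rightarrow> int \<Rightarrow>
    ((('v, 'a) path \<Rightarrow>\<^sub>0 'k::field) list \<Rightarrow> (('v, 'a) path \<Rightarrow>\<^sub>0 'k)) set" where
  "hoch_coboundaries Q n d =
     (case n of 0 \<Rightarrow> {0} | Suc m \<Rightarrow> hoch_diff Q m d ` hoch_cochains Q m d)"

definition quotient_space :: "'b::ab_group_add set \<Rightarrow> 'b set \<Rightarrow> 'b set set" where
  "quotient_space Z B = (\<lambda>z. (+) z ` B) ` Z"

text \<open>
  \<open>X\<close> is a \<open>k\<close>-linear basis of the space \<open>V\<close> of cosets: every \<open>h \<in> V\<close> is a unique finite linear combination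
  of elements of \<open>X\<close>. Linear combinations of cosets are computed on representatives; the sum lies in the
  coset \<open>h\<close> iff \<open>h\<close> is that linear combination.
\<close>

definition coset_basis ::
  "('k::field \<Rightarrow> 'b \<Rightarrow> 'b) \<Rightarrow> 'b::ab_group_add set set \<Rightarrow> 'b set set \<Rightarrow> bool" where
  "coset_basis scale V X \<longleftrightarrow>
     X \<subseteq> V \<and>
     (\<forall>h \<in> V. \<exists>!c :: 'b set \<Rightarrow> 'k.
        finite {x. c x \<noteq> 0} \<and> {x. c x \<noteq> 0} \<subseteq> X \<and>
        (\<Sum>x \<in> {x. c x \<noteq> 0}. scale (c x) (SOME z. z \<in> x)) \<in> h)"

definition HH ::
  "('v, 'a) graded_quiver \<Rightarrow> nat \<Rightarrow> int \<Rightarrow>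
    ((('v, 'a) path \<Rightarrow>\<^sub>0 'k::field) list \<Rightarrow> (('v, 'a) path \<Rightarrow>\<^sub>0 'k)) set set" where
  "HH Q n d = quotient_space (hoch_cocycles Q n d) (hoch_coboundaries Q n d)"

section \<open>The Bardzell complex\<close>

definition bardzell_basis ::
  "('v, 'a) graded_quiver \<Rightarrow> nat \<Rightarrow> int \<Rightarrow> (('v, 'a) path \<times> ('v, 'a) path) set" where
  "bardzell_basis Q n d = {(p, q). anti_path Q p \<and> plength p = n \<and> path_of_A Q q \<and>
     parallel Q p q \<and> pdegree Q q - pdegree Q p = d}"

definition bardzell_cochains ::
  "('v, 'a) graded_quiver \<Rightarrow> nat \<Rightarrow> int \<Rightarrow>
    ((('v, 'a) path \<times> ('v, 'a) path) \<Rightarrow>\<^sub>0 'k::field) set" where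
  "bardzell_cochains Q n d = {f. Poly_Mapping.keys f \<subseteq> bardzell_basis Q n d}"

definition bardzell_diff_basis ::
  "('v, 'a) graded_quiver \<Rightarrow> nat \<Rightarrow> int \<Rightarrow> ('v, 'a) path \<Rightarrow> ('v, 'a) path \<Rightarrow>
    ((('v, 'a) path \<times> ('v, 'a) path) \<Rightarrow>\<^sub>0 'k::field)" where
  "bardzell_diff_basis Q n d p q = smult ((-1) powi d)
     ((\<Sum>\<alpha> \<in> {\<alpha> \<in> arrows Q. composable Q (arrow_path Q \<alpha>) p \<and>
           anti_path Q (pcomp (arrow_path Q \<alpha>) p) \<and> path_of_A Q (pcomp (arrow_path Q \<alpha>) q)}.
         Poly_Mapping.single (pcomp (arrow_path Q \<alpha>) p, pcomp (arrow_path Q \<alpha>) q)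
           ((-1) powi (d * degree Q \<alpha>)))
      - (\<Sum>\<beta> \<in> {\<beta> \<in> arrows Q. composable Q p (arrow_path Q \<beta>) \<and>
           anti_path Q (pcomp p (arrow_path Q \<beta>)) \<and> path_of_A Q (pcomp q (arrow_path Q \<beta>))}.
         Poly_Mapping.single (pcomp p (arrow_path Q \<beta>), pcomp q (arrow_path Q \<beta>)) ((-1) ^ n)))"

definition bardzell_diff ::
  "('v, 'a) graded_quiver \<Rightarrow> nat \<Rightarrow> int \<Rightarrow>
    ((('v, 'a) path \<times> ('v, 'a) path) \<Rightarrow>\<^sub>0 'k::field) \<Rightarrow>
    ((('v, 'a) path \<times> ('v, 'a) path) \<Rightarrow>\<^sub>0 'k)" where
  "bardzell_diff Q n d f = (\<Sum>(p, q) \<in> Poly_Mapping.keys f.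
     smult (Poly_Mapping.lookup f (p, q)) (bardzell_diff_basis Q n d p q))"

definition bardzell_coboundaries ::
  "('v, 'a) graded_quiver \<Rightarrow> nat \<Rightarrow> int \<Rightarrow>
    ((('v, 'a) path \<times> ('v, 'a) path) \<Rightarrow>\<^sub>0 'k::field) set" where
  "bardzell_coboundaries Q n d =
     (case n of 0 \<Rightarrow> {0} | Suc m \<Rightarrow> bardzell_diff Q m d ` bardzell_cochains Q m d)"

text \<open>
  The comparison map \<open>C\<^sup>n\<^sup>,\<^sup>d(A) \<rightarrow> C\<^sub>P\<^sup>n\<^sup>,\<^sup>d(A)\<close>: it sends \<open>\<phi>\<close> to the cochain whose value on an anti-path
  \<open>p = \<alpha>\<^sub>1\<dots>\<alpha>\<^sub>n\<close> is the part of \<open>\<phi>(\<alpha>\<^sub>1, \<dots>, \<alpha>\<^sub>n)\<close> in the span of the paths parallel to \<open>p\<close>. It is dual to the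
  embedding of the Bardzell resolution into the bar resolution, hence a quasi-isomorphism, and \<open>HH\<close> is
  identified with the cohomology of the Bardzell complex along it.
\<close>

definition comparison ::
  "('v, 'a) graded_quiver \<Rightarrow> nat \<Rightarrow>
    ((('v, 'a) path \<Rightarrow>\<^sub>0 'k::field) list \<Rightarrow> (('v, 'a) path \<Rightarrow>\<^sub>0 'k)) \<Rightarrow>
    ((('v, 'a) path \<times> ('v, 'a) path) \<Rightarrow>\<^sub>0 'k)" where
  "comparison Q n \<phi> =
     (\<Sum>p \<in> {p. anti_path Q p \<and> plength p = n}.
        let f = \<phi> (map (\<lambda>\<alpha>. Poly_Mapping.single (arrow_path Q \<alpha>) 1) (snd p))
        in \<Sum>q \<in> {q \<in> Poly_Mapping.keys f. parallel Q p q}.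
             Poly_Mapping.single (p, q) (Poly_Mapping.lookup f q))"

text \<open>
  The class in \<open>HH\<^sup>n\<^sup>,\<^sup>d(A, A)\<close> of an element \<open>b\<close> of the Bardzell complex, as the set of Hochschild cocycles
  which the comparison map sends to \<open>b\<close> up to a coboundary. That this set is a single coset is part of
  \<open>HH_basis\<close>.
\<close>

definition HH_class ::
  "('v, 'a) graded_quiver \<Rightarrow> nat \<Rightarrow> int \<Rightarrow>
    ((('v, 'a) path \<times> ('v, 'a) path) \<Rightarrow>\<^sub>0 'k::field) \<Rightarrow>
    ((('v, 'a) path \<Rightarrow>\<^sub>0 'k) list \<Rightarrow> (('v, 'a) path \<Rightarrow>\<^sub>0 'k)) set" where
  "HH_class Q n d b =
     {\<phi> \<in> hoch_cocycles Q n d. comparison Q n \<phi> - b \<in> bardzell_coboundaries Q n d}"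

definition HH_basis ::
  "('v, 'a) graded_quiver \<Rightarrow> nat \<Rightarrow> int \<Rightarrow>
    ((('v, 'a) path \<times> ('v, 'a) path) \<Rightarrow>\<^sub>0 'k::field) set \<Rightarrow> bool" where
  "HH_basis Q n d S \<longleftrightarrow>
     inj_on (HH_class Q n d) S \<and>
     coset_basis (\<lambda>c \<phi> xs. smult c (\<phi> xs)) (HH Q n d) (HH_class Q n d ` S)"

section \<open>The elements of the basis\<close>

definition unit_element ::
  "('v, 'a) graded_quiver \<Rightarrow> ((('v, 'a) path \<times> ('v, 'a) path) \<Rightarrow>\<^sub>0 'k::field)" where
  "unit_element Q = (\<Sum>x \<in> vertices Q. Poly_Mapping.single (trivial x, trivial x) 1)"

text \<open>
  \<open>N_anti Q s p\<close> and \<open>N_path Q s q\<close> are the elements \<open>N\<^sup>s(p)\<close> and \<open>N\<^sup>s(q)\<close>, for \<open>s \<in> {0, 1}\<close>. The differential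
  of \<open>N\<^sup>0(p)\<close> is \<open>0\<close> if \<open>\<omega>(p)\<close> is even and \<open>\<plusminus>2 N\<^sup>1(p)\<close> if \<open>\<omega>(p)\<close> is odd. Hence outside characteristic 2 both
  \<open>N\<^sup>0(p)\<close> and \<open>N\<^sup>1(p)\<close> contribute to a basis of the cohomology when \<open>\<omega>(p)\<close> is even, and neither does when
  \<open>\<omega>(p)\<close> is odd (in terms of the total degree \<open>s - \<omega>(p)\<close> of \<open>N\<^sup>s(p)\<close>: when it lies in \<open>2\<int> + s\<close>).
  The same holds for \<open>q\<close>.
\<close>

definition N_anti ::
  "('v, 'a) graded_quiver \<Rightarrow> nat \<Rightarrow> ('v, 'a) path \<Rightarrow>
    ((('v, 'a) path \<times> ('v, 'a) path) \<Rightarrow>\<^sub>0 'k::field)" where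
  "N_anti Q s p =
     (if s = 0
      then \<Sum>i < period Q p.
        Poly_Mapping.single ((rot Q ^^ i) p, trivial (psource ((rot Q ^^ i) p)))
          ((-1) powi (int i * int (plength p)
             + pdegree Q p * (\<Sum>\<alpha>\<leftarrow>take i (snd p). degree Q \<alpha>)))
      else let \<alpha> = arrow_path Q (last (snd p)) in Poly_Mapping.single (pcomp \<alpha> p, \<alpha>) 1)"

definition N_path ::
  "('v, 'a) graded_quiver \<Rightarrow> nat \<Rightarrow> ('v, 'a) path \<Rightarrow>
    ((('v, 'a) path \<times> ('v, 'a) path) \<Rightarrow>\<^sub>0 'k::field)" where
  "N_path Q s q =
     (if s = 0
      then \<Sum>i < period Q q.
        Poly_Mapping.single (trivial (psource ((rot Q ^^ i) q)), (rot Q ^^ i) q)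
          ((-1) powi (pdegree Q q * (\<Sum>\<beta>\<leftarrow>take i (snd q). degree Q \<beta>)))
      else let \<beta> = arrow_path Q (last (snd q)) in Poly_Mapping.single (\<beta>, pcomp \<beta> q) 1)"

end

theory Submission
  imports Defs
begin

text \<open>
  The bar complex computing \<open>HH\<close> has as coordinates the values \<open>coef \<phi> [p\<^sub>1, \<dots>, p\<^sub>n] q\<close> of a cochain on
  paths. An acyclic matching on these coordinates, whose unmatched cells are the pairs of an anti-path and a
  parallel path, shows that the comparison map to the Bardzell complex induces a bijection in cohomology:
  a cochain can be prescribed on the unmatched cells and its differential on the lower matched cells, and a
  cocycle vanishing on both is zero. No projective resolution is needed.

  In the Bardzell complex, the differential of \<open>f\<close> at a pair \<open>k\<close> only involves the values of \<open>f\<close> at \<open>k\<close> with a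
  common first arrow stripped and at \<open>k\<close> with a common last arrow stripped. Since the quiver is gentle, each
  pair is obtained in at most one way by stripping on a given side, except for the pairs \<open>(x, x)\<close>. So the
  complex splits into squares and shorter pieces, on which the maximal paths and anti-paths survive, into one
  cyclic piece for every rotation class of complete paths or anti-paths, where the product of the signs around
  the cycle decides about the cohomology, and into the complex \<open>k\<^bsup>Q\<^sub>0\<^esup> \<rightarrow> k\<^bsup>Q\<^sub>1\<^esup>\<close> of the underlying graph.
\<close>

text \<open>Tensor powers are taken over the field, neither relative to the vertices nor normalised.
  A coordinate may therefore list trivial paths or paths that do not compose, and the matching has
  to remove these before it can look at anti-paths: a mismatch of vertices or a trivial entry is
  dealt with by inserting or deleting trivial paths, and only entries that fit together are split
  into arrows. Since \<open>A\<close> may be infinite-dimensional, a cochain can have infinitely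
  many coordinates while each of its values must be a finite combination of paths; so the values on
  the upper matched cells come from an explicit recursion, along which degree and finiteness are
  checked. All pivots are signs, hence the comparison works over every field. The characteristic
  matters only for a cycle whose product of signs is -1, where 2 has to be inverted. The pairs
  \<open>(x, x)\<close> differ from all others because up to two arrows may start or end at
  \<open>x\<close>: stripping down to \<open>(x, x)\<close> loses the arrow that was removed. This
  is where the spanning tree enters.\<close>

declare split_paired_All [simp del] split_paired_Ex [simp del]

section \<open>Linear algebra of finitely supported functions\<close>

abbreviation lk :: "('b \<Rightarrow>\<^sub>0 'c::zero) \<Rightarrow> 'b \<Rightarrow> 'c" where "lk \<equiv> Poly_Mapping.lookup"

abbreviation sg :: "'b \<Rightarrow> ('b \<Rightarrow>\<^sub>0 'k::field)" where "sg p \<equiv> Poly_Mapping.single p 1"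

lemma lookup_smult [simp]: "lk (smult c f) p = c * lk f p"
  unfolding smult_def by transfer (auto simp: when_def)

lemma keys_smult: "Poly_Mapping.keys (smult c f) \<subseteq> Poly_Mapping.keys f"
  by (auto simp: in_keys_iff)

lemma smult_simps [simp]:
  "smult c 0 = 0" "smult 0 f = 0" "smult 1 f = f" "smult a (smult b f) = smult (a * b) f"
  "smult c (Poly_Mapping.single p a) = Poly_Mapping.single p (c * a)"
  by (auto intro!: poly_mapping_eqI simp: mult.assoc lookup_single when_def)

lemma smult_add: "smult c (f + g) = smult c f + smult c g"
  by (rule poly_mapping_eqI) (simp add: lookup_add algebra_simps)

lemma smult_add_left: "smult (a + b) f = smult a f + smult b f"
  by (rule poly_mapping_eqI) (simp add: lookup_add algebra_simps)

lemma smult_diff: "smult c (f - g) = smult c f - smult c g"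
  by (rule poly_mapping_eqI) (simp add: lookup_minus algebra_simps)

lemma smult_minus_one: "smult (-1) f = - f"
  by (rule poly_mapping_eqI) simp

lemma smult_sum: "smult c (\<Sum>i\<in>S. f i) = (\<Sum>i\<in>S. smult c (f i))"
  by (rule poly_mapping_eqI) (simp add: lookup_sum sum_distrib_left)

lemma sum_singles:
  assumes "finite K" "Poly_Mapping.keys f \<subseteq> K"
  shows "f = (\<Sum>p\<in>K. smult (lk f p) (sg p))"
  using assms by (intro poly_mapping_eqI) (auto simp: lookup_sum lookup_single when_def in_keys_iff)

lemma pm_induct [case_names zero single add]:
  fixes f :: "'b \<Rightarrow>\<^sub>0 'k::field"
  assumes "P 0" "\<And>p c. P (Poly_Mapping.single p c)" "\<And>f g. P f \<Longrightarrow> P g \<Longrightarrow> P (f + g)"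
  shows "P f"
proof -
  have "P (\<Sum>p\<in>K. smult (lk f p) (sg p))" if "finite K" for K
    using that by (induction K) (auto intro: assms)
  then show ?thesis
    using sum_singles[of "Poly_Mapping.keys f" f] by (metis finite_keys order_refl)
qed

section \<open>The algebra\<close>

lemma alg_iff: "f \<in> alg Q \<longleftrightarrow> (\<forall>p. lk f p \<noteq> 0 \<longrightarrow> path_of_A Q p)"
  by (auto simp: alg_def in_keys_iff)

lemma alg_closed [simp, intro]:
  "0 \<in> alg Q" "f \<in> alg Q \<Longrightarrow> g \<in> alg Q \<Longrightarrow> f + g \<in> alg Q" "f \<in> alg Q \<Longrightarrow> smult c f \<in> alg Q"
  "alg_mult Q f g \<in> alg Q" "path_of_A Q p \<Longrightarrow> Poly_Mapping.single p c \<in> alg Q"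
proof -
  show "f \<in> alg Q \<Longrightarrow> g \<in> alg Q \<Longrightarrow> f + g \<in> alg Q"
    unfolding alg_iff lookup_add by (metis add_0)
qed (auto simp: alg_iff alg_mult_def lookup_reduce lookup_single when_def split: if_splits)

lemma alg_sum [intro]: "(\<And>i. i \<in> S \<Longrightarrow> f i \<in> alg Q) \<Longrightarrow> (\<Sum>i\<in>S. f i) \<in> alg Q"
  by (induction S rule: infinite_finite_induct) auto

lemma alg_path_algebra: "f \<in> alg Q \<Longrightarrow> f \<in> path_algebra Q"
  by (auto simp: alg_def path_algebra_def path_of_A_def)

lemma alg_degree_iff:
  "f \<in> alg_degree Q e \<longleftrightarrow> (\<forall>p. lk f p \<noteq> 0 \<longrightarrow> path_of_A Q p \<and> pdegree Q p = e)"
  by (auto simp: alg_degree_def alg_iff in_keys_iff)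

lemma alg_degree_closed [simp, intro]:
  "0 \<in> alg_degree Q e" "f \<in> alg_degree Q e \<Longrightarrow> g \<in> alg_degree Q e \<Longrightarrow> f + g \<in> alg_degree Q e"
  "f \<in> alg_degree Q e \<Longrightarrow> smult c f \<in> alg_degree Q e"
proof -
  show "f \<in> alg_degree Q e \<Longrightarrow> g \<in> alg_degree Q e \<Longrightarrow> f + g \<in> alg_degree Q e"
    unfolding alg_degree_iff lookup_add by (metis add_0)
qed (auto simp: alg_degree_iff)

lemma alg_degree_sum: "(\<And>i. i \<in> S \<Longrightarrow> f i \<in> alg_degree Q e) \<Longrightarrow> (\<Sum>i\<in>S. f i) \<in> alg_degree Q e"
  by (induction S rule: infinite_finite_induct) auto

lemma alg_degree_alg: "f \<in> alg_degree Q e \<Longrightarrow> f \<in> alg Q"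
  by (simp add: alg_degree_def)

lemma pdegree_pcomp: "pdegree Q (pcomp p q) = pdegree Q p + pdegree Q q"
  by (simp add: pdegree_def pcomp_def)

text \<open>The product is a double sum over supports, and a sum may have smaller support than its
  summands. All products are therefore expanded over one finite set \<open>?F\<close> containing
  every support involved.\<close>

lemma path_mult_add_left: "path_mult Q (f + g) h = path_mult Q f h + path_mult Q g h"
proof (rule poly_mapping_eqI)
  fix r
  let ?F = "Poly_Mapping.keys f \<union> Poly_Mapping.keys g \<union> Poly_Mapping.keys (f + g)"
  have F: "finite ?F" "Poly_Mapping.keys f \<subseteq> ?F" "Poly_Mapping.keys g \<subseteq> ?F"
    "Poly_Mapping.keys (f + g) \<subseteq> ?F" by auto
  show "lk (path_mult Q (f + g) h) r = lk (path_mult Q f h + path_mult Q g h) r"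
    unfolding lookup_add lookup_path_mult[OF F(1,2) finite_keys order_refl]
      lookup_path_mult[OF F(1,3) finite_keys order_refl]
      lookup_path_mult[OF F(1,4) finite_keys order_refl] sum.distrib[symmetric]
    by (intro sum.cong refl) (auto simp: algebra_simps)
qed

lemma path_mult_add_right: "path_mult Q h (f + g) = path_mult Q h f + path_mult Q h g"
proof (rule poly_mapping_eqI)
  fix r
  let ?F = "Poly_Mapping.keys f \<union> Poly_Mapping.keys g \<union> Poly_Mapping.keys (f + g)"
  have F: "finite ?F" "Poly_Mapping.keys f \<subseteq> ?F" "Poly_Mapping.keys g \<subseteq> ?F"
    "Poly_Mapping.keys (f + g) \<subseteq> ?F" by auto
  show "lk (path_mult Q h (f + g)) r = lk (path_mult Q h f + path_mult Q h g) r"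
    unfolding lookup_add lookup_path_mult[OF finite_keys order_refl F(1,2)]
      lookup_path_mult[OF finite_keys order_refl F(1,3)]
      lookup_path_mult[OF finite_keys order_refl F(1,4)] sum.distrib[symmetric]
    by (intro sum.cong refl) (auto simp: algebra_simps)
qed

lemma path_mult_smult_left: "path_mult Q (smult c f) h = smult c (path_mult Q f h)"
proof (rule poly_mapping_eqI)
  fix r
  show "lk (path_mult Q (smult c f) h) r = lk (smult c (path_mult Q f h)) r"
    unfolding lookup_smult lookup_path_mult[OF finite_keys keys_smult finite_keys order_refl]
      lookup_path_mult[where f = f, OF finite_keys order_refl finite_keys order_refl] sum_distrib_left
    by (intro sum.cong refl) (auto simp: algebra_simps)
qed

lemma path_mult_smult_right: "path_mult Q h (smult c f) = smult c (path_mult Q h f)"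
proof (rule poly_mapping_eqI)
  fix r
  show "lk (path_mult Q h (smult c f)) r = lk (smult c (path_mult Q h f)) r"
    unfolding lookup_smult lookup_path_mult[OF finite_keys order_refl finite_keys keys_smult]
      lookup_path_mult[where g = f, OF finite_keys order_refl finite_keys order_refl] sum_distrib_left
    by (intro sum.cong refl) (auto simp: algebra_simps)
qed

lemma path_mult_zero [simp]: "path_mult Q 0 f = 0" "path_mult Q f 0 = 0"
  by (simp_all add: path_mult_def)

lemma pcomp_assoc: "pcomp (pcomp p q) r = pcomp p (pcomp q r)"
  by (simp add: pcomp_def psource_def)

lemma composable_pcomp_left [simp]: "composable Q (pcomp p q) r \<longleftrightarrow> composable Q q r"
  by (simp add: composable_def pcomp_def psource_def)

lemma ptarget_pcomp: "composable Q p q \<Longrightarrow> ptarget Q (pcomp p q) = ptarget Q p"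
  by (auto simp: composable_def pcomp_def psource_def ptarget_def)

lemma psource_pcomp [simp]: "psource (pcomp p q) = psource q"
  by (simp add: pcomp_def psource_def)

lemma composable_pcomp_right:
  "composable Q q r \<Longrightarrow> composable Q p (pcomp q r) \<longleftrightarrow> composable Q p q"
  by (simp add: composable_def[of Q p] ptarget_pcomp)

lemma path_mult_assoc: "path_mult Q (path_mult Q f g) h = path_mult Q f (path_mult Q g h)"
proof (induction f rule: pm_induct)
  case f: (single p a)
  show ?case
  proof (induction g rule: pm_induct)
    case g: (single q b)
    show ?case
    proof (induction h rule: pm_induct)
      case (single r c)
      show ?case
        by (auto simp: path_mult_single composable_pcomp_right pcomp_assoc mult.assoc)
    qed (simp_all add: path_mult_add_right)
  qed (simp_all add: path_mult_add_right path_mult_add_left)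
qed (simp_all add: path_mult_add_left)

lemma is_path_pcomp: "is_path Q p \<Longrightarrow> is_path Q q \<Longrightarrow> composable Q p q \<Longrightarrow> is_path Q (pcomp p q)"
  by (auto simp: is_path_def composable_def pcomp_def psource_def ptarget_def
      successively_append_iff split: if_splits)

lemma path_mult_path_algebra:
  assumes "f \<in> path_algebra Q" "g \<in> path_algebra Q"
  shows "path_mult Q f g \<in> path_algebra Q"
proof -
  have "is_path Q r" if "r \<in> Poly_Mapping.keys (path_mult Q f g)" for r
  proof (rule ccontr)
    assume "\<not> is_path Q r"
    then have "\<not> (composable Q p q \<and> pcomp p q = r)"
      if "p \<in> Poly_Mapping.keys f" "q \<in> Poly_Mapping.keys g" for p q
      using assms is_path_pcomp[of Q p q] that by (auto simp: path_algebra_def)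
    then have "lk (path_mult Q f g) r = 0"
      unfolding lookup_path_mult[OF finite_keys order_refl finite_keys order_refl]
      by (intro sum.neutral ballI if_not_P) blast
    then show False using that by (simp add: in_keys_iff)
  qed
  then show ?thesis by (auto simp: path_algebra_def)
qed

lemma reduce_alg: "f \<in> alg Q \<Longrightarrow> reduce Q f = f"
  by (intro poly_mapping_eqI) (auto simp: lookup_reduce alg_iff)

lemma reduce_smult: "reduce Q (smult c f) = smult c (reduce Q f)"
  by (intro poly_mapping_eqI) (auto simp: lookup_reduce)

text \<open>Associativity is inherited from the path algebra, because \<open>reduce\<close> is
  multiplicative there.\<close>

lemma alg_mult_assoc:
  assumes "f \<in> alg Q" "g \<in> alg Q" "h \<in> alg Q"
  shows "alg_mult Q (alg_mult Q f g) h = alg_mult Q f (alg_mult Q g h)"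
proof -
  have "alg_mult Q (alg_mult Q f g) h = reduce Q (path_mult Q (path_mult Q f g) h)"
    using reduce_path_mult[of "path_mult Q f g" Q h] assms
    by (simp add: reduce_alg alg_path_algebra path_mult_path_algebra alg_mult_def)
  moreover have "alg_mult Q f (alg_mult Q g h) = reduce Q (path_mult Q f (path_mult Q g h))"
    using reduce_path_mult[of f Q "path_mult Q g h"] assms
    by (simp add: reduce_alg alg_path_algebra path_mult_path_algebra alg_mult_def)
  ultimately show ?thesis by (simp add: path_mult_assoc)
qed

lemma alg_mult_linear:
  "alg_mult Q (f + g) h = alg_mult Q f h + alg_mult Q g h"
  "alg_mult Q h (f + g) = alg_mult Q h f + alg_mult Q h g"
  "alg_mult Q (smult c f) h = smult c (alg_mult Q f h)"
  "alg_mult Q h (smult c f) = smult c (alg_mult Q h f)"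
  "alg_mult Q 0 f = 0" "alg_mult Q f 0 = 0"
  by (simp_all add: alg_mult_def path_mult_add_left path_mult_add_right path_mult_smult_left
      path_mult_smult_right reduce_add reduce_smult) (simp_all add: reduce_def)

lemma alg_mult_sum:
  "alg_mult Q h (\<Sum>i\<in>S. f i) = (\<Sum>i\<in>S. alg_mult Q h (f i))"
  "alg_mult Q (\<Sum>i\<in>S. f i) h = (\<Sum>i\<in>S. alg_mult Q (f i) h)"
  by (induction S rule: infinite_finite_induct) (auto simp: alg_mult_linear)

lemma alg_degree_mult:
  assumes "f \<in> alg_degree Q a" "g \<in> alg_degree Q b"
  shows "alg_mult Q f g \<in> alg_degree Q (a + b)"
  unfolding alg_degree_iff
proof (intro allI impI)
  fix r assume r: "lk (alg_mult Q f g) r \<noteq> 0"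
  then have "lk (path_mult Q f g) r \<noteq> 0" and p: "path_of_A Q r"
    by (auto simp: alg_mult_def lookup_reduce split: if_splits)
  then have "r \<in> Poly_Mapping.keys (path_mult Q f g)" by (simp add: in_keys_iff)
  then obtain p q where "p \<in> Poly_Mapping.keys f" "q \<in> Poly_Mapping.keys g" and r: "r = pcomp p q"
    by (rule keys_path_mult)
  then have "pdegree Q p = a" "pdegree Q q = b"
    using assms by (auto simp: alg_degree_iff in_keys_iff)
  then show "path_of_A Q r \<and> pdegree Q r = a + b"
    using p r by (simp add: pdegree_pcomp)
qed

lemma lookup_koszul [simp]: "lk (koszul_sign Q d f) p = (-1) powi (d * pdegree Q p) * lk f p"
  unfolding koszul_sign_def by (auto simp: lookup_sum lookup_single when_def in_keys_iff)

lemma koszul_linear: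
  "koszul_sign Q d (f + g) = koszul_sign Q d f + koszul_sign Q d g"
  "koszul_sign Q d (smult c f) = smult c (koszul_sign Q d f)"
  "koszul_sign Q d 0 = 0"
  by (auto intro!: poly_mapping_eqI simp: lookup_add algebra_simps)

lemma koszul_alg [simp, intro]: "f \<in> alg Q \<Longrightarrow> koszul_sign Q d f \<in> alg Q"
  by (auto simp: alg_iff)

lemma koszul_degree: "f \<in> alg_degree Q e \<Longrightarrow> koszul_sign Q d f \<in> alg_degree Q e"
  by (auto simp: alg_degree_iff)

text \<open>Degrees add under concatenation, so the Koszul sign is multiplicative. This is what
  makes the first two faces of the Hochschild differential compatible.\<close>

lemma koszul_mult:
  "koszul_sign Q d (alg_mult Q f g) = alg_mult Q (koszul_sign Q d f) (koszul_sign Q d g)"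
proof (rule poly_mapping_eqI)
  fix r
  have k: "Poly_Mapping.keys (koszul_sign Q d h) \<subseteq> Poly_Mapping.keys h" for h :: "('a, 'b) path \<Rightarrow>\<^sub>0 'c"
    by (auto simp: in_keys_iff)
  show "lk (koszul_sign Q d (alg_mult Q f g)) r =
    lk (alg_mult Q (koszul_sign Q d f) (koszul_sign Q d g)) r"
    unfolding lookup_koszul alg_mult_def lookup_reduce
      lookup_path_mult[OF finite_keys order_refl finite_keys order_refl, of Q f g]
      lookup_path_mult[OF finite_keys k finite_keys k]
    by (auto simp: sum_distrib_left pdegree_pcomp algebra_simps power_int_add intro!: sum.cong)
qed

section \<open>Multilinear cochains\<close>

text \<open>Additivity and homogeneity in one slot are combined into a single equation, so that
  proofs about cochains check one clause; the separate laws come back with \<open>c = 1\<close> and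
  \<open>y = 0\<close>.\<close>

definition mlin :: "('v, 'a) graded_quiver \<Rightarrow> nat \<Rightarrow>
    ((('v, 'a) path \<Rightarrow>\<^sub>0 'k::field) list \<Rightarrow> (('v, 'a) path \<Rightarrow>\<^sub>0 'k)) \<Rightarrow> bool" where
  "mlin Q n \<phi> \<longleftrightarrow> (\<forall>xs i c x y. length xs = n \<and> set xs \<subseteq> alg Q \<and> i < n \<and> x \<in> alg Q \<and> y \<in> alg Q \<longrightarrow>
     \<phi> (xs[i := smult c x + y]) = smult c (\<phi> (xs[i := x])) + \<phi> (xs[i := y]))"

lemma hoch_cochains_iff:
  "\<phi> \<in> hoch_cochains Q n d \<longleftrightarrow> (\<forall>xs. \<phi> xs \<in> alg Q) \<and>
     (\<forall>xs. \<not> (length xs = n \<and> set xs \<subseteq> alg Q) \<longrightarrow> \<phi> xs = 0) \<and> mlin Q n \<phi> \<and>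
     (\<forall>xs es. length xs = n \<and> list_all2 (\<lambda>x e. x \<in> alg_degree Q e) xs es \<longrightarrow>
        \<phi> xs \<in> alg_degree Q (sum_list es + d))"
proof -
  let ?P = "\<lambda>xs i. length xs = n \<and> set xs \<subseteq> alg Q \<and> i < n"
  have E: "(\<forall>xs i x y. length xs = n \<and> set xs \<subseteq> alg Q \<and> i < n \<and> x \<in> alg Q \<and> y \<in> alg Q \<longrightarrow>
        \<phi> (xs[i := x + y]) = \<phi> (xs[i := x]) + \<phi> (xs[i := y])) \<and>
     (\<forall>xs i c x. length xs = n \<and> set xs \<subseteq> alg Q \<and> i < n \<and> x \<in> alg Q \<longrightarrow>
        \<phi> (xs[i := smult c x]) = smult c (\<phi> (xs[i := x]))) \<longleftrightarrow> mlin Q n \<phi>" (is "?A \<longleftrightarrow> ?B")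
  proof
    assume ?A then show ?B by (auto simp: mlin_def)
  next
    assume B: ?B
    have add: "\<phi> (xs[i := x + y]) = \<phi> (xs[i := x]) + \<phi> (xs[i := y])"
      if "?P xs i" "x \<in> alg Q" "y \<in> alg Q" for xs i x y
      using B[unfolded mlin_def, rule_format, of xs i x y 1] that by simp
    have zero: "\<phi> (xs[i := 0]) = 0" if "?P xs i" for xs i
      using add[OF that, of 0 0] by simp
    have "\<phi> (xs[i := smult c x]) = smult c (\<phi> (xs[i := x]))" if "?P xs i" "x \<in> alg Q" for xs i c x
      using B[unfolded mlin_def, rule_format, of xs i x 0 c] that zero by simp
    with add show ?A by blast
  qed
  show ?thesis unfolding hoch_cochains_def mem_Collect_eq E[symmetric] by (simp only: conj_assoc)
qed

lemma cochain_alg [simp, intro]: "\<phi> \<in> hoch_cochains Q n d \<Longrightarrow> \<phi> xs \<in> alg Q"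
  by (simp add: hoch_cochains_iff)

lemma mlin_sum:
  assumes "mlin Q n \<phi>" "length xs = n" "set xs \<subseteq> alg Q" "i < n" "finite K"
    "\<And>p. p \<in> K \<Longrightarrow> f p \<in> alg Q"
  shows "\<phi> (xs[i := (\<Sum>p\<in>K. smult (c p) (f p))]) = (\<Sum>p\<in>K. smult (c p) (\<phi> (xs[i := f p])))"
  using assms(5,6)
proof (induction K)
  case empty
  have "\<phi> (xs[i := smult 1 0 + 0]) = smult 1 (\<phi> (xs[i := 0])) + \<phi> (xs[i := 0])"
    using assms unfolding mlin_def by blast
  then show ?case by simp
next
  case (insert p K)
  have "\<phi> (xs[i := smult (c p) (f p) + (\<Sum>p\<in>K. smult (c p) (f p))]) =
    smult (c p) (\<phi> (xs[i := f p])) + \<phi> (xs[i := (\<Sum>p\<in>K. smult (c p) (f p))])"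
    using assms insert by (intro assms(1)[unfolded mlin_def, rule_format]) auto
  then show ?case using insert by simp
qed

lemma cochain_eqI:
  assumes "mlin Q n \<phi>" "mlin Q n \<psi>"
    "\<And>ps. length ps = n \<Longrightarrow> (\<forall>p\<in>set ps. path_of_A Q p) \<Longrightarrow> \<phi> (map sg ps) = \<psi> (map sg ps)"
    "length xs = n" "set xs \<subseteq> alg Q"
  shows "\<phi> xs = \<psi> xs"
proof -
  \<comment> \<open>The entries are replaced by basis paths one at a time: only the first
    \<open>k\<close> entries are arbitrary, all later ones are single paths.\<close>
  have "\<phi> xs = \<psi> xs"
    if "k \<le> n" "length xs = n" "set xs \<subseteq> alg Q"
      "\<And>i. k \<le> i \<Longrightarrow> i < n \<Longrightarrow> \<exists>p. path_of_A Q p \<and> xs ! i = sg p" for k xs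
    using that
  proof (induction k arbitrary: xs)
    case 0
    have "\<exists>p. path_of_A Q p \<and> x = sg p" if "x \<in> set xs" for x
      using 0 that by (metis in_set_conv_nth zero_le)
    then obtain h where h: "\<And>x. x \<in> set xs \<Longrightarrow> path_of_A Q (h x) \<and> x = sg (h x)" by metis
    then have "map sg (map h xs) = xs" by (auto intro: map_idI)
    then show ?case using assms(3)[of "map h xs"] h 0 by auto
  next
    case (Suc k)
    let ?x = "xs ! k"
    have x: "?x \<in> alg Q" using Suc.prems by (meson Suc_le_lessD nth_mem subsetD)
    let ?K = "Poly_Mapping.keys ?x"
    have x_eq: "?x = (\<Sum>p\<in>?K. smult (lk ?x p) (sg p))" by (rule sum_singles) auto
    have K: "path_of_A Q p" if "p \<in> ?K" for p using x that by (auto simp: alg_def)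
    have upd: "xs = xs[k := (\<Sum>p\<in>?K. smult (lk ?x p) (sg p))]" using x_eq[symmetric] by simp
    have *: "\<phi> (xs[k := sg p]) = \<psi> (xs[k := sg p])" if "p \<in> ?K" for p
    proof (rule Suc.IH)
      show "set (xs[k := sg p]) \<subseteq> alg Q" using Suc.prems(3) K[OF that] 
        by (metis (no_types) alg_closed(5) insert_subset order_trans set_update_subset_insert)
    qed (use Suc.prems K[OF that] in \<open>auto simp: nth_list_update\<close>)
    have "\<phi> xs = (\<Sum>p\<in>?K. smult (lk ?x p) (\<phi> (xs[k := sg p])))"
      by (subst upd, rule mlin_sum[OF assms(1)]) (use Suc.prems K in auto)
    also have "\<dots> = (\<Sum>p\<in>?K. smult (lk ?x p) (\<psi> (xs[k := sg p])))" using * by simp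
    also have "\<dots> = \<psi> xs"
      by (subst (2) upd, rule mlin_sum[OF assms(2), symmetric]) (use Suc.prems K in auto)
    finally show ?case .
  qed
  from this[of n xs] assms show ?thesis by auto
qed

text \<open>The multilinear extension of a function given on lists of paths. The value 0 outside the
  lists in \<open>alg Q\<close>, which \<open>hoch_cochains\<close> demands, is added by a case
  distinction where cochains are built.\<close>

fun ext :: "(('v, 'a) path list \<Rightarrow> (('v, 'a) path \<Rightarrow>\<^sub>0 'k::field)) \<Rightarrow>
    (('v, 'a) path \<Rightarrow>\<^sub>0 'k) list \<Rightarrow> (('v, 'a) path \<Rightarrow>\<^sub>0 'k)" where
  "ext f [] = f []"
| "ext f (x # xs) = (\<Sum>p\<in>Poly_Mapping.keys x. smult (lk x p) (ext (\<lambda>ps. f (p # ps)) xs))"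

lemma ext_sg [simp]: "ext f (map sg ps) = f ps"
  by (induction ps arbitrary: f) simp_all

lemma ext_alg: "(\<And>ps. f ps \<in> alg Q) \<Longrightarrow> ext f xs \<in> alg Q"
  by (induction xs arbitrary: f) auto

lemma ext_Cons_superset:
  assumes "finite K" "Poly_Mapping.keys x \<subseteq> K"
  shows "ext f (x # xs) = (\<Sum>p\<in>K. smult (lk x p) (ext (\<lambda>ps. f (p # ps)) xs))"
  unfolding ext.simps using assms by (intro sum.mono_neutral_left) (auto simp: in_keys_iff)

lemma ext_mlin:
  "i < length xs \<Longrightarrow> ext f (xs[i := smult c x + y]) = smult c (ext f (xs[i := x])) + ext f (xs[i := y])"
proof (induction xs arbitrary: f i)
  case (Cons z xs)
  show ?case
  proof (cases i)
    case 0
    let ?K = "Poly_Mapping.keys x \<union> Poly_Mapping.keys y \<union> Poly_Mapping.keys (smult c x + y)"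
    have K: "finite ?K" "Poly_Mapping.keys x \<subseteq> ?K" "Poly_Mapping.keys y \<subseteq> ?K"
      "Poly_Mapping.keys (smult c x + y) \<subseteq> ?K" by auto
    show ?thesis unfolding 0 list_update_code ext_Cons_superset[OF K(1,2)]
        ext_Cons_superset[OF K(1,3)] ext_Cons_superset[OF K(1,4)] smult_sum sum.distrib[symmetric]
      by (intro sum.cong refl) (simp add: lookup_add smult_add_left)
  next
    case (Suc j)
    with Cons show ?thesis
      by (auto simp: smult_sum sum.distrib[symmetric] smult_add mult.commute intro!: sum.cong)
  qed
qed simp

lemma ext_degree:
  assumes "list_all2 (\<lambda>x e. x \<in> alg_degree Q e) xs es"
    "\<And>ps. length ps = length xs \<Longrightarrow> (\<forall>p\<in>set ps. path_of_A Q p) \<Longrightarrow>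
      f ps \<in> alg_degree Q ((\<Sum>p\<leftarrow>ps. pdegree Q p) + d)"
  shows "ext f xs \<in> alg_degree Q (sum_list es + d)"
  using assms
proof (induction xs es arbitrary: f d rule: list_all2_induct)
  case Nil then show ?case by (auto dest: Nil.prems[of "[]"])
next
  case (Cons x xs e es)
  have "ext (\<lambda>ps. f (p # ps)) xs \<in> alg_degree Q (sum_list es + (e + d))"
    if "p \<in> Poly_Mapping.keys x" for p
  proof (rule Cons.IH)
    have "path_of_A Q p" "pdegree Q p = e"
      using that Cons.hyps(1) by (auto simp: alg_degree_iff in_keys_iff)
    then show "f (p # ps) \<in> alg_degree Q ((\<Sum>p\<leftarrow>ps. pdegree Q p) + (e + d))"
      if "length ps = length xs" "\<forall>p\<in>set ps. path_of_A Q p" for ps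
      using Cons.prems[of "p # ps"] that by (auto simp: algebra_simps)
  qed
  then show ?case by (auto intro!: alg_degree_sum alg_degree_closed(3) simp: algebra_simps)
qed

lemma ext_cochain:
  assumes "\<And>ps. f ps \<in> alg Q"
    "\<And>ps. length ps = n \<Longrightarrow> (\<forall>p\<in>set ps. path_of_A Q p) \<Longrightarrow>
      f ps \<in> alg_degree Q ((\<Sum>p\<leftarrow>ps. pdegree Q p) + d)"
  shows "(\<lambda>xs. if length xs = n \<and> set xs \<subseteq> alg Q then ext f xs else 0) \<in> hoch_cochains Q n d"
proof -
  have upd: "set (xs[i := z]) \<subseteq> alg Q" if "set xs \<subseteq> alg Q" "z \<in> alg Q"
    for xs i and z :: "('a, 'b) path \<Rightarrow>\<^sub>0 'c"
    using that by (meson insert_subset order_trans set_update_subset_insert)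
  have "mlin Q n (\<lambda>xs. if length xs = n \<and> set xs \<subseteq> alg Q then ext f xs else 0)"
    unfolding mlin_def by (auto simp: upd ext_mlin)
  then show ?thesis
    unfolding hoch_cochains_iff using assms by (auto simp: ext_alg intro!: ext_degree)
qed

section \<open>The Hochschild differential\<close>

definition merge :: "('v, 'a) graded_quiver \<Rightarrow> nat \<Rightarrow> (('v, 'a) path \<Rightarrow>\<^sub>0 'k::field) list \<Rightarrow>
    (('v, 'a) path \<Rightarrow>\<^sub>0 'k) list" where
  "merge Q j xs = take j xs @ [alg_mult Q (xs ! j) (xs ! Suc j)] @ drop (j + 2) xs"

lemma length_merge [simp]: "Suc j < length xs \<Longrightarrow> length (merge Q j xs) = length xs - 1"
  by (auto simp: merge_def)

lemma nth_merge:
  assumes "Suc j < length xs" "i < length xs - 1"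
  shows "merge Q j xs ! i =
    (if i < j then xs ! i else if i = j then alg_mult Q (xs ! j) (xs ! Suc j) else xs ! Suc i)"
proof -
  have "min (length xs) j = j" using assms by simp
  moreover have "Suc (Suc (j + (i - Suc j))) = Suc i" if "j < i" using that by simp
  ultimately show ?thesis using assms by (auto simp: merge_def nth_append nth_Cons')
qed

lemma merge_alg: "set xs \<subseteq> alg Q \<Longrightarrow> set (merge Q j xs) \<subseteq> alg Q"
  by (auto simp: merge_def dest: in_set_takeD in_set_dropD)

lemma tl_alg: "set xs \<subseteq> alg Q \<Longrightarrow> set (tl xs) \<subseteq> alg Q"
  by (cases xs) auto

lemma butlast_alg: "set xs \<subseteq> alg Q \<Longrightarrow> set (butlast xs) \<subseteq> alg Q"
  by (auto dest: in_set_butlastD)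

text \<open>The summands of the Hochschild differential without their alternating signs, indexed so
  that \<open>i = 0\<close> and \<open>i = n + 1\<close> are the outer ones. Separating them reduces
  the vanishing of the squared differential to the presimplicial relations
  \<open>face_face\<close>.\<close>

definition face :: "('v, 'a) graded_quiver \<Rightarrow> int \<Rightarrow> nat \<Rightarrow> nat \<Rightarrow>
    ((('v, 'a) path \<Rightarrow>\<^sub>0 'k::field) list \<Rightarrow> (('v, 'a) path \<Rightarrow>\<^sub>0 'k)) \<Rightarrow>
    (('v, 'a) path \<Rightarrow>\<^sub>0 'k) list \<Rightarrow> (('v, 'a) path \<Rightarrow>\<^sub>0 'k)" where
  "face Q d n i \<phi> xs =
     (if i = 0 then alg_mult Q (koszul_sign Q d (hd xs)) (\<phi> (tl xs))
      else if i \<le> n then \<phi> (merge Q (i - 1) xs) else alg_mult Q (\<phi> (butlast xs)) (last xs))"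

lemma hoch_diff_face:
  assumes "length xs = Suc n" "set xs \<subseteq> alg Q"
  shows "hoch_diff Q n d \<phi> xs =
    smult ((-1) powi d) (\<Sum>i\<le>Suc n. smult ((-1) ^ i) (face Q d n i \<phi> xs))"
proof -
  have "{..Suc n} = insert 0 (insert (Suc n) {1..n})" by auto
  moreover have "take (i - 1) xs @ [alg_mult Q (xs ! (i - 1)) (xs ! i)] @ drop (i + 1) xs =
      merge Q (i - 1) xs" if "i \<in> {1..n}" for i
    using that by (auto simp: merge_def)
  ultimately show ?thesis using assms
    by (simp add: hoch_diff_def face_def algebra_simps)
qed

lemma hoch_diff_outside: "\<not> (length xs = Suc n \<and> set xs \<subseteq> alg Q) \<Longrightarrow> hoch_diff Q n d \<phi> xs = 0"
  by (auto simp: hoch_diff_def)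

lemma face_alg [simp]: "(\<And>ys. \<phi> ys \<in> alg Q) \<Longrightarrow> face Q d n i \<phi> xs \<in> alg Q"
  by (simp add: face_def)

lemma face_sum:
  "face Q d n j (\<lambda>ys. smult s (\<Sum>i\<in>I. smult (c i) (\<phi> i ys))) xs =
    smult s (\<Sum>i\<in>I. smult (c i) (face Q d n j (\<phi> i) xs))"
  by (simp add: face_def alg_mult_linear alg_mult_sum)

lemma face_cong:
  assumes "length xs = Suc n" "set xs \<subseteq> alg Q" "j \<le> Suc n"
    "\<And>ys. length ys = n \<Longrightarrow> set ys \<subseteq> alg Q \<Longrightarrow> \<phi> ys = \<psi> ys"
  shows "face Q d n j \<phi> xs = face Q d n j \<psi> xs"
  using assms by (auto simp: face_def merge_alg tl_alg butlast_alg)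

text \<open>Products at distant positions do not interact; for \<open>Suc i = j\<close> this is
  associativity.\<close>

lemma merge_merge:
  assumes "i < j" "Suc j < length xs" "set xs \<subseteq> alg Q"
  shows "merge Q i (merge Q j xs) = merge Q (j - 1) (merge Q i xs)"
proof (rule nth_equalityI)
  show "length (merge Q i (merge Q j xs)) = length (merge Q (j - 1) (merge Q i xs))"
    using assms by simp
next
  fix k assume k: "k < length (merge Q i (merge Q j xs))"
  have [simp]: "xs ! l \<in> alg Q" if "l \<le> Suc j" for l
    using assms that by (meson le_less_trans nth_mem subsetD)
  consider "Suc i = j" | "Suc i < j" using assms by linarith
  then show "merge Q i (merge Q j xs) ! k = merge Q (j - 1) (merge Q i xs) ! k"
  proof cases
    case 1
    then show ?thesis using assms(2) k by (auto simp: nth_merge alg_mult_assoc)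
  next
    case 2
    then have "Suc (j - Suc 0) = j" by simp
    then show ?thesis using 2 assms(2) k by (auto simp: nth_merge)
  qed
qed

text \<open>Inner faces commute by \<open>merge_merge\<close>. Where an outer face meets a
  neighbouring face or the opposite outer face, the relation is associativity, for
  \<open>i = 0\<close> and \<open>j = 1\<close> together with \<open>koszul_mult\<close>.\<close>

lemma face_face:
  fixes \<phi> :: "(('v, 'a) path \<Rightarrow>\<^sub>0 'k::field) list \<Rightarrow> (('v, 'a) path \<Rightarrow>\<^sub>0 'k)"
  assumes "i < j" "j \<le> n + 2" and len: "length xs = n + 2" and alg: "set xs \<subseteq> alg Q"
    and val: "\<And>ys. \<phi> ys \<in> alg Q"
  shows "face Q d (Suc n) j (face Q d n i \<phi>) xs = face Q d (Suc n) i (face Q d n (j - 1) \<phi>) xs"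
proof -
  obtain x y zs where xs: "xs = x # y # zs" using len by (metis Suc_length_conv add_2_eq_Suc')
  have [simp]: "x \<in> alg Q" "y \<in> alg Q" using alg xs by auto
  have last_alg [simp]: "last xs \<in> alg Q" using alg xs by (metis last_in_set list.discI subsetD)
  have [simp]: "last zs \<in> alg Q" if "zs \<noteq> []" using last_alg that xs by simp
  consider (a) "i = 0" "j = 1" | (b) "i = 0" "2 \<le> j" "j \<le> Suc n" | (c) "i = 0" "j = n + 2"
    | (d) "1 \<le> i" "j \<le> Suc n" | (e) "1 \<le> i" "i \<le> n" "j = n + 2" | (f) "i = Suc n" "j = n + 2"
    using assms by linarith
  then show ?thesis
  proof cases
    case a
    then show ?thesis using xs by (simp add: face_def merge_def koszul_mult alg_mult_assoc val)
  next
    case b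
    define j' where "j' = j - 2"
    have j: "j = Suc (Suc j')" using b by (simp add: j'_def)
    then show ?thesis using b xs len by (simp add: face_def merge_def)
  next
    case c
    then show ?thesis using xs len by (cases n) (auto simp: face_def alg_mult_assoc val butlast_tl)
  next
    case d
    have "merge Q (i - 1) (merge Q (j - 1) xs) = merge Q (j - 1 - 1) (merge Q (i - 1) xs)"
      using d assms by (intro merge_merge) auto
    then show ?thesis using d assms by (auto simp: face_def)
  next
    case e
    have "merge Q (i - 1) (butlast xs) = butlast (merge Q (i - 1) xs)"
      using e len by (intro nth_equalityI) (auto simp: nth_merge nth_butlast)
    moreover have "last (merge Q (i - 1) xs) = last xs"
    proof -
      have "merge Q (i - 1) xs \<noteq> []" "xs \<noteq> []" using len by (auto simp: merge_def)
      then show ?thesis using e len by (auto simp: last_conv_nth nth_merge)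
    qed
    ultimately show ?thesis using e by (auto simp: face_def)
  next
    case f
    obtain ws w where ws: "xs = ws @ [w]" using len by (cases xs rule: rev_cases) auto
    moreover obtain us u where "ws = us @ [u]" using len ws by (cases ws rule: rev_cases) auto
    ultimately have us: "xs = us @ [u, w]" by simp
    then have "length us = n" "u \<in> alg Q" "w \<in> alg Q" using len alg by auto
    then show ?thesis using f us by (simp add: face_def merge_def butlast_append nth_append alg_mult_assoc val)
  qed
qed

text \<open>Terms with \<open>i < j\<close> correspond to terms with \<open>j \<le> i\<close> under
  \<open>(j, i) \<mapsto> (i, j - 1)\<close>; the hypothesis equates the values, and the sign
  changes.\<close>

lemma alternating_sum_zero:
  fixes T :: "nat \<Rightarrow> nat \<Rightarrow> 'c::comm_ring_1"
  assumes "\<And>i j. i < j \<Longrightarrow> j \<le> Suc n \<Longrightarrow> T j i = T i (j - 1)"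
  shows "(\<Sum>j\<le>Suc n. \<Sum>i\<le>n. (-1) ^ (i + j) * T j i) = 0"
proof -
  let ?f = "\<lambda>(j, i). (-1) ^ (i + j) * T j i"
  let ?A = "{(j, i). i < j \<and> j \<le> Suc n}" and ?B = "{(j, i). j \<le> i \<and> i \<le> n}"
  have fin: "finite ?A" "finite ?B"
    by (rule finite_subset[of _ "{..Suc n} \<times> {..Suc n}"]; auto)+
  have "(\<Sum>j\<le>Suc n. \<Sum>i\<le>n. (-1) ^ (i + j) * T j i) = sum ?f ({..Suc n} \<times> {..n})"
    by (simp only: sum.cartesian_product)
  also have "{..Suc n} \<times> {..n} = ?A \<union> ?B" by auto
  also have "sum ?f (?A \<union> ?B) = sum ?f ?A + sum ?f ?B"
    using fin by (intro sum.union_disjoint) auto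
  also have "sum ?f ?A = (\<Sum>p\<in>?B. - ?f p)"
  proof (rule sum.reindex_bij_witness[where j = "\<lambda>(j, i). (i, j - 1)" and i = "\<lambda>(j, i). (Suc i, j)"])
    fix p assume "p \<in> ?A"
    then obtain j i where p: "p = (Suc j, i)" "i < Suc j" "Suc j \<le> Suc n"
      by (cases p; cases "fst p") auto
    then show "- ?f (case p of (j, i) \<Rightarrow> (i, j - 1)) = ?f p"
      using assms[of i "Suc j"] by (simp add: add.commute)
  qed auto
  finally show ?thesis by (simp add: sum_negf)
qed

lemma hoch_diff_hoch_diff:
  fixes \<phi> :: "(('v, 'a) path \<Rightarrow>\<^sub>0 'k::field) list \<Rightarrow> (('v, 'a) path \<Rightarrow>\<^sub>0 'k)"
  assumes val: "\<And>ys. \<phi> ys \<in> alg Q"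
  shows "hoch_diff Q (Suc n) d (hoch_diff Q n d \<phi>) = 0"
proof
  fix xs
  show "hoch_diff Q (Suc n) d (hoch_diff Q n d \<phi>) xs = 0 xs"
  proof (cases "length xs = Suc (Suc n) \<and> set xs \<subseteq> alg Q")
    case False
    then show ?thesis by (simp add: hoch_diff_outside)
  next
    case True
    let ?s = "(-1) powi d :: 'k"
    have 1: "face Q d (Suc n) j (hoch_diff Q n d \<phi>) xs =
      smult ?s (\<Sum>i\<le>Suc n. smult ((-1) ^ i) (face Q d (Suc n) j (face Q d n i \<phi>) xs))"
      if "j \<le> Suc (Suc n)" for j
      unfolding face_sum[symmetric] using True that
      by (intro face_cong) (auto simp: hoch_diff_face)
    show ?thesis
    proof (rule poly_mapping_eqI)
      fix q
      have "lk (hoch_diff Q (Suc n) d (hoch_diff Q n d \<phi>) xs) q = ?s * ?s *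
        (\<Sum>j\<le>Suc (Suc n). \<Sum>i\<le>Suc n. (-1) ^ (i + j) * lk (face Q d (Suc n) j (face Q d n i \<phi>) xs) q)"
        using True 1
        by (simp add: hoch_diff_face lookup_sum sum_distrib_left power_add mult_ac del: sum.atMost_Suc)
      also have "\<dots> = ?s * ?s * 0"
        using True by (subst alternating_sum_zero) (auto simp: face_face val)
      finally show "lk (hoch_diff Q (Suc n) d (hoch_diff Q n d \<phi>) xs) q = lk (0 xs) q" by simp
    qed
  qed
qed

lemma face_mlin:
  fixes \<phi> :: "(('v, 'a) path \<Rightarrow>\<^sub>0 'k::field) list \<Rightarrow> (('v, 'a) path \<Rightarrow>\<^sub>0 'k)"
  assumes "mlin Q n \<phi>" "i \<le> Suc n"
  shows "mlin Q (Suc n) (face Q d n i \<phi>)"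
  unfolding mlin_def
proof (intro allI impI, elim conjE)
  fix xs :: "(('v, 'a) path \<Rightarrow>\<^sub>0 'k) list" and k c and x y :: "('v, 'a) path \<Rightarrow>\<^sub>0 'k"
  assume len: "length xs = Suc n" and alg: "set xs \<subseteq> alg Q" and k: "k < Suc n"
    and xy: "x \<in> alg Q" "y \<in> alg Q"
  note lin = assms(1)[unfolded mlin_def, rule_format]
  have nth: "xs ! l \<in> alg Q" if "l < Suc n" for l using alg len that by (metis nth_mem subsetD)
  consider "i = 0" | "1 \<le> i" "i \<le> n" | "i = Suc n" using assms(2) by linarith
  then show "face Q d n i \<phi> (xs[k := smult c x + y]) =
    smult c (face Q d n i \<phi> (xs[k := x])) + face Q d n i \<phi> (xs[k := y])"
  proof cases
    case 1
    obtain z zs where xs: "xs = z # zs" using len by (cases xs) auto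
    then show ?thesis using 1 len k alg xy lin
      by (cases k) (auto simp: face_def alg_mult_linear koszul_linear)
  next
    case 3
    obtain zs z where xs: "xs = zs @ [z]" using len by (cases xs rule: rev_cases) auto
    then show ?thesis using 3 len k alg xy lin
      by (cases "k = n") (auto simp: face_def alg_mult_linear list_update_append)
  next
    case 2
    then obtain j where j: "i = Suc j" "j < n" by (cases i) auto
    \<comment> \<open>Four cases: the changed entry lies before the merged pair, is its left or its
      right factor, or lies behind it and moves one place to the left.\<close>
    have u: "merge Q j (xs[k := z]) =
      (if k < j then (merge Q j xs)[k := z]
       else if k = j then (merge Q j xs)[j := alg_mult Q z (xs ! Suc j)]
       else if k = Suc j then (merge Q j xs)[j := alg_mult Q (xs ! j) z]
       else (merge Q j xs)[k - 1 := z])" for z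
    proof (rule nth_equalityI)
      fix l assume "l < length (merge Q j (xs[k := z]))"
      then have "l < n" using j len by simp
      then show "merge Q j (xs[k := z]) ! l = (if k < j then (merge Q j xs)[k := z]
       else if k = j then (merge Q j xs)[j := alg_mult Q z (xs ! Suc j)]
       else if k = Suc j then (merge Q j xs)[j := alg_mult Q (xs ! j) z]
       else (merge Q j xs)[k - 1 := z]) ! l"
        using j len k by (auto simp: nth_merge nth_list_update)
    qed (use j len in auto)
    have m: "length (merge Q j xs) = n" "set (merge Q j xs) \<subseteq> alg Q"
      using j len alg by (simp_all add: merge_alg)
    show ?thesis
      using j xy nth[of j] nth[of "Suc j"] k m
      by (auto simp: face_def u alg_mult_linear lin)
  qed
qed

lemma face_degree:
  assumes "\<phi> \<in> hoch_cochains Q n d" "length xs = Suc n" "i \<le> Suc n"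
    "list_all2 (\<lambda>x e. x \<in> alg_degree Q e) xs es"
  shows "face Q d n i \<phi> xs \<in> alg_degree Q (sum_list es + d)"
proof -
  have deg: "\<phi> ys \<in> alg_degree Q (sum_list fs + d)"
    if "length ys = n" "list_all2 (\<lambda>x e. x \<in> alg_degree Q e) ys fs" for ys fs
    using assms(1) that by (simp add: hoch_cochains_iff)
  have les: "length es = Suc n" using assms by (simp add: list_all2_lengthD)
  consider "i = 0" | "1 \<le> i" "i \<le> n" | "i = Suc n" using assms(3) by linarith
  then show ?thesis
  proof cases
    case 1
    obtain x ys where xs: "xs = x # ys" using assms(2) by (cases xs) auto
    then obtain e fs where es: "es = e # fs" "x \<in> alg_degree Q e"
      "list_all2 (\<lambda>x e. x \<in> alg_degree Q e) ys fs"
      using assms(4) by (auto simp: list_all2_Cons1)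
    then show ?thesis
      using 1 xs assms(2) alg_degree_mult[OF koszul_degree[OF es(2)] deg[OF _ es(3)]]
      by (simp add: face_def add.assoc)
  next
    case 3
    obtain ys x where xs: "xs = ys @ [x]" using assms(2) by (cases xs rule: rev_cases) auto
    then obtain e fs where es: "es = fs @ [e]" "x \<in> alg_degree Q e"
      "list_all2 (\<lambda>x e. x \<in> alg_degree Q e) ys fs"
      using assms(4) by (auto simp: list_all2_append1 list_all2_Cons1)
    then show ?thesis
      using 3 xs assms(2) alg_degree_mult[OF deg[OF _ es(3)] es(2)]
      by (simp add: face_def algebra_simps)
  next
    case 2
    then obtain j where j: "i = Suc j" "j < n" by (cases i) auto
    define ys where "ys = take j xs"
    define zs where "zs = drop (j + 2) xs"
    have xs: "xs = ys @ xs ! j # xs ! Suc j # zs"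
      unfolding ys_def zs_def using j assms(2)
      by (metis Cons_nth_drop_Suc Suc_less_eq add_2_eq_Suc' append_take_drop_id less_SucI)
    have l: "Suc (length ys + length zs) = n" unfolding ys_def zs_def using j assms(2) by simp
    have m: "merge Q j xs = ys @ alg_mult Q (xs ! j) (xs ! Suc j) # zs"
      by (simp add: merge_def ys_def zs_def)
    obtain fs e e' gs where es: "es = fs @ e # e' # gs"
      "list_all2 (\<lambda>x e. x \<in> alg_degree Q e) ys fs" "xs ! j \<in> alg_degree Q e"
      "xs ! Suc j \<in> alg_degree Q e'" "list_all2 (\<lambda>x e. x \<in> alg_degree Q e) zs gs"
    proof -
      have "list_all2 (\<lambda>x e. x \<in> alg_degree Q e) (ys @ xs ! j # xs ! Suc j # zs) es"
        using assms(4) xs by metis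
      then show thesis using that by (auto simp: list_all2_append1 list_all2_Cons1)
    qed
    have "\<phi> (merge Q j xs) \<in> alg_degree Q (sum_list (fs @ (e + e') # gs) + d)"
      using m es j assms(2) l by (intro deg) (auto intro!: list_all2_appendI alg_degree_mult)
    then show ?thesis using j es by (simp add: face_def algebra_simps)
  qed
qed

lemma list_all2_degree_alg:
  "list_all2 (\<lambda>x e. x \<in> alg_degree Q e) xs es \<Longrightarrow> set xs \<subseteq> alg Q"
  by (auto simp: list_all2_conv_all_nth in_set_conv_nth dest!: alg_degree_alg)

lemma hoch_diff_cochain:
  fixes \<phi> :: "(('v, 'a) path \<Rightarrow>\<^sub>0 'k::field) list \<Rightarrow> (('v, 'a) path \<Rightarrow>\<^sub>0 'k)"
  assumes \<phi>: "\<phi> \<in> hoch_cochains Q n d"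
  shows "hoch_diff Q n d \<phi> \<in> hoch_cochains Q (Suc n) d"
  unfolding hoch_cochains_iff
proof (intro conjI allI impI)
  have lin: "mlin Q n \<phi>" using \<phi> by (simp add: hoch_cochains_iff)
  show "hoch_diff Q n d \<phi> xs \<in> alg Q" for xs
    using \<phi> by (cases "length xs = Suc n \<and> set xs \<subseteq> alg Q")
      (auto simp: hoch_diff_face hoch_diff_outside intro!: alg_closed(3) alg_sum face_alg simp del: sum.atMost_Suc)
  show "hoch_diff Q n d \<phi> xs = 0" if "\<not> (length xs = Suc n \<and> set xs \<subseteq> alg Q)" for xs
    using that by (rule hoch_diff_outside)
  show "mlin Q (Suc n) (hoch_diff Q n d \<phi>)"
    unfolding mlin_def
  proof (intro allI impI, elim conjE)
    fix xs :: "(('v, 'a) path \<Rightarrow>\<^sub>0 'k) list" and k c and x y :: "('v, 'a) path \<Rightarrow>\<^sub>0 'k"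
    assume len: "length xs = Suc n" and alg: "set xs \<subseteq> alg Q" and k: "k < Suc n"
      and xy: "x \<in> alg Q" "y \<in> alg Q"
    have upd: "set (xs[k := z]) \<subseteq> alg Q" if "z \<in> alg Q" for z
      using that alg by (meson insert_subset order_trans set_update_subset_insert)
    have f: "face Q d n i \<phi> (xs[k := smult c x + y]) =
      smult c (face Q d n i \<phi> (xs[k := x])) + face Q d n i \<phi> (xs[k := y])" if "i \<le> Suc n" for i
      using face_mlin[OF lin that, of d] len alg k xy unfolding mlin_def by blast
    show "hoch_diff Q n d \<phi> (xs[k := smult c x + y]) =
      smult c (hoch_diff Q n d \<phi> (xs[k := x])) + hoch_diff Q n d \<phi> (xs[k := y])"
      using len upd xy f
      by (simp add: hoch_diff_face smult_sum smult_add sum.distrib mult_ac del: sum.atMost_Suc)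
  qed
  show "hoch_diff Q n d \<phi> xs \<in> alg_degree Q (sum_list es + d)"
    if "length xs = Suc n \<and> list_all2 (\<lambda>x e. x \<in> alg_degree Q e) xs es" for xs es
    using that face_degree[OF \<phi>] 
    by (auto simp: hoch_diff_face list_all2_degree_alg simp del: sum.atMost_Suc
        intro!: alg_degree_closed(3) alg_degree_sum)
qed

section \<open>The Hochschild differential on basis paths\<close>

definition coef :: "((('v, 'a) path \<Rightarrow>\<^sub>0 'k::field) list \<Rightarrow> (('v, 'a) path \<Rightarrow>\<^sub>0 'k)) \<Rightarrow>
    ('v, 'a) path list \<Rightarrow> ('v, 'a) path \<Rightarrow> 'k" where
  "coef \<phi> ps q = lk (\<phi> (map sg ps)) q"

text \<open>The only candidate \<open>x\<close> for \<open>pcomp p x = q\<close>;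
  \<open>ldiv\<close> tests that it is one. On the other side \<open>rquot\<close> has to be given
  its source, the target of \<open>p\<close>, since a path records nothing but its source and its
  arrows.\<close>

definition lquot :: "('v, 'a) path \<Rightarrow> ('v, 'a) path \<Rightarrow> ('v, 'a) path" where
  "lquot p q = (fst q, drop (length (snd p)) (snd q))"

definition ldiv :: "('v, 'a) graded_quiver \<Rightarrow> ('v, 'a) path \<Rightarrow> ('v, 'a) path \<Rightarrow> bool" where
  "ldiv Q p q \<longleftrightarrow> composable Q p (lquot p q) \<and> pcomp p (lquot p q) = q"

definition rquot :: "('v, 'a) graded_quiver \<Rightarrow> ('v, 'a) path \<Rightarrow> ('v, 'a) path \<Rightarrow> ('v, 'a) path" where
  "rquot Q p q = (ptarget Q p, take (length (snd q) - length (snd p)) (snd q))"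

definition rdiv :: "('v, 'a) graded_quiver \<Rightarrow> ('v, 'a) path \<Rightarrow> ('v, 'a) path \<Rightarrow> bool" where
  "rdiv Q p q \<longleftrightarrow> pcomp (rquot Q p q) p = q"

lemma lquot_pcomp [simp]: "lquot p (pcomp p q) = q"
  by (simp add: lquot_def pcomp_def psource_def)

lemma rquot_pcomp [simp]: "composable Q q p \<Longrightarrow> rquot Q p (pcomp q p) = q"
  by (simp add: rquot_def pcomp_def composable_def psource_def prod_eq_iff)

lemma composable_rquot [simp]: "composable Q (rquot Q p q) p"
  by (simp add: composable_def rquot_def psource_def)

lemma lookup_sg_mult:
  assumes "path_of_A Q q"
  shows "lk (alg_mult Q (sg p) f) q = (if ldiv Q p q then lk f (lquot p q) else 0)"
proof -
  have "lk (alg_mult Q (sg p) f) q =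
      (\<Sum>q'\<in>Poly_Mapping.keys f. if composable Q p q' \<and> pcomp p q' = q then lk f q' else 0)"
    using assms lookup_path_mult[of "{p}" "sg p" "Poly_Mapping.keys f" f Q q]
    by (simp add: alg_mult_def lookup_reduce cong: if_cong)
  also have "\<dots> = (\<Sum>q'\<in>Poly_Mapping.keys f. if q' = lquot p q then (if ldiv Q p q then lk f q' else 0) else 0)"
    by (intro sum.cong refl) (auto simp: ldiv_def)
  also have "\<dots> = (if ldiv Q p q then lk f (lquot p q) else 0)"
    by (auto simp: sum.delta in_keys_iff)
  finally show ?thesis .
qed

lemma lookup_mult_sg:
  assumes "path_of_A Q q"
  shows "lk (alg_mult Q f (sg p)) q = (if rdiv Q p q then lk f (rquot Q p q) else 0)"
proof -
  have "lk (alg_mult Q f (sg p)) q =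
      (\<Sum>q'\<in>Poly_Mapping.keys f. if composable Q q' p \<and> pcomp q' p = q then lk f q' else 0)"
    using assms lookup_path_mult[of "Poly_Mapping.keys f" f "{p}" "sg p" Q q]
    by (simp add: alg_mult_def lookup_reduce cong: if_cong)
  also have "\<dots> = (\<Sum>q'\<in>Poly_Mapping.keys f. if q' = rquot Q p q then (if rdiv Q p q then lk f q' else 0) else 0)"
    by (intro sum.cong refl) (auto simp: rdiv_def)
  also have "\<dots> = (if rdiv Q p q then lk f (rquot Q p q) else 0)"
    by (auto simp: sum.delta in_keys_iff)
  finally show ?thesis .
qed

lemma alg_mult_sg:
  "alg_mult Q (sg p) (sg q) =
    (if composable Q p q \<and> path_of_A Q (pcomp p q) then sg (pcomp p q) else 0)"
  by (intro poly_mapping_eqI)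
    (auto simp: alg_mult_def path_mult_single lookup_reduce lookup_single when_def)

text \<open>The inner products and the last summand of the Hochschild differential, up to a common
  sign: \<open>f\<close> is evaluated on lists with two neighbours multiplied, \<open>h\<close> on
  the list without its last entry. Recursion along the list, instead of a sum over positions, allows
  leading arrows of an anti-path and runs of trivial paths to be peeled off.\<close>

fun msum :: "('v, 'a) graded_quiver \<Rightarrow> (('v, 'a) path list \<Rightarrow> 'k::field) \<Rightarrow>
    (('v, 'a) path list \<Rightarrow> 'k) \<Rightarrow> ('v, 'a) path list \<Rightarrow> 'k" where
  "msum Q f h (p # q # ps) =
     (if composable Q p q \<and> path_of_A Q (pcomp p q) then f (pcomp p q # ps) else 0)
     - msum Q (\<lambda>r. f (p # r)) (\<lambda>r. h (p # r)) (q # ps)"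
| "msum Q f h [p] = h []"
| "msum Q f h [] = 0"

text \<open>A product of two paths is a path or 0 in \<open>A\<close>. The hypothesis on
  \<open>F\<close> removes the zero case, so that only lists of paths remain on the right.\<close>

lemma msum_merge:
  fixes F :: "(('v, 'a) path \<Rightarrow>\<^sub>0 'k::field) list \<Rightarrow> 'k"
  assumes "length ps = Suc n" "\<And>ys. 0 \<in> set ys \<Longrightarrow> F ys = 0"
  shows "(\<Sum>j<n. (-1) ^ Suc j * F (merge Q j (map sg ps))) + (-1) ^ Suc n * h (butlast ps) =
    - msum Q (\<lambda>r. F (map sg r)) h ps"
  using assms
proof (induction Q "\<lambda>r. F (map sg r)" h ps arbitrary: F n rule: msum.induct)
  case (1 Q h p q ps)
  then obtain m where n: "n = Suc m" "length (q # ps) = Suc m" by auto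
  have gen: "A + H' = - (X - M)" if "B + H = - M" "A = - X - B" "H' = - H" for A B X H M H' :: 'k
  proof -
    have "M = - (B + H)" using that(1) by simp
    then show ?thesis using that(2,3) by simp
  qed
  have E1: "(\<Sum>j<m. (-1) ^ Suc j * F (sg p # merge Q j (map sg (q # ps)))) +
      (-1) ^ Suc m * h (p # butlast (q # ps)) =
    - msum Q (\<lambda>r. F (map sg (p # r))) (\<lambda>r. h (p # r)) (q # ps)"
    using 1(1)[of "\<lambda>ys. F (sg p # ys)" m] 1(3) n by simp
  have E2: "(\<Sum>j<n. (-1) ^ Suc j * F (merge Q j (map sg (p # q # ps)))) =
    - F (merge Q 0 (map sg (p # q # ps)))
    - (\<Sum>j<m. (-1) ^ Suc j * F (sg p # merge Q j (map sg (q # ps))))"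
    unfolding n sum.lessThan_Suc_shift by (simp add: merge_def sum_negf)
  have E3: "F (merge Q 0 (map sg (p # q # ps))) =
    (if composable Q p q \<and> path_of_A Q (pcomp p q) then F (map sg (pcomp p q # ps)) else 0)"
    using 1(3) by (simp add: merge_def alg_mult_sg)
  have E4: "(-1) ^ Suc n * h (butlast (p # q # ps)) = - ((-1) ^ Suc m * h (p # butlast (q # ps)))"
    using n by simp
  show ?case unfolding msum.simps by (rule gen[OF E1 E2[unfolded E3] E4])
qed auto

lemma cochain_zero_arg:
  assumes "\<phi> \<in> hoch_cochains Q n d" "0 \<in> set ys"
  shows "\<phi> ys = 0"
proof (cases "length ys = n \<and> set ys \<subseteq> alg Q")
  case True
  from assms(2) obtain i where i: "i < length ys" "ys ! i = 0" by (auto simp: in_set_conv_nth)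
  then show ?thesis
    using mlin_sum[of Q n \<phi> ys i "{}" "\<lambda>_. 0" "\<lambda>_. 0"] assms(1) True
    by (auto simp: hoch_cochains_iff list_update_same_conv[THEN iffD2])
qed (use assms in \<open>auto simp: hoch_cochains_iff\<close>)

lemma coef_diff:
  fixes \<phi> :: "(('v, 'a) path \<Rightarrow>\<^sub>0 'k::field) list \<Rightarrow> (('v, 'a) path \<Rightarrow>\<^sub>0 'k)"
  assumes \<phi>: "\<phi> \<in> hoch_cochains Q n d" and len: "length ps = Suc n"
    and ps: "\<forall>p\<in>set ps. path_of_A Q p" and q: "path_of_A Q q"
  shows "coef (hoch_diff Q n d \<phi>) ps q = (-1) powi d *
    ((if ldiv Q (hd ps) q then (-1) powi (d * pdegree Q (hd ps)) * coef \<phi> (tl ps) (lquot (hd ps) q) else 0)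
     - msum Q (\<lambda>r. coef \<phi> r q)
        (\<lambda>r. if rdiv Q (last ps) q then coef \<phi> r (rquot Q (last ps) q) else 0) ps)"
proof -
  let ?xs = "map sg ps :: (('v, 'a) path \<Rightarrow>\<^sub>0 'k) list"
  have ne: "ps \<noteq> []" using len by auto
  have xs: "length ?xs = Suc n" "set ?xs \<subseteq> alg Q" using len ps by auto
  have k: "koszul_sign Q d (sg (hd ps)) = smult ((-1) powi (d * pdegree Q (hd ps))) (sg (hd ps))"
    by (intro poly_mapping_eqI) (auto simp: lookup_single when_def)
  have L: "lk (face Q d n 0 \<phi> ?xs) q = (if ldiv Q (hd ps) q
    then (-1) powi (d * pdegree Q (hd ps)) * coef \<phi> (tl ps) (lquot (hd ps) q) else 0)"
    using ne q by (simp add: face_def hd_map k alg_mult_linear lookup_sg_mult coef_def map_tl del: smult_simps(5))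
  have R: "lk (face Q d n (Suc n) \<phi> ?xs) q =
    (if rdiv Q (last ps) q then coef \<phi> (butlast ps) (rquot Q (last ps) q) else 0)"
    using ne q by (simp add: face_def last_map lookup_mult_sg coef_def map_butlast)
  have M: "(\<Sum>i\<le>Suc n. (-1) ^ i * lk (face Q d n i \<phi> ?xs) q) =
    lk (face Q d n 0 \<phi> ?xs) q + ((\<Sum>j<n. (-1) ^ Suc j * lk (\<phi> (merge Q j ?xs)) q)
     + (-1) ^ Suc n * lk (face Q d n (Suc n) \<phi> ?xs) q)"
    unfolding sum.atMost_Suc sum.atMost_shift by (simp add: face_def)
  have MM: "(\<Sum>j<n. (-1) ^ Suc j * lk (\<phi> (merge Q j ?xs)) q) + (-1) ^ Suc n *
      (if rdiv Q (last ps) q then coef \<phi> (butlast ps) (rquot Q (last ps) q) else 0) =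
    - msum Q (\<lambda>r. coef \<phi> r q)
        (\<lambda>r. if rdiv Q (last ps) q then coef \<phi> r (rquot Q (last ps) q) else 0) ps"
    unfolding coef_def
    by (rule msum_merge[where F = "\<lambda>ys. lk (\<phi> ys) q" and
          h = "\<lambda>r. if rdiv Q (last ps) q then lk (\<phi> (map sg r)) (rquot Q (last ps) q) else 0", OF len])
      (simp add: cochain_zero_arg[OF \<phi>])
  show ?thesis
    unfolding coef_def[of "hoch_diff Q n d \<phi>"] hoch_diff_face[OF xs] lookup_smult lookup_sum M R MM L
    by simp
qed

section \<open>An acyclic matching on the bar complex\<close>

text \<open>
  \<open>scan\<close> reads the longest anti-path formed by leading arrows of a list of paths, and compares the vertex
  \<open>x\<close> reached with the next entry. A cell is matched either by inserting the trivial path at \<open>x\<close> there (the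
  parity of the number of trivial paths already present decides between \<open>Up_Insert\<close> and \<open>Down\<close>), or by splitting
  off the first arrow of the next entry; \<open>Critical\<close> cells consist of a single anti-path parallel to \<open>q\<close>.
\<close>

datatype cell_kind = Critical | Down | Up_Insert | Up_Split

definition continues :: "('v, 'a) graded_quiver \<Rightarrow> 'v \<Rightarrow> 'a option \<Rightarrow> ('v, 'a) path \<Rightarrow> bool" where
  "continues Q x prev p \<longleftrightarrow> (\<exists>\<alpha>\<in>arrows Q. p = arrow_path Q \<alpha> \<and> target Q \<alpha> = x \<and>
     (\<forall>\<beta>. prev = Some \<beta> \<longrightarrow> (\<beta>, \<alpha>) \<in> relations Q))"

text \<open>With \<open>t\<close> trivial paths at \<open>x\<close> in front, the value is
  \<open>t\<close> even if the next vertex differs from \<open>x\<close>, and \<open>t\<close> odd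
  if it equals \<open>x\<close>. One more trivial path always flips the value, so inserting and
  deleting are inverse to each other, and a list that continues at \<open>x\<close> without a
  trivial entry stays available for splitting.\<close>

fun insertable :: "('v, 'a) graded_quiver \<Rightarrow> 'v \<Rightarrow> ('v, 'a) path list \<Rightarrow> 'v \<Rightarrow> bool" where
  "insertable Q x [] y \<longleftrightarrow> x \<noteq> y"
| "insertable Q x (p # ps) y \<longleftrightarrow> (if p = (x, []) then \<not> insertable Q x ps y else ptarget Q p \<noteq> x)"

fun scan :: "('v, 'a) graded_quiver \<Rightarrow> 'v \<Rightarrow> 'a option \<Rightarrow> ('v, 'a) path list \<Rightarrow> 'v \<Rightarrow> nat \<times> cell_kind" where
  "scan Q x prev [] y = (0, if x = y then Critical else Up_Insert)"
| "scan Q x prev (p # ps) y =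
     (if continues Q x prev p then apfst Suc (scan Q (fst p) (Some (hd (snd p))) ps y)
      else (0, if snd p = [] \<or> ptarget Q p \<noteq> x
               then (if insertable Q x (p # ps) y then Up_Insert else Down)
               else if \<exists>\<beta>. prev = Some \<beta> \<and> (\<beta>, hd (snd p)) \<notin> relations Q then Down else Up_Split))"

abbreviation scan_cell :: "('v, 'a) graded_quiver \<Rightarrow> ('v, 'a) path list \<Rightarrow> ('v, 'a) path \<Rightarrow> nat \<times> cell_kind" where
  "scan_cell Q ps q \<equiv> scan Q (ptarget Q q) None ps (fst q)"

abbreviation kind :: "('v, 'a) graded_quiver \<Rightarrow> ('v, 'a) path list \<Rightarrow> ('v, 'a) path \<Rightarrow> cell_kind" where
  "kind Q ps q \<equiv> snd (scan_cell Q ps q)"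

text \<open>Anti-paths in the form in which \<open>scan\<close> meets them: read from the target
  \<open>x\<close> to the source \<open>z\<close>, with the preceding arrow as a state. For
  \<open>prev = None\<close> this is \<open>anti_path\<close> with prescribed end points, see
  \<open>chain_anti_path\<close>.\<close>

fun chain :: "('v, 'a) graded_quiver \<Rightarrow> 'v \<Rightarrow> 'a option \<Rightarrow> 'a list \<Rightarrow> 'v \<Rightarrow> bool" where
  "chain Q x prev [] z \<longleftrightarrow> x = z"
| "chain Q x prev (\<alpha> # w) z \<longleftrightarrow> \<alpha> \<in> arrows Q \<and> target Q \<alpha> = x \<and>
     (\<forall>\<beta>. prev = Some \<beta> \<longrightarrow> (\<beta>, \<alpha>) \<in> relations Q) \<and> chain Q (source Q \<alpha>) (Some \<alpha>) w z"

definition last_arrow :: "'a option \<Rightarrow> 'a list \<Rightarrow> 'a option" where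
  "last_arrow prev w = (if w = [] then prev else Some (last w))"

lemma last_arrow_simps [simp]:
  "last_arrow prev [] = prev"
  "last_arrow prev (w @ [\<alpha>]) = Some \<alpha>"
  by (auto simp: last_arrow_def)

lemma arrow_path_simps [simp]:
  "snd (arrow_path Q \<alpha>) = [\<alpha>]" "fst (arrow_path Q \<alpha>) = source Q \<alpha>"
  "ptarget Q (arrow_path Q \<alpha>) = target Q \<alpha>" "psource (arrow_path Q \<alpha>) = source Q \<alpha>"
  "pdegree Q (arrow_path Q \<alpha>) = degree Q \<alpha>"
  by (auto simp: arrow_path_def ptarget_def psource_def pdegree_def)

lemma arrow_path_not_trivial [simp]: "arrow_path Q \<alpha> \<noteq> (x, [])" "(x, []) \<noteq> arrow_path Q \<alpha>"
  by (auto simp: arrow_path_def)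

lemma not_continues_trivial [simp]: "\<not> continues Q z prev (x, [])"
  by (simp add: continues_def)

lemma scan_chain:
  "chain Q x prev w z \<Longrightarrow>
    scan Q x prev (map (arrow_path Q) w @ R) y = apfst ((+) (length w)) (scan Q z (last_arrow prev w) R y)"
proof (induction w arbitrary: x prev)
  case Nil
  then show ?case by (cases "scan Q z prev R y") simp
next
  case (Cons \<alpha> w)
  then have "continues Q x prev (arrow_path Q \<alpha>)" by (auto simp: continues_def)
  with Cons show ?case
    by (cases "scan Q z (last_arrow prev (\<alpha> # w)) R y") (simp add: last_arrow_def split: if_splits)
qed

lemma chain_weaken: "chain Q x prev w z \<Longrightarrow> chain Q x None w z"
  by (cases w) auto

lemma chain_append:
  "chain Q x prev (w @ w') z \<longleftrightarrow> (\<exists>y. chain Q x prev w y \<and> chain Q y (last_arrow prev w) w' z)"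
  by (induction w arbitrary: x prev) (auto simp: last_arrow_def)

lemma scan_decomp:
  obtains w z R where "ps = map (arrow_path Q) w @ R" "chain Q x prev w z"
    "R = [] \<or> \<not> continues Q z (last_arrow prev w) (hd R)"
proof (induction ps arbitrary: x prev thesis)
  case Nil
  then show ?case by (metis append_Nil chain.simps(1) list.simps(8))
next
  case (Cons p ps)
  show ?case
  proof (cases "continues Q x prev p")
    case True
    then obtain \<alpha> where \<alpha>: "\<alpha> \<in> arrows Q" "p = arrow_path Q \<alpha>" "target Q \<alpha> = x"
      "\<forall>\<beta>. prev = Some \<beta> \<longrightarrow> (\<beta>, \<alpha>) \<in> relations Q" by (auto simp: continues_def)
    obtain w z R where "ps = map (arrow_path Q) w @ R" "chain Q (source Q \<alpha>) (Some \<alpha>) w z"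
      "R = [] \<or> \<not> continues Q z (last_arrow (Some \<alpha>) w) (hd R)"
      using Cons.IH by blast
    then show ?thesis using \<alpha> by (intro Cons.prems[of "\<alpha> # w" R z]) (auto simp: last_arrow_def split: if_splits)
  next
    case False
    then show ?thesis by (intro Cons.prems[of "[]" "p # ps" x]) auto
  qed
qed

lemma scan_insertable: "insertable Q z R y \<Longrightarrow> scan Q z prev R y = (0, Up_Insert)"
  by (cases R) (auto simp: continues_def ptarget_def split: if_splits)

lemma Up_Insert_decomp:
  assumes "scan Q x prev ps y = (j, Up_Insert)"
  obtains w z R where "ps = map (arrow_path Q) w @ R" "chain Q x prev w z" "insertable Q z R y" "j = length w"
proof -
  obtain w z R where w: "ps = map (arrow_path Q) w @ R" "chain Q x prev w z"
    "R = [] \<or> \<not> continues Q z (last_arrow prev w) (hd R)" by (rule scan_decomp)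
  have "insertable Q z R y \<and> j = length w"
    using assms w scan_chain[OF w(2), of R y]
    by (cases R) (auto split: if_splits simp del: insertable.simps(2))
  then show thesis using that w by blast
qed

lemma Critical_decomp:
  assumes "snd (scan Q x prev ps y) = Critical"
  obtains w where "ps = map (arrow_path Q) w" "chain Q x prev w y"
proof -
  obtain w z R where w: "ps = map (arrow_path Q) w @ R" "chain Q x prev w z"
    "R = [] \<or> \<not> continues Q z (last_arrow prev w) (hd R)" by (rule scan_decomp)
  have "R = [] \<and> z = y"
    using assms w scan_chain[OF w(2), of R y]
    by (cases R) (auto split: if_splits simp del: insertable.simps(2))
  then show thesis using that w by auto
qed

text \<open>A \<open>Down\<close> cell is described through its partner: delete the trivial path at
  \<open>z\<close>, or multiply the last arrow \<open>\<alpha>\<close> of the scanned anti-path with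
  the next entry \<open>p\<close>. The product is nonzero because \<open>\<alpha>\<close> and the
  first arrow of \<open>p\<close> form no relation.\<close>

lemma Down_decomp:
  assumes "snd (scan Q x prev ps y) = Down"
  obtains (insert) w z R where "ps = map (arrow_path Q) w @ (z, []) # R" "chain Q x prev w z"
      "insertable Q z R y"
  | (split) w z \<alpha> p R where "ps = map (arrow_path Q) w @ p # R" "chain Q x prev w z"
      "last_arrow prev w = Some \<alpha>" "snd p \<noteq> []" "ptarget Q p = z" "(\<alpha>, hd (snd p)) \<notin> relations Q"
proof -
  obtain w z R where w: "ps = map (arrow_path Q) w @ R" "chain Q x prev w z"
    "R = [] \<or> \<not> continues Q z (last_arrow prev w) (hd R)" by (rule scan_decomp)
  note sc = scan_chain[OF w(2), of R y]
  show thesis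
  proof (cases R)
    case Nil
    then show ?thesis using assms w sc by (auto split: if_splits)
  next
    case (Cons p R')
    show ?thesis
    proof (cases "snd p = [] \<or> ptarget Q p \<noteq> z")
      case True
      then have "\<not> insertable Q z (p # R') y"
        using assms w sc Cons by (auto split: if_splits simp del: insertable.simps(2))
      then have "p = (z, [])" "insertable Q z R' y"
        using True by (cases p; auto simp: ptarget_def split: if_splits)+
      then show ?thesis using insert w Cons by blast
    next
      case False
      then obtain \<alpha> where "last_arrow prev w = Some \<alpha>" "(\<alpha>, hd (snd p)) \<notin> relations Q"
        using assms w sc Cons by (auto split: if_splits simp del: insertable.simps(2))
      then show ?thesis using split w Cons False by blast
    qed
  qed
qed

lemma Up_Split_decomp:
  assumes "scan Q x prev ps y = (j, Up_Split)" "\<forall>p\<in>set ps. path_of_A Q p"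
  obtains w z p R where "ps = map (arrow_path Q) w @ p # R" "chain Q x prev w z" "j = length w"
    "ptarget Q p = z" "length (snd p) \<ge> 2"
    "\<And>\<beta>. last_arrow prev w = Some \<beta> \<Longrightarrow> (\<beta>, hd (snd p)) \<in> relations Q"
proof -
  obtain w z R where w: "ps = map (arrow_path Q) w @ R" "chain Q x prev w z"
    "R = [] \<or> \<not> continues Q z (last_arrow prev w) (hd R)" by (rule scan_decomp)
  note sc = scan_chain[OF w(2), of R y]
  obtain p R' where R: "R = p # R'"
    using assms w sc by (cases R) (auto split: if_splits)
  then have p: "\<not> (snd p = [] \<or> ptarget Q p \<noteq> z)" "j = length w"
    and rel: "\<And>\<beta>. last_arrow prev w = Some \<beta> \<Longrightarrow> (\<beta>, hd (snd p)) \<in> relations Q"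
    using assms w sc by (auto split: if_splits simp del: insertable.simps(2))
  \<comment> \<open>A single arrow that fits to the scanned anti-path and has a relation with its
    last arrow would have prolonged it.\<close>
  have "length (snd p) \<noteq> 1"
  proof
    assume "length (snd p) = 1"
    then obtain \<alpha> where \<alpha>: "snd p = [\<alpha>]" by (auto simp: length_Suc_conv)
    have "path_of_A Q p" using assms(2) w R by auto
    then have "p = arrow_path Q \<alpha>" "\<alpha> \<in> arrows Q"
      using \<alpha> by (auto simp: path_of_A_def is_path_def arrow_path_def prod_eq_iff)
    then have "continues Q z (last_arrow prev w) p"
      using p rel \<alpha> by (auto simp: continues_def)
    then show False using w R by auto
  qed
  moreover have "length (snd p) \<noteq> 0" using p by auto
  ultimately have "length (snd p) \<ge> 2" by linarith
  then show thesis using that w R p rel by blast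
qed

subsection \<open>The differential on matched cells\<close>

lemma msum_zero:
  "(\<And>r. f r = 0) \<Longrightarrow> h (butlast ps) = 0 \<Longrightarrow> msum Q f h ps = 0"
  by (induction Q f h ps rule: msum.induct) (auto split: if_splits)

lemma msum_head_zero:
  assumes "\<And>p' R'. ptarget Q p' = ptarget Q p \<Longrightarrow> (snd p \<noteq> [] \<Longrightarrow> snd p' \<noteq> []) \<Longrightarrow> f (p' # R') = 0"
    "h (butlast (p # R)) = 0"
  shows "msum Q f h (p # R) = 0"
proof (cases R)
  case (Cons p2 R2)
  have "f (pcomp p p2 # R2) = 0" if "composable Q p p2"
    using ptarget_pcomp[OF that] by (intro assms(1)) (auto simp: pcomp_def)
  moreover have "msum Q (\<lambda>r. f (p # r)) (\<lambda>r. h (p # r)) (p2 # R2) = 0"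
    using assms Cons by (intro msum_zero) auto
  ultimately show ?thesis using Cons by simp
qed (use assms(2) in simp)

text \<open>Trivial entries cancel in pairs: multiplying the first with the second, and the second
  with its successor, gives the same list with opposite signs. The other products lead to lists on
  which \<open>f\<close> and \<open>h\<close> vanish by hypothesis. The last hypothesis covers a run
  that reaches the end of the list: there, dropping the final trivial path takes the place of
  multiplying it with a successor.\<close>

lemma msum_run:
  assumes "insertable Q z R y" "\<forall>p\<in>set R. path_of_A Q p"
    "\<And>R'. insertable Q z R' y \<Longrightarrow> f ((z, []) # R') = 0"
    "\<And>R'. insertable Q z R' (ptarget Q (last ((z, []) # R))) \<Longrightarrow> h ((z, []) # R') = 0"
    "\<And>r. last ((z, []) # R) = (z, []) \<Longrightarrow> h r = (if z = y then f r else 0)"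
  shows "msum Q f h ((z, []) # R) = 0"
  using assms
proof (induction R arbitrary: f h rule: length_induct)
  case (1 R)
  note ins = 1(2) and paths = 1(3) and f = 1(4) and h = 1(5) and hf = 1(6)
  let ?e = "(z, []) :: ('a, 'b) path"
  show ?case
  proof (cases R)
    case Nil
    then show ?thesis using ins hf by simp
  next
    case (Cons c R1)
    show ?thesis
    proof (cases "c = ?e")
      case False
      then have c: "ptarget Q c \<noteq> z" using ins Cons by simp
      have "msum Q (\<lambda>r. f (?e # r)) (\<lambda>r. h (?e # r)) (c # R1) = 0"
      proof (rule msum_head_zero)
        show "f (?e # p' # R') = 0" if "ptarget Q p' = ptarget Q c" for p' R'
          using that c by (intro f) (auto simp: ptarget_def)
        show "h (?e # butlast (c # R1)) = 0"
        proof (cases "R1 = []")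
          case True
          then show ?thesis using c Cons by (simp add: h[of "[]"])
        next
          case False
          have "insertable Q z (c # butlast R1) (ptarget Q (last (?e # R)))"
            using c \<open>c \<noteq> ?e\<close> by simp
          then show ?thesis using h[of "c # butlast R1"] False by simp
        qed
      qed
      then show ?thesis using c Cons by (simp add: composable_def psource_def)
    next
      case c: True
      then have nins: "\<not> insertable Q z R1 y" using ins Cons by simp
      have ok: "composable Q ?e c" "pcomp ?e c = c" "path_of_A Q c"
        using c paths Cons by (auto simp: composable_def psource_def ptarget_def pcomp_def)
      show ?thesis
      proof (cases R1)
        case Nil
        then show ?thesis using nins c Cons ok hf[of "[?e]"] by simp
      next
        case R1: (Cons c2 R2)
        have c2: "ptarget Q c2 = z" using nins R1 by (auto simp: ptarget_def split: if_splits)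
        have ok2: "composable Q ?e c2" "pcomp ?e c2 = c2" "path_of_A Q c2"
          using c2 paths Cons R1 by (auto simp: composable_def psource_def pcomp_def)
        have "msum Q (\<lambda>r. f (?e # ?e # r)) (\<lambda>r. h (?e # ?e # r)) (c2 # R2) = 0"
        proof (cases "c2 = ?e")
          case True
          have IH: "msum Q (\<lambda>r. f (?e # ?e # r)) (\<lambda>r. h (?e # ?e # r)) (?e # R2) = 0"
            using 1(1)[rule_format, of R2 "\<lambda>r. f (?e # ?e # r)" "\<lambda>r. h (?e # ?e # r)"]
          proof (rule, goal_cases)
            case 1 show ?case using Cons R1 by simp
          next
            case 2 show ?case using nins R1 True by simp
          next
            case (3 p) then show ?case using paths Cons R1 by simp
          next
            case 4 then show ?case using f[of "?e # ?e # _"] by simp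
          next
            case (5 R') then show ?case using h[of "?e # ?e # R'"] Cons R1 c True by simp
          next
            case (6 r) then show ?case using hf[of "?e # ?e # r"] Cons R1 c True by simp
          qed simp
          then show ?thesis using True by simp
        next
          case False
          then have s: "snd c2 \<noteq> []" using c2 by (cases c2) (auto simp: ptarget_def)
          show ?thesis
          proof (rule msum_head_zero)
            show "f (?e # ?e # p' # R') = 0" if "ptarget Q p' = ptarget Q c2" "snd c2 \<noteq> [] \<Longrightarrow> snd p' \<noteq> []"
              for p' R'
            proof -
              have "p' \<noteq> ?e" using that(2) s by auto
              then show ?thesis using that(1) c2 f[of "?e # p' # R'"] by simp
            qed
            show "h (?e # ?e # butlast (c2 # R2)) = 0"
            proof (cases "R2 = []")
              case True
              then show ?thesis using Cons R1 c2 h[of "[?e]"] by simp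
            next
              case False
              then show ?thesis using \<open>c2 \<noteq> ?e\<close> c2 h[of "?e # c2 # butlast R2"] by simp
            qed
          qed
        qed
        then show ?thesis using Cons R1 c ok ok2 by simp
      qed
    qed
  qed
qed

text \<open>Neighbouring arrows of an anti-path multiply to zero in \<open>A\<close>, so no product
  inside it survives and each step contributes only a sign.\<close>

lemma msum_chain:
  "chain Q x prev (w @ [\<alpha>]) z \<Longrightarrow> msum Q f h (map (arrow_path Q) (w @ [\<alpha>]) @ X) =
    (-1) ^ length w * msum Q (\<lambda>r. f (map (arrow_path Q) w @ r)) (\<lambda>r. h (map (arrow_path Q) w @ r))
      (arrow_path Q \<alpha> # X)"
proof (induction w arbitrary: x prev f h)
  case (Cons \<beta> w)
  obtain \<gamma> w' where \<gamma>: "w @ [\<alpha>] = \<gamma> # w'" by (cases "w @ [\<alpha>]") auto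
  have "(\<beta>, \<gamma>) \<in> relations Q" using Cons.prems \<gamma> by simp
  then have "\<not> path_of_A Q (pcomp (arrow_path Q \<beta>) (arrow_path Q \<gamma>))"
    by (auto simp: path_of_A_def pcomp_def)
  then have "msum Q f h (map (arrow_path Q) ((\<beta> # w) @ [\<alpha>]) @ X) =
    - msum Q (\<lambda>r. f (arrow_path Q \<beta> # r)) (\<lambda>r. h (arrow_path Q \<beta> # r)) (map (arrow_path Q) (w @ [\<alpha>]) @ X)"
    using \<gamma> by simp
  then show ?case using Cons.IH[of "source Q \<beta>" "Some \<beta>"] Cons.prems by simp
qed simp

lemma rquot_facts:
  assumes "rdiv Q p q" "path_of_A Q q"
  shows "ptarget Q (rquot Q p q) = ptarget Q q" "fst (rquot Q p q) = ptarget Q p"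
proof -
  have "composable Q (rquot Q p q) p" "pcomp (rquot Q p q) p = q"
    using assms by (auto simp: rdiv_def)
  then show "ptarget Q (rquot Q p q) = ptarget Q q" using ptarget_pcomp by metis
qed (simp add: rquot_def)

lemma lquot_facts:
  assumes "ldiv Q p q"
  shows "ptarget Q (lquot p q) = psource p" "fst (lquot p q) = fst q" "ptarget Q q = ptarget Q p"
    "pcomp p (lquot p q) = q"
  using assms ptarget_pcomp[of Q p "lquot p q"] by (auto simp: ldiv_def composable_def lquot_def)

locale gentle =
  fixes Q :: "('v, 'a) graded_quiver"
  assumes gentle: "graded_gentle_quiver Q"
begin

abbreviation arr :: "'a \<Rightarrow> ('v, 'a) path" where "arr \<equiv> arrow_path Q"

lemma finite_quiver [simp]: "finite (vertices Q)" "finite (arrows Q)"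
  using gentle by (auto simp: graded_gentle_quiver_def)

lemma arrow_vertices [simp]: "\<alpha> \<in> arrows Q \<Longrightarrow> source Q \<alpha> \<in> vertices Q"
    "\<alpha> \<in> arrows Q \<Longrightarrow> target Q \<alpha> \<in> vertices Q"
  using gentle by (auto simp: graded_gentle_quiver_def)

lemma relationsD: "(\<beta>, \<alpha>) \<in> relations Q \<Longrightarrow> \<beta> \<in> arrows Q \<and> \<alpha> \<in> arrows Q \<and> source Q \<beta> = target Q \<alpha>"
  using gentle by (auto simp: graded_gentle_quiver_def)

lemma path_of_A_arr [simp]: "\<alpha> \<in> arrows Q \<Longrightarrow> path_of_A Q (arr \<alpha>)"
  by (auto simp: path_of_A_def is_path_def)

lemma path_of_A_trivial [simp]: "path_of_A Q (x, []) \<longleftrightarrow> x \<in> vertices Q"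
  by (auto simp: path_of_A_def is_path_def)

lemma is_path_vertices:
  assumes "is_path Q q"
  shows "fst q \<in> vertices Q" "ptarget Q q \<in> vertices Q"
  using assms by (cases "snd q"; auto simp: is_path_def ptarget_def)+

lemma path_of_A_vertices:
  assumes "path_of_A Q q"
  shows "fst q \<in> vertices Q" "ptarget Q q \<in> vertices Q"
  using assms is_path_vertices by (auto simp: path_of_A_def)

lemma is_path_rquot:
  assumes "is_path Q q" "rdiv Q p q" "is_path Q p"
  shows "is_path Q (rquot Q p q)"
proof -
  have q: "q = (fst p, snd (rquot Q p q) @ snd p)"
    using assms(2) by (auto simp: rdiv_def pcomp_def psource_def)
  have *: "is_path Q (fst p, snd (rquot Q p q) @ snd p)" using assms(1) q by metis
  have "ptarget Q p \<in> vertices Q" using assms(3) by (rule is_path_vertices)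
  then show ?thesis using *
    by (auto simp: is_path_def successively_append_iff rquot_def ptarget_def)
qed

lemma path_of_A_rquot:
  assumes "path_of_A Q q" "rdiv Q p q" "path_of_A Q p"
  shows "path_of_A Q (rquot Q p q)"
  using path_of_A_factors[of Q "rquot Q p q" p] is_path_rquot[of q p] assms
  by (simp add: path_of_A_def rdiv_def)

lemma path_of_A_lquot:
  assumes "path_of_A Q q" "ldiv Q p q" "path_of_A Q p"
  shows "path_of_A Q (lquot p q)"
proof -
  have q: "q = (fst q, snd p @ snd (lquot p q))" "fst (lquot p q) = fst q"
    using assms(2) by (auto simp: ldiv_def pcomp_def psource_def lquot_def)
  have *: "path_of_A Q (fst q, snd p @ snd (lquot p q))" using assms(1) q by metis
  then show ?thesis using q(2)
    by (auto simp: path_of_A_def is_path_def successively_append_iff split: if_splits)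
qed

lemma chain_arrows: "chain Q x prev w z \<Longrightarrow> set w \<subseteq> arrows Q"
  by (induction w arbitrary: x prev) auto

lemma chain_end: "chain Q x prev w z \<Longrightarrow> x \<in> vertices Q \<Longrightarrow> z \<in> vertices Q"
  by (induction w arbitrary: x prev) auto

lemma chain_last:
  assumes "chain Q x prev (w @ [\<alpha>]) z"
  shows "source Q \<alpha> = z"
  using assms by (auto simp: chain_append)

lemma kind_Down_insert:
  "chain Q (ptarget Q q) None w z \<Longrightarrow> insertable Q z R (fst q) \<Longrightarrow> kind Q (map arr w @ (z, []) # R) q = Down"
  by (simp add: scan_chain continues_def)

lemma kind_Down_split:
  assumes "chain Q (ptarget Q q) None (w @ [\<alpha>]) z" "snd p \<noteq> []" "ptarget Q p = z"
    "(\<alpha>, hd (snd p)) \<notin> relations Q"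
  shows "kind Q (map arr (w @ [\<alpha>]) @ p # R) q = Down"
proof -
  have n: "\<not> continues Q z (Some \<alpha>) p" using assms(4) by (auto simp: continues_def)
  have "scan Q z (Some \<alpha>) (p # R) (fst q) = (0, Down)"
    unfolding scan.simps using n assms(2-4) by simp
  then show ?thesis unfolding scan_chain[OF assms(1)] by simp
qed

text \<open>Only the partner contributes: dropping a first arrow leaves a \<open>Down\<close> cell,
  and the summands that change the tail vanish or cancel by \<open>msum_run\<close>. The surviving
  summand multiplies the inserted trivial path into the arrow before it, or into \<open>q\<close>
  when \<open>w\<close> is empty.\<close>

lemma coef_diff_insert:
  fixes g :: "(('v, 'a) path \<Rightarrow>\<^sub>0 'k::field) list \<Rightarrow> (('v, 'a) path \<Rightarrow>\<^sub>0 'k)"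
  assumes g: "g \<in> hoch_cochains Q n d"
    and down: "\<And>ps q. path_of_A Q q \<Longrightarrow> kind Q ps q = Down \<Longrightarrow> coef g ps q = 0"
    and q: "path_of_A Q q" and w: "chain Q (ptarget Q q) None w z" and R: "insertable Q z R (fst q)"
    and paths: "\<forall>p\<in>set R. path_of_A Q p" and len: "length w + length R = n"
  shows "coef (hoch_diff Q n d g) (map arr w @ (z, []) # R) q =
    (-1) powi d * (-1) ^ length w * coef g (map arr w @ R) q"
proof -
  let ?D = "map arr w @ (z, []) # R"
  define f where "f = (\<lambda>r. coef g r q)"
  define h where "h = (\<lambda>r. if rdiv Q (last ?D) q then coef g r (rquot Q (last ?D) q) else 0)"
  have z: "z \<in> vertices Q" using chain_end[OF w] path_of_A_vertices[OF q] by auto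
  have D: "length ?D = Suc n" "\<forall>p\<in>set ?D. path_of_A Q p"
    using len paths z chain_arrows[OF w] by auto
  have lastD: "last ?D = last ((z, []) # R)" "path_of_A Q (last ?D)"
    using D(2) last_in_set[of ?D] by (simp, blast)
  note diff = coef_diff[OF g D q, folded f_def h_def]
  have run: "msum Q (\<lambda>r. f (map arr w @ r)) (\<lambda>r. h (map arr w @ r)) ((z, []) # R) = 0"
  proof (rule msum_run[OF R paths])
    show "f (map arr w @ (z, []) # R') = 0" if "insertable Q z R' (fst q)" for R'
      unfolding f_def using kind_Down_insert[OF w that] q by (intro down)
    show "h (map arr w @ (z, []) # R') = 0" if ins: "insertable Q z R' (ptarget Q (last ((z, []) # R)))" for R'
    proof (cases "rdiv Q (last ?D) q")
      case True
      let ?q = "rquot Q (last ?D) q"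
      have "path_of_A Q ?q" using path_of_A_rquot[OF q True] lastD by blast
      moreover have "kind Q (map arr w @ (z, []) # R') ?q = Down"
        using ins w rquot_facts[OF True q] lastD by (intro kind_Down_insert) auto
      ultimately show ?thesis unfolding h_def using down by simp
    qed (simp add: h_def)
    show "h (map arr w @ r) = (if z = fst q then f (map arr w @ r) else 0)"
      if "last ((z, []) # R) = (z, [])" for r
    proof -
      have l: "last ?D = (z, [])" using that lastD by simp
      have "rdiv Q (z, []) q \<longleftrightarrow> z = fst q"
        by (auto simp: rdiv_def rquot_def pcomp_def psource_def prod_eq_iff)
      moreover have "rquot Q (z, []) q = q" if "z = fst q"
        using that by (auto simp: rquot_def ptarget_def prod_eq_iff)
      ultimately show ?thesis unfolding h_def l f_def by auto
    qed
  qed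
  show ?thesis
  proof (cases w rule: rev_cases)
    case Nil
    then have "ldiv Q (z, []) q" "lquot (z, []) q = q"
      using w by (auto simp: ldiv_def lquot_def composable_def psource_def pcomp_def prod_eq_iff)
    then show ?thesis using diff run Nil by (simp add: f_def pdegree_def)
  next
    case (snoc w0 \<alpha>)
    have "w \<noteq> []" using snoc by simp
    then obtain \<alpha>1 w1 where w1: "w = \<alpha>1 # w1" by (meson neq_Nil_conv)
    have L: "coef g (tl ?D) (lquot (hd ?D) q) = 0" if "ldiv Q (hd ?D) q"
    proof (rule down)
      have hd: "hd ?D = arr \<alpha>1" using w1 by simp
      then show "path_of_A Q (lquot (hd ?D) q)"
        using path_of_A_lquot[OF q that] chain_arrows[OF w] w1 by simp
      have "chain Q (source Q \<alpha>1) None w1 z" using w w1 chain_weaken by force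
      then show "kind Q (tl ?D) (lquot (hd ?D) q) = Down"
        using that hd lquot_facts[OF that] w1 R kind_Down_insert[of "lquot (hd ?D) q" w1 z R] by simp
    qed
    have "source Q \<alpha> = z" "\<alpha> \<in> arrows Q" using chain_last chain_arrows[OF w] w snoc by auto
    then have ok: "composable Q (arr \<alpha>) (z, [])" "pcomp (arr \<alpha>) (z, []) = arr \<alpha>"
      by (auto simp: composable_def psource_def ptarget_def pcomp_def arrow_path_def)
    have ok2: "path_of_A Q (arr \<alpha>)" using \<open>\<alpha> \<in> arrows Q\<close> by simp
    have "msum Q f h ?D = (-1) ^ length w0 * f (map arr w @ R)"
      using msum_chain[of Q "ptarget Q q" None w0 \<alpha> z f h "(z, []) # R"] w run ok ok2 snoc by simp
    then show ?thesis using diff L snoc by (simp add: f_def)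
  qed
qed

text \<open>Besides the partner, two summands can survive. If \<open>w\<close> is empty, splitting
  \<open>\<alpha>\<close> off \<open>q\<close> gives the list \<open>p # R\<close>, whose first
  entry is shorter than that of the partner. If \<open>R\<close> is empty, splitting
  \<open>p\<close> off \<open>q\<close> on the right leaves a list of arrows, which is a critical
  cell.\<close>

lemma coef_diff_split:
  fixes g :: "(('v, 'a) path \<Rightarrow>\<^sub>0 'k::field) list \<Rightarrow> (('v, 'a) path \<Rightarrow>\<^sub>0 'k)"
  assumes g: "g \<in> hoch_cochains Q n d"
    and down: "\<And>ps q. path_of_A Q q \<Longrightarrow> kind Q ps q = Down \<Longrightarrow> coef g ps q = 0"
    and q: "path_of_A Q q" and w: "chain Q (ptarget Q q) None (w @ [\<alpha>]) z"
    and p: "path_of_A Q p" "snd p \<noteq> []" "ptarget Q p = z" "(\<alpha>, hd (snd p)) \<notin> relations Q"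
    and paths: "\<forall>p\<in>set R. path_of_A Q p" and len: "Suc (length w + length R) = n"
  shows "coef (hoch_diff Q n d g) (map arr (w @ [\<alpha>]) @ p # R) q = (-1) powi d *
    ((if w = [] \<and> ldiv Q (arr \<alpha>) q
      then (-1) powi (d * degree Q \<alpha>) * coef g (p # R) (lquot (arr \<alpha>) q) else 0)
     - (-1) ^ length w * coef g (map arr w @ pcomp (arr \<alpha>) p # R) q
     + (if R = [] \<and> rdiv Q p q then (-1) ^ length w * coef g (map arr (w @ [\<alpha>])) (rquot Q p q) else 0))"
proof -
  let ?D = "map arr (w @ [\<alpha>]) @ p # R"
  define f where "f = (\<lambda>r. coef g r q)"
  define h where "h = (\<lambda>r. if rdiv Q (last ?D) q then coef g r (rquot Q (last ?D) q) else 0)"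
  have \<alpha>: "\<alpha> \<in> arrows Q" "source Q \<alpha> = z" using chain_arrows[OF w] chain_last[OF w] by auto
  have D: "length ?D = Suc n" "\<forall>p\<in>set ?D. path_of_A Q p"
    using len paths p chain_arrows[OF w] by auto
  have lastD: "path_of_A Q (last ?D)" using D(2) last_in_set[of ?D] by blast
  note diff = coef_diff[OF g D q, folded f_def h_def]
  have L: "(if ldiv Q (hd ?D) q then (-1) powi (d * pdegree Q (hd ?D)) * coef g (tl ?D) (lquot (hd ?D) q) else 0)
    = (if w = [] \<and> ldiv Q (arr \<alpha>) q
      then (-1) powi (d * degree Q \<alpha>) * coef g (p # R) (lquot (arr \<alpha>) q) else 0)"
  proof (cases w)
    case (Cons \<alpha>1 w1)
    have "coef g (tl ?D) (lquot (hd ?D) q) = 0" if "ldiv Q (hd ?D) q"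
    proof (rule down)
      have hd: "hd ?D = arr \<alpha>1" using Cons by simp
      then show "path_of_A Q (lquot (hd ?D) q)"
        using path_of_A_lquot[OF q that] chain_arrows[OF w] Cons by simp
      have "chain Q (source Q \<alpha>1) None (w1 @ [\<alpha>]) z" using w Cons chain_weaken by force
      then show "kind Q (tl ?D) (lquot (hd ?D) q) = Down"
        using that hd lquot_facts[OF that] Cons p
          kind_Down_split[of "lquot (hd ?D) q" w1 \<alpha> z p R] by simp
    qed
    then show ?thesis using Cons by simp
  qed simp
  have ok: "composable Q (arr \<alpha>) p" using \<alpha> p by (simp add: composable_def)
  obtain \<beta> u where "snd p = \<beta> # u" using p(2) by (cases "snd p") auto
  then have "path_of_A Q (pcomp (arr \<alpha>) p)"
    using p(1,3,4) \<alpha> by (auto simp: path_of_A_def is_path_def pcomp_def psource_def ptarget_def)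
  then have M: "msum Q f h ?D = (-1) ^ length w * (f (map arr w @ pcomp (arr \<alpha>) p # R)
    - msum Q (\<lambda>r. f (map arr w @ arr \<alpha> # r)) (\<lambda>r. h (map arr w @ arr \<alpha> # r)) (p # R))"
    unfolding msum_chain[OF w] using ok by simp
  have T: "msum Q (\<lambda>r. f (map arr w @ arr \<alpha> # r)) (\<lambda>r. h (map arr w @ arr \<alpha> # r)) (p # R) =
    (if R = [] then h (map arr (w @ [\<alpha>])) else 0)"
  proof (cases "R = []")
    case False
    have "msum Q (\<lambda>r. f (map arr w @ arr \<alpha> # r)) (\<lambda>r. h (map arr w @ arr \<alpha> # r)) (p # R) =
      (if composable Q p (hd R) \<and> path_of_A Q (pcomp p (hd R))
       then f (map arr (w @ [\<alpha>]) @ pcomp p (hd R) # tl R) else 0)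
      - msum Q (\<lambda>r. f (map arr (w @ [\<alpha>]) @ p # r)) (\<lambda>r. h (map arr (w @ [\<alpha>]) @ p # r)) R"
      using False by (cases R) auto
    moreover have "f (map arr (w @ [\<alpha>]) @ pcomp p (hd R) # tl R) = 0" if "composable Q p (hd R)"
      unfolding f_def using p ptarget_pcomp[OF that]
      by (intro down q kind_Down_split[OF w]) (auto simp: pcomp_def)
    moreover have "msum Q (\<lambda>r. f (map arr (w @ [\<alpha>]) @ p # r)) (\<lambda>r. h (map arr (w @ [\<alpha>]) @ p # r)) R = 0"
    proof (rule msum_zero)
      show "f (map arr (w @ [\<alpha>]) @ p # r) = 0" for r
        unfolding f_def using p by (intro down q kind_Down_split[OF w]) auto
      show "h (map arr (w @ [\<alpha>]) @ p # butlast R) = 0"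
      proof (cases "rdiv Q (last ?D) q")
        case True
        let ?q = "rquot Q (last ?D) q"
        have "path_of_A Q ?q" using path_of_A_rquot[OF q True] lastD by blast
        moreover have "kind Q (map arr (w @ [\<alpha>]) @ p # butlast R) ?q = Down"
          using p w rquot_facts[OF True q] by (intro kind_Down_split[of _ _ _ z]) auto
        ultimately show ?thesis unfolding h_def using down by simp
      qed (simp add: h_def)
    qed
    ultimately show ?thesis using False by simp
  qed simp
  show ?thesis unfolding diff L M T by (auto simp: h_def f_def algebra_simps)
qed

lemma Critical_coef: "chain Q (ptarget Q q) None w (fst q) \<Longrightarrow> kind Q (map arr w) q = Critical"
  using scan_chain[of Q "ptarget Q q" None w "fst q" "[]" "fst q"] by simp

end

subsection \<open>Solving for a cochain along the matching\<close>

definition cell_vertex :: "('v, 'a) graded_quiver \<Rightarrow> ('v, 'a) path list \<Rightarrow> ('v, 'a) path \<Rightarrow> nat \<Rightarrow> 'v" where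
  "cell_vertex Q ps q j = (if j = 0 then ptarget Q q else fst (ps ! (j - 1)))"

definition path_tl :: "('v, 'a) path \<Rightarrow> ('v, 'a) path" where
  "path_tl p = (fst p, tl (snd p))"

text \<open>
  The cochain with values \<open>b\<close> on critical cells and \<open>0\<close> on \<open>Down\<close> cells whose differential agrees with \<open>F\<close> on
  \<open>Down\<close> cells. The equation at the partner of an \<open>Up_Split\<close> cell involves at most one further \<open>Up\<close> cell,
  whose first entry is shorter.
\<close>

function sol :: "('v, 'a) graded_quiver \<Rightarrow> int \<Rightarrow> (('v, 'a) path list \<Rightarrow> ('v, 'a) path \<Rightarrow> 'k) \<Rightarrow>
    (('v, 'a) path list \<Rightarrow> ('v, 'a) path \<Rightarrow> 'k) \<Rightarrow> ('v, 'a) path list \<Rightarrow> ('v, 'a) path \<Rightarrow> 'k::field" where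
  "sol Q d b F ps q = (case scan_cell Q ps q of (j, k) \<Rightarrow> (case k of
     Critical \<Rightarrow> b ps q
   | Down \<Rightarrow> 0
   | Up_Insert \<Rightarrow> (-1) powi d * (-1) ^ j * F (take j ps @ (cell_vertex Q ps q j, []) # drop j ps) q
   | Up_Split \<Rightarrow> (-1) ^ j *
      ((if j = 0 \<and> ps \<noteq> [] \<and> snd (hd ps) \<noteq> [] \<and> ldiv Q (arrow_path Q (hd (snd (hd ps)))) q
        then (-1) powi (d * degree Q (hd (snd (hd ps)))) *
          sol Q d b F (path_tl (hd ps) # tl ps) (lquot (arrow_path Q (hd (snd (hd ps)))) q) else 0)
       + (if drop (Suc j) ps = [] \<and> rdiv Q (path_tl (ps ! j)) q
          then (-1) ^ j * b (take j ps @ [arrow_path Q (hd (snd (ps ! j)))]) (rquot Q (path_tl (ps ! j)) q)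
          else 0)
       - (-1) powi d *
          F (take j ps @ arrow_path Q (hd (snd (ps ! j))) # path_tl (ps ! j) # drop (Suc j) ps) q)))"
  by pat_completeness auto
termination
  by (relation "measure (\<lambda>(Q, d, b, F, ps, q). length (snd (hd ps)))") (auto simp: path_tl_def)

declare sol.simps [simp del]

lemma sign_square [simp]: "(-1) ^ m * (-1) ^ m = (1 :: 'k::field)"
  "(-1) powi d * ((-1) powi d * c) = (c :: 'k::field)" "(-1) ^ m * ((-1) ^ m * c) = (c :: 'k::field)"
proof -
  have 1: "(-1) powi d * (-1) powi d = (1 :: 'k)"
    by (simp add: power_int_minus_left)
  show 2: "(-1) ^ m * (-1) ^ m = (1 :: 'k)"
    by (simp flip: power_add mult_2)
  show "(-1) powi d * ((-1) powi d * c) = (c :: 'k)" "(-1) ^ m * ((-1) ^ m * c) = (c :: 'k)"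
    by (simp_all only: mult.assoc[symmetric] 1 2 mult_1)
qed

context gentle begin

lemma scan_cell_split:
  assumes "chain Q (ptarget Q q) None (w @ [\<alpha>]) z" "snd p \<noteq> []"
  shows "scan_cell Q (map arr w @ pcomp (arr \<alpha>) p # R) q = (length w, Up_Split)"
proof -
  obtain x where x: "chain Q (ptarget Q q) None w x" "target Q \<alpha> = x"
    "\<forall>\<beta>. last_arrow None w = Some \<beta> \<longrightarrow> (\<beta>, \<alpha>) \<in> relations Q"
    using assms(1) by (auto simp: chain_append)
  have "\<not> continues Q x (last_arrow None w) (pcomp (arr \<alpha>) p)"
    using assms(2) by (auto simp: continues_def pcomp_def arrow_path_def)
  moreover have "snd (pcomp (arr \<alpha>) p) = \<alpha> # snd p" "ptarget Q (pcomp (arr \<alpha>) p) = x"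
    using x by (auto simp: pcomp_def ptarget_def)
  ultimately show ?thesis using x by (simp add: scan_chain)
qed

lemma cell_vertex_chain:
  assumes "chain Q (ptarget Q q) None w z"
  shows "cell_vertex Q (map arr w @ R) q (length w) = z"
proof (cases w rule: rev_cases)
  case (snoc v \<alpha>)
  then show ?thesis using assms chain_last[of _ _ v \<alpha> z] by (simp add: cell_vertex_def nth_append)
qed (use assms in \<open>simp add: cell_vertex_def\<close>)

lemma sol_insert:
  assumes "chain Q (ptarget Q q) None w z" "insertable Q z R (fst q)"
  shows "sol Q d b F (map arr w @ R) q = (-1) powi d * (-1) ^ length w * F (map arr w @ (z, []) # R) q"
  using assms by (subst sol.simps) (simp add: scan_chain scan_insertable cell_vertex_chain)

lemma sol_split:
  assumes "chain Q (ptarget Q q) None (w @ [\<alpha>]) z" "snd p \<noteq> []"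
  shows "sol Q d b F (map arr w @ pcomp (arr \<alpha>) p # R) q = (-1) ^ length w *
    ((if w = [] \<and> ldiv Q (arr \<alpha>) q
      then (-1) powi (d * degree Q \<alpha>) * sol Q d b F (p # R) (lquot (arr \<alpha>) q) else 0)
     + (if R = [] \<and> rdiv Q p q then (-1) ^ length w * b (map arr (w @ [\<alpha>])) (rquot Q p q) else 0)
     - (-1) powi d * F (map arr (w @ [\<alpha>]) @ p # R) q)"
proof -
  have "snd (pcomp (arr \<alpha>) p) = \<alpha> # snd p" "path_tl (pcomp (arr \<alpha>) p) = p"
    by (auto simp: pcomp_def path_tl_def psource_def)
  then show ?thesis
    by (subst sol.simps, subst scan_cell_split[OF assms]) (cases w; simp add: nth_append)
qed

lemma sol_split_nonzero:
  assumes "chain Q (ptarget Q q) None (w @ [\<alpha>]) z" "snd p \<noteq> []"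
    "sol Q d b F (map arr w @ pcomp (arr \<alpha>) p # R) q \<noteq> 0"
  obtains "w = []" "ldiv Q (arr \<alpha>) q" "sol Q d b F (p # R) (lquot (arr \<alpha>) q) \<noteq> 0"
  | "R = []" "rdiv Q p q" "b (map arr (w @ [\<alpha>])) (rquot Q p q) \<noteq> 0"
  | "F (map arr (w @ [\<alpha>]) @ p # R) q \<noteq> 0"
proof (rule ccontr)
  assume "\<not> thesis"
  with that have "(if w = [] \<and> ldiv Q (arr \<alpha>) q
      then (-1) powi (d * degree Q \<alpha>) * sol Q d b F (p # R) (lquot (arr \<alpha>) q) else 0) = 0"
    "(if R = [] \<and> rdiv Q p q then (-1) ^ length w * b (map arr (w @ [\<alpha>])) (rquot Q p q) else 0) = 0"
    "F (map arr (w @ [\<alpha>]) @ p # R) q = 0"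
    by auto
  then show False using assms(3) unfolding sol_split[OF assms(1,2)] by simp
qed

lemma sol_Critical: "kind Q ps q = Critical \<Longrightarrow> sol Q d b F ps q = b ps q"
  by (subst sol.simps) (auto split: prod.splits)

lemma sol_Down: "kind Q ps q = Down \<Longrightarrow> sol Q d b F ps q = 0"
  by (subst sol.simps) (auto split: prod.splits)

lemma path_split:
  assumes "path_of_A Q p" "length (snd p) \<ge> 2"
  obtains \<alpha> p' where "p = pcomp (arr \<alpha>) p'" "path_of_A Q p'" "snd p' \<noteq> []" "\<alpha> \<in> arrows Q"
    "ptarget Q p' = source Q \<alpha>" "(\<alpha>, hd (snd p')) \<notin> relations Q" "hd (snd p) = \<alpha>" "ptarget Q p = target Q \<alpha>"
    "p' = path_tl p"
proof -
  obtain x \<alpha> \<beta> u where p: "p = (x, \<alpha> # \<beta> # u)"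
    using assms(2) by (cases p; cases "snd p"; cases "tl (snd p)") auto
  show thesis
  proof (rule that[of \<alpha> "(x, \<beta> # u)"])
    show "path_of_A Q (x, \<beta> # u)" using assms(1) p
      by (auto simp: path_of_A_def is_path_def split: if_splits)
  qed (use assms(1) p in \<open>auto simp: path_of_A_def is_path_def pcomp_def psource_def ptarget_def path_tl_def\<close>)
qed

lemma cell_cases:
  assumes "\<forall>p\<in>set ps. path_of_A Q p"
  obtains (Critical) w where "ps = map arr w" "chain Q (ptarget Q q) None w (fst q)"
  | (Down) "kind Q ps q = Down"
  | (Insert) w z R where "ps = map arr w @ R" "chain Q (ptarget Q q) None w z" "insertable Q z R (fst q)"
  | (Split) w \<alpha> z p R where "ps = map arr w @ pcomp (arr \<alpha>) p # R"
      "chain Q (ptarget Q q) None (w @ [\<alpha>]) z" "path_of_A Q p" "snd p \<noteq> []" "ptarget Q p = z"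
      "(\<alpha>, hd (snd p)) \<notin> relations Q" "p = path_tl (ps ! length w)" "\<alpha> = hd (snd (ps ! length w))"
proof -
  obtain j k where jk: "scan_cell Q ps q = (j, k)" by fastforce
  show thesis
  proof (cases k)
    case Critical
    then show ?thesis using jk Critical_decomp[of Q "ptarget Q q" None ps "fst q"] that(1) by (metis snd_conv)
  next
    case Down
    then show ?thesis using jk that(2) by simp
  next
    case Up_Insert
    then show ?thesis using jk Up_Insert_decomp[of Q "ptarget Q q" None ps "fst q" j] that(3) by metis
  next
    case Up_Split
    then obtain w z p R where w: "ps = map arr w @ p # R" "chain Q (ptarget Q q) None w z"
      "ptarget Q p = z" "length (snd p) \<ge> 2"
      "\<And>\<beta>. last_arrow None w = Some \<beta> \<Longrightarrow> (\<beta>, hd (snd p)) \<in> relations Q"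
      using jk Up_Split_decomp[of Q "ptarget Q q" None ps "fst q" j] assms by metis
    have "path_of_A Q p" using w(1) assms by simp
    then obtain \<alpha> p' where p': "p = pcomp (arr \<alpha>) p'" "path_of_A Q p'" "snd p' \<noteq> []" "\<alpha> \<in> arrows Q"
      "ptarget Q p' = source Q \<alpha>" "(\<alpha>, hd (snd p')) \<notin> relations Q" "hd (snd p) = \<alpha>" "ptarget Q p = target Q \<alpha>"
      "p' = path_tl p"
      using w(4) by (rule path_split)
    have "ps ! length w = p" using w(1) by (simp add: nth_append)
    moreover have "chain Q (ptarget Q q) None (w @ [\<alpha>]) (source Q \<alpha>)"
      using w(2,3,5) p'(4,7,8) by (auto simp: chain_append)
    ultimately show ?thesis using that(4)[of w \<alpha> p' R "source Q \<alpha>"] w(1) p' by metis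
  qed
qed

lemma pcomp_lquot: "ldiv Q p q \<Longrightarrow> pcomp p (lquot p q) = q"
  by (simp add: ldiv_def)

lemma sol_degree:
  fixes b F :: "('v, 'a) path list \<Rightarrow> ('v, 'a) path \<Rightarrow> 'k::field"
  assumes b: "\<And>ps q. b ps q \<noteq> 0 \<Longrightarrow> pdegree Q q = (\<Sum>p\<leftarrow>ps. pdegree Q p) + d"
    and F: "\<And>ps q. F ps q \<noteq> 0 \<Longrightarrow> pdegree Q q = (\<Sum>p\<leftarrow>ps. pdegree Q p) + d"
    and "\<forall>p\<in>set ps. path_of_A Q p" "path_of_A Q q" "sol Q d b F ps q \<noteq> 0"
  shows "pdegree Q q = (\<Sum>p\<leftarrow>ps. pdegree Q p) + d"
  using assms(3-)
proof (induction "length (snd (hd ps))" arbitrary: ps q rule: less_induct)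
  case less
  have nil: "pdegree Q (z, []) = 0" for z by (simp add: pdegree_def)
  from less.prems(1) show ?case
  proof (cases rule: cell_cases[where q = q])
    case (Critical w)
    then show ?thesis using less.prems(3) Critical_coef[OF Critical(2)] b by (simp add: sol_Critical)
  next
    case Down
    then show ?thesis using less.prems(3) by (simp add: sol_Down)
  next
    case (Insert w z R)
    then have "F (map arr w @ (z, []) # R) q \<noteq> 0"
      using less.prems(3) sol_insert[OF Insert(2,3), of d b F] by auto
    then show ?thesis using F Insert(1) nil by fastforce
  next
    case (Split w \<alpha> z p R)
    have deg: "pdegree Q (pcomp (arr \<alpha>) p) = degree Q \<alpha> + pdegree Q p" by (simp add: pdegree_pcomp)
    have \<alpha>: "\<alpha> \<in> arrows Q" using chain_arrows[OF Split(2)] by simp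
    consider (A) "w = []" "ldiv Q (arr \<alpha>) q" "sol Q d b F (p # R) (lquot (arr \<alpha>) q) \<noteq> 0"
      | (B) "R = []" "rdiv Q p q" "b (map arr (w @ [\<alpha>])) (rquot Q p q) \<noteq> 0"
      | (C) "F (map arr (w @ [\<alpha>]) @ p # R) q \<noteq> 0"
      using less.prems(3) sol_split_nonzero[OF Split(2,4)] Split(1) by metis
    then show ?thesis
    proof cases
      case A
      have "pdegree Q (lquot (arr \<alpha>) q) = (\<Sum>p\<leftarrow>p # R. pdegree Q p) + d"
      proof (rule less.hyps)
        show "length (snd (hd (p # R))) < length (snd (hd ps))" using A Split(1) by (simp add: pcomp_def)
        show "path_of_A Q (lquot (arr \<alpha>) q)" using path_of_A_lquot[OF less.prems(2) A(2)] \<alpha> by simp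
      qed (use A(3) Split(3) less.prems(1) in \<open>auto simp: Split(1)\<close>)
      then show ?thesis
        using A(1) Split(1) deg pdegree_pcomp[of Q "arr \<alpha>" "lquot (arr \<alpha>) q"] pcomp_lquot[OF A(2)] by simp
    next
      case B
      have "pdegree Q q = pdegree Q (rquot Q p q) + pdegree Q p"
        using B(2) pdegree_pcomp[of Q "rquot Q p q" p] by (simp add: rdiv_def)
      then show ?thesis using b[OF B(3)] B(1) Split(1) deg by simp
    next
      case C
      then show ?thesis using F[OF C] Split(1) deg by simp
    qed
  qed
qed

text \<open>The values of \<open>sol\<close> on a fixed list have to assemble to an element of
  \<open>A\<close>, which may be infinite-dimensional. Each of \<open>?X1\<close> to
  \<open>?X5\<close> bounds one kind of summand: critical values, inserted trivial paths, split
  entries, right quotients, and the recursive call; the unknown vertex and position range over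
  finite sets.\<close>

lemma sol_finite:
  fixes b F :: "('v, 'a) path list \<Rightarrow> ('v, 'a) path \<Rightarrow> 'k::field"
  assumes b: "\<And>ps. finite {q. b ps q \<noteq> 0}" and F: "\<And>ps. finite {q. F ps q \<noteq> 0}"
    and "\<forall>p\<in>set ps. path_of_A Q p"
  shows "finite {q. path_of_A Q q \<and> sol Q d b F ps q \<noteq> 0}"
  using assms(3)
proof (induction "length (snd (hd ps))" arbitrary: ps rule: less_induct)
  case less
  let ?\<alpha> = "\<lambda>j. arr (hd (snd (ps ! j)))"
  let ?p = "\<lambda>j. path_tl (ps ! j)"
  let ?X1 = "{q. b ps q \<noteq> 0}"
  let ?X2 = "\<Union>z\<in>vertices Q. \<Union>j\<in>{..length ps}. {q. F (take j ps @ (z, []) # drop j ps) q \<noteq> 0}"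
  let ?X3 = "\<Union>j\<in>{..length ps}. {q. F (take j ps @ ?\<alpha> j # ?p j # drop (Suc j) ps) q \<noteq> 0}"
  let ?X4 = "\<Union>j\<in>{..length ps}. (\<lambda>q. pcomp q (?p j)) ` {q. b (take j ps @ [?\<alpha> j]) q \<noteq> 0}"
  let ?S = "{q. path_of_A Q q \<and> sol Q d b F (?p 0 # drop (Suc 0) ps) q \<noteq> 0}"
  let ?X5 = "if length (snd (?p 0)) < length (snd (hd ps)) \<and> path_of_A Q (?p 0) then pcomp (?\<alpha> 0) ` ?S else {}"
  have "finite ?S" if "length (snd (?p 0)) < length (snd (hd ps))" "path_of_A Q (?p 0)"
    using that less.prems by (intro less.hyps) (auto dest: in_set_dropD)
  then have fin: "finite (?X1 \<union> ?X2 \<union> ?X3 \<union> ?X4 \<union> ?X5)"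
    using b F by auto
  have "q \<in> ?X1 \<union> ?X2 \<union> ?X3 \<union> ?X4 \<union> ?X5" if q: "path_of_A Q q" "sol Q d b F ps q \<noteq> 0" for q
    using less.prems
  proof (cases rule: cell_cases[where q = q])
    case (Critical w)
    then show ?thesis using q Critical_coef[OF Critical(2)] by (simp add: sol_Critical)
  next
    case Down
    then show ?thesis using q by (simp add: sol_Down)
  next
    case (Insert w z R)
    then have "F (take (length w) ps @ (z, []) # drop (length w) ps) q \<noteq> 0"
      using q sol_insert[OF Insert(2,3), of d b F] by auto
    moreover have "z \<in> vertices Q" using chain_end[OF Insert(2)] path_of_A_vertices[OF q(1)] by simp
    moreover have "length w \<in> {..length ps}" using Insert(1) by simp
    ultimately show ?thesis by blast
  next
    case (Split w \<alpha> z p R)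
    have j: "length w \<in> {..length ps}" using Split(1) by simp
    have t: "take (length w) ps = map arr w" "drop (Suc (length w)) ps = R" using Split(1) by auto
    have \<alpha>: "\<alpha> \<in> arrows Q" using chain_arrows[OF Split(2)] by simp
    consider (A) "w = []" "ldiv Q (arr \<alpha>) q" "sol Q d b F (p # R) (lquot (arr \<alpha>) q) \<noteq> 0"
      | (B) "R = []" "rdiv Q p q" "b (map arr (w @ [\<alpha>])) (rquot Q p q) \<noteq> 0"
      | (C) "F (map arr (w @ [\<alpha>]) @ p # R) q \<noteq> 0"
      using q(2) sol_split_nonzero[OF Split(2,4)] Split(1) by metis
    then show ?thesis
    proof cases
      case A
      have 0: "?\<alpha> 0 = arr \<alpha>" "?p 0 = p" "drop (Suc 0) ps = R" using Split(7,8) A(1) t by auto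
      have "path_of_A Q (lquot (arr \<alpha>) q)" using path_of_A_lquot[OF q(1) A(2)] \<alpha> by simp
      then have "lquot (arr \<alpha>) q \<in> ?S" using A(3) unfolding 0 by simp
      then have "pcomp (arr \<alpha>) (lquot (arr \<alpha>) q) \<in> pcomp (?\<alpha> 0) ` ?S" unfolding 0 by (rule imageI)
      moreover have "length (snd p) < length (snd (hd ps))" using A Split(1) by (simp add: pcomp_def)
      ultimately have "q \<in> ?X5" using pcomp_lquot[OF A(2)] Split(3) unfolding 0 by simp
      then show ?thesis by blast
    next
      case B
      have "b (take (length w) ps @ [?\<alpha> (length w)]) (rquot Q p q) \<noteq> 0" using B(3) Split(8) t by simp
      moreover have "q = pcomp (rquot Q p q) (?p (length w))" using B(2) Split(7) by (simp add: rdiv_def)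
      ultimately show ?thesis using j by blast
    next
      case C
      then have "F (take (length w) ps @ ?\<alpha> (length w) # ?p (length w) # drop (Suc (length w)) ps) q \<noteq> 0"
        using t Split(7,8) by simp
      then show ?thesis using j by blast
    qed
  qed
  then show ?case by (intro finite_subset[OF _ fin]) blast
qed

lemma coef_nonzero:
  fixes \<phi> :: "(('v, 'a) path \<Rightarrow>\<^sub>0 'k::field) list \<Rightarrow> (('v, 'a) path \<Rightarrow>\<^sub>0 'k)"
  assumes "\<phi> \<in> hoch_cochains Q n d" "coef \<phi> ps q \<noteq> 0"
  shows "length ps = n" "\<forall>p\<in>set ps. path_of_A Q p" "path_of_A Q q"
    "pdegree Q q = (\<Sum>p\<leftarrow>ps. pdegree Q p) + d"
proof -
  have "\<phi> (map sg ps) \<noteq> 0" using assms(2) by (auto simp: coef_def)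
  then have *: "length ps = n \<and> set (map sg ps) \<subseteq> (alg Q :: (('v, 'a) path \<Rightarrow>\<^sub>0 'k) set)"
    using assms(1) unfolding hoch_cochains_iff by (metis length_map)
  then show "length ps = n" by simp
  show paths: "\<forall>p\<in>set ps. path_of_A Q p"
    using * by (auto simp: alg_def)
  have "list_all2 (\<lambda>x e. x \<in> alg_degree Q e) (map sg ps :: (('v, 'a) path \<Rightarrow>\<^sub>0 'k) list) (map (pdegree Q) ps)"
    using paths by (auto simp: list_all2_conv_all_nth alg_degree_iff lookup_single when_def)
  then have "\<phi> (map sg ps) \<in> alg_degree Q (sum_list (map (pdegree Q) ps) + d)"
    using assms(1) * unfolding hoch_cochains_iff by simp
  then show "path_of_A Q q" "pdegree Q q = (\<Sum>p\<leftarrow>ps. pdegree Q p) + d"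
    using assms(2) by (auto simp: alg_degree_iff coef_def)
qed

text \<open>Both halves of the comparison come from this statement: \<open>F = 0\<close> lifts
  Bardzell cocycles, and a cocycle \<open>F\<close> together with a bounding Bardzell cochain
  \<open>c\<close> yields a cochain bounding \<open>F\<close>.\<close>

lemma solve_along_matching:
  fixes F :: "(('v, 'a) path \<Rightarrow>\<^sub>0 'k::field) list \<Rightarrow> (('v, 'a) path \<Rightarrow>\<^sub>0 'k)"
  assumes F: "F \<in> hoch_cochains Q (Suc n) d" and c: "c \<in> bardzell_cochains Q n d"
  shows "\<exists>g\<in>hoch_cochains Q n d.
    (\<forall>w q. path_of_A Q q \<longrightarrow> length w = n \<longrightarrow> chain Q (ptarget Q q) None w (fst q) \<longrightarrow>
      coef g (map arr w) q = lk c ((fst q, w), q)) \<and>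
    (\<forall>ps q. length ps = Suc n \<longrightarrow> (\<forall>p\<in>set ps. path_of_A Q p) \<longrightarrow> path_of_A Q q \<longrightarrow>
      kind Q ps q = Down \<longrightarrow> coef (hoch_diff Q n d g) ps q = coef F ps q)"
proof -
  \<comment> \<open>A Bardzell pair is read off a list of arrows. The condition says that all
    entries are arrows, and the source of the anti-path is taken from \<open>q\<close>, which is
    parallel to it.\<close>
  define b :: "('v, 'a) path list \<Rightarrow> ('v, 'a) path \<Rightarrow> 'k" where
    "b = (\<lambda>ps q. if ps = map arr (map (hd \<circ> snd) ps) then lk c ((fst q, map (hd \<circ> snd) ps), q) else 0)"
  let ?F = "coef F"
  define s where "s = sol Q d b ?F"
  have b_arr: "b (map arr w) q = lk c ((fst q, w), q)" for w q
    by (simp add: b_def o_def)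
  have b_fin: "finite {q. b ps q \<noteq> 0}" for ps
  proof (rule finite_subset)
    show "{q. b ps q \<noteq> 0} \<subseteq> snd ` Poly_Mapping.keys c"
    proof
      fix q assume "q \<in> {q. b ps q \<noteq> 0}"
      then have "((fst q, map (hd \<circ> snd) ps), q) \<in> Poly_Mapping.keys c"
        by (simp add: b_def in_keys_iff split: if_splits)
      then show "q \<in> snd ` Poly_Mapping.keys c" by force
    qed
  qed simp
  have b_deg: "pdegree Q q = (\<Sum>p\<leftarrow>ps. pdegree Q p) + d" if "b ps q \<noteq> 0" for ps q
  proof -
    define w where "w = map (hd \<circ> snd) ps"
    have ps: "ps = map arr w" "lk c ((fst q, w), q) \<noteq> 0"
      using that by (auto simp: b_def w_def split: if_splits)
    then have "((fst q, w), q) \<in> bardzell_basis Q n d"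
      using c by (auto simp: bardzell_cochains_def in_keys_iff)
    then show ?thesis unfolding ps(1) by (simp add: bardzell_basis_def pdegree_def[of Q "(fst q, w)"] o_def)
  qed
  have F_fin: "finite {q. ?F ps q \<noteq> 0}" for ps
    unfolding coef_def by simp
  have F_deg: "pdegree Q q = (\<Sum>p\<leftarrow>ps. pdegree Q p) + d" if "?F ps q \<noteq> 0" for ps q
    using coef_nonzero[OF F that] by simp
  \<comment> \<open>\<open>sol\<close> has values at all lists and paths; the restriction to paths
    of \<open>A\<close> is what makes the support finite by \<open>sol_finite\<close>.\<close>
  define f where "f = (\<lambda>ps. if length ps = n \<and> (\<forall>p\<in>set ps. path_of_A Q p)
    then Abs_poly_mapping (\<lambda>q. if path_of_A Q q then s ps q else 0) else 0)"
  have lf: "lk (f ps) q = (if length ps = n \<and> (\<forall>p\<in>set ps. path_of_A Q p) \<and> path_of_A Q q then s ps q else 0)"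
    for ps q
  proof (cases "length ps = n \<and> (\<forall>p\<in>set ps. path_of_A Q p)")
    case True
    have "{q. (if path_of_A Q q then s ps q else 0) \<noteq> 0} = {q. path_of_A Q q \<and> s ps q \<noteq> 0}" by auto
    then have "finite {q. (if path_of_A Q q then s ps q else 0) \<noteq> 0}"
      using sol_finite[of b ?F ps d] b_fin F_fin True by (simp add: s_def)
    then show ?thesis using True by (simp add: f_def)
  qed (auto simp: f_def)
  define g where "g = (\<lambda>xs. if length xs = n \<and> set xs \<subseteq> alg Q then ext f xs else 0)"
  have g: "g \<in> hoch_cochains Q n d"
    unfolding g_def
  proof (rule ext_cochain)
    show "f ps \<in> alg Q" for ps by (auto simp: alg_iff lf)
    show "f ps \<in> alg_degree Q ((\<Sum>p\<leftarrow>ps. pdegree Q p) + d)"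
      if "length ps = n" "\<forall>p\<in>set ps. path_of_A Q p" for ps
      using sol_degree[of b d ?F ps] b_deg F_deg that by (auto simp: alg_degree_iff lf s_def split: if_splits)
  qed
  have cg: "coef g ps q = (if length ps = n \<and> (\<forall>p\<in>set ps. path_of_A Q p) \<and> path_of_A Q q then s ps q else 0)"
    for ps q
  proof (cases "coef g ps q = 0")
    case False
    then have "length ps = n" "\<forall>p\<in>set ps. path_of_A Q p" "path_of_A Q q" using coef_nonzero[OF g] by blast+
    then show ?thesis by (auto simp: coef_def g_def lf)
  next
    case True
    have "set (map sg ps) \<subseteq> (alg Q :: (('v, 'a) path \<Rightarrow>\<^sub>0 'k) set)" if "\<forall>p\<in>set ps. path_of_A Q p"
      using that by auto
    then show ?thesis using True by (auto simp: coef_def g_def lf)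
  qed
  have down: "coef g ps q = 0" if "path_of_A Q q" "kind Q ps q = Down" for ps q
    using that by (simp add: cg s_def sol_Down)
  have crit: "coef g (map arr w) q = lk c ((fst q, w), q)"
    if "path_of_A Q q" "length w = n" "chain Q (ptarget Q q) None w (fst q)" for w q
    using that chain_arrows[OF that(3)] Critical_coef[OF that(3)]
    by (auto simp: cg s_def sol_Critical b_arr subset_iff)
  show ?thesis
  proof (intro bexI[OF _ g] conjI allI impI)
    show "coef g (map arr w) q = lk c ((fst q, w), q)"
      if "path_of_A Q q" "length w = n" "chain Q (ptarget Q q) None w (fst q)" for w q
      using that by (rule crit)
    fix ps q
    assume len: "length ps = Suc n" and paths: "\<forall>p\<in>set ps. path_of_A Q p" and q: "path_of_A Q q"
      and k: "kind Q ps q = Down"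
    show "coef (hoch_diff Q n d g) ps q = coef F ps q"
      using k
    proof (cases rule: Down_decomp)
      case (insert w z R)
      have "coef g (map arr w @ R) q = (-1) powi d * (-1) ^ length w * coef F ps q"
        using len paths q insert sol_insert[OF insert(2,3), of d b ?F] by (simp add: cg s_def)
      moreover have "coef (hoch_diff Q n d g) ps q = (-1) powi d * (-1) ^ length w * coef g (map arr w @ R) q"
        unfolding insert(1) using len paths insert
        by (intro coef_diff_insert[OF g down q]) auto
      ultimately show ?thesis by (simp add: mult_ac)
    next
      case (split w' z \<alpha> p R)
      then obtain w where w': "w' = w @ [\<alpha>]" by (cases w' rule: rev_cases) (auto simp: last_arrow_def)
      have ch: "chain Q (ptarget Q q) None (w @ [\<alpha>]) z" using split w' by simp
      have \<alpha>: "\<alpha> \<in> arrows Q" "source Q \<alpha> = z" "set w \<subseteq> arrows Q"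
        using chain_arrows[OF ch] chain_last[OF ch] by auto
      have p: "path_of_A Q p" "\<forall>p\<in>set R. path_of_A Q p" using paths split(1) by auto
      obtain \<beta> u where "snd p = \<beta> # u" using split(4) by (cases "snd p") auto
      then have up: "path_of_A Q (pcomp (arr \<alpha>) p)"
        using p(1) split(5,6) \<alpha> by (auto simp: path_of_A_def is_path_def pcomp_def psource_def ptarget_def)
      have lenR: "Suc (length w + length R) = n" using len split(1) w' by simp
      have cU: "coef g (map arr w @ pcomp (arr \<alpha>) p # R) q = s (map arr w @ pcomp (arr \<alpha>) p # R) q"
        using lenR up p q \<alpha> by (auto simp: cg)
      have cA: "coef g (p # R) (lquot (arr \<alpha>) q) = s (p # R) (lquot (arr \<alpha>) q)"
        if "w = []" "ldiv Q (arr \<alpha>) q"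
        using lenR that p path_of_A_lquot[OF q that(2)] \<alpha> by (auto simp: cg)
      \<comment> \<open>Removing \<open>p\<close> from \<open>q\<close> on the right turns the
        arrows \<open>w @ [\<alpha>]\<close> into a critical cell, so the value there is the
        prescribed one.\<close>
      have cB: "coef g (map arr (w @ [\<alpha>])) (rquot Q p q) = b (map arr (w @ [\<alpha>])) (rquot Q p q)"
        if "R = []" "rdiv Q p q"
      proof -
        have "chain Q (ptarget Q (rquot Q p q)) None (w @ [\<alpha>]) (fst (rquot Q p q))"
          using rquot_facts[OF that(2) q] ch split(5) by simp
        then show ?thesis
          using crit[of "rquot Q p q" "w @ [\<alpha>]"] b_arr[of "w @ [\<alpha>]"] path_of_A_rquot[OF q that(2) p(1)] lenR that
          by simp
      qed
      define A where "A = (if w = [] \<and> ldiv Q (arr \<alpha>) q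
        then (-1) powi (d * degree Q \<alpha>) * s (p # R) (lquot (arr \<alpha>) q) else 0)"
      define B where "B = (if R = [] \<and> rdiv Q p q
        then (-1) ^ length w * b (map arr (w @ [\<alpha>])) (rquot Q p q) else 0)"
      have "coef (hoch_diff Q n d g) ps q =
        (-1) powi d * (A - (-1) ^ length w * s (map arr w @ pcomp (arr \<alpha>) p # R) q + B)"
        unfolding split(1) w' A_def B_def
        using coef_diff_split[OF g down q ch p(1) split(4,5,6) p(2) lenR] cA cB cU by (simp cong: if_cong)
      moreover have "s (map arr w @ pcomp (arr \<alpha>) p # R) q =
        (-1) ^ length w * (A + B - (-1) powi d * coef F ps q)"
        unfolding s_def sol_split[OF ch split(4)] A_def B_def split(1) w' by simp
      ultimately show ?thesis by simp
    qed
  qed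
qed

text \<open>The cocycle equation at a \<open>Down\<close> cell of length \<open>n + 1\<close>
  expresses the value at its partner of length \<open>n\<close> by a value on a critical cell and
  one on a list with shorter first entry. The former vanishes by hypothesis, the latter by
  induction.\<close>

lemma cocycle_zero:
  fixes F :: "(('v, 'a) path \<Rightarrow>\<^sub>0 'k::field) list \<Rightarrow> (('v, 'a) path \<Rightarrow>\<^sub>0 'k)"
  assumes F: "F \<in> hoch_cochains Q n d" "hoch_diff Q n d F = 0"
    and down: "\<And>ps q. length ps = n \<Longrightarrow> \<forall>p\<in>set ps. path_of_A Q p \<Longrightarrow> path_of_A Q q \<Longrightarrow>
      kind Q ps q = Down \<Longrightarrow> coef F ps q = 0"
    and crit: "\<And>w q. path_of_A Q q \<Longrightarrow> length w = n \<Longrightarrow> chain Q (ptarget Q q) None w (fst q) \<Longrightarrow>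
      coef F (map arr w) q = 0"
  shows "F = 0"
proof -
  have down': "coef F ps q = 0" if "path_of_A Q q" "kind Q ps q = Down" for ps q
    using down that coef_nonzero[OF F(1)] by blast
  have diff: "coef (hoch_diff Q n d F) ps q = 0" for ps q
    using F(2) by (simp add: coef_def)
  have "coef F ps q = 0" if "\<forall>p\<in>set ps. path_of_A Q p" "path_of_A Q q" "length ps = n" for ps q
    using that
  proof (induction "length (snd (hd ps))" arbitrary: ps q rule: less_induct)
    case less
    from less.prems(1) show ?case
    proof (cases rule: cell_cases[where q = q])
      case (Critical w)
      then show ?thesis using crit[OF less.prems(2)] less.prems by simp
    next
      case Down
      then show ?thesis using down less.prems by simp
    next
      case (Insert w z R)
      have "0 = (-1) powi d * (-1) ^ length w * coef F (map arr w @ R) q"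
        unfolding diff[symmetric, of "map arr w @ (z, []) # R" q] using Insert less.prems
        by (intro coef_diff_insert[OF F(1) down']) auto
      then show ?thesis using Insert(1) by simp
    next
      case (Split w \<alpha> z p R)
      have \<alpha>: "\<alpha> \<in> arrows Q" using chain_arrows[OF Split(2)] by simp
      have R: "\<forall>p\<in>set R. path_of_A Q p" and len: "Suc (length w + length R) = n"
        using Split(1) less.prems by auto
      have A: "coef F (p # R) (lquot (arr \<alpha>) q) = 0" if "w = []" "ldiv Q (arr \<alpha>) q"
      proof (rule less.hyps)
        show "length (snd (hd (p # R))) < length (snd (hd ps))" using that Split(1) by (simp add: pcomp_def)
        show "path_of_A Q (lquot (arr \<alpha>) q)" using path_of_A_lquot[OF less.prems(2) that(2)] \<alpha> by simp
      qed (use that Split(3) R len in auto)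
      have B: "coef F (map arr (w @ [\<alpha>])) (rquot Q p q) = 0" if "R = []" "rdiv Q p q"
      proof (rule crit)
        show "chain Q (ptarget Q (rquot Q p q)) None (w @ [\<alpha>]) (fst (rquot Q p q))"
          using rquot_facts[OF that(2) less.prems(2)] Split(2,5) by simp
      qed (use path_of_A_rquot[OF less.prems(2) that(2) Split(3)] len that in auto)
      have "0 = (-1) powi d * (- ((-1) ^ length w * coef F (map arr w @ pcomp (arr \<alpha>) p # R) q))"
        using coef_diff_split[OF F(1) down' less.prems(2) Split(2-6) R len] A B diff by (simp cong: if_cong)
      then show ?thesis using Split(1) by simp
    qed
  qed
  then have "coef F ps q = 0" for ps q using coef_nonzero[OF F(1)] by metis
  then have z: "F (map sg ps) = 0" for ps
    by (intro poly_mapping_eqI) (simp add: coef_def)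
  show ?thesis
  proof
    fix xs
    have m: "mlin Q n F" "mlin Q n (\<lambda>_. 0 :: ('v, 'a) path \<Rightarrow>\<^sub>0 'k)"
      using F(1) by (auto simp: hoch_cochains_iff mlin_def)
    show "F xs = 0 xs"
    proof (cases "length xs = n \<and> set xs \<subseteq> alg Q")
      case True
      show ?thesis unfolding zero_fun_apply
        by (rule cochain_eqI[OF m]) (simp_all only: z True)
    next
      case False
      then show ?thesis using F(1) by (simp add: hoch_cochains_iff)
    qed
  qed
qed

end

section \<open>The comparison map\<close>

definition path_butlast :: "('v, 'a) graded_quiver \<Rightarrow> ('v, 'a) path \<Rightarrow> ('v, 'a) path" where
  "path_butlast Q p = (target Q (last (snd p)), butlast (snd p))"

lemma bardzell_cochains_iff:
  "f \<in> bardzell_cochains Q n d \<longleftrightarrow> (\<forall>k. lk f k \<noteq> 0 \<longrightarrow> k \<in> bardzell_basis Q n d)"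
  by (auto simp: bardzell_cochains_def in_keys_iff)

lemma bardzell_cochains_lin:
  "f \<in> bardzell_cochains Q n d \<Longrightarrow> g \<in> bardzell_cochains Q n d \<Longrightarrow> smult c f + g \<in> bardzell_cochains Q n d"
  unfolding bardzell_cochains_iff lookup_add lookup_smult by (metis add_0 mult_zero_right)

lemma bardzell_cochains_zero [simp]: "0 \<in> bardzell_cochains Q n d"
  by (simp add: bardzell_cochains_iff)

lemma ptarget_path_tl:
  "is_path Q p \<Longrightarrow> snd p \<noteq> [] \<Longrightarrow> ptarget Q (path_tl p) = source Q (hd (snd p))"
  by (cases p; cases "snd p"; cases "tl (snd p)") (auto simp: is_path_def path_tl_def ptarget_def)

lemma pcomp_arrow_path_tl:
  "is_path Q p \<Longrightarrow> snd p \<noteq> [] \<Longrightarrow> pcomp (arrow_path Q (hd (snd p))) (path_tl p) = p"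
  by (simp add: pcomp_def path_tl_def psource_def prod_eq_iff)

lemma pcomp_path_butlast_arrow:
  "is_path Q p \<Longrightarrow> snd p \<noteq> [] \<Longrightarrow> pcomp (path_butlast Q p) (arrow_path Q (last (snd p))) = p"
  by (simp add: pcomp_def path_butlast_def is_path_def prod_eq_iff)

lemma path_tl_pcomp_arrow [simp]: "path_tl (pcomp (arrow_path Q \<alpha>) p) = p"
  by (simp add: pcomp_def path_tl_def psource_def)

lemma path_butlast_pcomp_arrow:
  "composable Q p (arrow_path Q \<beta>) \<Longrightarrow> path_butlast Q (pcomp p (arrow_path Q \<beta>)) = p"
  by (simp add: pcomp_def path_butlast_def composable_def psource_def prod_eq_iff)

context gentle begin

lemma successively_relations:
  "successively (\<lambda>\<alpha> \<beta>. (\<alpha>, \<beta>) \<in> relations Q) w \<Longrightarrow> successively (\<lambda>\<alpha> \<beta>. source Q \<alpha> = target Q \<beta>) w"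
  by (induction w rule: induct_list012) (auto dest: relationsD)

lemma chain_iff:
  "chain Q x prev w z \<longleftrightarrow> set w \<subseteq> arrows Q \<and> successively (\<lambda>\<alpha> \<beta>. (\<alpha>, \<beta>) \<in> relations Q) w \<and>
    (if w = [] then x = z else target Q (hd w) = x \<and> source Q (last w) = z \<and>
      (\<forall>\<beta>. prev = Some \<beta> \<longrightarrow> (\<beta>, hd w) \<in> relations Q))"
  by (induction w arbitrary: x prev) (auto simp: successively_Cons dest: relationsD)

text \<open>Identifies the critical cells of the matching with the pairs spanning the Bardzell
  complex.\<close>

lemma chain_anti_path:
  assumes "path_of_A Q q"
  shows "chain Q (ptarget Q q) None w (fst q) \<longleftrightarrow> anti_path Q (fst q, w) \<and> parallel Q (fst q, w) q"
  using path_of_A_vertices[OF assms] successively_relations[of w]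
  by (auto simp: chain_iff anti_path_def is_path_def parallel_def psource_def ptarget_def[of Q "(fst q, w)"])

text \<open>The definition says where a basis pair is sent; here the differential is read at a
  target pair. The arrow added on the left must be the common first arrow of the target, the one
  added on the right its common last arrow, so each sum contributes at most one term.\<close>

lemma lookup_bardzell_diff:
  fixes f :: "(('v, 'a) path \<times> ('v, 'a) path) \<Rightarrow>\<^sub>0 'k::field"
  assumes f: "f \<in> bardzell_cochains Q n d"
  shows "lk (bardzell_diff Q n d f) (P, R) =
    (if anti_path Q P \<and> plength P = Suc n \<and> path_of_A Q R \<and> parallel Q P R then (-1) powi d *
      ((if snd R \<noteq> [] \<and> hd (snd R) = hd (snd P)
        then (-1) powi (d * degree Q (hd (snd P))) * lk f (path_tl P, path_tl R) else 0)
       - (if snd R \<noteq> [] \<and> last (snd R) = last (snd P)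
          then (-1) ^ n * lk f (path_butlast Q P, path_butlast Q R) else 0)) else 0)"
proof -
  define valid where "valid \<longleftrightarrow> anti_path Q P \<and> plength P = Suc n \<and> path_of_A Q R \<and> parallel Q P R"
  define lc where "lc \<longleftrightarrow> valid \<and> snd R \<noteq> [] \<and> hd (snd R) = hd (snd P)"
  define rc where "rc \<longleftrightarrow> valid \<and> snd R \<noteq> [] \<and> last (snd R) = last (snd P)"
  define c1 where "c1 = ((-1) powi (d * degree Q (hd (snd P))) :: 'k)"
  have path: "is_path Q P" "is_path Q R" "snd P \<noteq> []" "set (snd P) \<subseteq> arrows Q" if valid
    using that by (auto simp: valid_def anti_path_def path_of_A_def plength_def is_path_def)
  have b: "lk (bardzell_diff_basis Q n d p q :: _ \<Rightarrow>\<^sub>0 'k) (P, R) = (-1) powi d *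
     ((if (p, q) = (path_tl P, path_tl R) \<and> lc then c1 else 0)
      - (if (p, q) = (path_butlast Q P, path_butlast Q R) \<and> rc then (-1) ^ n else 0))"
    if "(p, q) \<in> bardzell_basis Q n d" for p q
  proof -
    have pq: "anti_path Q p" "plength p = n" "path_of_A Q q" "parallel Q p q"
      using that by (auto simp: bardzell_basis_def)
    let ?A = "{\<alpha> \<in> arrows Q. composable Q (arr \<alpha>) p \<and> anti_path Q (pcomp (arr \<alpha>) p) \<and>
      path_of_A Q (pcomp (arr \<alpha>) q)}"
    let ?B = "{\<beta> \<in> arrows Q. composable Q p (arr \<beta>) \<and> anti_path Q (pcomp p (arr \<beta>)) \<and>
      path_of_A Q (pcomp q (arr \<beta>))}"
    have par: "fst p = fst q" "ptarget Q p = ptarget Q q" using pq(4) by (auto simp: parallel_def psource_def)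
    have A: "\<alpha> \<in> ?A \<and> (pcomp (arr \<alpha>) p, pcomp (arr \<alpha>) q) = (P, R) \<longleftrightarrow>
      \<alpha> = hd (snd P) \<and> (p, q) = (path_tl P, path_tl R) \<and> lc" (is "?l \<longleftrightarrow> ?r") for \<alpha>
    proof
      assume ?l
      then have l: "P = pcomp (arr \<alpha>) p" "R = pcomp (arr \<alpha>) q" "anti_path Q P" "path_of_A Q R"
        "composable Q (arr \<alpha>) p" by auto
      have "composable Q (arr \<alpha>) q" using l(5) par by (simp add: composable_def)
      then have "parallel Q P R" using l par by (simp add: parallel_def ptarget_pcomp psource_def[of p] psource_def[of q])
      then have valid using l pq by (simp add: valid_def plength_def pcomp_def)
      then show ?r using l by (auto simp: lc_def) (auto simp: pcomp_def)
    next
      assume r: ?r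
      then have v: valid "snd R \<noteq> []" "hd (snd R) = hd (snd P)" by (auto simp: lc_def)
      note path = path[OF v(1)]
      have "pcomp (arr \<alpha>) p = P" "pcomp (arr \<alpha>) q = R"
        using pcomp_arrow_path_tl[OF path(1,3)] pcomp_arrow_path_tl[OF path(2) v(2)] r v by simp_all
      moreover have "composable Q (arr \<alpha>) p"
        using ptarget_path_tl[OF path(1,3)] r by (simp add: composable_def)
      moreover have "\<alpha> \<in> arrows Q" using r path(3,4) by auto
      ultimately show ?l using v(1) by (auto simp: valid_def)
    qed
    have B: "\<beta> \<in> ?B \<and> (pcomp p (arr \<beta>), pcomp q (arr \<beta>)) = (P, R) \<longleftrightarrow>
      \<beta> = last (snd P) \<and> (p, q) = (path_butlast Q P, path_butlast Q R) \<and> rc" (is "?l \<longleftrightarrow> ?r") for \<beta>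
    proof
      assume ?l
      then have l: "P = pcomp p (arr \<beta>)" "R = pcomp q (arr \<beta>)" "anti_path Q P" "path_of_A Q R"
        "composable Q p (arr \<beta>)" by auto
      have q: "composable Q q (arr \<beta>)" using l(5) par by (simp add: composable_def psource_def)
      then have "parallel Q P R" using l par by (simp add: parallel_def ptarget_pcomp)
      then have valid using l pq by (simp add: valid_def plength_def pcomp_def)
      then show ?r using l q by (auto simp: rc_def path_butlast_pcomp_arrow) (auto simp: pcomp_def)
    next
      assume r: ?r
      then have v: valid "snd R \<noteq> []" "last (snd R) = last (snd P)" by (auto simp: rc_def)
      note path = path[OF v(1)]
      have "pcomp p (arr \<beta>) = P" "pcomp q (arr \<beta>) = R"
        using pcomp_path_butlast_arrow[OF path(1,3)] pcomp_path_butlast_arrow[OF path(2) v(2)] r v by simp_all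
      moreover have "composable Q p (arr \<beta>)"
        using r by (simp add: composable_def path_butlast_def psource_def)
      moreover have "\<beta> \<in> arrows Q" using r path(3,4) by auto
      ultimately show ?l using v(1) by (auto simp: valid_def)
    qed
    have fin: "finite ?A" "finite ?B" by auto
    have "(\<Sum>\<alpha>\<in>?A. lk (Poly_Mapping.single (pcomp (arr \<alpha>) p, pcomp (arr \<alpha>) q)
        ((-1) powi (d * degree Q \<alpha>))) (P, R)) =
      (\<Sum>\<alpha>\<in>?A. if \<alpha> = hd (snd P) then (if (p, q) = (path_tl P, path_tl R) \<and> lc then c1 else 0) else 0)"
    proof (intro sum.cong refl)
      fix \<alpha> assume "\<alpha> \<in> ?A"
      then have E: "(pcomp (arr \<alpha>) p, pcomp (arr \<alpha>) q) = (P, R) \<longleftrightarrow>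
        \<alpha> = hd (snd P) \<and> (p, q) = (path_tl P, path_tl R) \<and> lc"
        using A[of \<alpha>] by blast
      show "lk (Poly_Mapping.single (pcomp (arr \<alpha>) p, pcomp (arr \<alpha>) q) ((-1) powi (d * degree Q \<alpha>))) (P, R) =
        (if \<alpha> = hd (snd P) then (if (p, q) = (path_tl P, path_tl R) \<and> lc then c1 else 0) else 0)"
        unfolding lookup_single when_def E c1_def by presburger
    qed
    also have "\<dots> = (if (p, q) = (path_tl P, path_tl R) \<and> lc then c1 else 0)"
      unfolding sum.delta[OF fin(1)] using A[of "hd (snd P)"] by presburger
    finally have 1: "(\<Sum>\<alpha>\<in>?A. lk (Poly_Mapping.single (pcomp (arr \<alpha>) p, pcomp (arr \<alpha>) q)
        ((-1) powi (d * degree Q \<alpha>))) (P, R)) = (if (p, q) = (path_tl P, path_tl R) \<and> lc then c1 else 0)" .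
    have "(\<Sum>\<beta>\<in>?B. lk (Poly_Mapping.single (pcomp p (arr \<beta>), pcomp q (arr \<beta>)) ((-1) ^ n :: 'k)) (P, R)) =
      (\<Sum>\<beta>\<in>?B. if \<beta> = last (snd P)
        then (if (p, q) = (path_butlast Q P, path_butlast Q R) \<and> rc then (-1) ^ n else 0) else 0)"
    proof (intro sum.cong refl)
      fix \<beta> assume "\<beta> \<in> ?B"
      then have E: "(pcomp p (arr \<beta>), pcomp q (arr \<beta>)) = (P, R) \<longleftrightarrow>
        \<beta> = last (snd P) \<and> (p, q) = (path_butlast Q P, path_butlast Q R) \<and> rc"
        using B[of \<beta>] by blast
      show "lk (Poly_Mapping.single (pcomp p (arr \<beta>), pcomp q (arr \<beta>)) ((-1) ^ n :: 'k)) (P, R) =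
        (if \<beta> = last (snd P)
        then (if (p, q) = (path_butlast Q P, path_butlast Q R) \<and> rc then (-1) ^ n else 0) else 0)"
        unfolding lookup_single when_def E by presburger
    qed
    also have "\<dots> = (if (p, q) = (path_butlast Q P, path_butlast Q R) \<and> rc then (-1) ^ n else 0)"
      unfolding sum.delta[OF fin(2)] using B[of "last (snd P)"] by presburger
    finally show ?thesis using 1
      unfolding bardzell_diff_basis_def lookup_smult lookup_minus lookup_sum by simp
  qed
  have keys: "k \<in> bardzell_basis Q n d" if "k \<in> Poly_Mapping.keys f" for k
    using f that by (auto simp: bardzell_cochains_def)
  define kl where "kl = (path_tl P, path_tl R)"
  define kr where "kr = (path_butlast Q P, path_butlast Q R)"
  have b': "lk (bardzell_diff_basis Q n d (fst k) (snd k) :: _ \<Rightarrow>\<^sub>0 'k) (P, R) = (-1) powi d *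
     ((if k = kl \<and> lc then c1 else 0) - (if k = kr \<and> rc then (-1) ^ n else 0))"
    if "k \<in> Poly_Mapping.keys f" for k
    using b[of "fst k" "snd k"] keys[OF that] by (simp only: kl_def kr_def prod.collapse)
  have "lk (bardzell_diff Q n d f) (P, R) =
    (\<Sum>k\<in>Poly_Mapping.keys f. lk f k * lk (bardzell_diff_basis Q n d (fst k) (snd k)) (P, R))"
    by (simp add: bardzell_diff_def lookup_sum case_prod_beta)
  also have "\<dots> = (\<Sum>k\<in>Poly_Mapping.keys f.
      (if k = kl then (-1) powi d * (if lc then c1 * lk f k else 0) else 0)
      - (if k = kr then (-1) powi d * (if rc then (-1) ^ n * lk f k else 0) else 0))"
    by (intro sum.cong refl) (simp add: b' algebra_simps)
  also have "\<dots> = (-1) powi d * ((if lc then c1 * lk f kl else 0) - (if rc then (-1) ^ n * lk f kr else 0))"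
    by (auto simp: sum_subtractf sum.delta in_keys_iff algebra_simps)
  finally show ?thesis unfolding lc_def rc_def c1_def valid_def kl_def kr_def by auto
qed

lemma bardzell_diff_cochain:
  assumes "f \<in> bardzell_cochains Q n d"
  shows "bardzell_diff Q n d f \<in> bardzell_cochains Q (Suc n) d"
  unfolding bardzell_cochains_iff
proof (intro allI impI)
  fix k assume k: "lk (bardzell_diff Q n d f) k \<noteq> 0"
  obtain P R where PR: "k = (P, R)" by fastforce
  have v: "anti_path Q P" "plength P = Suc n" "path_of_A Q R" "parallel Q P R"
    using k unfolding PR lookup_bardzell_diff[OF assms] by (auto split: if_splits)
  have P: "is_path Q P" "snd P \<noteq> []" "is_path Q R"
    using v by (auto simp: anti_path_def plength_def path_of_A_def)
  have "lk f (path_tl P, path_tl R) \<noteq> 0 \<and> snd R \<noteq> [] \<and> hd (snd R) = hd (snd P) \<or>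
    lk f (path_butlast Q P, path_butlast Q R) \<noteq> 0 \<and> snd R \<noteq> [] \<and> last (snd R) = last (snd P)"
    using k unfolding PR lookup_bardzell_diff[OF assms] by (auto split: if_splits)
  then have "pdegree Q R - pdegree Q P = d"
  proof (elim disjE conjE)
    assume "lk f (path_tl P, path_tl R) \<noteq> 0" "snd R \<noteq> []" "hd (snd R) = hd (snd P)"
    then have "pdegree Q (path_tl R) - pdegree Q (path_tl P) = d" 
      "pdegree Q R = degree Q (hd (snd P)) + pdegree Q (path_tl R)"
      "pdegree Q P = degree Q (hd (snd P)) + pdegree Q (path_tl P)"
      using assms P by (cases "snd R"; cases "snd P"; auto simp: bardzell_cochains_iff bardzell_basis_def pdegree_def path_tl_def)+
    then show ?thesis by simp
  next
    assume "lk f (path_butlast Q P, path_butlast Q R) \<noteq> 0" "snd R \<noteq> []" "last (snd R) = last (snd P)"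
    then have "pdegree Q (path_butlast Q R) - pdegree Q (path_butlast Q P) = d" 
      "pdegree Q R = pdegree Q (path_butlast Q R) + degree Q (last (snd P))"
      "pdegree Q P = pdegree Q (path_butlast Q P) + degree Q (last (snd P))"
      using assms P by (cases "snd R" rule: rev_cases; cases "snd P" rule: rev_cases;
          auto simp: bardzell_cochains_iff bardzell_basis_def pdegree_def path_butlast_def)+
    then show ?thesis by simp
  qed
  then show "k \<in> bardzell_basis Q (Suc n) d" using v PR by (simp add: bardzell_basis_def)
qed

lemma bardzell_diff_lin:
  assumes "f \<in> bardzell_cochains Q n d" "g \<in> bardzell_cochains Q n d"
  shows "bardzell_diff Q n d (smult c f + g) = smult c (bardzell_diff Q n d f) + bardzell_diff Q n d g"
proof (rule poly_mapping_eqI)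
  fix k :: "('v, 'a) path \<times> ('v, 'a) path"
  obtain P R where PR: "k = (P, R)" by fastforce
  show "lk (bardzell_diff Q n d (smult c f + g)) k = lk (smult c (bardzell_diff Q n d f) + bardzell_diff Q n d g) k"
    unfolding PR lookup_add lookup_smult lookup_bardzell_diff[OF assms(1)] lookup_bardzell_diff[OF assms(2)]
      lookup_bardzell_diff[OF bardzell_cochains_lin[OF assms]]
    by (simp add: algebra_simps)
qed

lemma finite_anti_paths: "finite {p. anti_path Q p \<and> plength p = n}"
  by (rule finite_subset[of _ "vertices Q \<times> {w. set w \<subseteq> arrows Q \<and> length w = n}"])
    (auto simp: anti_path_def is_path_def plength_def finite_lists_length_eq)

lemma lookup_comparison:
  "lk (comparison Q n \<phi>) (p, q) = (if anti_path Q p \<and> plength p = n \<and> parallel Q p q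
    then coef \<phi> (map arr (snd p)) q else 0)"
proof -
  let ?P = "{p. anti_path Q p \<and> plength p = n}"
  have "lk (comparison Q n \<phi>) (p, q) = (\<Sum>p'\<in>?P. if p' = p then
    (if parallel Q p q then coef \<phi> (map arr (snd p)) q else 0) else 0)"
    unfolding comparison_def lookup_sum Let_def
    by (intro sum.cong refl) (auto simp: lookup_single when_def coef_def o_def in_keys_iff)
  then show ?thesis using finite_anti_paths by (simp add: sum.delta)
qed

lemma comparison_lin:
  "comparison Q n (\<lambda>xs. smult c (\<phi> xs) + \<psi> xs) = smult c (comparison Q n \<phi>) + comparison Q n \<psi>"
proof (rule poly_mapping_eqI)
  fix k :: "('v, 'a) path \<times> ('v, 'a) path"
  obtain p q where k: "k = (p, q)" by fastforce
  show "lk (comparison Q n (\<lambda>xs. smult c (\<phi> xs) + \<psi> xs)) k = lk (smult c (comparison Q n \<phi>) + comparison Q n \<psi>) k"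
    unfolding k lookup_add lookup_smult lookup_comparison by (simp add: coef_def lookup_add)
qed

lemma comparison_zero [simp]: "comparison Q n 0 = 0"
proof (rule poly_mapping_eqI)
  fix k :: "('v, 'a) path \<times> ('v, 'a) path"
  obtain p q where k: "k = (p, q)" by fastforce
  show "lk (comparison Q n 0) k = lk 0 k" unfolding k lookup_comparison by (simp add: coef_def)
qed

lemma comparison_cochain:
  assumes "\<phi> \<in> hoch_cochains Q n d"
  shows "comparison Q n \<phi> \<in> bardzell_cochains Q n d"
  unfolding bardzell_cochains_iff
proof (intro allI impI)
  fix k assume k: "lk (comparison Q n \<phi>) k \<noteq> 0"
  obtain p q where pq: "k = (p, q)" by fastforce
  have "anti_path Q p" "plength p = n" "parallel Q p q" "coef \<phi> (map arr (snd p)) q \<noteq> 0"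
    using k unfolding pq lookup_comparison by (auto split: if_splits)
  then show "k \<in> bardzell_basis Q n d"
    using coef_nonzero[OF assms, of "map arr (snd p)" q]
    by (simp add: pq bardzell_basis_def pdegree_def[of Q p] o_def)
qed

text \<open>On the arrows of an anti-path all inner products vanish, and the two outer summands
  strip a common first or last arrow. These are the two sums of the Bardzell differential.\<close>

lemma comparison_diff:
  fixes \<phi> :: "(('v, 'a) path \<Rightarrow>\<^sub>0 'k::field) list \<Rightarrow> (('v, 'a) path \<Rightarrow>\<^sub>0 'k)"
  assumes \<phi>: "\<phi> \<in> hoch_cochains Q n d"
  shows "comparison Q (Suc n) (hoch_diff Q n d \<phi>) = bardzell_diff Q n d (comparison Q n \<phi>)"
proof (rule poly_mapping_eqI)
  fix k :: "('v, 'a) path \<times> ('v, 'a) path"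
  obtain P R where k: "k = (P, R)" by fastforce
  show "lk (comparison Q (Suc n) (hoch_diff Q n d \<phi>)) k = lk (bardzell_diff Q n d (comparison Q n \<phi>)) k"
  proof (cases "anti_path Q P \<and> plength P = Suc n \<and> parallel Q P R \<and> path_of_A Q R")
    case False
    then have "\<not> path_of_A Q R \<Longrightarrow> coef (hoch_diff Q n d \<phi>) (map arr (snd P)) R = 0"
      using coef_nonzero(3)[OF hoch_diff_cochain[OF \<phi>]] by blast
    with False show ?thesis
      unfolding k lookup_comparison lookup_bardzell_diff[OF comparison_cochain[OF \<phi>]] by auto
  next
    case True
    then have P: "anti_path Q P" "plength P = Suc n" "parallel Q P R" and R: "path_of_A Q R" by auto
    let ?w = "snd P"
    have PP: "is_path Q P" "is_path Q R" using P R by (auto simp: anti_path_def path_of_A_def)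
    have w: "length ?w = Suc n" "?w \<noteq> []" "set ?w \<subseteq> arrows Q"
      using P PP by (auto simp: plength_def is_path_def)
    have ch: "chain Q (ptarget Q R) None ?w (fst R)"
      using P R chain_anti_path[OF R, of ?w] by (cases P) (auto simp: parallel_def psource_def)
    have tgt: "target Q (hd ?w) = ptarget Q R" "source Q (last ?w) = fst R"
      using ch w(2) by (auto simp: chain_iff)
    have L: "ldiv Q (arr (hd ?w)) R \<longleftrightarrow> snd R \<noteq> [] \<and> hd (snd R) = hd ?w"
    proof
      assume "ldiv Q (arr (hd ?w)) R"
      then have "pcomp (arr (hd ?w)) (lquot (arr (hd ?w)) R) = R" by (rule pcomp_lquot)
      then have "snd R = hd ?w # snd (lquot (arr (hd ?w)) R)" by (metis append_Cons append_Nil arrow_path_simps(1) pcomp_def snd_conv)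
      then show "snd R \<noteq> [] \<and> hd (snd R) = hd ?w" by simp
    next
      assume a: "snd R \<noteq> [] \<and> hd (snd R) = hd ?w"
      have "lquot (arr (hd ?w)) R = path_tl R" by (simp add: lquot_def path_tl_def drop_Suc)
      then show "ldiv Q (arr (hd ?w)) R"
        using a pcomp_arrow_path_tl[OF PP(2)] ptarget_path_tl[OF PP(2)]
        by (simp add: ldiv_def composable_def)
    qed
    have lq: "lquot (arr (hd ?w)) R = path_tl R" by (simp add: lquot_def path_tl_def drop_Suc)
    have Rr: "rdiv Q (arr (last ?w)) R \<longleftrightarrow> snd R \<noteq> [] \<and> last (snd R) = last ?w"
      using tgt(2) by (cases "snd R" rule: rev_cases) (auto simp: rdiv_def rquot_def pcomp_def prod_eq_iff)
    have rq: "rquot Q (arr (last ?w)) R = path_butlast Q R" if "snd R \<noteq> []" "last (snd R) = last ?w"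
      using that by (simp add: rquot_def path_butlast_def butlast_conv_take)
    have cl: "lk (comparison Q n \<phi>) (path_tl P, path_tl R) = coef \<phi> (map arr (tl ?w)) (path_tl R)"
      if "snd R \<noteq> []" "hd (snd R) = hd ?w"
    proof -
      have "anti_path Q (path_tl P)"
        using P(1) w by (cases P; cases "snd P")
          (auto simp: anti_path_def is_path_def path_tl_def successively_Cons split: if_splits)
      moreover have "parallel Q (path_tl P) (path_tl R)"
        using ptarget_path_tl[OF PP(1) w(2)] ptarget_path_tl[OF PP(2) that(1)] that P(3)
        by (simp add: parallel_def) (simp add: path_tl_def psource_def)
      ultimately show ?thesis using w(1) unfolding lookup_comparison by (simp add: plength_def path_tl_def)
    qed
    have cr: "lk (comparison Q n \<phi>) (path_butlast Q P, path_butlast Q R) =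
      coef \<phi> (map arr (butlast ?w)) (path_butlast Q R)"
      if "snd R \<noteq> []" "last (snd R) = last ?w"
    proof -
      have "anti_path Q (path_butlast Q P)"
        using P(1) w by (cases P; cases "snd P" rule: rev_cases)
          (auto simp: anti_path_def is_path_def path_butlast_def successively_append_iff)
      moreover have "ptarget Q (path_butlast Q P) = ptarget Q P"
        using PP(1) w(2) by (cases P; cases "snd P" rule: rev_cases)
          (auto simp: path_butlast_def ptarget_def)
      moreover have "ptarget Q (path_butlast Q R) = ptarget Q R"
        using PP(2) that(1) by (cases R; cases "snd R" rule: rev_cases)
          (auto simp: path_butlast_def ptarget_def)
      ultimately show ?thesis using w(1) that P(3) unfolding lookup_comparison
        by (simp add: plength_def parallel_def) (simp add: path_butlast_def psource_def)
    qed
    obtain w0 \<alpha> where w0: "?w = w0 @ [\<alpha>]" using w(2) by (cases ?w rule: rev_cases) auto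
    have ms: "msum Q f h (map arr ?w) = (-1) ^ n * h (map arr (butlast ?w))"
      for f h :: "('v, 'a) path list \<Rightarrow> 'k"
      using msum_chain[of Q "ptarget Q R" None w0 \<alpha> "fst R" f h "[]"] ch w(1) w0 by simp
    have paths: "length (map arr ?w) = Suc n" "\<forall>p\<in>set (map arr ?w). path_of_A Q p" using w by auto
    have hl: "hd (map arr ?w) = arr (hd ?w)" "last (map arr ?w) = arr (last ?w)" "tl (map arr ?w) = map arr (tl ?w)"
      using w(2) by (auto simp: hd_map last_map map_tl)
    have "coef (hoch_diff Q n d \<phi>) (map arr ?w) R = (-1) powi d *
      ((if snd R \<noteq> [] \<and> hd (snd R) = hd ?w
        then (-1) powi (d * degree Q (hd ?w)) * lk (comparison Q n \<phi>) (path_tl P, path_tl R) else 0)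
       - (if snd R \<noteq> [] \<and> last (snd R) = last ?w
          then (-1) ^ n * lk (comparison Q n \<phi>) (path_butlast Q P, path_butlast Q R) else 0))"
      unfolding coef_diff[OF \<phi> paths R] hl L Rr ms using cl cr lq rq by (simp cong: if_cong)
    then show ?thesis
      unfolding k lookup_comparison[of "Suc n"] lookup_bardzell_diff[OF comparison_cochain[OF \<phi>]]
      using True by simp
  qed
qed

lemma hoch_cochains_lin:
  assumes "\<phi> \<in> hoch_cochains Q n d" "\<psi> \<in> hoch_cochains Q n d"
  shows "(\<lambda>xs. smult c (\<phi> xs) + \<psi> xs) \<in> hoch_cochains Q n d"
  using assms unfolding hoch_cochains_iff mlin_def
  by (auto simp: smult_add add_ac mult.commute intro!: alg_degree_closed(2,3))

lemma hoch_diff_lin: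
  "hoch_diff Q n d (\<lambda>xs. smult c (\<phi> xs) + \<psi> xs) =
    (\<lambda>xs. smult c (hoch_diff Q n d \<phi> xs) + hoch_diff Q n d \<psi> xs)"
proof
  fix xs
  have "face Q d n i (\<lambda>xs. smult c (\<phi> xs) + \<psi> xs) xs = smult c (face Q d n i \<phi> xs) + face Q d n i \<psi> xs" for i
    by (simp add: face_def alg_mult_linear)
  then show "hoch_diff Q n d (\<lambda>xs. smult c (\<phi> xs) + \<psi> xs) xs =
    smult c (hoch_diff Q n d \<phi> xs) + hoch_diff Q n d \<psi> xs"
    by (cases "length xs = Suc n \<and> set xs \<subseteq> alg Q")
      (auto simp: hoch_diff_face hoch_diff_outside smult_add smult_sum sum.distrib mult_ac simp del: sum.atMost_Suc)
qed

lemma hoch_cochains_zero [simp]: "0 \<in> hoch_cochains Q n d"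
  by (auto simp: hoch_cochains_iff mlin_def)

lemma critical_coef_comparison:
  assumes "path_of_A Q q" "length w = n" "chain Q (ptarget Q q) None w (fst q)"
  shows "coef \<phi> (map arr w) q = lk (comparison Q n \<phi>) ((fst q, w), q)"
  using assms chain_anti_path[OF assms(1), of w] by (simp add: lookup_comparison plength_def)

lemma comparison_eqI:
  assumes g: "g \<in> hoch_cochains Q n d" and b: "b \<in> bardzell_cochains Q n d"
    and "\<And>w q. path_of_A Q q \<Longrightarrow> length w = n \<Longrightarrow> chain Q (ptarget Q q) None w (fst q) \<Longrightarrow>
      coef g (map arr w) q = lk b ((fst q, w), q)"
  shows "comparison Q n g = b"
proof (rule poly_mapping_eqI)
  fix k :: "('v, 'a) path \<times> ('v, 'a) path"
  obtain p q where k: "k = (p, q)" by fastforce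
  show "lk (comparison Q n g) k = lk b k"
  proof (cases "anti_path Q p \<and> plength p = n \<and> path_of_A Q q \<and> parallel Q p q")
    case True
    then have p: "p = (fst q, snd p)" by (simp add: parallel_def psource_def prod_eq_iff)
    have "chain Q (ptarget Q q) None (snd p) (fst q)" using chain_anti_path[of q "snd p"] True p by metis
    then show ?thesis using assms(3)[of q "snd p"] True p unfolding k lookup_comparison
      by (simp add: plength_def)
  next
    case False
    then have "lk b (p, q) = 0" using b by (auto simp: bardzell_cochains_iff bardzell_basis_def)
    moreover have "coef g (map arr (snd p)) q = 0" if "\<not> path_of_A Q q"
      using that coef_nonzero(3)[OF g] by blast
    ultimately show ?thesis using False unfolding k lookup_comparison by auto
  qed
qed

text \<open>Surjectivity in cohomology. The differential of the lift vanishes on \<open>Down\<close>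
  cells by choice and on critical cells because \<open>b\<close> is a cocycle, so
  \<open>cocycle_zero\<close> applies to it one degree higher.\<close>

lemma lift_cocycle:
  fixes b :: "(('v, 'a) path \<times> ('v, 'a) path) \<Rightarrow>\<^sub>0 'k::field"
  assumes b: "b \<in> bardzell_cochains Q n d" "bardzell_diff Q n d b = 0"
  obtains \<phi> where "\<phi> \<in> hoch_cocycles Q n d" "comparison Q n \<phi> = b"
proof -
  have zero: "(0 :: (('v, 'a) path \<Rightarrow>\<^sub>0 'k) list \<Rightarrow> _) \<in> hoch_cochains Q (Suc n) d" by simp
  obtain g where g: "g \<in> hoch_cochains Q n d"
    "\<forall>w q. path_of_A Q q \<longrightarrow> length w = n \<longrightarrow> chain Q (ptarget Q q) None w (fst q) \<longrightarrow>
      coef g (map arr w) q = lk b ((fst q, w), q)"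
    "\<forall>ps q. length ps = Suc n \<longrightarrow> (\<forall>p\<in>set ps. path_of_A Q p) \<longrightarrow> path_of_A Q q \<longrightarrow>
      kind Q ps q = Down \<longrightarrow> coef (hoch_diff Q n d g) ps q = coef (0 :: (('v, 'a) path \<Rightarrow>\<^sub>0 'k) list \<Rightarrow> _) ps q"
    using solve_along_matching[OF zero b(1)] by (elim bexE conjE)
  have c: "comparison Q n g = b" by (rule comparison_eqI[OF g(1) b(1) g(2)[rule_format]])
  have "hoch_diff Q n d g = 0"
  proof (rule cocycle_zero[OF hoch_diff_cochain[OF g(1)]])
    show "hoch_diff Q (Suc n) d (hoch_diff Q n d g) = 0" using g(1) by (intro hoch_diff_hoch_diff) auto
    show "coef (hoch_diff Q n d g) ps q = 0"
      if "length ps = Suc n" "\<forall>p\<in>set ps. path_of_A Q p" "path_of_A Q q" "kind Q ps q = Down" for ps q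
      using g(3)[rule_format, OF that(1) _ that(3,4)] that(2) by (simp add: coef_def)
    show "coef (hoch_diff Q n d g) (map arr w) q = 0"
      if "path_of_A Q q" "length w = Suc n" "chain Q (ptarget Q q) None w (fst q)" for w q
      unfolding critical_coef_comparison[OF that] comparison_diff[OF g(1)] c b(2) by simp
  qed
  then show thesis using that g(1) c by (simp add: hoch_cocycles_def)
qed

text \<open>Injectivity in cohomology. A cochain is chosen whose critical values bound
  \<open>comparison Q n \<phi>\<close> and whose differential agrees with \<open>\<phi>\<close> on
  \<open>Down\<close> cells; the difference is a cocycle vanishing on both kinds of cells.\<close>

lemma coboundary_of_comparison:
  fixes \<phi> :: "(('v, 'a) path \<Rightarrow>\<^sub>0 'k::field) list \<Rightarrow> (('v, 'a) path \<Rightarrow>\<^sub>0 'k)"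
  assumes \<phi>: "\<phi> \<in> hoch_cocycles Q n d" "comparison Q n \<phi> \<in> bardzell_coboundaries Q n d"
  shows "\<phi> \<in> hoch_coboundaries Q n d"
proof -
  have c: "\<phi> \<in> hoch_cochains Q n d" "hoch_diff Q n d \<phi> = 0" using \<phi>(1) by (auto simp: hoch_cocycles_def)
  show ?thesis
  proof (cases n)
    case 0
    \<comment> \<open>The only list of length 0 is the empty one, which is never a
      \<open>Down\<close> cell.\<close>
    have "\<phi> = 0"
    proof (rule cocycle_zero[OF c])
      show "coef \<phi> ps q = 0" if "length ps = n" "kind Q ps q = Down" for ps q
        using that 0 by (auto split: if_splits)
      show "coef \<phi> (map arr w) q = 0"
        if "path_of_A Q q" "length w = n" "chain Q (ptarget Q q) None w (fst q)" for w q
        unfolding critical_coef_comparison[OF that] using \<phi>(2) 0 by (simp add: bardzell_coboundaries_def)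
    qed
    then show ?thesis using 0 by (simp add: hoch_coboundaries_def)
  next
    case (Suc m)
    then obtain b where b: "b \<in> bardzell_cochains Q m d" "comparison Q n \<phi> = bardzell_diff Q m d b"
      using \<phi>(2) by (auto simp: bardzell_coboundaries_def)
    have cS: "\<phi> \<in> hoch_cochains Q (Suc m) d" using c Suc by simp
    obtain g where g: "g \<in> hoch_cochains Q m d"
      "\<forall>w q. path_of_A Q q \<longrightarrow> length w = m \<longrightarrow> chain Q (ptarget Q q) None w (fst q) \<longrightarrow>
        coef g (map arr w) q = lk b ((fst q, w), q)"
      "\<forall>ps q. length ps = Suc m \<longrightarrow> (\<forall>p\<in>set ps. path_of_A Q p) \<longrightarrow> path_of_A Q q \<longrightarrow>
        kind Q ps q = Down \<longrightarrow> coef (hoch_diff Q m d g) ps q = coef \<phi> ps q"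
      using solve_along_matching[OF cS b(1)] by (elim bexE conjE)
    have cg: "comparison Q m g = b" by (rule comparison_eqI[OF g(1) b(1) g(2)[rule_format]])
    let ?\<psi> = "\<lambda>xs. smult (-1) (hoch_diff Q m d g xs) + \<phi> xs"
    have dd: "hoch_diff Q (Suc m) d (hoch_diff Q m d g) = 0" using g(1) by (intro hoch_diff_hoch_diff) auto
    have coef_\<psi>: "coef ?\<psi> ps q = coef \<phi> ps q - coef (hoch_diff Q m d g) ps q" for ps q
      by (simp add: coef_def lookup_add)
    have "?\<psi> = 0"
    proof (rule cocycle_zero[OF hoch_cochains_lin[OF hoch_diff_cochain[OF g(1)] cS]])
      show "hoch_diff Q (Suc m) d ?\<psi> = 0"
        unfolding hoch_diff_lin dd using c(2) Suc by (auto simp: fun_eq_iff)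
      show "coef ?\<psi> ps q = 0"
        if "length ps = Suc m" "\<forall>p\<in>set ps. path_of_A Q p" "path_of_A Q q" "kind Q ps q = Down" for ps q
        unfolding coef_\<psi> using g(3)[rule_format, OF that(1) _ that(3,4)] that(2) by simp
      show "coef ?\<psi> (map arr w) q = 0"
        if "path_of_A Q q" "length w = Suc m" "chain Q (ptarget Q q) None w (fst q)" for w q
        unfolding coef_\<psi> critical_coef_comparison[OF that] comparison_diff[OF g(1)] cg b(2)[symmetric]
        using Suc by simp
    qed
    then have "\<phi> xs = hoch_diff Q m d g xs" for xs
      by (simp add: fun_eq_iff smult_minus_one add_eq_0_iff)
    then have "\<phi> = hoch_diff Q m d g" by (rule ext)
    then show ?thesis using g(1) Suc by (auto simp: hoch_coboundaries_def)
  qed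
qed

lemma comparison_coboundary:
  assumes "\<phi> \<in> hoch_coboundaries Q n d"
  shows "comparison Q n \<phi> \<in> bardzell_coboundaries Q n d" "\<phi> \<in> hoch_cocycles Q n d"
proof -
  show "comparison Q n \<phi> \<in> bardzell_coboundaries Q n d"
    using assms by (cases n) (auto simp: hoch_coboundaries_def bardzell_coboundaries_def comparison_diff comparison_cochain)
  have "hoch_diff Q 0 d 0 = 0" by (auto simp: hoch_diff_face hoch_diff_outside fun_eq_iff face_def alg_mult_linear hoch_diff_def)
  then show "\<phi> \<in> hoch_cocycles Q n d"
    using assms by (cases n)
      (auto simp: hoch_coboundaries_def hoch_cocycles_def hoch_diff_cochain intro!: hoch_diff_hoch_diff)
qed

lemma bardzell_coboundaries_lin:
  assumes "f \<in> bardzell_coboundaries Q n d" "g \<in> bardzell_coboundaries Q n d"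
  shows "smult c f + g \<in> bardzell_coboundaries Q n d"
proof (cases n)
  case (Suc m)
  then obtain f' g' where fg: "f' \<in> bardzell_cochains Q m d" "g' \<in> bardzell_cochains Q m d"
    "f = bardzell_diff Q m d f'" "g = bardzell_diff Q m d g'"
    using assms by (auto simp: bardzell_coboundaries_def)
  then have "smult c f + g = bardzell_diff Q m d (smult c f' + g')" by (simp add: bardzell_diff_lin)
  then show ?thesis using imageI[OF bardzell_cochains_lin[OF fg(1,2)], of "bardzell_diff Q m d" c] Suc
    by (simp add: bardzell_coboundaries_def)
qed (use assms in \<open>auto simp: bardzell_coboundaries_def\<close>)

lemma bardzell_coboundaries_zero: "0 \<in> bardzell_coboundaries Q n d"
proof (cases n)
  case (Suc m)
  have "bardzell_diff Q m d 0 = 0" by (simp add: bardzell_diff_def)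
  then show ?thesis using Suc by (auto simp: bardzell_coboundaries_def intro!: image_eqI[of _ _ 0])
qed (simp add: bardzell_coboundaries_def)

lemma bardzell_cocycle_comparison:
  assumes "\<phi> \<in> hoch_cocycles Q n d"
  shows "comparison Q n \<phi> \<in> bardzell_cochains Q n d" "bardzell_diff Q n d (comparison Q n \<phi>) = 0"
  using assms comparison_diff[of \<phi> n d] by (auto simp: hoch_cocycles_def comparison_cochain)

end

section \<open>Transfer of a basis from Bardzell cohomology to Hochschild cohomology\<close>

lemma smult_diff_left: "smult (a - b) f = smult a f - smult b f"
  by (rule poly_mapping_eqI) (simp add: lookup_minus algebra_simps)

context gentle begin

lemma hoch_cocycles_lin:
  assumes "\<phi> \<in> hoch_cocycles Q n d" "\<psi> \<in> hoch_cocycles Q n d"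
  shows "(\<lambda>xs. smult c (\<phi> xs) + \<psi> xs) \<in> hoch_cocycles Q n d"
  using assms hoch_cochains_lin[of \<phi> n d \<psi> c] by (auto simp: hoch_cocycles_def hoch_diff_lin fun_eq_iff)

lemma bardzell_coboundaries_diff:
  assumes "f \<in> bardzell_coboundaries Q n d" "g \<in> bardzell_coboundaries Q n d"
  shows "f - g \<in> bardzell_coboundaries Q n d"
  using bardzell_coboundaries_lin[OF assms(2,1), of "-1"] by (simp add: smult_minus_one)

lemma bardzell_coboundaries_add:
  assumes "f \<in> bardzell_coboundaries Q n d" "g \<in> bardzell_coboundaries Q n d"
  shows "f + g \<in> bardzell_coboundaries Q n d"
  using bardzell_coboundaries_lin[OF assms, of 1] by simp

lemma bardzell_coboundaries_smult:
  assumes "f \<in> bardzell_coboundaries Q n d"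
  shows "smult c f \<in> bardzell_coboundaries Q n d"
  using bardzell_coboundaries_lin[OF assms bardzell_coboundaries_zero, of c] by simp

lemma bardzell_coboundaries_sum:
  "(\<And>x. x \<in> X \<Longrightarrow> f x \<in> bardzell_coboundaries Q n d) \<Longrightarrow> (\<Sum>x\<in>X. f x) \<in> bardzell_coboundaries Q n d"
  by (induction X rule: infinite_finite_induct) (auto intro: bardzell_coboundaries_add bardzell_coboundaries_zero)

text \<open>Coboundaries map to coboundaries, and cocycles mapping to coboundaries are coboundaries;
  so a coset can be tested entirely on the Bardzell side.\<close>

lemma mem_coset_iff:
  fixes \<phi> \<psi> :: "(('v, 'a) path \<Rightarrow>\<^sub>0 'k::field) list \<Rightarrow> (('v, 'a) path \<Rightarrow>\<^sub>0 'k)"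
  assumes "\<phi> \<in> hoch_cocycles Q n d"
  shows "\<psi> \<in> (+) \<phi> ` hoch_coboundaries Q n d \<longleftrightarrow>
    \<psi> \<in> hoch_cocycles Q n d \<and> comparison Q n \<psi> - comparison Q n \<phi> \<in> bardzell_coboundaries Q n d"
proof
  assume "\<psi> \<in> (+) \<phi> ` hoch_coboundaries Q n d"
  then obtain \<beta> where \<beta>: "\<beta> \<in> hoch_coboundaries Q n d" "\<psi> = \<phi> + \<beta>" by auto
  then have \<psi>: "\<psi> = (\<lambda>xs. smult 1 (\<phi> xs) + \<beta> xs)" by (auto simp: fun_eq_iff)
  show "\<psi> \<in> hoch_cocycles Q n d \<and> comparison Q n \<psi> - comparison Q n \<phi> \<in> bardzell_coboundaries Q n d"
    using hoch_cocycles_lin[OF assms comparison_coboundary(2)[OF \<beta>(1)], of 1]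
      comparison_coboundary(1)[OF \<beta>(1)] comparison_lin[of n 1 \<phi> \<beta>] unfolding \<psi> by (simp add: \<psi>)
next
  assume r: "\<psi> \<in> hoch_cocycles Q n d \<and> comparison Q n \<psi> - comparison Q n \<phi> \<in> bardzell_coboundaries Q n d"
  let ?\<beta> = "\<lambda>xs. smult (-1) (\<phi> xs) + \<psi> xs"
  have "comparison Q n ?\<beta> = comparison Q n \<psi> - comparison Q n \<phi>"
    unfolding comparison_lin by (simp add: smult_minus_one)
  then have mem: "?\<beta> \<in> hoch_coboundaries Q n d"
    using r hoch_cocycles_lin[OF assms, of \<psi> "-1"] by (intro coboundary_of_comparison) auto
  have eq: "\<psi> = \<phi> + ?\<beta>" by (auto simp: fun_eq_iff smult_minus_one)
  show "\<psi> \<in> (+) \<phi> ` hoch_coboundaries Q n d" using imageI[OF mem, of "(+) \<phi>"] eq by simp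
qed

lemma hoch_diff_zero: "hoch_diff Q n d 0 = 0"
proof -
  have eq: "(\<lambda>xs. smult (-1) (0 xs) + 0 xs) = (0 :: (('v, 'a) path \<Rightarrow>\<^sub>0 'k::field) list \<Rightarrow> ('v, 'a) path \<Rightarrow>\<^sub>0 'k)"
    by (simp add: fun_eq_iff)
  show ?thesis using hoch_diff_lin[of n d "-1" 0 0] unfolding eq
    by (simp only: smult_minus_one add.left_inverse zero_fun_def)
qed

lemma comparison_sum:
  assumes "finite X" "\<And>x. x \<in> X \<Longrightarrow> r x \<in> hoch_cocycles Q n d"
  shows "(\<Sum>x\<in>X. (\<lambda>xs. smult (c x) (r x xs))) \<in> hoch_cocycles Q n d"
    "comparison Q n (\<Sum>x\<in>X. (\<lambda>xs. smult (c x) (r x xs))) = (\<Sum>x\<in>X. smult (c x) (comparison Q n (r x)))"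
proof -
  have "(\<Sum>x\<in>X. (\<lambda>xs. smult (c x) (r x xs))) \<in> hoch_cocycles Q n d \<and>
    comparison Q n (\<Sum>x\<in>X. (\<lambda>xs. smult (c x) (r x xs))) = (\<Sum>x\<in>X. smult (c x) (comparison Q n (r x)))"
    using assms
  proof (induction X)
    case empty
    show ?case unfolding sum.empty
      by (simp only: hoch_cocycles_def mem_Collect_eq hoch_diff_zero hoch_cochains_zero comparison_zero simp_thms)
  next
    case (insert x X)
    have "(\<Sum>x\<in>insert x X. (\<lambda>xs. smult (c x) (r x xs))) =
      (\<lambda>xs. smult (c x) (r x xs) + (\<Sum>x\<in>X. (\<lambda>xs. smult (c x) (r x xs))) xs)"
      using insert by (simp add: plus_fun_def)
    then show ?case using insert hoch_cocycles_lin[of "r x" n d _ "c x"] by (simp add: comparison_lin)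
  qed
  then show "(\<Sum>x\<in>X. (\<lambda>xs. smult (c x) (r x xs))) \<in> hoch_cocycles Q n d"
    "comparison Q n (\<Sum>x\<in>X. (\<lambda>xs. smult (c x) (r x xs))) = (\<Sum>x\<in>X. smult (c x) (comparison Q n (r x)))"
    by auto
qed

text \<open>\<open>coset_basis\<close> computes with arbitrarily chosen representatives. Their
  comparison images agree with the given elements only up to coboundaries, so all sums are compared
  modulo coboundaries.\<close>

lemma HH_basis_of_bardzell:
  fixes S :: "((('v, 'a) path \<times> ('v, 'a) path) \<Rightarrow>\<^sub>0 'k::field) set"
  assumes S: "\<And>b. b \<in> S \<Longrightarrow> b \<in> bardzell_cochains Q n d" "\<And>b. b \<in> S \<Longrightarrow> bardzell_diff Q n d b = 0"
    and span: "\<And>f :: _ \<Rightarrow>\<^sub>0 'k. f \<in> bardzell_cochains Q n d \<Longrightarrow> bardzell_diff Q n d f = 0 \<Longrightarrow>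
      \<exists>K c. finite K \<and> K \<subseteq> S \<and> f - (\<Sum>s\<in>K. smult (c s) s) \<in> bardzell_coboundaries Q n d"
    and indep: "\<And>K c. finite K \<Longrightarrow> K \<subseteq> S \<Longrightarrow> (\<Sum>s\<in>K. smult (c s) s) \<in> bardzell_coboundaries Q n d \<Longrightarrow>
      \<forall>s\<in>K. c s = (0 :: 'k)"
  shows "HH_basis Q n d S"
proof -
  let ?cl = "HH_class Q n d" and ?B = "bardzell_coboundaries Q n d"
  have cl: "?cl b \<in> HH Q n d \<and> (\<exists>\<phi>. \<phi> \<in> ?cl b)" if b: "b \<in> S" for b
  proof -
    obtain \<phi> where \<phi>: "\<phi> \<in> hoch_cocycles Q n d" "comparison Q n \<phi> = b"
      by (rule lift_cocycle[OF S(1)[OF b] S(2)[OF b]])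
    have "?cl b = (+) \<phi> ` hoch_coboundaries Q n d"
      using mem_coset_iff[OF \<phi>(1)] \<phi>(2) by (auto simp: HH_class_def)
    moreover have "\<phi> \<in> ?cl b" using \<phi> by (simp add: HH_class_def bardzell_coboundaries_zero)
    ultimately show ?thesis using \<phi>(1) by (auto simp: HH_def quotient_space_def)
  qed
  have inj: "inj_on ?cl S"
  proof (rule inj_onI, rule ccontr)
    fix s s' assume s: "s \<in> S" "s' \<in> S" "?cl s = ?cl s'" "s \<noteq> s'"
    then obtain \<phi> where "\<phi> \<in> ?cl s" "\<phi> \<in> ?cl s'" using cl by metis
    then have "(comparison Q n \<phi> - s') - (comparison Q n \<phi> - s) \<in> ?B"
      by (intro bardzell_coboundaries_diff[of "comparison Q n \<phi> - s'"]) (auto simp: HH_class_def)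
    then have "(\<Sum>x\<in>{s, s'}. smult (if x = s then 1 else -1) x) \<in> ?B"
      using s(4) by (simp add: smult_minus_one)
    from indep[OF _ _ this] s show False by auto
  qed
  let ?r = "\<lambda>x. SOME z. z \<in> (x :: ((('v, 'a) path \<Rightarrow>\<^sub>0 'k) list \<Rightarrow> ('v, 'a) path \<Rightarrow>\<^sub>0 'k) set)"
  have r: "?r (?cl s) \<in> ?cl s" if "s \<in> S" for s
    using cl[OF that] someI_ex[of "\<lambda>z. z \<in> ?cl s"] by blast
  \<comment> \<open>\<open>K\<close> may index more than the support of \<open>c\<close>; this
    freedom allows two coefficient functions to be compared over a common finite set.\<close>
  have key: "(\<Sum>x\<in>{x. c x \<noteq> 0}. (\<lambda>xs. smult (c x) (?r x xs))) \<in> (+) \<phi> ` hoch_coboundaries Q n d \<longleftrightarrow>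
      (\<Sum>s\<in>K. smult (c (?cl s)) s) - comparison Q n \<phi> \<in> ?B"
    if \<phi>: "\<phi> \<in> hoch_cocycles Q n d" and K: "finite K" "K \<subseteq> S" "{x. c x \<noteq> 0} \<subseteq> ?cl ` K"
    for \<phi> :: "((('v, 'a) path \<Rightarrow>\<^sub>0 'k) list \<Rightarrow> ('v, 'a) path \<Rightarrow>\<^sub>0 'k)" and c K
  proof -
    have injK: "inj_on ?cl K" using inj K(2) by (rule inj_on_subset)
    have 1: "(\<Sum>x\<in>{x. c x \<noteq> 0}. (\<lambda>xs. smult (c x) (?r x xs))) = (\<Sum>x\<in>?cl ` K. (\<lambda>xs. smult (c x) (?r x xs)))"
      using K by (intro sum.mono_neutral_left) (auto simp: fun_eq_iff)
    have rK: "?r x \<in> hoch_cocycles Q n d" if "x \<in> ?cl ` K" for x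
      using that r K(2) by (auto simp: HH_class_def)
    note cs = comparison_sum[of "?cl ` K" ?r n d c, OF _ rK]
    have "comparison Q n (\<Sum>x\<in>?cl ` K. (\<lambda>xs. smult (c x) (?r x xs))) =
      (\<Sum>s\<in>K. smult (c (?cl s)) (comparison Q n (?r (?cl s))))"
      using cs(2) K(1) injK by (simp add: sum.reindex o_def)
    then have "comparison Q n (\<Sum>x\<in>?cl ` K. (\<lambda>xs. smult (c x) (?r x xs))) - (\<Sum>s\<in>K. smult (c (?cl s)) s) =
      (\<Sum>s\<in>K. smult (c (?cl s)) (comparison Q n (?r (?cl s)) - s))"
      by (simp add: smult_diff sum_subtractf)
    also have "\<dots> \<in> ?B"
      using r K(2) by (intro bardzell_coboundaries_sum bardzell_coboundaries_smult) (auto simp: HH_class_def)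
    finally have 2: "comparison Q n (\<Sum>x\<in>?cl ` K. (\<lambda>xs. smult (c x) (?r x xs))) - (\<Sum>s\<in>K. smult (c (?cl s)) s) \<in> ?B" .
    show ?thesis
      unfolding 1 mem_coset_iff[OF \<phi>] using cs(1) K(1) bardzell_coboundaries_diff[OF _ 2]
        bardzell_coboundaries_add[OF 2] by fastforce
  qed
  have "coset_basis (\<lambda>c \<phi> xs. smult c (\<phi> xs)) (HH Q n d) (?cl ` S)"
    unfolding coset_basis_def
  proof (intro conjI ballI)
    show "?cl ` S \<subseteq> HH Q n d" using cl by auto
    fix h :: "((('v, 'a) path \<Rightarrow>\<^sub>0 'k) list \<Rightarrow> ('v, 'a) path \<Rightarrow>\<^sub>0 'k) set" assume "h \<in> HH Q n d"
    then obtain \<phi> where \<phi>: "\<phi> \<in> hoch_cocycles Q n d" "h = (+) \<phi> ` hoch_coboundaries Q n d"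
      by (auto simp: HH_def quotient_space_def)
    obtain K c where K: "finite K" "K \<subseteq> S" "comparison Q n \<phi> - (\<Sum>s\<in>K. smult (c s) s) \<in> ?B"
      using span[OF bardzell_cocycle_comparison[OF \<phi>(1)]] by blast
    define e where "e = (\<lambda>x. if x \<in> ?cl ` K then c (inv_into K ?cl x) else 0)"
    have injK: "inj_on ?cl K" using inj K(2) by (rule inj_on_subset)
    have e: "e (?cl s) = c s" if "s \<in> K" for s using that injK by (simp add: e_def)
    have supp: "{x. e x \<noteq> 0} \<subseteq> ?cl ` K" by (auto simp: e_def)
    show "\<exists>!c. finite {x. c x \<noteq> 0} \<and> {x. c x \<noteq> 0} \<subseteq> ?cl ` S \<and>
      (\<Sum>x\<in>{x. c x \<noteq> 0}. (\<lambda>xs. smult (c x) (?r x xs))) \<in> h"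
    proof (rule ex1I[of _ e])
      have "(\<Sum>s\<in>K. smult (e (?cl s)) s) - comparison Q n \<phi> \<in> ?B"
        using bardzell_coboundaries_smult[OF K(3), of "-1"] e by (simp add: smult_minus_one)
      then have "(\<Sum>x\<in>{x. e x \<noteq> 0}. (\<lambda>xs. smult (e x) (?r x xs))) \<in> h"
        unfolding \<phi>(2) using key[OF \<phi>(1) K(1,2) supp] by simp
      then show "finite {x. e x \<noteq> 0} \<and> {x. e x \<noteq> 0} \<subseteq> ?cl ` S \<and>
        (\<Sum>x\<in>{x. e x \<noteq> 0}. (\<lambda>xs. smult (e x) (?r x xs))) \<in> h"
        by (intro conjI finite_subset[OF supp finite_imageI[OF K(1)]] order_trans[OF supp image_mono[OF K(2)]])
    next
      fix e' assume e': "finite {x. e' x \<noteq> 0} \<and> {x. e' x \<noteq> 0} \<subseteq> ?cl ` S \<and>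
        (\<Sum>x\<in>{x. e' x \<noteq> 0}. (\<lambda>xs. smult (e' x) (?r x xs))) \<in> h"
      \<comment> \<open>A common index set for \<open>e\<close> and \<open>e'\<close>, so that their
        difference becomes one relation among finitely many elements of \<open>S\<close>.\<close>
      define K' where "K' = K \<union> inv_into S ?cl ` {x. e' x \<noteq> 0}"
      have K': "finite K'" "K' \<subseteq> S" "{x. e' x \<noteq> 0} \<subseteq> ?cl ` K'" "{x. e x \<noteq> 0} \<subseteq> ?cl ` K'"
      proof -
        show "finite K'" "K' \<subseteq> S" using K e' by (auto simp: K'_def inv_into_into)
        show "{x. e x \<noteq> 0} \<subseteq> ?cl ` K'" using supp by (auto simp: K'_def)
        show "{x. e' x \<noteq> 0} \<subseteq> ?cl ` K'"
        proof
          fix x assume x: "x \<in> {x. e' x \<noteq> 0}"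
          then have "?cl (inv_into S ?cl x) = x" using e' by (intro f_inv_into_f) auto
          then show "x \<in> ?cl ` K'" using x by (force simp: K'_def)
        qed
      qed
      have "(\<Sum>s\<in>K'. smult (e' (?cl s)) s) - comparison Q n \<phi> \<in> ?B"
        using e' key[OF \<phi>(1) K'(1,2,3)] \<phi>(2) by simp
      moreover have "(\<Sum>s\<in>K. smult (e (?cl s)) s) = (\<Sum>s\<in>K'. smult (e (?cl s)) s)"
      proof (rule sum.mono_neutral_left)
        have "?cl s \<notin> ?cl ` K" if "s \<in> K' - K" for s
          using that inj K(2) K'(2) by (auto simp: inj_on_def) 
        then show "\<forall>s\<in>K' - K. smult (e (?cl s)) s = 0" by (auto simp: e_def)
      qed (use K' in \<open>auto simp: K'_def\<close>)
      moreover have "comparison Q n \<phi> - (\<Sum>s\<in>K. smult (e (?cl s)) s) \<in> ?B" using K(3) e by simp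
      ultimately have "((\<Sum>s\<in>K'. smult (e' (?cl s)) s) - comparison Q n \<phi>) +
        (comparison Q n \<phi> - (\<Sum>s\<in>K'. smult (e (?cl s)) s)) \<in> ?B"
        by (intro bardzell_coboundaries_add[of "_ - comparison Q n \<phi>"]) simp_all
      then have "(\<Sum>s\<in>K'. smult (e' (?cl s) - e (?cl s)) s) \<in> ?B"
        by (simp add: smult_diff_left sum_subtractf)
      then have eq: "\<forall>s\<in>K'. e' (?cl s) = e (?cl s)" using indep[OF K'(1,2)] by fastforce
      show "e' = e"
      proof
        fix x
        show "e' x = e x"
        proof (cases "x \<in> ?cl ` K'")
          case True
          then show ?thesis using eq by blast
        next
          case False
          then have "e' x = 0" "e x = 0" using K'(3,4) by blast+
          then show ?thesis by simp
        qed
      qed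
    qed
  qed
  then show ?thesis using inj by (simp add: HH_basis_def)
qed

end

section \<open>The combinatorics of the Bardzell complex\<close>

text \<open>A basis pair is reached from another one by adding an arrow on the left exactly if its
  two paths begin with the same arrow, and \<open>lstrip\<close> gives the pair it comes from.
  \<open>Lsame\<close> and \<open>Rsame\<close> thus describe what arrives at a pair under the
  differential.\<close>

definition Lsame :: "('v, 'a) path \<times> ('v, 'a) path \<Rightarrow> bool" where
  "Lsame k \<longleftrightarrow> snd (fst k) \<noteq> [] \<and> snd (snd k) \<noteq> [] \<and> hd (snd (fst k)) = hd (snd (snd k))"

definition Rsame :: "('v, 'a) path \<times> ('v, 'a) path \<Rightarrow> bool" where
  "Rsame k \<longleftrightarrow> snd (fst k) \<noteq> [] \<and> snd (snd k) \<noteq> [] \<and> last (snd (fst k)) = last (snd (snd k))"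

definition lstrip :: "('v, 'a) path \<times> ('v, 'a) path \<Rightarrow> ('v, 'a) path \<times> ('v, 'a) path" where
  "lstrip k = (path_tl (fst k), path_tl (snd k))"

definition rstrip :: "('v, 'a) graded_quiver \<Rightarrow> ('v, 'a) path \<times> ('v, 'a) path \<Rightarrow> ('v, 'a) path \<times> ('v, 'a) path" where
  "rstrip Q k = (path_butlast Q (fst k), path_butlast Q (snd k))"

lemma Lsame_simps [simp]:
  "Lsame ((y, \<alpha> # u), (z, \<beta> # v)) \<longleftrightarrow> \<alpha> = \<beta>" "\<not> Lsame ((y, []), q)" "\<not> Lsame (p, (y, []))"
  by (auto simp: Lsame_def)

lemma Rsame_simps [simp]:
  "Rsame ((y, u @ [\<alpha>]), (z, v @ [\<beta>])) \<longleftrightarrow> \<alpha> = \<beta>" "\<not> Rsame ((y, []), q)" "\<not> Rsame (p, (y, []))"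
  by (auto simp: Rsame_def)

lemma strip_simps [simp]:
  "lstrip ((y, \<alpha> # u), (z, \<beta> # v)) = ((y, u), (z, v))"
  "rstrip Q ((y, u @ [\<alpha>]), (z, v @ [\<beta>])) = ((target Q \<alpha>, u), (target Q \<beta>, v))"
  by (auto simp: lstrip_def rstrip_def path_tl_def path_butlast_def)

context gentle begin

text \<open>
  The flag \<open>m\<close> treats paths of \<open>A\<close> (\<open>m = True\<close>) and anti-paths (\<open>m = False\<close>) uniformly.
\<close>

definition link :: "bool \<Rightarrow> 'a \<Rightarrow> 'a \<Rightarrow> bool" where
  "link m \<beta> \<alpha> \<longleftrightarrow> \<alpha> \<in> arrows Q \<and> \<beta> \<in> arrows Q \<and> source Q \<beta> = target Q \<alpha> \<and> ((\<beta>, \<alpha>) \<in> relations Q \<longleftrightarrow> \<not> m)"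

lemma link_arrows: "link m \<beta> \<alpha> \<Longrightarrow> \<alpha> \<in> arrows Q \<and> \<beta> \<in> arrows Q \<and> source Q \<beta> = target Q \<alpha>"
  by (simp add: link_def)

lemma link_not: "link m \<beta> \<alpha> \<Longrightarrow> link m' \<beta> \<alpha> \<longleftrightarrow> m' = m"
  by (auto simp: link_def)

lemma link_cases: "\<alpha> \<in> arrows Q \<Longrightarrow> \<beta> \<in> arrows Q \<Longrightarrow> source Q \<beta> = target Q \<alpha> \<Longrightarrow> link m \<beta> \<alpha> \<or> link (\<not> m) \<beta> \<alpha>"
  by (auto simp: link_def)

text \<open>This is how gentleness enters the combinatorics: the four cardinality bounds say that
  paths of each kind prolong in at most one way on either side.\<close>

lemma link_unique:
  "link m \<beta> \<alpha> \<Longrightarrow> link m \<beta>' \<alpha> \<Longrightarrow> \<beta> = \<beta>'" "link m \<beta> \<alpha> \<Longrightarrow> link m \<beta> \<alpha>' \<Longrightarrow> \<alpha> = \<alpha>'"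
proof -
  have c: "x = y" if "card {z \<in> arrows Q. P z} \<le> 1" "x \<in> arrows Q" "P x" "y \<in> arrows Q" "P y" for P x y
  proof -
    have "card {z \<in> arrows Q. P z} \<le> Suc 0" using that(1) by simp
    then show ?thesis using that(2-) card_le_Suc0_iff_eq[of "{z \<in> arrows Q. P z}"] by auto
  qed
  have G: "\<forall>\<alpha>\<in>arrows Q.
        card {\<beta> \<in> arrows Q. source Q \<beta> = target Q \<alpha> \<and> (\<beta>, \<alpha>) \<in> relations Q} \<le> 1 \<and>
        card {\<beta> \<in> arrows Q. source Q \<beta> = target Q \<alpha> \<and> (\<beta>, \<alpha>) \<notin> relations Q} \<le> 1 \<and>
        card {\<gamma> \<in> arrows Q. target Q \<gamma> = source Q \<alpha> \<and> (\<alpha>, \<gamma>) \<in> relations Q} \<le> 1 \<and>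
        card {\<gamma> \<in> arrows Q. target Q \<gamma> = source Q \<alpha> \<and> (\<alpha>, \<gamma>) \<notin> relations Q} \<le> 1"
    using gentle by (simp add: graded_gentle_quiver_def)
  show "\<beta> = \<beta>'" if l: "link m \<beta> \<alpha>" "link m \<beta>' \<alpha>"
  proof (cases m)
    case True
    then show ?thesis using l G
      by (intro c[of "\<lambda>\<beta>. source Q \<beta> = target Q \<alpha> \<and> (\<beta>, \<alpha>) \<notin> relations Q"]) (auto simp: link_def)
  next
    case False
    then show ?thesis using l G
      by (intro c[of "\<lambda>\<beta>. source Q \<beta> = target Q \<alpha> \<and> (\<beta>, \<alpha>) \<in> relations Q"]) (auto simp: link_def)
  qed
  show "\<alpha> = \<alpha>'" if l: "link m \<beta> \<alpha>" "link m \<beta> \<alpha>'"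
  proof (cases m)
    case True
    then show ?thesis using l G
      by (intro c[of "\<lambda>\<gamma>. target Q \<gamma> = source Q \<beta> \<and> (\<beta>, \<gamma>) \<notin> relations Q"]) (auto simp: link_def)
  next
    case False
    then show ?thesis using l G
      by (intro c[of "\<lambda>\<gamma>. target Q \<gamma> = source Q \<beta> \<and> (\<beta>, \<gamma>) \<in> relations Q"]) (auto simp: link_def)
  qed
qed

definition mpath :: "bool \<Rightarrow> ('v, 'a) path \<Rightarrow> bool" where
  "mpath m q = (if m then path_of_A Q q else anti_path Q q)"

lemma mpath_iff:
  "mpath m q \<longleftrightarrow> fst q \<in> vertices Q \<and> set (snd q) \<subseteq> arrows Q \<and> successively (link m) (snd q) \<and>
    (snd q \<noteq> [] \<longrightarrow> source Q (last (snd q)) = fst q)"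
proof -
  have "successively (\<lambda>\<alpha> \<beta>. source Q \<alpha> = target Q \<beta>) w \<and>
    successively (\<lambda>\<alpha> \<beta>. (\<alpha>, \<beta>) \<in> relations Q \<longleftrightarrow> \<not> m) w \<longleftrightarrow> successively (link m) w"
    if "set w \<subseteq> arrows Q" for w
    using that by (induction w rule: induct_list012) (auto simp: link_def)
  then show ?thesis
    by (cases m) (auto simp: mpath_def path_of_A_def anti_path_def is_path_def)
qed

lemma mpath_Nil [simp]: "mpath m (y, []) \<longleftrightarrow> y \<in> vertices Q"
  by (simp add: mpath_iff)

lemma mpath_Cons:
  "mpath m (y, \<alpha> # w) \<longleftrightarrow> \<alpha> \<in> arrows Q \<and> mpath m (y, w) \<and> source Q \<alpha> = ptarget Q (y, w) \<and>
    (w \<noteq> [] \<longrightarrow> link m \<alpha> (hd w))"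
  by (cases w) (auto simp: mpath_iff ptarget_def link_arrows)

lemma mpath_snoc:
  "mpath m (y, w @ [\<beta>]) \<longleftrightarrow> \<beta> \<in> arrows Q \<and> y = source Q \<beta> \<and> mpath m (target Q \<beta>, w) \<and>
    (w \<noteq> [] \<longrightarrow> link m (last w) \<beta>)"
  by (cases w rule: rev_cases) (auto simp: mpath_iff successively_append_iff link_arrows)

lemma ptarget_simps [simp]:
  "ptarget Q (y, []) = y" "ptarget Q (y, \<alpha> # w) = target Q \<alpha>"
  by (auto simp: ptarget_def)

lemma ptarget_snoc [simp]: "ptarget Q (y, w @ [\<beta>]) = ptarget Q (target Q \<beta>, w)"
  by (cases w) auto

definition good :: "('v, 'a) path \<times> ('v, 'a) path \<Rightarrow> bool" where
  "good k \<longleftrightarrow> mpath False (fst k) \<and> mpath True (snd k) \<and> parallel Q (fst k) (snd k)"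

lemma good_iff:
  "good ((y, u), (z, v)) \<longleftrightarrow> mpath False (y, u) \<and> mpath True (y, v) \<and> z = y \<and> ptarget Q (y, u) = ptarget Q (y, v)"
  by (auto simp: good_def parallel_def psource_def)

lemma good_elim:
  assumes "good k"
  obtains y u v where "k = ((y, u), (y, v))"
  using assms by (cases k; cases "fst k"; cases "snd k") (auto simp: good_iff)

lemma bardzell_basis_good:
  "k \<in> bardzell_basis Q n d \<longleftrightarrow> good k \<and> plength (fst k) = n \<and> pdegree Q (snd k) - pdegree Q (fst k) = d"
  by (cases k) (auto simp: bardzell_basis_def good_def mpath_def)

lemma good_Cons:
  "good ((y, \<alpha> # u), (y, \<alpha> # v)) \<longleftrightarrow> \<alpha> \<in> arrows Q \<and> good ((y, u), (y, v)) \<and> source Q \<alpha> = ptarget Q (y, u) \<and>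
    (u \<noteq> [] \<longrightarrow> link False \<alpha> (hd u)) \<and> (v \<noteq> [] \<longrightarrow> link True \<alpha> (hd v))"
  by (auto simp: good_iff mpath_Cons)

lemma good_snoc:
  "good ((y, u @ [\<beta>]), (y, v @ [\<beta>])) \<longleftrightarrow> \<beta> \<in> arrows Q \<and> y = source Q \<beta> \<and>
    good ((target Q \<beta>, u), (target Q \<beta>, v)) \<and>
    (u \<noteq> [] \<longrightarrow> link False (last u) \<beta>) \<and> (v \<noteq> [] \<longrightarrow> link True (last v) \<beta>)"
  by (auto simp: good_iff mpath_snoc)

lemma Lsame_elim:
  assumes "good k" "Lsame k"
  obtains y \<alpha> u v where "k = ((y, \<alpha> # u), (y, \<alpha> # v))"
proof -
  obtain y u v where k: "k = ((y, u), (y, v))" using assms(1) by (rule good_elim)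
  then show thesis using assms(2) that by (cases u; cases v) auto
qed

lemma Rsame_elim:
  assumes "good k" "Rsame k"
  obtains \<beta> u v where "k = ((source Q \<beta>, u @ [\<beta>]), (source Q \<beta>, v @ [\<beta>]))"
proof -
  obtain y u v where k: "k = ((y, u), (y, v))" using assms(1) by (rule good_elim)
  then obtain u' v' \<beta> where "u = u' @ [\<beta>]" "v = v' @ [\<beta>]"
    using assms(2) by (cases u rule: rev_cases; cases v rule: rev_cases) auto
  then show thesis using that k assms(1) by (simp add: good_snoc)
qed

lemma lstrip_good:
  assumes "good k" "Lsame k"
  shows "good (lstrip k)"
proof -
  obtain y \<alpha> u v where "k = ((y, \<alpha> # u), (y, \<alpha> # v))" using assms by (rule Lsame_elim)
  then show ?thesis using assms(1) by (simp add: good_Cons)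
qed

lemma rstrip_good:
  assumes "good k" "Rsame k"
  shows "good (rstrip Q k)"
proof -
  obtain \<beta> u v where "k = ((source Q \<beta>, u @ [\<beta>]), (source Q \<beta>, v @ [\<beta>]))" using assms by (rule Rsame_elim)
  then show ?thesis using assms(1) by (simp add: good_snoc)
qed

text \<open>Two successive common arrows would form a path of length 2 that lies in
  \<open>I\<close>, as part of an anti-path, and does not, as part of a path of
  \<open>A\<close>.\<close>

lemma lstrip_not_Lsame:
  assumes "good k" "Lsame k"
  shows "\<not> Lsame (lstrip k)"
proof
  assume l: "Lsame (lstrip k)"
  obtain y \<alpha> u v where k: "k = ((y, \<alpha> # u), (y, \<alpha> # v))" using assms by (rule Lsame_elim)
  then show False using l assms(1) link_not[of False \<alpha> "hd u" True]
    by (cases u; cases v) (auto simp: good_Cons)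
qed

lemma rstrip_not_Rsame:
  assumes "good k" "Rsame k"
  shows "\<not> Rsame (rstrip Q k)"
proof
  assume l: "Rsame (rstrip Q k)"
  obtain \<beta> u v where k: "k = ((source Q \<beta>, u @ [\<beta>]), (source Q \<beta>, v @ [\<beta>]))" using assms by (rule Rsame_elim)
  have "Rsame ((target Q \<beta>, u), (target Q \<beta>, v))" using l k by simp
  then have "u \<noteq> []" "v \<noteq> []" "last u = last v" by (auto simp: Rsame_def)
  then show False using assms(1) k link_not[of False "last u" \<beta> True] by (simp add: good_snoc)
qed

text \<open>Complete paths for \<open>m = True\<close> and complete anti-paths for
  \<open>m = False\<close>; see \<open>complete_path_comp\<close> and
  \<open>complete_anti_path_comp\<close>.\<close>

definition comp :: "bool \<Rightarrow> ('v, 'a) path \<Rightarrow> bool" where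
  "comp m q \<longleftrightarrow> mpath m q \<and> snd q \<noteq> [] \<and> fst q = ptarget Q q \<and> link m (last (snd q)) (hd (snd q))"

text \<open>The arrow added on the left is forced: it and the last arrow of the closed word both
  stand before \<open>hd v\<close> in words of the same kind. So the prolongation winds around the
  cycle, and deleting its last arrow leaves a rotation.\<close>

lemma comp_Cons:
  assumes "comp m (y, v)" "mpath m (y, \<alpha> # v)"
  obtains w where "v = w @ [\<alpha>]" "comp m (target Q \<alpha>, \<alpha> # w)"
proof -
  have v: "v \<noteq> []" "link m (last v) (hd v)" using assms(1) by (auto simp: comp_def)
  have "link m \<alpha> (hd v)" using assms(2) v by (simp add: mpath_Cons)
  then have "last v = \<alpha>" using link_unique(1) v(2) by blast
  then obtain w where w: "v = w @ [\<alpha>]" using v(1) by (metis append_butlast_last_id)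
  have "mpath m (y, (\<alpha> # w) @ [\<alpha>])" using assms(2) w by simp
  then have "mpath m (target Q \<alpha>, \<alpha> # w)" "link m (last (\<alpha> # w)) \<alpha>"
    unfolding mpath_snoc by auto
  then show thesis using that w by (simp add: comp_def)
qed

lemma comp_snoc:
  assumes "comp m (target Q \<beta>, v)" "mpath m (y, v @ [\<beta>])"
  obtains w where "v = \<beta> # w" "comp m (source Q \<beta>, w @ [\<beta>])" "y = source Q \<beta>"
proof -
  have v: "v \<noteq> []" "link m (last v) (hd v)" using assms(1) by (auto simp: comp_def)
  have y: "link m (last v) \<beta>" "y = source Q \<beta>" using assms(2) v by (auto simp: mpath_snoc)
  then have "hd v = \<beta>" using link_unique(2) v(2) by blast
  then obtain w where w: "v = \<beta> # w" using v(1) by (cases v) auto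
  have m: "mpath m (source Q \<beta>, \<beta> # (w @ [\<beta>]))" using assms(2) w y by simp
  then have "mpath m (source Q \<beta>, w @ [\<beta>])" "link m \<beta> (hd (w @ [\<beta>]))"
    "source Q \<beta> = ptarget Q (source Q \<beta>, w @ [\<beta>])"
    unfolding mpath_Cons[of m _ \<beta> "w @ [\<beta>]"] by auto
  then show thesis using that w y by (simp add: comp_def)
qed

text \<open>
  The complex is a direct sum of squares, cycles and one graph. The cycles come from complete paths and
  complete anti-paths, the graph from the pairs \<open>(x, x)\<close> and \<open>(\<alpha>, \<alpha>)\<close>; the pairs outside the squares are
  called special.
\<close>

definition core :: "('v, 'a) path \<times> ('v, 'a) path \<Rightarrow> bool" where
  "core k \<longleftrightarrow> snd (fst k) = [] \<and> snd (snd k) = [] \<or> snd (fst k) = [] \<and> comp True (snd k) \<or>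
     snd (snd k) = [] \<and> comp False (fst k)"

definition special :: "('v, 'a) path \<times> ('v, 'a) path \<Rightarrow> bool" where
  "special k \<longleftrightarrow> core k \<or> Lsame k \<and> core (lstrip k)"

lemma core_not_same: "core k \<Longrightarrow> \<not> Lsame k \<and> \<not> Rsame k"
  by (auto simp: core_def Lsame_def Rsame_def)

text \<open>The two strips of such a pair are neighbouring rotations of one cycle, or they are the
  pairs \<open>(x, x)\<close> at the two ends of an arrow.\<close>

lemma core_lstrip_rstrip:
  assumes "good k" "Lsame k" "core (lstrip k)"
  shows "Rsame k" "core (rstrip Q k)"
proof -
  obtain y \<alpha> u v where k: "k = ((y, \<alpha> # u), (y, \<alpha> # v))" using assms(1,2) by (rule Lsame_elim)
  have g: "mpath False (y, \<alpha> # u)" "mpath True (y, \<alpha> # v)" using assms(1) k by (auto simp: good_iff)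
  have "Rsame k \<and> core (rstrip Q k)"
  proof -
    consider "u = []" "v = []" | "u = []" "comp True (y, v)" | "v = []" "comp False (y, u)"
      using assms(3) k by (auto simp: core_def)
    then show ?thesis
    proof cases
      case 1
      then show ?thesis using k strip_simps(2)[of Q y "[]" \<alpha> y "[]" \<alpha>] by (auto simp: core_def Rsame_def)
    next
      case 2
      obtain w where w: "v = w @ [\<alpha>]" "comp True (target Q \<alpha>, \<alpha> # w)" using comp_Cons[OF 2(2) g(2)] .
      then show ?thesis using k 2 strip_simps(2)[of Q y "[]" \<alpha> y "\<alpha> # w" \<alpha>]
        by (auto simp: core_def Rsame_def)
    next
      case 3
      obtain w where w: "u = w @ [\<alpha>]" "comp False (target Q \<alpha>, \<alpha> # w)" using comp_Cons[OF 3(2) g(1)] .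
      then show ?thesis using k 3 strip_simps(2)[of Q y "\<alpha> # w" \<alpha> y "[]" \<alpha>]
        by (auto simp: core_def Rsame_def)
    qed
  qed
  then show "Rsame k" "core (rstrip Q k)" by auto
qed

lemma core_rstrip_lstrip:
  assumes "good k" "Rsame k" "core (rstrip Q k)"
  shows "Lsame k" "core (lstrip k)"
proof -
  obtain \<beta> u v where k: "k = ((source Q \<beta>, u @ [\<beta>]), (source Q \<beta>, v @ [\<beta>]))"
    using assms(1,2) by (rule Rsame_elim)
  have g: "mpath False (source Q \<beta>, u @ [\<beta>])" "mpath True (source Q \<beta>, v @ [\<beta>])"
    using assms(1) k by (auto simp: good_iff)
  have "Lsame k \<and> core (lstrip k)"
  proof -
    consider "u = []" "v = []" | "u = []" "comp True (target Q \<beta>, v)" | "v = []" "comp False (target Q \<beta>, u)"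
      using assms(3) k by (auto simp: core_def)
    then show ?thesis
    proof cases
      case 1
      then show ?thesis using k by (auto simp: core_def)
    next
      case 2
      obtain w where "v = \<beta> # w" "comp True (source Q \<beta>, w @ [\<beta>])" using comp_snoc[OF 2(2) g(2)] .
      then show ?thesis using k 2 by (auto simp: core_def)
    next
      case 3
      obtain w where "u = \<beta> # w" "comp False (source Q \<beta>, w @ [\<beta>])" using comp_snoc[OF 3(2) g(1)] .
      then show ?thesis using k 3 by (auto simp: core_def)
    qed
  qed
  then show "Lsame k" "core (lstrip k)" by auto
qed

text \<open>With \<open>special_rstrip\<close>: no strip leads from special pairs to other pairs or
  back, so the Bardzell complex is the direct sum of these two parts.\<close>

lemma special_lstrip: "good k \<Longrightarrow> Lsame k \<Longrightarrow> special (lstrip k) \<longleftrightarrow> special k"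
  using core_not_same[of k] lstrip_not_Lsame[of k] by (auto simp: special_def)

lemma special_rstrip:
  assumes "good k" "Rsame k"
  shows "special (rstrip Q k) \<longleftrightarrow> special k"
proof
  assume "special (rstrip Q k)"
  then consider "core (rstrip Q k)" | "Lsame (rstrip Q k)" "core (lstrip (rstrip Q k))"
    by (auto simp: special_def)
  then show "special k"
  proof cases
    case 1
    then show ?thesis using core_rstrip_lstrip[OF assms] by (simp add: special_def)
  next
    case 2
    then show ?thesis using core_lstrip_rstrip(1)[OF rstrip_good[OF assms]] rstrip_not_Rsame[OF assms] by blast
  qed
next
  assume "special k"
  then show "special (rstrip Q k)"
    using core_not_same[of k] assms core_lstrip_rstrip[OF assms(1)] by (auto simp: special_def)
qed

text \<open>This closes the square: a pair with common arrows on both sides can be stripped on both.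
  If the right strip had an empty component, it would be a vertex or a cycle, and the pair would be
  special.\<close>

lemma nonspecial_both_same:
  assumes "good k" "\<not> special k" "Lsame k" "Rsame k"
  shows "Lsame (rstrip Q k)"
proof -
  obtain \<beta> u v where k: "k = ((source Q \<beta>, u @ [\<beta>]), (source Q \<beta>, v @ [\<beta>]))"
    using assms(1,4) by (rule Rsame_elim)
  have g: "good ((target Q \<beta>, u), (target Q \<beta>, v))"
    "u \<noteq> [] \<longrightarrow> link False (last u) \<beta>" "v \<noteq> [] \<longrightarrow> link True (last v) \<beta>"
    using assms(1) k by (auto simp: good_snoc)
  have n: "\<not> core ((target Q \<beta>, u), (target Q \<beta>, v))"
    using special_rstrip[OF assms(1,4)] assms(2) k by (auto simp: special_def)
  have "u \<noteq> []"
  proof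
    assume u: "u = []"
    then have "v \<noteq> []" using n by (auto simp: core_def)
    moreover have "hd v = \<beta>" using assms(3) k u calculation by (cases v) auto
    ultimately have "comp True (target Q \<beta>, v)"
      using g u by (cases v) (auto simp: comp_def good_iff)
    then show False using n u by (simp add: core_def)
  qed
  moreover have "v \<noteq> []"
  proof
    assume v: "v = []"
    then have "u \<noteq> []" using n by (auto simp: core_def)
    moreover have "hd u = \<beta>" using assms(3) k v calculation by (cases u) auto
    ultimately have "comp False (target Q \<beta>, u)"
      using g v by (cases u) (auto simp: comp_def good_iff)
    then show False using n v by (simp add: core_def)
  qed
  ultimately have "Lsame ((target Q \<beta>, u), (target Q \<beta>, v))"
    using assms(3) unfolding k by (simp add: Lsame_def)
  then show ?thesis unfolding k by simp
qed

text \<open>A nonempty component of the strip determines the removed arrow by gentleness. For the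
  strip \<open>(x, x)\<close> this fails, since any arrow starting at \<open>x\<close> may have been
  removed.\<close>

lemma lstrip_inj:
  assumes "good k" "Lsame k" "good k'" "Lsame k'" "lstrip k = lstrip k'"
    "snd (fst (lstrip k)) \<noteq> [] \<or> snd (snd (lstrip k)) \<noteq> []"
  shows "k = k'"
proof -
  obtain y \<alpha> u v where k: "k = ((y, \<alpha> # u), (y, \<alpha> # v))" using assms(1,2) by (rule Lsame_elim)
  obtain y' \<alpha>' u' v' where k': "k' = ((y', \<alpha>' # u'), (y', \<alpha>' # v'))" using assms(3,4) by (rule Lsame_elim)
  have e: "y' = y" "u' = u" "v' = v" using assms(5) k k' by auto
  have "\<alpha> = \<alpha>'"
    using assms(1,3,6) k k' e link_unique(1)[of False \<alpha> "hd u" \<alpha>'] link_unique(1)[of True \<alpha> "hd v" \<alpha>']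
    by (auto simp: good_Cons)
  then show ?thesis using k k' e by simp
qed

lemma rstrip_inj:
  assumes "good k" "Rsame k" "good k'" "Rsame k'" "rstrip Q k = rstrip Q k'"
    "snd (fst (rstrip Q k)) \<noteq> [] \<or> snd (snd (rstrip Q k)) \<noteq> []"
  shows "k = k'"
proof -
  obtain \<beta> u v where k: "k = ((source Q \<beta>, u @ [\<beta>]), (source Q \<beta>, v @ [\<beta>]))" using assms(1,2) by (rule Rsame_elim)
  obtain \<beta>' u' v' where k': "k' = ((source Q \<beta>', u' @ [\<beta>']), (source Q \<beta>', v' @ [\<beta>']))" using assms(3,4) by (rule Rsame_elim)
  have e: "u' = u" "v' = v" using assms(5) k k' by auto
  have "\<beta> = \<beta>'"
    using assms(1,3,6) k k' e link_unique(2)[of False "last u" \<beta> \<beta>'] link_unique(2)[of True "last v" \<beta> \<beta>']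
    by (auto simp: good_snoc)
  then show ?thesis using k k' e by simp
qed

lemma nonspecial_nontrivial: "\<not> special k \<Longrightarrow> snd (fst k) \<noteq> [] \<or> snd (snd k) \<noteq> []"
  by (auto simp: special_def core_def)

definition lsign :: "int \<Rightarrow> ('v, 'a) path \<times> ('v, 'a) path \<Rightarrow> 'k::field" where
  "lsign d k = (-1) powi (d * degree Q (hd (snd (fst k))))"

lemma lsign_square [simp]: "lsign d k * lsign d k = 1" "lsign d k * (lsign d k * c) = c"
  by (simp_all add: lsign_def)

lemma lookup_diff:
  fixes f :: "(('v, 'a) path \<times> ('v, 'a) path) \<Rightarrow>\<^sub>0 'k::field"
  assumes "f \<in> bardzell_cochains Q n d"
  shows "lk (bardzell_diff Q n d f) k = (if good k \<and> plength (fst k) = Suc n then (-1) powi d *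
    ((if Lsame k then lsign d k * lk f (lstrip k) else 0)
     - (if Rsame k then (-1) ^ n * lk f (rstrip Q k) else 0)) else 0)"
proof -
  obtain P R where k: "k = (P, R)" by fastforce
  have "snd P \<noteq> []" if "plength P = Suc n" using that by (auto simp: plength_def)
  then show ?thesis
    unfolding k lookup_bardzell_diff[OF assms]
    by (auto simp: good_def mpath_def Lsame_def Rsame_def lstrip_def rstrip_def lsign_def)
qed

text \<open>Inherited from the Hochschild complex, because every Bardzell cochain is the comparison
  image of some cochain by \<open>solve_along_matching\<close>.\<close>

lemma bardzell_diff_diff:
  fixes f :: "(('v, 'a) path \<times> ('v, 'a) path) \<Rightarrow>\<^sub>0 'k::field"
  assumes f: "f \<in> bardzell_cochains Q n d"
  shows "bardzell_diff Q (Suc n) d (bardzell_diff Q n d f) = 0"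
proof -
  have zero: "(0 :: (('v, 'a) path \<Rightarrow>\<^sub>0 'k) list \<Rightarrow> ('v, 'a) path \<Rightarrow>\<^sub>0 'k) \<in> hoch_cochains Q (Suc n) d" by simp
  obtain g :: "(('v, 'a) path \<Rightarrow>\<^sub>0 'k) list \<Rightarrow> ('v, 'a) path \<Rightarrow>\<^sub>0 'k" where g: "g \<in> hoch_cochains Q n d"
    "\<forall>w q. path_of_A Q q \<longrightarrow> length w = n \<longrightarrow> chain Q (ptarget Q q) None w (fst q) \<longrightarrow>
      coef g (map arr w) q = lk f ((fst q, w), q)"
    using solve_along_matching[OF zero f] by (elim bexE conjE)
  have "comparison Q n g = f" by (rule comparison_eqI[OF g(1) f g(2)[rule_format]])
  then show ?thesis
    using comparison_diff[OF g(1)] comparison_diff[OF hoch_diff_cochain[OF g(1)]]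
      hoch_diff_hoch_diff[of g Q n d] g(1) by simp
qed

lemma coboundary_cocycle:
  assumes "f \<in> bardzell_coboundaries Q n d"
  shows "f \<in> bardzell_cochains Q n d" "bardzell_diff Q n d f = 0"
proof -
  have "bardzell_diff Q n d 0 = 0" by (simp add: bardzell_diff_def)
  then show "f \<in> bardzell_cochains Q n d" "bardzell_diff Q n d f = 0"
    using assms by (cases n; auto simp: bardzell_coboundaries_def bardzell_diff_cochain bardzell_diff_diff)+
qed

lemma sg_cochain: "k \<in> bardzell_basis Q n d \<Longrightarrow> sg k \<in> bardzell_cochains Q n d"
  by (auto simp: bardzell_cochains_def)

lemma strip_basis:
  assumes "k \<in> bardzell_basis Q (Suc n) d"
  shows "Lsame k \<Longrightarrow> lstrip k \<in> bardzell_basis Q n d" "Rsame k \<Longrightarrow> rstrip Q k \<in> bardzell_basis Q n d"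
proof -
  have k: "good k" "plength (fst k) = Suc n" "pdegree Q (snd k) - pdegree Q (fst k) = d"
    using assms by (auto simp: bardzell_basis_good)
  show "lstrip k \<in> bardzell_basis Q n d" if L: "Lsame k"
  proof -
    obtain y \<alpha> u v where "k = ((y, \<alpha> # u), (y, \<alpha> # v))" using k(1) L by (rule Lsame_elim)
    then show ?thesis using k lstrip_good[OF k(1) L] by (auto simp: bardzell_basis_good plength_def pdegree_def)
  qed
  show "rstrip Q k \<in> bardzell_basis Q n d" if R: "Rsame k"
  proof -
    obtain \<beta> u v where "k = ((source Q \<beta>, u @ [\<beta>]), (source Q \<beta>, v @ [\<beta>]))" using k(1) R by (rule Rsame_elim)
    then show ?thesis using k rstrip_good[OF k(1) R] by (auto simp: bardzell_basis_good plength_def pdegree_def)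
  qed
qed

text \<open>The values at pairs with a common first arrow are moved to their left strips, and
  differentiating the resulting \<open>g\<close> returns them. Right strips do not interfere: here
  they still have a common first arrow, whereas \<open>g\<close> is supported on left strips, which
  have none.\<close>

lemma kill_Lsame:
  fixes f :: "(('v, 'a) path \<times> ('v, 'a) path) \<Rightarrow>\<^sub>0 'k::field"
  assumes f: "f \<in> bardzell_cochains Q n d"
  obtains h where "h \<in> bardzell_coboundaries Q n d"
    "\<And>k. Lsame k \<Longrightarrow> \<not> special k \<Longrightarrow> lk (f - h) k = 0"
proof (cases n)
  case 0
  have z: "lk f k = 0" if "Lsame k" for k
    using f that 0 by (auto simp: bardzell_cochains_iff bardzell_basis_def Lsame_def plength_def)
  show thesis by (rule that[of 0]) (simp_all add: bardzell_coboundaries_zero z)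
next
  case (Suc m)
  let ?K = "{k \<in> Poly_Mapping.keys f. Lsame k \<and> \<not> special k}"
  let ?c = "\<lambda>k. (-1) powi d * (lsign d k * lk f k)"
  define g where "g = (\<Sum>k\<in>?K. smult (?c k) (sg (lstrip k)))"
  have K: "k \<in> bardzell_basis Q (Suc m) d" if "k \<in> Poly_Mapping.keys f" for k
    using f that Suc by (auto simp: bardzell_cochains_def)
  have lg: "lk g j = (\<Sum>k\<in>?K. if lstrip k = j then ?c k else 0)" for j
    by (auto simp: g_def lookup_sum lookup_single when_def intro!: sum.cong)
  have g: "g \<in> bardzell_cochains Q m d"
    unfolding bardzell_cochains_iff
  proof (intro allI impI)
    fix j assume "lk g j \<noteq> 0"
    then have "(\<Sum>k\<in>?K. if lstrip k = j then ?c k else 0) \<noteq> 0" by (simp only: lg not_False_eq_True)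
    then obtain k where "k \<in> ?K" "(if lstrip k = j then ?c k else 0) \<noteq> 0"
      by (rule sum.not_neutral_contains_not_neutral)
    then show "j \<in> bardzell_basis Q m d" using strip_basis(1)[OF K, of k] by (auto split: if_splits)
  qed
  have "lk (f - bardzell_diff Q m d g) k = 0" if k: "Lsame k" "\<not> special k" for k
  proof (cases "k \<in> bardzell_basis Q (Suc m) d")
    case False
    then have "lk f k = 0" "lk (bardzell_diff Q m d g) k = 0"
      using f Suc bardzell_diff_cochain[OF g] by (auto simp: bardzell_cochains_iff)
    then show ?thesis by (simp add: lookup_minus)
  next
    case True
    then have gk: "good k" "plength (fst k) = Suc m" by (auto simp: bardzell_basis_good)
    \<comment> \<open>The strip is not of the form \<open>(x, x)\<close>, since such pairs are
      special; so \<open>k\<close> is recovered from it.\<close>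
    have inj: "k' = k" if "k' \<in> ?K" "lstrip k' = lstrip k" for k'
    proof -
      have "good k'" using K that(1) by (auto simp: bardzell_basis_good)
      moreover have "\<not> special (lstrip k)" using special_lstrip[OF gk(1) k(1)] k(2) by simp
      ultimately show ?thesis
        using that lstrip_inj[OF _ _ gk(1) k(1), of k'] nonspecial_nontrivial[of "lstrip k"] by auto
    qed
    have "lk g (lstrip k) = (\<Sum>k'\<in>?K. if k' = k then ?c k else 0)"
      unfolding lg using inj by (intro sum.cong refl) auto
    also have "\<dots> = ?c k" using k by (auto simp: sum.delta in_keys_iff)
    finally have 1: "lk g (lstrip k) = ?c k" .
    have 2: "lk g (rstrip Q k) = 0" if "Rsame k"
      unfolding lg
    proof (intro sum.neutral ballI)
      fix k' assume k': "k' \<in> ?K"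
      then have "\<not> Lsame (lstrip k')" using K lstrip_not_Lsame by (auto simp: bardzell_basis_good)
      then show "(if lstrip k' = rstrip Q k then ?c k' else 0) = 0"
        using nonspecial_both_same[OF gk(1) k(2,1) that] by auto
    qed
    show ?thesis unfolding lookup_minus lookup_diff[OF g] using gk k 1 2 by (simp add: mult_ac)
  qed
  then show thesis using that[of "bardzell_diff Q m d g"] g Suc by (auto simp: bardzell_coboundaries_def)
qed

text \<open>Such a pair is sent to no other pair, so its differential is zero.\<close>

definition terminal :: "('v, 'a) path \<times> ('v, 'a) path \<Rightarrow> bool" where
  "terminal k \<longleftrightarrow> (\<forall>k'. good k' \<longrightarrow> Lsame k' \<longrightarrow> lstrip k' \<noteq> k) \<and>
     (\<forall>k'. good k' \<longrightarrow> Rsame k' \<longrightarrow> rstrip Q k' \<noteq> k)"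

lemma terminal_cocycle:
  assumes "k \<in> bardzell_basis Q n d" "terminal k"
  shows "bardzell_diff Q n d (sg k) = 0"
proof (rule poly_mapping_eqI)
  fix k'
  show "lk (bardzell_diff Q n d (sg k)) k' = lk 0 k'"
    unfolding lookup_diff[OF sg_cochain[OF assms(1)]] using assms(2)
    by (auto simp: lookup_single when_def terminal_def)
qed

text \<open>The square closed in the other direction: an arrow that prolongs the right strip on the
  left also prolongs \<open>k\<close> itself.\<close>

lemma extend_left:
  assumes k: "good k" "\<not> Lsame k" "Rsame k" "\<not> special k"
    and j: "good j" "Lsame j" "lstrip j = rstrip Q k"
  obtains k' where "good k'" "Lsame k'" "lstrip k' = k"
proof -
  obtain \<beta> u v where ke: "k = ((source Q \<beta>, u @ [\<beta>]), (source Q \<beta>, v @ [\<beta>]))" using k(1,3) by (rule Rsame_elim)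
  obtain y \<alpha> u' v' where je: "j = ((y, \<alpha> # u'), (y, \<alpha> # v'))" using j(1,2) by (rule Lsame_elim)
  have e: "y = target Q \<beta>" "u' = u" "v' = v" using j(3) ke je by auto
  have gj: "\<alpha> \<in> arrows Q" "source Q \<alpha> = ptarget Q (target Q \<beta>, u)"
    "u \<noteq> [] \<Longrightarrow> link False \<alpha> (hd u)" "v \<noteq> [] \<Longrightarrow> link True \<alpha> (hd v)"
    using j(1) je e by (auto simp: good_Cons)
  have gk: "\<beta> \<in> arrows Q" "good ((target Q \<beta>, u), (target Q \<beta>, v))" using k(1) ke by (auto simp: good_snoc)
  have "\<not> core ((target Q \<beta>, u), (target Q \<beta>, v))"
    using special_rstrip[OF k(1,3)] k(4) ke by (auto simp: special_def)
  then have uv: "u \<noteq> [] \<or> v \<noteq> []" by (auto simp: core_def)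
  \<comment> \<open>If \<open>u\<close> is empty, the product of \<open>\<alpha>\<close> with the
    first arrow of \<open>v\<close> is not in \<open>I\<close>. That arrow differs from
    \<open>\<beta>\<close>, as \<open>k\<close> has no common first arrow, so gentleness puts the
    product of \<open>\<alpha>\<close> and \<open>\<beta>\<close> into \<open>I\<close>.\<close>
  have lu: "link False \<alpha> (hd (u @ [\<beta>]))"
  proof (cases "u = []")
    case True
    then have "v \<noteq> []" "hd v \<noteq> \<beta>" using uv k(2) ke by (cases v; auto)+
    then have "\<not> link True \<alpha> \<beta>" using gj(4) link_unique(2) by blast
    then show ?thesis using link_cases[of \<beta> \<alpha> True] True gj gk by simp
  qed (use gj in simp)
  have lv: "link True \<alpha> (hd (v @ [\<beta>]))"
  proof (cases "v = []")
    case True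
    then have "u \<noteq> []" "hd u \<noteq> \<beta>" using uv k(2) ke by (cases u; auto)+
    then have "\<not> link False \<alpha> \<beta>" using gj(3) link_unique(2) by blast
    moreover have "source Q \<alpha> = target Q \<beta>" using gj(2) gk(2) True by (simp add: good_iff)
    ultimately show ?thesis using link_cases[of \<beta> \<alpha> True] True gj gk by simp
  qed (use gj in simp)
  have "good ((source Q \<beta>, \<alpha> # u @ [\<beta>]), (source Q \<beta>, \<alpha> # v @ [\<beta>]))"
    unfolding good_Cons using lu lv k(1) ke gj(1,2) by simp
  then show thesis using that ke by (metis Lsame_simps(1) strip_simps(1))
qed

text \<open>The cocycle equation at a left extension of \<open>k\<close> would force
  \<open>lk f k = 0\<close>. If \<open>k\<close> has a common last arrow, its right strip has no
  left extension either, so the differential of that strip is \<open>k\<close> up to sign; otherwise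
  the equation excludes right extensions of \<open>k\<close> as well.\<close>

lemma nonspecial_key:
  fixes f :: "(('v, 'a) path \<times> ('v, 'a) path) \<Rightarrow>\<^sub>0 'k::field"
  assumes f: "f \<in> bardzell_cochains Q n d" "bardzell_diff Q n d f = 0"
    and L: "\<And>k. Lsame k \<Longrightarrow> \<not> special k \<Longrightarrow> lk f k = 0"
    and k: "\<not> special k" "lk f k \<noteq> 0"
  shows "sg k \<in> (bardzell_coboundaries Q n d :: (_ \<Rightarrow>\<^sub>0 'k) set) \<or> terminal k \<and> \<not> Lsame k \<and> \<not> Rsame k"
proof -
  have kb: "k \<in> bardzell_basis Q n d" using f(1) k(2) by (auto simp: bardzell_cochains_iff)
  have gk: "good k" using kb by (simp add: bardzell_basis_good)
  have nL: "\<not> Lsame k" using L k by blast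
  have eq: "(if Lsame k' then lsign d k' * lk f (lstrip k') else 0) =
    (if Rsame k' then (-1) ^ n * lk f (rstrip Q k') else 0)"
    if "good k'" "plength (fst k') = Suc n" for k'
    using arg_cong[OF f(2), of "\<lambda>h. lk h k'"] that unfolding lookup_diff[OF f(1)] by simp
  have len: "plength (fst k') = Suc n" if "good k'" "Lsame k' \<and> lstrip k' = k \<or> Rsame k' \<and> rstrip Q k' = k" for k'
    using kb that by (auto simp: bardzell_basis_good plength_def lstrip_def rstrip_def path_tl_def path_butlast_def
        Lsame_def Rsame_def)
  have noL: "lstrip k' \<noteq> k" if k': "good k'" "Lsame k'" for k'
  proof
    assume e: "lstrip k' = k"
    have ns: "\<not> special k'" using special_lstrip[OF k'] e k(1) by simp
    have "lk f (rstrip Q k') = 0" if "Rsame k'"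
      using L nonspecial_both_same[OF k'(1) ns k'(2) that] special_rstrip[OF k'(1) that] ns by simp
    then have "lsign d k' * lk f k = 0" using eq[OF k'(1)] len[of k'] k' e by (auto split: if_splits)
    then show False using k(2) by (auto simp: lsign_def)
  qed
  show ?thesis
  proof (cases "Rsame k")
    case True
    obtain m where n: "n = Suc m" using kb True
      by (cases n) (auto simp: bardzell_basis_good Rsame_def plength_def)
    let ?j = "rstrip Q k"
    have jb: "?j \<in> bardzell_basis Q m d" using strip_basis(2)[of k m d] kb n True by simp
    have js: "snd (fst ?j) \<noteq> [] \<or> snd (snd ?j) \<noteq> []"
      using special_rstrip[OF gk True] k(1) nonspecial_nontrivial by blast
    have "lk (bardzell_diff Q m d (sg ?j :: _ \<Rightarrow>\<^sub>0 'k)) k' = lk (smult (- ((-1) powi d * (-1) ^ m)) (sg k)) k'" for k'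
    proof -
      have 1: "lstrip k' \<noteq> ?j" if "good k'" "Lsame k'"
        using extend_left[OF gk nL True k(1) that] noL by blast
      have 2: "rstrip Q k' = ?j \<longleftrightarrow> k' = k" if "good k'" "Rsame k'"
        by (rule iffI) (use rstrip_inj[OF gk True that] js in simp_all)
      have 3: "plength (fst k) = Suc m" using kb n by (simp add: bardzell_basis_good)
      have 4: "lk (sg ?j :: _ \<Rightarrow>\<^sub>0 'k) (lstrip k') = 0" if "good k'" "Lsame k'"
        using 1[OF that] by (auto simp: lookup_single when_def)
      have 5: "lk (sg ?j :: _ \<Rightarrow>\<^sub>0 'k) (rstrip Q k') = (if k' = k then 1 else 0)" if "good k'" "Rsame k'"
        using 2[OF that] by (auto simp: lookup_single when_def)
      have 6: "lk (sg k :: _ \<Rightarrow>\<^sub>0 'k) k' = (if k' = k then 1 else 0)"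
        by (auto simp: lookup_single when_def)
      show ?thesis
      proof (cases "k' = k")
        case True
        then show ?thesis unfolding lookup_diff[OF sg_cochain[OF jb]] lookup_smult 6
          using 3 5 gk nL \<open>Rsame k\<close> by simp
      next
        case False
        then show ?thesis unfolding lookup_diff[OF sg_cochain[OF jb]] lookup_smult 6
          using 4 5 6 by simp
      qed
    qed
    then have "bardzell_diff Q m d (sg ?j :: _ \<Rightarrow>\<^sub>0 'k) = smult (- ((-1) powi d * (-1) ^ m)) (sg k)"
      by (rule poly_mapping_eqI)
    moreover have "bardzell_diff Q m d (sg ?j) \<in> (bardzell_coboundaries Q n d :: (_ \<Rightarrow>\<^sub>0 'k) set)"
      using sg_cochain[OF jb] n by (auto simp: bardzell_coboundaries_def)
    \<comment> \<open>The coefficient is a sign, so multiplying by it again recovers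
      \<open>sg k\<close>.\<close>
    ultimately have "smult (- ((-1) powi d * (-1) ^ m)) (smult (- ((-1) powi d * (-1) ^ m)) (sg k))
        \<in> (bardzell_coboundaries Q n d :: (_ \<Rightarrow>\<^sub>0 'k) set)"
      using bardzell_coboundaries_smult by metis
    then show ?thesis by (simp add: mult_ac)
  next
    case False
    have "rstrip Q k' \<noteq> k" if k': "good k'" "Rsame k'" for k'
    proof
      assume e: "rstrip Q k' = k"
      have "\<not> special k'" using special_rstrip[OF k'] e k(1) by simp
      then have "\<not> Lsame k'" using nonspecial_both_same[OF k'(1) _ _ k'(2)] e nL by blast
      then have "(-1) ^ n * lk f k = 0" using eq[OF k'(1)] len[of k'] k' e by (auto split: if_splits)
      then show False using k(2) by simp
    qed
    then show ?thesis using noL nL False by (simp add: terminal_def)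
  qed
qed

end

section \<open>Cycles\<close>

text \<open>Commuting words are powers of a common word; as the length of \<open>u\<close> divides
  that of \<open>v\<close>, the word \<open>u\<close> itself will do.\<close>

lemma commuting_append:
  "v @ u = u @ v \<Longrightarrow> length v = t * length u \<Longrightarrow> v = concat (replicate t u)"
proof (induction t arbitrary: v)
  case (Suc t)
  then have "take (length u) (v @ u) = u" by simp
  then have "take (length u) v = u" using Suc.prems(2) by simp
  then obtain v' where v: "v = u @ v'" by (metis append_take_drop_id)
  then show ?case using Suc by simp
qed simp

lemma rotate_periodic:
  assumes "rotate r xs = xs" "length xs = t * r" "t > 0"
  shows "xs = concat (replicate t (take r xs))"
proof -
  obtain s where t: "t = Suc s" using assms(3) by (cases t) auto
  have r: "r \<le> length xs" using assms(2) t by simp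
  have "drop r xs @ take r xs = xs"
  proof (cases "r = length xs")
    case False
    then show ?thesis using assms(1) r by (simp add: rotate_drop_take)
  qed simp
  then have "drop r xs @ take r xs = take r xs @ drop r xs" by simp
  moreover have "length (drop r xs) = s * length (take r xs)" using assms(2) r t by simp
  ultimately have "drop r xs = concat (replicate s (take r xs))" by (rule commuting_append)
  then show ?thesis using t by (metis append_take_drop_id concat.simps(2) replicate_Suc)
qed

lemma sum_list_concat_replicate: "sum_list (concat (replicate t xs)) = of_nat t * sum_list (xs :: int list)"
  by (induction t) (auto simp: algebra_simps)

context gentle begin

text \<open>\<open>cyc_len\<close> and \<open>cyc_deg\<close> give the bidegree of
  \<open>N\<^sup>0(q)\<close>.\<close>

definition cyc_len :: "bool \<Rightarrow> ('v, 'a) path \<Rightarrow> nat" where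
  "cyc_len m q = (if m then 0 else plength q)"

definition cyc_deg :: "bool \<Rightarrow> ('v, 'a) path \<Rightarrow> int" where
  "cyc_deg m q = (if m then pdegree Q q else - pdegree Q q)"

text \<open>
  \<open>cyc0 m q\<close> and \<open>cyc1 m q\<close> are the pairs occurring in \<open>N\<^sup>0(q)\<close> and \<open>N\<^sup>1(q)\<close>.
\<close>

definition cyc0 :: "bool \<Rightarrow> ('v, 'a) path \<Rightarrow> ('v, 'a) path \<times> ('v, 'a) path" where
  "cyc0 m q = (if m then ((fst q, []), q) else (q, (fst q, [])))"

definition cyc1 :: "bool \<Rightarrow> ('v, 'a) path \<Rightarrow> ('v, 'a) path \<times> ('v, 'a) path" where
  "cyc1 m q = (if m then (arr (last (snd q)), pcomp (arr (last (snd q))) q)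
    else (pcomp (arr (last (snd q))) q, arr (last (snd q))))"

definition cyc_sign :: "bool \<Rightarrow> ('v, 'a) path \<Rightarrow> nat \<Rightarrow> 'k::field" where
  "cyc_sign m q i = (-1) powi (int i * int (cyc_len m q) + pdegree Q q * (\<Sum>\<alpha>\<leftarrow>take i (snd q). degree Q \<alpha>))"

text \<open>The quotient of consecutive coefficients of \<open>N\<^sup>0(q)\<close>, see
  \<open>cyc_sign_Suc\<close>. Length and degree being invariant under rotation, it depends only on
  the first arrow of the rotation reached.\<close>

definition cyc_step :: "bool \<Rightarrow> ('v, 'a) path \<Rightarrow> 'k::field" where
  "cyc_step m q = (-1) powi (int (cyc_len m q) + pdegree Q q * degree Q (hd (snd q)))"

lemma mpath_ends:
  "mpath m q \<Longrightarrow> snd q \<noteq> [] \<Longrightarrow> hd (snd q) \<in> arrows Q \<and> last (snd q) \<in> arrows Q \<and> source Q (last (snd q)) = fst q"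
  by (auto simp: mpath_iff)

lemma complete_path_comp: "complete_path Q q \<longleftrightarrow> comp True q"
  using mpath_ends[of True q]
  by (auto simp: complete_path_def comp_def mpath_def plength_def psource_def link_def ptarget_def Suc_le_eq)

lemma complete_anti_path_comp: "complete_anti_path Q q \<longleftrightarrow> comp False q"
  using mpath_ends[of False q]
  by (auto simp: complete_anti_path_def comp_def mpath_def plength_def psource_def link_def ptarget_def Suc_le_eq)

lemma comp_elim:
  assumes "comp m q"
  obtains \<alpha> w where "q = (target Q \<alpha>, \<alpha> # w)" "\<alpha> \<in> arrows Q" "mpath m (target Q \<alpha>, w)"
    "source Q \<alpha> = ptarget Q (target Q \<alpha>, w)" "w \<noteq> [] \<longrightarrow> link m \<alpha> (hd w)" "link m (last (\<alpha> # w)) \<alpha>"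
  using assms by (cases q; cases "snd q") (auto simp: comp_def mpath_Cons)

lemma comp_rot:
  assumes "comp m q"
  shows "comp m (rot Q q)"
proof -
  obtain \<alpha> w where q: "q = (target Q \<alpha>, \<alpha> # w)" "\<alpha> \<in> arrows Q" "mpath m (target Q \<alpha>, w)"
    "source Q \<alpha> = ptarget Q (target Q \<alpha>, w)" "w \<noteq> [] \<longrightarrow> link m \<alpha> (hd w)" "link m (last (\<alpha> # w)) \<alpha>"
    using assms by (rule comp_elim)
  have "mpath m (source Q \<alpha>, w @ [\<alpha>])" using q by (auto simp: mpath_snoc)
  moreover have "link m \<alpha> (hd (w @ [\<alpha>]))" using q by (cases w) auto
  ultimately show ?thesis using q by (simp add: comp_def rot_def)
qed

lemma snd_rot [simp]: "snd (rot Q q) = rotate1 (snd q)"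
  by (cases "snd q") (auto simp: rot_def)

lemma snd_rot_funpow [simp]: "snd ((rot Q ^^ i) q) = rotate i (snd q)"
  by (induction i) (auto simp: rotate_def)

lemma comp_rot_funpow: "comp m q \<Longrightarrow> comp m ((rot Q ^^ i) q)"
  by (induction i) (auto simp: comp_rot)

lemma comp_eqI: "comp m q \<Longrightarrow> comp m q' \<Longrightarrow> snd q = snd q' \<Longrightarrow> q = q'"
  by (cases q; cases q') (auto simp: comp_def ptarget_def)

lemma comp_length: "comp m q \<Longrightarrow> length (snd q) > 0"
  by (simp add: comp_def)

lemma rot_length [simp]: "comp m q \<Longrightarrow> (rot Q ^^ length (snd q)) q = q"
  by (intro comp_eqI[of m] comp_rot_funpow) auto

lemma rot_inverse: 
  assumes "comp m q"
  obtains q' where "comp m q'" "rot Q q' = q" "q' = (rot Q ^^ (length (snd q) - 1)) q"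
proof (rule that[OF _ _ refl])
  show "comp m ((rot Q ^^ (length (snd q) - 1)) q)" using assms by (rule comp_rot_funpow)
  have "Suc (length (snd q) - 1) = length (snd q)" using comp_length[OF assms] by simp
  then have "rot Q ((rot Q ^^ (length (snd q) - 1)) q) = (rot Q ^^ length (snd q)) q"
    by (metis funpow.simps(2) comp_apply)
  then show "rot Q ((rot Q ^^ (length (snd q) - 1)) q) = q" using assms by simp
qed

lemma cyc_rot [simp]:
  "plength ((rot Q ^^ i) q) = plength q" "pdegree Q ((rot Q ^^ i) q) = pdegree Q q"
  "cyc_len m ((rot Q ^^ i) q) = cyc_len m q" "cyc_deg m ((rot Q ^^ i) q) = cyc_deg m q"
  "plength (rot Q q) = plength q" "pdegree Q (rot Q q) = pdegree Q q"
  "cyc_len m (rot Q q) = cyc_len m q" "cyc_deg m (rot Q q) = cyc_deg m q"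
proof -
  have r1: "sum_list (map f (rotate1 xs)) = (sum_list (map f xs) :: int)" for f and xs :: "'a list"
    by (cases xs) auto
  have p: "plength (rot Q q) = plength q" "pdegree Q (rot Q q) = pdegree Q q" for q
    by (auto simp: plength_def pdegree_def r1)
  then have "plength ((rot Q ^^ i) q) = plength q \<and> pdegree Q ((rot Q ^^ i) q) = pdegree Q q"
    by (induction i) auto
  with p show "plength ((rot Q ^^ i) q) = plength q" "pdegree Q ((rot Q ^^ i) q) = pdegree Q q"
    "cyc_len m ((rot Q ^^ i) q) = cyc_len m q" "cyc_deg m ((rot Q ^^ i) q) = cyc_deg m q"
    "plength (rot Q q) = plength q" "pdegree Q (rot Q q) = pdegree Q q"
    "cyc_len m (rot Q q) = cyc_len m q" "cyc_deg m (rot Q q) = cyc_deg m q"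
    by (auto simp: cyc_len_def cyc_deg_def)
qed

lemma period_props:
  assumes "comp m q"
  shows "period Q q \<ge> 1" "(rot Q ^^ period Q q) q = q"
    "\<And>i. 1 \<le> i \<Longrightarrow> (rot Q ^^ i) q = q \<Longrightarrow> period Q q \<le> i" "period Q q \<le> length (snd q)"
proof -
  have ex: "length (snd q) \<ge> 1 \<and> (rot Q ^^ length (snd q)) q = q"
    using comp_length[OF assms] assms by (simp add: Suc_le_eq)
  show "period Q q \<ge> 1" "(rot Q ^^ period Q q) q = q"
    unfolding period_def using LeastI[of "\<lambda>r. r \<ge> 1 \<and> (rot Q ^^ r) q = q", OF ex] by auto
  show *: "period Q q \<le> i" if "1 \<le> i" "(rot Q ^^ i) q = q" for i
    unfolding period_def using that by (intro Least_le) auto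
  show "period Q q \<le> length (snd q)" using ex * by blast
qed

lemma orbit_mod:
  assumes "comp m q"
  shows "(rot Q ^^ (i mod period Q q)) q = (rot Q ^^ i) q"
  using funpow_mod_eq[OF period_props(2)[OF assms]] .

lemma orbit_inj:
  assumes "comp m q" "(rot Q ^^ i) q = (rot Q ^^ j) q" "i < period Q q" "j < period Q q"
  shows "i = j"
proof -
  have *: "i = j" if "i \<le> j" "(rot Q ^^ i) q = (rot Q ^^ j) q" "j < period Q q" for i j
  proof (rule ccontr)
    assume "i \<noteq> j"
    let ?r = "period Q q"
    have "(rot Q ^^ (?r - j)) ((rot Q ^^ i) q) = (rot Q ^^ (?r - j)) ((rot Q ^^ j) q)" using that by simp
    then have "(rot Q ^^ (?r - j + i)) q = (rot Q ^^ (?r - j + j)) q" by (simp only: funpow_add o_apply)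
    then have "(rot Q ^^ (?r - j + i)) q = q" using that(3) period_props(2)[OF assms(1)] by simp
    then have "?r \<le> ?r - j + i" using that by (intro period_props(3)[OF assms(1)]) auto
    then show False using that \<open>i \<noteq> j\<close> by simp
  qed
  show ?thesis
  proof (cases "i \<le> j")
    case True
    then show ?thesis using * assms by blast
  next
    case False
    then show ?thesis using *[of j i] assms by simp
  qed
qed

lemma period_dvd:
  assumes "comp m q"
  shows "period Q q dvd length (snd q)"
proof -
  let ?s = "length (snd q) mod period Q q"
  have "(rot Q ^^ ?s) q = q" using orbit_mod[OF assms, of "length (snd q)"] assms by simp
  then have "\<not> 1 \<le> ?s" using period_props(1,3)[OF assms] mod_less_divisor[of "period Q q" "length (snd q)"]
    by (metis Suc_le_eq One_nat_def leD)
  then show ?thesis by (simp add: dvd_eq_mod_eq_0)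
qed

lemma minus_one_even: "even e \<Longrightarrow> (-1) powi e = (1 :: 'k::field)"
  by (simp add: power_int_minus_left)

lemma minus_one_odd: "odd e \<Longrightarrow> (-1) powi e = (-1 :: 'k::field)"
  by (simp add: power_int_minus_left)

lemma char_two: "CHAR('k::field) = 2 \<Longrightarrow> (-1) powi e = (1 :: 'k)"
proof -
  assume "CHAR('k) = 2"
  then have "(of_nat 2 :: 'k) = 0" using of_nat_CHAR[where ?'a = 'k] by simp
  then have "(1 :: 'k) + 1 = 0" by simp
  then have "(-1 :: 'k) = 1" by (metis add_eq_0_iff)
  then show "(-1) powi e = (1 :: 'k)" by (simp only: power_int_1_left)
qed

lemma not_char_two: "CHAR('k::field) \<noteq> 2 \<Longrightarrow> (2 :: 'k) \<noteq> 0"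
proof
  assume c: "CHAR('k) \<noteq> 2" and "(2 :: 'k) = 0"
  then have "of_nat 2 = (0 :: 'k)" by simp
  then have "CHAR('k) dvd 2" by (simp only: of_nat_eq_0_iff_char_dvd)
  moreover from this have "CHAR('k) \<le> 2" by (rule dvd_imp_le) simp
  moreover have "CHAR('k) \<noteq> 1" using of_nat_CHAR[where ?'a = 'k] by (metis of_nat_1 zero_neq_one)
  ultimately show False using c by (cases "CHAR('k) = 0") auto
qed

text \<open>The parity of \<open>\<omega>(q)\<close>, in the form in which it governs the product of
  the step signs once around the whole word.\<close>

definition cyc_ok :: "'k::field itself \<Rightarrow> bool \<Rightarrow> ('v, 'a) path \<Rightarrow> bool" where
  "cyc_ok _ m q \<longleftrightarrow> even (int (cyc_len m q) + pdegree Q q) \<or> CHAR('k) = 2"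

lemma cyc_sign_0 [simp]: "cyc_sign m q 0 = 1"
  by (simp add: cyc_sign_def)

lemma cyc_sign_Suc:
  assumes "i < length (snd q)"
  shows "cyc_sign m q (Suc i) = (cyc_sign m q i * cyc_step m ((rot Q ^^ i) q) :: 'k::field)"
proof -
  have "hd (rotate i (snd q)) = snd q ! i"
    using assms by (subst hd_rotate_conv_nth) auto
  then show ?thesis using assms
    by (simp add: cyc_sign_def cyc_step_def take_Suc_conv_app_nth power_int_add[symmetric] algebra_simps)
qed

text \<open>The exponent is the sum of the squares of \<open>cyc_len m q\<close> and the degree,
  which has the parity of their sum.\<close>

lemma cyc_sign_length:
  assumes "comp m q"
  shows "(cyc_sign m q (length (snd q)) :: 'k::field) =
    (if even (int (cyc_len m q) + pdegree Q q) then 1 else -1)"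
proof -
  let ?E = "int (length (snd q)) * int (cyc_len m q) + pdegree Q q * pdegree Q q"
  have ev: "even (int (cyc_len m q) + pdegree Q q) \<longleftrightarrow> even ?E"
    by (auto simp: cyc_len_def plength_def)
  have s: "cyc_sign m q (length (snd q)) = ((-1) powi ?E :: 'k)"
    by (simp add: cyc_sign_def pdegree_def)
  show ?thesis
  proof (cases "even ?E")
    case True
    show ?thesis unfolding s ev minus_one_even[OF True] by (simp only: True if_True)
  next
    case False
    show ?thesis unfolding s ev minus_one_odd[OF False] by (simp only: False if_False)
  qed
qed

text \<open>\<open>N\<^sup>0(q)\<close> sums over one period only, so the signs have to close up
  after \<open>period Q q\<close> steps and not just after the whole word. If the word is the
  \<open>t\<close>-th power of a word of length \<open>r\<close> and degree \<open>D\<close>, the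
  exponent for an anti-path is \<open>t * (r * r + D * D)\<close>, which has the parity of
  \<open>t * (r + D)\<close>.\<close>

lemma cyc_sign_period:
  assumes "comp m q" "cyc_ok TYPE('k) m q"
  shows "(cyc_sign m q (period Q q) :: 'k::field) = 1"
proof (cases "CHAR('k) = 2")
  case False
  let ?r = "period Q q"
  let ?D = "\<Sum>\<alpha>\<leftarrow>take ?r (snd q). degree Q \<alpha>"
  have ev: "even (int (cyc_len m q) + pdegree Q q)" using assms(2) False by (simp add: cyc_ok_def)
  obtain t where t: "length (snd q) = t * ?r" using period_dvd[OF assms(1)] by (metis dvd_def mult.commute)
  have "rotate ?r (snd q) = snd q" using period_props(2)[OF assms(1)] snd_rot_funpow by metis
  moreover have "t > 0" using t comp_length[OF assms(1)] by (cases t) auto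
  ultimately have "snd q = concat (replicate t (take ?r (snd q)))" using t by (intro rotate_periodic)
  then have "map (degree Q) (snd q) = concat (replicate t (map (degree Q) (take ?r (snd q))))"
    by (metis map_concat map_replicate)
  then have D: "pdegree Q q = int t * ?D"
    by (simp add: pdegree_def sum_list_concat_replicate)
  have "even (int ?r * int (cyc_len m q) + pdegree Q q * ?D)"
  proof (cases m)
    case True
    then show ?thesis using ev by (simp add: cyc_len_def)
  next
    case False
    then have "even (int t * (int ?r + ?D))" using ev D t
      by (simp add: cyc_len_def plength_def algebra_simps)
    then have "even (int t * (int ?r * int ?r + ?D * ?D))" by auto
    moreover have "int ?r * int (cyc_len m q) + pdegree Q q * ?D = int t * (int ?r * int ?r + ?D * ?D)"
      using False t D by (simp add: cyc_len_def plength_def algebra_simps)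
    ultimately show ?thesis by simp
  qed
  then show ?thesis by (simp add: cyc_sign_def minus_one_even)
qed (simp add: cyc_sign_def char_two)

subsection \<open>The basis elements on a cycle\<close>

lemma cyc0_inj [simp]: "comp m q \<Longrightarrow> comp m' q' \<Longrightarrow> cyc0 m q = cyc0 m' q' \<longleftrightarrow> m = m' \<and> q = q'"
  by (auto simp: cyc0_def comp_def prod_eq_iff split: if_splits)

lemma cyc0_core: "comp m q \<Longrightarrow> core (cyc0 m q)"
  by (auto simp: cyc0_def core_def)

lemma cyc0_basis: 
  assumes "comp m q"
  shows "cyc0 m q \<in> bardzell_basis Q (cyc_len m q) (cyc_deg m q)"
proof -
  have "fst q \<in> vertices Q" "mpath m q" "fst q = ptarget Q q" using assms by (auto simp: comp_def mpath_iff)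
  then show ?thesis
    by (cases q) (auto simp: bardzell_basis_good cyc0_def cyc_len_def cyc_deg_def good_iff plength_def pdegree_def)
qed

lemma cyc1_props:
  assumes "comp m q"
  shows "good (cyc1 m q)" "Lsame (cyc1 m q)" "lstrip (cyc1 m q) = cyc0 m q"
    "hd (snd (fst (cyc1 m q))) = last (snd q)" "plength (fst (cyc1 m q)) = Suc (cyc_len m q)"
proof -
  obtain y v where q: "q = (y, v)" "v \<noteq> []" "mpath m (y, v)" "y = ptarget Q (y, v)" "link m (last v) (hd v)"
    using assms by (cases q) (auto simp: comp_def)
  have s: "source Q (last v) = y" "y \<in> vertices Q" "last v \<in> arrows Q" using q by (auto simp: mpath_iff)
  have c: "cyc1 m q = (if m then ((y, [last v]), (y, last v # v)) else ((y, last v # v), (y, [last v])))"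
    using q s by (auto simp: cyc1_def pcomp_def arrow_path_def psource_def)
  have "good ((y, []), (y, v))" if m using q(3) q(4)[symmetric] s that by (simp add: good_iff)
  moreover have "good ((y, v), (y, []))" if "\<not> m" using q(3) q(4)[symmetric] s that by (simp add: good_iff)
  ultimately show "good (cyc1 m q)" unfolding c using q(2,5) q(4)[symmetric] s by (cases m) (auto simp: good_Cons)
  show "Lsame (cyc1 m q)" "lstrip (cyc1 m q) = cyc0 m q" "hd (snd (fst (cyc1 m q))) = last (snd q)"
    "plength (fst (cyc1 m q)) = Suc (cyc_len m q)"
    unfolding c using q(1) by (auto simp: cyc0_def cyc_len_def plength_def)
qed

text \<open>With \<open>cyc1_props\<close>: the pair \<open>cyc1 m (rot Q q)\<close> joins
  \<open>cyc0 m (rot Q q)\<close>, its left strip, to \<open>cyc0 m q\<close>, its right strip. An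
  orbit of rotations thus forms a polygon with the \<open>cyc0\<close> as vertices and the
  \<open>cyc1\<close> as edges.\<close>

lemma cyc1_rot:
  assumes "comp m q"
  shows "Rsame (cyc1 m (rot Q q))" "rstrip Q (cyc1 m (rot Q q)) = cyc0 m q"
    "hd (snd (fst (cyc1 m (rot Q q)))) = hd (snd q)"
proof -
  obtain \<alpha> w where q: "q = (target Q \<alpha>, \<alpha> # w)" using assms by (rule comp_elim)
  have c: "cyc1 m (rot Q q) = (if m then ((source Q \<alpha>, [] @ [\<alpha>]), (source Q \<alpha>, (\<alpha> # w) @ [\<alpha>]))
    else ((source Q \<alpha>, (\<alpha> # w) @ [\<alpha>]), (source Q \<alpha>, [] @ [\<alpha>])))"
    using q by (auto simp: cyc1_def rot_def pcomp_def arrow_path_def psource_def)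
  show "Rsame (cyc1 m (rot Q q))" "rstrip Q (cyc1 m (rot Q q)) = cyc0 m q"
    "hd (snd (fst (cyc1 m (rot Q q)))) = hd (snd q)"
    unfolding c by (cases m; simp only: if_True if_False strip_simps Rsame_simps q cyc0_def fst_conv snd_conv; simp)+
qed

lemma cyc0_nontrivial: "comp m q \<Longrightarrow> snd (fst (cyc0 m q)) \<noteq> [] \<or> snd (snd (cyc0 m q)) \<noteq> []"
  by (auto simp: cyc0_def comp_def)

lemma cyc1_unique_left: "comp m q \<Longrightarrow> good k \<Longrightarrow> Lsame k \<Longrightarrow> lstrip k = cyc0 m q \<longleftrightarrow> k = cyc1 m q"
  using lstrip_inj[of "cyc1 m q" k] cyc1_props[of m q] cyc0_nontrivial[of m q] by auto

lemma cyc1_unique_right: 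
  assumes "comp m q" "good k" "Rsame k"
  shows "rstrip Q k = cyc0 m q \<longleftrightarrow> k = cyc1 m (rot Q q)"
  using rstrip_inj[OF cyc1_props(1)[OF comp_rot[OF assms(1)]] cyc1_rot(1)[OF assms(1)] assms(2,3)]
    cyc1_rot[OF assms(1)] cyc0_nontrivial[OF assms(1)] by auto

lemma cyc1_inj:
  assumes "comp m q" "comp m' q'" "cyc1 m q = cyc1 m' q'"
  shows "m = m' \<and> q = q'"
proof -
  have "cyc0 m q = cyc0 m' q'"
    using cyc1_props(3)[OF assms(1)] cyc1_props(3)[OF assms(2)] assms(3) by simp
  then show ?thesis using cyc0_inj[OF assms(1,2)] by blast
qed

lemma cyc1_basis: 
  assumes "comp m q"
  shows "cyc1 m q \<in> bardzell_basis Q (Suc (cyc_len m q)) (cyc_deg m q)"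
proof -
  have "pdegree Q (pcomp (arr (last (snd q))) q) = degree Q (last (snd q)) + pdegree Q q" by (simp add: pdegree_pcomp)
  then show ?thesis using cyc1_props[OF assms]
    by (auto simp: bardzell_basis_good cyc1_def cyc_deg_def)
qed

lemma lsign_cyc1: "comp m q \<Longrightarrow> lsign (cyc_deg m q) (cyc1 m (rot Q q)) =
    ((-1) ^ cyc_len m q * cyc_step m q :: 'k::field)"
proof -
  assume q: "comp m q"
  have "(-1) powi (- pdegree Q q * e) = ((-1) powi (pdegree Q q * e) :: 'k)" for e
    by (simp add: power_int_minus_left)
  then have "lsign (cyc_deg m q) (cyc1 m (rot Q q)) = ((-1) powi (pdegree Q q * degree Q (hd (snd q))) :: 'k)"
    using q by (auto simp: lsign_def cyc1_rot cyc_deg_def)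
  moreover have "cyc_step m q = ((-1) ^ cyc_len m q * (-1) powi (pdegree Q q * degree Q (hd (snd q))) :: 'k)"
    by (simp add: cyc_step_def power_int_add)
  ultimately show ?thesis by simp
qed

lemma cyc_step_square [simp]: "cyc_step m q * (cyc_step m q * c) = (c :: 'k::field)"
  by (simp add: cyc_step_def)

text \<open>The differential along one edge of the polygon. On an orbit a cocycle is therefore
  determined by one value and the step signs.\<close>

lemma cocycle_cyc_step:
  fixes f :: "(('v, 'a) path \<times> ('v, 'a) path) \<Rightarrow>\<^sub>0 'k::field"
  assumes f: "f \<in> bardzell_cochains Q n d" and q: "comp m q" "cyc_len m q = n" "cyc_deg m q = d"
  shows "lk (bardzell_diff Q n d f) (cyc1 m (rot Q q)) = (-1) powi d * (-1) ^ n *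
    (cyc_step m q * lk f (cyc0 m (rot Q q)) - lk f (cyc0 m q))"
proof -
  have l: "(lsign d (cyc1 m (rot Q q)) :: 'k) = (-1) ^ n * cyc_step m q" using lsign_cyc1[OF q(1)] q by simp
  show ?thesis
    unfolding lookup_diff[OF f] l using cyc1_props[OF comp_rot[OF q(1)]] cyc1_rot[OF q(1)] q
    by (simp add: algebra_simps)
qed

lemma cyc0_diff:
  assumes q: "comp m q"
  shows "bardzell_diff Q (cyc_len m q) (cyc_deg m q) (sg (cyc0 m (rot Q q)) :: _ \<Rightarrow>\<^sub>0 'k::field) =
    smult ((-1) powi (cyc_deg m q) * (-1) ^ cyc_len m q)
      (smult (cyc_step m q) (sg (cyc1 m (rot Q q))) - sg (cyc1 m (rot Q (rot Q q))))"
proof (rule poly_mapping_eqI)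
  fix k
  let ?q = "rot Q q"
  have q': "comp m ?q" using q by (rule comp_rot)
  have c: "(sg (cyc0 m ?q) :: _ \<Rightarrow>\<^sub>0 'k) \<in> bardzell_cochains Q (cyc_len m q) (cyc_deg m q)"
    using sg_cochain[OF cyc0_basis[OF q']] by simp
  have 1: "lk (sg (cyc0 m ?q) :: _ \<Rightarrow>\<^sub>0 'k) (lstrip k) = (if k = cyc1 m ?q then 1 else 0)" if "good k" "Lsame k"
    using cyc1_unique_left[OF q' that] by (auto simp: lookup_single when_def)
  have 2: "lk (sg (cyc0 m ?q) :: _ \<Rightarrow>\<^sub>0 'k) (rstrip Q k) = (if k = cyc1 m (rot Q ?q) then 1 else 0)"
    if "good k" "Rsame k"
    using cyc1_unique_right[OF q' that] by (auto simp: lookup_single when_def)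
  have 3: "lk (sg k' :: _ \<Rightarrow>\<^sub>0 'k) k = (if k = k' then 1 else 0)" for k'
    by (auto simp: lookup_single when_def)
  have 4: "Lsame k \<and> good k \<and> plength (fst k) = Suc (cyc_len m q)" if "k = cyc1 m ?q"
    using cyc1_props[OF q'] that by simp
  have 5: "Rsame k \<and> good k \<and> plength (fst k) = Suc (cyc_len m q)" if "k = cyc1 m (rot Q ?q)"
    using cyc1_props[OF comp_rot[OF q']] cyc1_rot[OF q'] that by simp
  let ?L = "if k = cyc1 m ?q then (-1) ^ cyc_len m q * cyc_step m q else 0 :: 'k"
  let ?R = "if k = cyc1 m (rot Q ?q) then (-1) ^ cyc_len m q else 0 :: 'k"
  have "lk (bardzell_diff Q (cyc_len m q) (cyc_deg m q) (sg (cyc0 m ?q) :: _ \<Rightarrow>\<^sub>0 'k)) k =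
    (-1) powi (cyc_deg m q) * (?L - ?R)"
  proof (cases "good k \<and> plength (fst k) = Suc (cyc_len m q)")
    case True
    have "(if Lsame k then lsign (cyc_deg m q) k * lk (sg (cyc0 m ?q)) (lstrip k) else 0) = ?L"
      using True 1 4 lsign_cyc1[OF q] by auto
    moreover have "(if Rsame k then (-1) ^ cyc_len m q * lk (sg (cyc0 m ?q)) (rstrip Q k) else 0) = ?R"
      using True 2 5 by auto
    ultimately show ?thesis unfolding lookup_diff[OF c] using True by simp
  next
    case False
    then have "k \<noteq> cyc1 m ?q" "k \<noteq> cyc1 m (rot Q ?q)" using 4 5 by blast+
    moreover have "(good k \<and> plength (fst k) = Suc (cyc_len m q)) = False" using False by blast
    ultimately show ?thesis unfolding lookup_diff[OF c] by (simp only: if_False diff_zero mult_zero_right)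
  qed
  then show "lk (bardzell_diff Q (cyc_len m q) (cyc_deg m q) (sg (cyc0 m ?q) :: _ \<Rightarrow>\<^sub>0 'k)) k =
    lk (smult ((-1) powi (cyc_deg m q) * (-1) ^ cyc_len m q)
      (smult (cyc_step m q) (sg (cyc1 m (rot Q q))) - sg (cyc1 m (rot Q (rot Q q))))) k"
    by (auto simp: lookup_minus 3 algebra_simps simp del: smult_simps(5))
qed

definition cycN0 :: "bool \<Rightarrow> ('v, 'a) path \<Rightarrow> (('v, 'a) path \<times> ('v, 'a) path) \<Rightarrow>\<^sub>0 'k::field" where
  "cycN0 m q = (\<Sum>i<period Q q. Poly_Mapping.single (cyc0 m ((rot Q ^^ i) q)) (cyc_sign m q i))"

lemma lookup_cycN0:
  assumes "comp m q"
  shows "lk (cycN0 m q) k = (\<Sum>i<period Q q. if k = cyc0 m ((rot Q ^^ i) q) then cyc_sign m q i else 0)"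
  by (auto simp: cycN0_def lookup_sum lookup_single when_def intro!: sum.cong)

lemma lookup_cycN0_orbit:
  assumes "comp m q" "i < period Q q"
  shows "lk (cycN0 m q) (cyc0 m ((rot Q ^^ i) q)) = cyc_sign m q i"
proof -
  have "lk (cycN0 m q) (cyc0 m ((rot Q ^^ i) q)) = (\<Sum>j<period Q q. if j = i then cyc_sign m q j else 0)"
    unfolding lookup_cycN0[OF assms(1)] using assms orbit_inj[OF assms(1), of i]
    by (intro sum.cong refl) (auto simp: comp_rot_funpow)
  then show ?thesis using assms(2) by (simp add: sum.delta)
qed

lemma lookup_cycN0_nonzero:
  assumes "comp m q" "lk (cycN0 m q) k \<noteq> (0 :: 'k::field)"
  obtains i where "i < period Q q" "k = cyc0 m ((rot Q ^^ i) q)"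
proof -
  obtain i where "i \<in> {..<period Q q}" "(if k = cyc0 m ((rot Q ^^ i) q) then cyc_sign m q i else 0) \<noteq> (0 :: 'k)"
    using assms(2) unfolding lookup_cycN0[OF assms(1)] by (rule sum.not_neutral_contains_not_neutral)
  then show thesis using that by (auto split: if_splits)
qed

lemma cycN0_cochain:
  assumes "comp m q"
  shows "cycN0 m q \<in> bardzell_cochains Q (cyc_len m q) (cyc_deg m q)"
  unfolding bardzell_cochains_iff
  using lookup_cycN0_nonzero[OF assms] cyc0_basis[OF comp_rot_funpow[OF assms]] by (metis cyc_rot(3,4))

lemma cycN0_step:
  assumes q: "comp m q" "cyc_ok TYPE('k) m q" and p: "comp m p"
  shows "cyc_step m p * lk (cycN0 m q) (cyc0 m (rot Q p)) = (lk (cycN0 m q) (cyc0 m p) :: 'k::field)"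
proof (cases "\<exists>i. p = (rot Q ^^ i) q")
  case True
  then obtain i where i: "p = (rot Q ^^ i) q" "i < period Q q"
    using orbit_mod[OF q(1)] period_props(1)[OF q(1)] by (metis mod_less_divisor Suc_le_eq One_nat_def)
  have sg: "cyc_sign m q (Suc i) = (cyc_sign m q i * cyc_step m p :: 'k)"
    unfolding i(1) using i(2) period_props(4)[OF q(1)] by (intro cyc_sign_Suc) simp
  have "lk (cycN0 m q) (cyc0 m (rot Q p)) = (cyc_sign m q (Suc i) :: 'k)"
  \<comment> \<open>The polygon closes up here: after one period the coefficient must return to 1,
    which is \<open>cyc_sign_period\<close>.\<close>
  proof (cases "Suc i = period Q q")
    case True
    then have "rot Q p = (rot Q ^^ 0) q" using i(1) period_props(2)[OF q(1)] by (metis funpow.simps(1,2) comp_apply id_apply)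
    then show ?thesis using lookup_cycN0_orbit[OF q(1), of 0] period_props(1)[OF q(1)]
        cyc_sign_period[OF q] True by simp
  next
    case False
    then show ?thesis using lookup_cycN0_orbit[OF q(1), of "Suc i"] i by simp
  qed
  moreover have "lk (cycN0 m q) (cyc0 m p) = (cyc_sign m q i :: 'k)"
    unfolding i(1) by (rule lookup_cycN0_orbit[OF q(1) i(2)])
  ultimately show ?thesis unfolding sg by (simp add: mult_ac)
next
  case False
  have "lk (cycN0 m q) (cyc0 m p) = (0 :: 'k)"
    using False lookup_cycN0_nonzero[OF q(1)] p comp_rot_funpow[OF q(1)] by (metis cyc0_inj)
  moreover have "lk (cycN0 m q) (cyc0 m (rot Q p)) = (0 :: 'k)"
  proof (rule ccontr)
    assume "lk (cycN0 m q) (cyc0 m (rot Q p)) \<noteq> (0 :: 'k)"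
    then obtain i where "cyc0 m (rot Q p) = cyc0 m ((rot Q ^^ i) q)" using lookup_cycN0_nonzero[OF q(1)] by metis
    then have r: "rot Q p = (rot Q ^^ i) q" using comp_rot[OF p] comp_rot_funpow[OF q(1)] by simp
    have "p = (rot Q ^^ Suc (length (snd p) - 1)) p" using p comp_length[OF p] by simp
    also have "\<dots> = (rot Q ^^ (length (snd p) - 1)) (rot Q p)" by (simp only: funpow_Suc_right o_apply)
    also have "\<dots> = (rot Q ^^ (length (snd p) - 1 + i)) q" by (simp add: r funpow_add)
    finally show False using False by blast
  qed
  ultimately show ?thesis by simp
qed

lemma cycN0_cocycle:
  assumes q: "comp m q" "cyc_ok TYPE('k) m q"
  shows "bardzell_diff Q (cyc_len m q) (cyc_deg m q) (cycN0 m q) = (0 :: _ \<Rightarrow>\<^sub>0 'k::field)"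
proof (rule poly_mapping_eqI)
  fix k
  let ?N = "cycN0 m q :: _ \<Rightarrow>\<^sub>0 'k"
  have c: "?N \<in> bardzell_cochains Q (cyc_len m q) (cyc_deg m q)" using q(1) by (rule cycN0_cochain)
  show "lk (bardzell_diff Q (cyc_len m q) (cyc_deg m q) ?N) k = lk 0 k"
  proof (cases "\<exists>p. comp m p \<and> cyc_len m p = cyc_len m q \<and> cyc_deg m p = cyc_deg m q \<and> k = cyc1 m (rot Q p)")
    case True
    then obtain p where p: "comp m p" "cyc_len m p = cyc_len m q" "cyc_deg m p = cyc_deg m q" "k = cyc1 m (rot Q p)"
      by blast
    then show ?thesis using cocycle_cyc_step[OF c p(1-3)] cycN0_step[OF q p(1)] by simp
  next
    case False
    have "lk ?N (lstrip k) = 0" if "good k" "Lsame k"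
    proof (rule ccontr)
      assume "lk ?N (lstrip k) \<noteq> 0"
      then obtain i where "lstrip k = cyc0 m ((rot Q ^^ i) q)" by (rule lookup_cycN0_nonzero[OF q(1)])
      then have k: "k = cyc1 m ((rot Q ^^ i) q)" using cyc1_unique_left[OF comp_rot_funpow[OF q(1)] that] by simp
      obtain p where p: "comp m p" "rot Q p = (rot Q ^^ i) q" using rot_inverse[OF comp_rot_funpow[OF q(1)]] by metis
      then have "cyc_len m p = cyc_len m q" "cyc_deg m p = cyc_deg m q"
        using cyc_rot(7,8)[of m p] cyc_rot(3,4)[of m i q] by simp_all
      then show False using False p k by metis
    qed
    moreover have "lk ?N (rstrip Q k) = 0" if "good k" "Rsame k"
    proof (rule ccontr)
      assume "lk ?N (rstrip Q k) \<noteq> 0"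
      then obtain i where "rstrip Q k = cyc0 m ((rot Q ^^ i) q)" by (rule lookup_cycN0_nonzero[OF q(1)])
      then have k: "k = cyc1 m (rot Q ((rot Q ^^ i) q))"
        using cyc1_unique_right[OF comp_rot_funpow[OF q(1)] that] by simp
      then show False using False comp_rot_funpow[OF q(1), of i] by (metis cyc_rot(3,4))
    qed
    ultimately show ?thesis unfolding lookup_diff[OF c] by simp
  qed
qed

text \<open>The pair has common arrows on both sides, whereas a left strip never has a common first
  arrow and a right strip never a common last one.\<close>

lemma cyc1_terminal:
  assumes "comp m q"
  shows "terminal (cyc1 m q)"
proof -
  obtain p where "comp m p" "rot Q p = q" using rot_inverse[OF assms] by metis
  then have "Rsame (cyc1 m q)" using cyc1_rot(1) by blast
  show ?thesis unfolding terminal_def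
  proof (intro conjI allI impI notI)
    fix k' assume "good k'" "Lsame k'" "lstrip k' = cyc1 m q"
    then show False using lstrip_not_Lsame[of k'] cyc1_props(2)[OF assms] by simp
  next
    fix k' assume "good k'" "Rsame k'" "rstrip Q k' = cyc1 m q"
    then show False using rstrip_not_Rsame[of k'] \<open>Rsame (cyc1 m q)\<close> by simp
  qed
qed

end

section \<open>Spanning trees\<close>

lemma undirected_walk_append:
  "undirected_walk Q x (as @ bs) y \<longleftrightarrow> (\<exists>z. undirected_walk Q x as z \<and> undirected_walk Q z bs y)"
  by (induction as arbitrary: x) auto

text \<open>Acyclicity of a spanning tree speaks of distinct arrows only. A walk that uses
  \<open>\<gamma>\<close> twice is shortened: if both traversals start at the same vertex, the part
  between them is cut out with one copy of \<open>\<gamma>\<close>; if they are opposite, both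
  copies go.\<close>

lemma undirected_walk_distinct:
  assumes "undirected_walk Q x as y" "set as \<subseteq> F"
  obtains bs where "undirected_walk Q x bs y" "set bs \<subseteq> F" "distinct bs"
proof -
  have "\<exists>bs. undirected_walk Q x bs y \<and> set bs \<subseteq> F \<and> distinct bs"
    using assms
  proof (induction "length as" arbitrary: as rule: less_induct)
    case less
    show ?case
    proof (cases "distinct as")
      case False
      then obtain xs ys zs \<gamma> where as: "as = xs @ [\<gamma>] @ ys @ [\<gamma>] @ zs" using not_distinct_decomp by blast
      then obtain a b c e where w: "undirected_walk Q x xs a" "undirected_walk Q a [\<gamma>] b"
        "undirected_walk Q c [\<gamma>] e" "undirected_walk Q e zs y"
        using less.prems(1) by (fastforce simp only: undirected_walk_append)
      have "a = c \<or> a = e" using w(2,3) by auto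
      then obtain bs where "undirected_walk Q x bs y" "set bs \<subseteq> set as" "length bs < length as"
      proof
        assume "a = c"
        then have "undirected_walk Q x (xs @ [\<gamma>] @ zs) y" using w unfolding undirected_walk_append by blast
        then show thesis using as by (intro that[of "xs @ [\<gamma>] @ zs"]) auto
      next
        assume "a = e"
        then have "undirected_walk Q x (xs @ zs) y" using w unfolding undirected_walk_append by blast
        then show thesis using as by (intro that[of "xs @ zs"]) auto
      qed
      then show ?thesis using less.hyps[of bs] less.prems(2) by auto
    qed (use less.prems in blast)
  qed
  then show thesis using that by blast
qed

text \<open>A new arrow joins two different components of the forest, so the potential may be
  shifted by a constant on the component \<open>C\<close> of its source without disturbing the
  arrows treated before.\<close>

lemma forest_potential:
  fixes val :: "'a \<Rightarrow> 'k::ab_group_add"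
  assumes "finite F" "F \<subseteq> T"
    and acyclic: "\<not> (\<exists>x as. as \<noteq> [] \<and> distinct as \<and> set as \<subseteq> T \<and> undirected_walk Q x as x)"
  shows "\<exists>G. \<forall>\<alpha>\<in>F. G (source Q \<alpha>) - G (target Q \<alpha>) = val \<alpha>"
  using assms(1,2)
proof (induction F)
  case (insert \<alpha> F)
  then obtain G where G: "\<forall>\<beta>\<in>F. G (source Q \<beta>) - G (target Q \<beta>) = val \<beta>" by auto
  define C where "C = {x. \<exists>as. set as \<subseteq> F \<and> undirected_walk Q (source Q \<alpha>) as x}"
  have s: "source Q \<alpha> \<in> C" unfolding C_def by (rule CollectI, rule exI[of _ "[]"]) simp
  have t: "target Q \<alpha> \<notin> C"
  proof
    assume "target Q \<alpha> \<in> C"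
    then obtain as where "set as \<subseteq> F" "undirected_walk Q (source Q \<alpha>) as (target Q \<alpha>)" by (auto simp: C_def)
    then obtain bs where "set bs \<subseteq> F" "undirected_walk Q (source Q \<alpha>) bs (target Q \<alpha>)" "distinct bs"
      using undirected_walk_distinct by metis
    then have "undirected_walk Q (target Q \<alpha>) (\<alpha> # bs) (target Q \<alpha>)" "distinct (\<alpha> # bs)" "set (\<alpha> # bs) \<subseteq> T"
      using insert by auto
    then show False using acyclic by blast
  qed
  have C: "source Q \<beta> \<in> C \<longleftrightarrow> target Q \<beta> \<in> C" if "\<beta> \<in> F" for \<beta>
  proof -
    have *: "z \<in> C" if "y \<in> C" "undirected_walk Q y [\<beta>] z" for y z
    proof -
      obtain as where "set as \<subseteq> F" "undirected_walk Q (source Q \<alpha>) as y" using \<open>y \<in> C\<close> by (auto simp: C_def)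
      then have "set (as @ [\<beta>]) \<subseteq> F" "undirected_walk Q (source Q \<alpha>) (as @ [\<beta>]) z"
        using \<open>\<beta> \<in> F\<close> that(2) unfolding undirected_walk_append by auto
      then show ?thesis unfolding C_def by blast
    qed
    show ?thesis using *[of "source Q \<beta>" "target Q \<beta>"] *[of "target Q \<beta>" "source Q \<beta>"] by auto
  qed
  let ?G = "\<lambda>x. G x + (if x \<in> C then val \<alpha> - (G (source Q \<alpha>) - G (target Q \<alpha>)) else 0)"
  have "\<forall>\<beta>\<in>insert \<alpha> F. ?G (source Q \<beta>) - ?G (target Q \<beta>) = val \<beta>"
    using G C s t by auto
  then show ?case by (rule exI[of _ ?G])
qed simp

section \<open>The basis of the Bardzell cohomology\<close>

text \<open>\<open>R True\<close> and \<open>R False\<close> are the chosen representatives of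
  complete paths and of complete anti-paths.\<close>

locale gentle_tree = gentle Q for Q :: "('v, 'a) graded_quiver" +
  fixes T :: "'a set" and R :: "bool \<Rightarrow> ('v, 'a) path set"
  assumes tree: "spanning_tree Q T"
    and reps: "\<And>m. rotation_representatives Q {q. comp m q} (R m)"
begin

lemma tree_arrows: "T \<subseteq> arrows Q" and vertices_nonempty: "vertices Q \<noteq> {}"
  using tree by (auto simp: spanning_tree_def)

lemma tree_walk:
  assumes "x \<in> vertices Q" "y \<in> vertices Q"
  shows "\<exists>as. set as \<subseteq> T \<and> undirected_walk Q x as y"
  using tree assms unfolding spanning_tree_def by blast

lemma tree_constant:
  assumes "\<And>\<beta>. \<beta> \<in> T \<Longrightarrow> G (source Q \<beta>) = G (target Q \<beta>)" "x \<in> vertices Q" "y \<in> vertices Q"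
  shows "G x = G y"
proof -
  obtain as where "set as \<subseteq> T" "undirected_walk Q x as y"
    using tree_walk[OF assms(2,3)] by blast
  then show ?thesis
  proof (induction as arbitrary: x)
    case (Cons \<alpha> as)
    then show ?case using assms(1)[of \<alpha>] by auto
  qed simp
qed

lemma isolated_vertex:
  assumes "x \<in> vertices Q" "\<And>\<alpha>. \<alpha> \<in> arrows Q \<Longrightarrow> source Q \<alpha> \<noteq> x \<and> target Q \<alpha> \<noteq> x"
  shows "vertices Q = {x}"
proof -
  have "y = x" if y: "y \<in> vertices Q" for y
  proof -
    obtain as where "set as \<subseteq> T" "undirected_walk Q x as y"
      using tree_walk[OF assms(1) y] by blast
    then show ?thesis using assms(2) tree_arrows by (cases as) auto
  qed
  then show ?thesis using assms(1) by blast
qed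

text \<open>Rotation is invertible on complete words, its inverse being a power of it; so the
  equivalence closure adds nothing to the forward iterates.\<close>

lemma rotation_equiv_orbit:
  assumes "equivclp (\<lambda>p q. p \<in> {q. comp m q} \<and> q = rot Q p) p r" "comp m p"
  shows "\<exists>i. r = (rot Q ^^ i) p"
  using assms(1)
proof (induction rule: equivclp_induct)
  case base
  show ?case by (rule exI[of _ 0]) simp
next
  case (step y z)
  then obtain i where i: "y = (rot Q ^^ i) p" by blast
  from step(2) show ?case
  proof
    assume "y \<in> {q. comp m q} \<and> z = rot Q y"
    then have "z = (rot Q ^^ Suc i) p" using i by simp
    then show ?thesis by blast
  next
    assume z: "z \<in> {q. comp m q} \<and> y = rot Q z"
    then have "Suc (length (snd z) - 1) = length (snd z)" using comp_length[of m z] by simp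
    then have "z = (rot Q ^^ Suc (length (snd z) - 1)) z"
      using rot_length[of m z] z by (simp only: mem_Collect_eq)
    also have "\<dots> = (rot Q ^^ (length (snd z) - 1)) y" using z by (simp only: funpow_Suc_right o_apply)
    also have "\<dots> = (rot Q ^^ (length (snd z) - 1 + i)) p" using i by (simp add: funpow_add)
    finally show ?thesis by blast
  qed
qed

lemma rotation_equiv:
  "comp m p \<Longrightarrow> equivclp (\<lambda>p q. p \<in> {q. comp m q} \<and> q = rot Q p) p ((rot Q ^^ i) p)"
proof (induction i)
  case (Suc i)
  then show ?case
    using comp_rot_funpow[of m p i] by (auto intro: equivclp_into_equivclp)
qed simp

lemma reps_comp: "q \<in> R m \<Longrightarrow> comp m q"
  using reps[of m] by (auto simp: rotation_representatives_def)

lemma reps_exists: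
  assumes "comp m p"
  obtains q i where "q \<in> R m" "p = (rot Q ^^ i) q"
proof -
  let ?E = "equivclp (\<lambda>p q. p \<in> {q. comp m q} \<and> q = rot Q p)"
  obtain q where q: "q \<in> R m" "?E p q"
    using reps[of m] assms unfolding rotation_representatives_def by blast
  from q(2) have "?E q p" by (rule equivclp_sym)
  from rotation_equiv_orbit[OF this reps_comp[OF q(1)]] show thesis using that q(1) by blast
qed

lemma reps_unique:
  assumes "q \<in> R m" "q' \<in> R m" "(rot Q ^^ i) q = (rot Q ^^ j) q'"
  shows "q = q'"
proof -
  let ?E = "equivclp (\<lambda>p q. p \<in> {q. comp m q} \<and> q = rot Q p)"
  let ?z = "(rot Q ^^ i) q"
  have "?E ?z q" using rotation_equiv[OF reps_comp[OF assms(1)]] by (rule equivclp_sym)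
  moreover have "?E ?z q'"
    unfolding assms(3) using rotation_equiv[OF reps_comp[OF assms(2)]] by (rule equivclp_sym)
  moreover have "comp m ?z" using comp_rot_funpow reps_comp[OF assms(1)] .
  ultimately show ?thesis
    using reps[of m] assms(1,2) unfolding rotation_representatives_def by blast
qed

definition triv :: "'v \<Rightarrow> ('v, 'a) path \<times> ('v, 'a) path" where
  "triv x = ((x, []), (x, []))"

definition arrow_pair :: "'a \<Rightarrow> ('v, 'a) path \<times> ('v, 'a) path" where
  "arrow_pair \<alpha> = (arr \<alpha>, arr \<alpha>)"

definition mmax :: "bool \<Rightarrow> ('v, 'a) path \<Rightarrow> bool" where
  "mmax m u \<longleftrightarrow> mpath m u \<and> (\<forall>p q. composable Q p u \<and> composable Q u q \<and> mpath m (pcomp p (pcomp u q)) \<longrightarrow>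
     pcomp p (pcomp u q) = u)"

lemma maximal_mmax: "maximal_anti_path Q u \<longleftrightarrow> mmax False u" "maximal_path Q u \<longleftrightarrow> mmax True u"
  by (auto simp: mmax_def mpath_def maximal_anti_path_def maximal_path_def)

text \<open>The families of the theorem, with both kinds of cycles covered by the flag
  \<open>m\<close>; the inductive form supplies the case distinction for the proofs below.\<close>

inductive_set basis_set :: "nat \<Rightarrow> int \<Rightarrow> ((('v, 'a) path \<times> ('v, 'a) path) \<Rightarrow>\<^sub>0 'k::field) set"
  for n :: nat and d :: int where
  unit: "n = 0 \<Longrightarrow> d = 0 \<Longrightarrow> unit_element Q \<in> basis_set n d"
| cycle0: "q \<in> R m \<Longrightarrow> cyc_ok TYPE('k) m q \<Longrightarrow> n = cyc_len m q \<Longrightarrow> d = cyc_deg m q \<Longrightarrow> cycN0 m q \<in> basis_set n d"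
| cycle1: "q \<in> R m \<Longrightarrow> cyc_ok TYPE('k) m q \<Longrightarrow> n = Suc (cyc_len m q) \<Longrightarrow> d = cyc_deg m q \<Longrightarrow>
    sg (cyc1 m q) \<in> basis_set n d"
| max_anti: "mmax False u \<Longrightarrow> odot Q u w \<Longrightarrow> n = plength u \<Longrightarrow> d = pdegree Q w - pdegree Q u \<Longrightarrow>
    sg (u, w) \<in> basis_set n d"
| max_path: "mmax True u \<Longrightarrow> psource u = ptarget Q u \<Longrightarrow> n = 0 \<Longrightarrow> d = pdegree Q u \<Longrightarrow>
    sg ((psource u, []), u) \<in> basis_set n d"
| arrow: "\<alpha> \<in> arrows Q - T \<Longrightarrow> n = 1 \<Longrightarrow> d = 0 \<Longrightarrow> sg (arrow_pair \<alpha>) \<in> basis_set n d"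

lemma arrow_pair_eq: "arrow_pair \<alpha> = ((source Q \<alpha>, [\<alpha>]), (source Q \<alpha>, [\<alpha>]))"
  by (simp add: arrow_pair_def arrow_path_def)

lemma arrow_pair_props:
  assumes "\<alpha> \<in> arrows Q"
  shows "good (arrow_pair \<alpha>)" "Lsame (arrow_pair \<alpha>)" "Rsame (arrow_pair \<alpha>)"
    "lstrip (arrow_pair \<alpha>) = triv (source Q \<alpha>)" "rstrip Q (arrow_pair \<alpha>) = triv (target Q \<alpha>)"
    "plength (fst (arrow_pair \<alpha>)) = 1" "arrow_pair \<alpha> \<in> bardzell_basis Q 1 0"
proof -
  show g: "good (arrow_pair \<alpha>)" using assms by (simp add: arrow_pair_eq mpath_Cons good_iff)
  show "Lsame (arrow_pair \<alpha>)" "Rsame (arrow_pair \<alpha>)" by (simp_all add: arrow_pair_eq Rsame_def)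
  show "lstrip (arrow_pair \<alpha>) = triv (source Q \<alpha>)" by (simp add: arrow_pair_eq triv_def)
  show "rstrip Q (arrow_pair \<alpha>) = triv (target Q \<alpha>)"
    by (simp add: arrow_pair_eq triv_def rstrip_def path_butlast_def)
  show l: "plength (fst (arrow_pair \<alpha>)) = 1" by (simp add: arrow_pair_eq plength_def)
  show "arrow_pair \<alpha> \<in> bardzell_basis Q 1 0" using g l by (simp add: bardzell_basis_good) (simp add: arrow_pair_def)
qed

lemma triv_basis: "triv x \<in> bardzell_basis Q n d \<longleftrightarrow> x \<in> vertices Q \<and> n = 0 \<and> d = 0"
  by (auto simp: triv_def bardzell_basis_good good_iff plength_def pdegree_def)

lemma core_cases:
  assumes "good k" "core k"
  obtains x where "k = triv x" | m q where "comp m q" "k = cyc0 m q"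
proof -
  obtain y u v where k: "k = ((y, u), (y, v))" using assms(1) by (rule good_elim)
  then consider "u = []" "v = []" | "u = []" "comp True (y, v)" | "v = []" "comp False (y, u)"
    using assms(2) by (auto simp: core_def)
  then show thesis
  proof cases
    case 1
    then show ?thesis using that(1)[of y] k by (simp add: triv_def)
  next
    case 2
    then show ?thesis using that(2)[of True "(y, v)"] k by (simp add: cyc0_def)
  next
    case 3
    then show ?thesis using that(2)[of False "(y, u)"] k by (simp add: cyc0_def)
  qed
qed

lemma triv_not_cyc0: "comp m q \<Longrightarrow> triv x \<noteq> cyc0 m q"
  using cyc0_nontrivial[of m q] by (metis fst_conv snd_conv triv_def)

lemma strip_triv:
  assumes "good k"
  shows "Lsame k \<Longrightarrow> lstrip k = triv x \<longleftrightarrow> (\<exists>\<alpha>\<in>arrows Q. k = arrow_pair \<alpha> \<and> source Q \<alpha> = x)"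
    "Rsame k \<Longrightarrow> rstrip Q k = triv x \<longleftrightarrow> (\<exists>\<alpha>\<in>arrows Q. k = arrow_pair \<alpha> \<and> target Q \<alpha> = x)"
proof -
  show "lstrip k = triv x \<longleftrightarrow> (\<exists>\<alpha>\<in>arrows Q. k = arrow_pair \<alpha> \<and> source Q \<alpha> = x)" if L: "Lsame k"
  proof
    assume l: "lstrip k = triv x"
    obtain y \<alpha> u v where k: "k = ((y, \<alpha> # u), (y, \<alpha> # v))" using assms L by (rule Lsame_elim)
    then have "u = []" "v = []" "y = x" using l by (auto simp: triv_def)
    then show "\<exists>\<alpha>\<in>arrows Q. k = arrow_pair \<alpha> \<and> source Q \<alpha> = x"
      using assms k by (intro bexI[of _ \<alpha>]) (auto simp: good_Cons arrow_pair_eq)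
  qed (auto simp: arrow_pair_props)
  show "rstrip Q k = triv x \<longleftrightarrow> (\<exists>\<alpha>\<in>arrows Q. k = arrow_pair \<alpha> \<and> target Q \<alpha> = x)" if Rr: "Rsame k"
  proof
    assume l: "rstrip Q k = triv x"
    obtain \<beta> u v where k: "k = ((source Q \<beta>, u @ [\<beta>]), (source Q \<beta>, v @ [\<beta>]))" using assms Rr by (rule Rsame_elim)
    then have "u = []" "v = []" "target Q \<beta> = x" using l by (auto simp: triv_def)
    then show "\<exists>\<alpha>\<in>arrows Q. k = arrow_pair \<alpha> \<and> target Q \<alpha> = x"
      using assms k by (intro bexI[of _ \<beta>]) (auto simp: good_iff mpath_Cons arrow_pair_eq)
  qed (auto simp: arrow_pair_props)
qed

lemma lookup_unit: "lk (unit_element Q) k = (if \<exists>x\<in>vertices Q. k = triv x then 1 else 0)"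
proof (cases "\<exists>x\<in>vertices Q. k = triv x")
  case True
  then obtain x where x: "x \<in> vertices Q" "k = triv x" by blast
  then have "lk (unit_element Q) k = (\<Sum>y\<in>vertices Q. if y = x then 1 else 0)"
    by (auto simp: unit_element_def lookup_sum lookup_single when_def triv_def trivial_def intro!: sum.cong)
  then show ?thesis using x by auto
next
  case False
  then have "lk (unit_element Q) k = (\<Sum>y\<in>vertices Q. 0)"
    unfolding unit_element_def lookup_sum
    by (intro sum.cong refl) (auto simp: lookup_single when_def triv_def trivial_def)
  then show ?thesis using False by auto
qed

lemma diff_arrow_pair:
  assumes "g \<in> bardzell_cochains Q 0 0" "\<alpha> \<in> arrows Q"
  shows "lk (bardzell_diff Q 0 0 g) (arrow_pair \<alpha>) = lk g (triv (source Q \<alpha>)) - lk g (triv (target Q \<alpha>))"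
  unfolding lookup_diff[OF assms(1)] using arrow_pair_props[OF assms(2)] by (simp add: lsign_def)

lemma diff_graph:
  assumes g: "g \<in> bardzell_cochains Q 0 0" "\<And>k. lk g k \<noteq> 0 \<Longrightarrow> \<exists>x. k = triv x"
    and k: "\<And>\<alpha>. \<alpha> \<in> arrows Q \<Longrightarrow> k \<noteq> arrow_pair \<alpha>"
  shows "lk (bardzell_diff Q 0 0 g) k = 0"
proof -
  have "lk g (lstrip k) = 0" if "good k" "Lsame k"
    using g(2) strip_triv(1)[OF that] k by metis
  moreover have "lk g (rstrip Q k) = 0" if "good k" "Rsame k"
    using g(2) strip_triv(2)[OF that] k by metis
  ultimately show ?thesis unfolding lookup_diff[OF g(1)] by simp
qed

lemma unit_cocycle:
  "(unit_element Q :: _ \<Rightarrow>\<^sub>0 'k::field) \<in> bardzell_cochains Q 0 0"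
  "bardzell_diff Q 0 0 (unit_element Q :: _ \<Rightarrow>\<^sub>0 'k) = 0"
proof -
  show c: "(unit_element Q :: _ \<Rightarrow>\<^sub>0 'k) \<in> bardzell_cochains Q 0 0"
    by (auto simp: bardzell_cochains_iff lookup_unit triv_basis split: if_splits)
  show "bardzell_diff Q 0 0 (unit_element Q :: _ \<Rightarrow>\<^sub>0 'k) = 0"
  proof (rule poly_mapping_eqI)
    fix k
    show "lk (bardzell_diff Q 0 0 (unit_element Q :: _ \<Rightarrow>\<^sub>0 'k)) k = lk 0 k"
    proof (cases "\<exists>\<alpha>\<in>arrows Q. k = arrow_pair \<alpha>")
      case True
      then obtain \<alpha> where \<alpha>: "\<alpha> \<in> arrows Q" "k = arrow_pair \<alpha>" by blast
      then show ?thesis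
        using diff_arrow_pair[OF c \<alpha>(1)] arrow_vertices[OF \<alpha>(1)]
        by (simp add: lookup_unit triv_def)
    next
      case False
      have "\<exists>x. k' = triv x" if "lk (unit_element Q :: _ \<Rightarrow>\<^sub>0 'k) k' \<noteq> 0" for k'
        using that by (auto simp: lookup_unit split: if_splits)
      with False show ?thesis using diff_graph[OF c, of k] by auto
    qed
  qed
qed

text \<open>Maximality quantifies over prolongations by arbitrary paths on both sides; single arrows
  on one side already decide it.\<close>

lemma mmax_iff:
  assumes "mpath m (y, u)" "u \<noteq> []"
  shows "mmax m (y, u) \<longleftrightarrow> (\<forall>\<alpha>. \<not> link m \<alpha> (hd u)) \<and> (\<forall>\<beta>. \<not> link m (last u) \<beta>)"
proof
  assume M: "mmax m (y, u)"
  have y: "source Q (last u) = y" "ptarget Q (y, u) = target Q (hd u)"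
    using assms by (auto simp: mpath_iff ptarget_def)
  have "\<not> link m \<alpha> (hd u)" for \<alpha>
  proof
    assume l: "link m \<alpha> (hd u)"
    have "pcomp (arr \<alpha>) (pcomp (y, u) (y, [])) = (y, \<alpha> # u)" by (simp add: pcomp_def psource_def)
    moreover have "mpath m (y, \<alpha> # u)" using l assms y link_arrows[OF l] by (simp add: mpath_Cons)
    moreover have "composable Q (arr \<alpha>) (y, u)" "composable Q (y, u) (y, [])"
      using link_arrows[OF l] y by (auto simp: composable_def psource_def)
    ultimately have "(y, \<alpha> # u) = (y, u)" using M unfolding mmax_def by metis
    then show False by simp
  qed
  moreover have "\<not> link m (last u) \<beta>" for \<beta>
  proof
    assume l: "link m (last u) \<beta>"
    have e: "pcomp (target Q (hd u), []) (pcomp (y, u) (arr \<beta>)) = (source Q \<beta>, u @ [\<beta>])"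
      by (simp add: pcomp_def psource_def)
    moreover have "mpath m (source Q \<beta>, u @ [\<beta>])"
      using l assms y link_arrows[OF l] by (simp add: mpath_snoc)
    moreover have "composable Q (target Q (hd u), []) (y, u)" "composable Q (y, u) (arr \<beta>)"
      using link_arrows[OF l] y by (auto simp: composable_def psource_def)
    ultimately have "(source Q \<beta>, u @ [\<beta>]) = (y, u)" using M unfolding mmax_def by metis
    then show False by simp
  qed
  ultimately show "(\<forall>\<alpha>. \<not> link m \<alpha> (hd u)) \<and> (\<forall>\<beta>. \<not> link m (last u) \<beta>)" by blast
next
  assume N: "(\<forall>\<alpha>. \<not> link m \<alpha> (hd u)) \<and> (\<forall>\<beta>. \<not> link m (last u) \<beta>)"
  show "mmax m (y, u)"
    unfolding mmax_def
  proof (intro conjI allI impI, rule assms(1), elim conjE)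
    fix p q assume c: "composable Q p (y, u)" "composable Q (y, u) q" and mp: "mpath m (pcomp p (pcomp (y, u) q))"
    have s: "successively (link m) (snd p @ u @ snd q)"
      using mp by (simp add: mpath_iff pcomp_def)
    have "snd p = []" using s N assms(2) by (auto simp: successively_append_iff)
    moreover have "snd q = []" using s N assms(2) by (auto simp: successively_append_iff)
    ultimately show "pcomp p (pcomp (y, u) q) = (y, u)"
      using c(2) by (cases q) (simp add: pcomp_def composable_def psource_def)
  qed
qed

lemma mmax_trivial:
  assumes "mmax m (y, [])"
  shows "y \<in> vertices Q" "\<And>\<alpha>. \<alpha> \<in> arrows Q \<Longrightarrow> source Q \<alpha> \<noteq> y \<and> target Q \<alpha> \<noteq> y"
proof -
  show y: "y \<in> vertices Q" using assms by (simp add: mmax_def)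
  fix \<alpha> assume \<alpha>: "\<alpha> \<in> arrows Q"
  have m: "mpath m (source Q \<alpha>, [\<alpha>])" using \<alpha> by (simp add: mpath_Cons)
  have M: "pcomp p (pcomp (y, []) q) = (y, [])"
    if "composable Q p (y, [])" "composable Q (y, []) q" "mpath m (pcomp p (pcomp (y, []) q))" for p q
    using assms that unfolding mmax_def by blast
  show "source Q \<alpha> \<noteq> y \<and> target Q \<alpha> \<noteq> y"
  proof (intro conjI notI)
    assume "source Q \<alpha> = y"
    then show False using M[of "arr \<alpha>" "(y, [])"] m by (simp add: composable_def psource_def pcomp_def)
  next
    assume "target Q \<alpha> = y"
    then show False using M[of "(y, [])" "arr \<alpha>"] m by (simp add: composable_def psource_def pcomp_def)
  qed
qed

lemma terminal_same: "Lsame k \<Longrightarrow> Rsame k \<Longrightarrow> terminal k"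
  using lstrip_not_Lsame rstrip_not_Rsame unfolding terminal_def by blast

lemma terminal_iff:
  "terminal ((y, u), (y, v)) \<longleftrightarrow>
    (\<forall>\<alpha>. \<not> good ((y, \<alpha> # u), (y, \<alpha> # v))) \<and>
    (\<forall>\<beta>. target Q \<beta> = y \<longrightarrow> \<not> good ((source Q \<beta>, u @ [\<beta>]), (source Q \<beta>, v @ [\<beta>])))"
proof -
  have "(\<forall>k'. good k' \<longrightarrow> Lsame k' \<longrightarrow> lstrip k' \<noteq> ((y, u), (y, v))) \<longleftrightarrow>
    (\<forall>\<alpha>. \<not> good ((y, \<alpha> # u), (y, \<alpha> # v)))" (is "?a \<longleftrightarrow> ?b")
  proof
    assume ?a
    then show ?b by (metis Lsame_simps(1) strip_simps(1))
  next
    assume b: ?b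
    show ?a
    proof (intro allI impI notI)
      fix k' assume k': "good k'" "Lsame k'" "lstrip k' = ((y, u), (y, v))"
      obtain y' \<alpha> u' v' where "k' = ((y', \<alpha> # u'), (y', \<alpha> # v'))" using k'(1,2) by (rule Lsame_elim)
      then show False using k' b by simp
    qed
  qed
  moreover have "(\<forall>k'. good k' \<longrightarrow> Rsame k' \<longrightarrow> rstrip Q k' \<noteq> ((y, u), (y, v))) \<longleftrightarrow>
    (\<forall>\<beta>. target Q \<beta> = y \<longrightarrow> \<not> good ((source Q \<beta>, u @ [\<beta>]), (source Q \<beta>, v @ [\<beta>])))" (is "?a \<longleftrightarrow> ?b")
  proof
    assume ?a
    then show ?b by (metis Rsame_simps(1) strip_simps(2))
  next
    assume b: ?b
    show ?a
    proof (intro allI impI notI)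
      fix k' assume k': "good k'" "Rsame k'" "rstrip Q k' = ((y, u), (y, v))"
      obtain \<beta> u' v' where "k' = ((source Q \<beta>, u' @ [\<beta>]), (source Q \<beta>, v' @ [\<beta>]))" using k'(1,2) by (rule Rsame_elim)
      then show False using k' b by simp
    qed
  qed
  ultimately show ?thesis by (simp add: terminal_def)
qed

text \<open>An extension of the pair prolongs both components, so one maximal component suffices to
  exclude it.\<close>

lemma mmax_terminal:
  assumes g: "good ((y, u), (y, v))" and "mmax False (y, u) \<or> mmax True (y, v)"
  shows "terminal ((y, u), (y, v))"
proof -
  have paths: "mpath False (y, u)" "mpath True (y, v)" using g by (auto simp: good_iff)
  have False if "good ((y, \<alpha> # u), (y, \<alpha> # v))" for \<alpha>
    using assms(2)
  proof
    assume M: "mmax False (y, u)"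
    show False
    proof (cases "u = []")
      case True
      then show ?thesis using that mmax_trivial(2)[of False y \<alpha>] M by (simp add: good_Cons)
    next
      case False
      then show ?thesis using that mmax_iff[OF paths(1) False] M by (auto simp: good_Cons)
    qed
  next
    assume M: "mmax True (y, v)"
    show False
    proof (cases "v = []")
      case True
      then show ?thesis using that g mmax_trivial(2)[of True y \<alpha>] M by (simp add: good_iff mpath_Cons)
    next
      case False
      then show ?thesis using that mmax_iff[OF paths(2) False] M by (auto simp: good_Cons)
    qed
  qed
  moreover have False if "target Q \<beta> = y" "good ((source Q \<beta>, u @ [\<beta>]), (source Q \<beta>, v @ [\<beta>]))" for \<beta>
    using assms(2)
  proof
    assume M: "mmax False (y, u)"
    show False
    proof (cases "u = []")
      case True
      then show ?thesis using that mmax_trivial(2)[of False y \<beta>] M by (simp add: good_iff mpath_Cons)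
    next
      case False
      then show ?thesis using that mmax_iff[OF paths(1) False] M by (auto simp: good_snoc)
    qed
  next
    assume M: "mmax True (y, v)"
    show False
    proof (cases "v = []")
      case True
      then show ?thesis using that mmax_trivial(2)[of True y \<beta>] M by (simp add: good_iff mpath_Cons)
    next
      case False
      then show ?thesis using that mmax_iff[OF paths(2) False] M by (auto simp: good_snoc)
    qed
  qed
  ultimately show ?thesis unfolding terminal_iff by blast
qed

lemma odot_pair:
  assumes "odot Q u w" "mpath False u"
  obtains y u' v' where "u = (y, u')" "w = (y, v')" "good ((y, u'), (y, v'))" "\<not> Lsame (u, w)" "\<not> Rsame (u, w)"
proof -
  obtain y u' z v' where uw: "u = (y, u')" "w = (z, v')" by (cases u; cases w) auto
  then show thesis using assms that[of y u' v']
    by (auto simp: odot_def parallel_def psource_def good_iff mpath_def Lsame_def Rsame_def)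
qed

lemma basis_set_cocycle:
  fixes s :: "(('v, 'a) path \<times> ('v, 'a) path) \<Rightarrow>\<^sub>0 'k::field"
  assumes "s \<in> basis_set n d"
  shows "s \<in> bardzell_cochains Q n d" "bardzell_diff Q n d s = 0"
proof -
  have "s \<in> bardzell_cochains Q n d \<and> bardzell_diff Q n d s = 0"
    using assms
  proof cases
    case unit
    then show ?thesis using unit_cocycle by simp
  next
    case (cycle0 q m)
    then show ?thesis
      using cycN0_cochain[OF reps_comp[OF cycle0(2)]] cycN0_cocycle[OF reps_comp[OF cycle0(2)] cycle0(3)] by simp
  next
    case (cycle1 q m)
    note c = reps_comp[OF cycle1(2)]
    have "cyc1 m q \<in> bardzell_basis Q n d" using cyc1_basis[OF c] cycle1 by simp
    then show ?thesis using sg_cochain terminal_cocycle cyc1_terminal[OF c] cycle1(1) by blast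
  next
    case (max_anti u w)
    have "mpath False u" using max_anti(2) by (simp add: mmax_def)
    with max_anti(3) obtain y u' v' where uw: "u = (y, u')" "w = (y, v')" "good ((y, u'), (y, v'))"
      by (rule odot_pair)
    then have "(u, w) \<in> bardzell_basis Q n d" using max_anti by (simp add: bardzell_basis_good)
    moreover have "terminal (u, w)" using mmax_terminal[OF uw(3)] max_anti(2) uw by simp
    ultimately show ?thesis using sg_cochain terminal_cocycle max_anti(1) by blast
  next
    case (max_path u)
    obtain y u' where u: "u = (y, u')" by (cases u)
    have g: "good ((y, []), (y, u'))"
      using max_path u by (auto simp: good_iff mmax_def mpath_iff psource_def)
    then have "((psource u, []), u) \<in> bardzell_basis Q n d"
      using max_path u by (simp add: bardzell_basis_good psource_def plength_def) (simp add: pdegree_def)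
    moreover have "terminal ((psource u, []), u)" using mmax_terminal[OF g] max_path(2) u by (simp add: psource_def)
    ultimately show ?thesis using sg_cochain terminal_cocycle max_path(1) by blast
  next
    case (arrow \<alpha>)
    then have "arrow_pair \<alpha> \<in> bardzell_basis Q n d" "terminal (arrow_pair \<alpha>)"
      using arrow_pair_props[of \<alpha>] terminal_same by auto
    then show ?thesis using sg_cochain terminal_cocycle arrow(1) by blast
  qed
  then show "s \<in> bardzell_cochains Q n d" "bardzell_diff Q n d s = 0" by auto
qed

text \<open>A maximal trivial path sits at an isolated vertex, and connectedness leaves no other
  vertex. The unit, the pair from the maximal anti-path and the pair from the closed maximal path
  are then one and the same element \<open>(x, x)\<close>, so the overlap of these families causes
  no linear dependence.\<close>

lemma isolated_unit:
  assumes "mmax m (y, [])"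
  shows "(unit_element Q :: _ \<Rightarrow>\<^sub>0 'k::field) = sg (triv y)"
proof -
  have "vertices Q = {y}" using isolated_vertex mmax_trivial[OF assms] by blast
  then show ?thesis by (simp add: unit_element_def triv_def trivial_def)
qed

text \<open>The shape of a pair in the support, a vertex, a rotation of a cycle or neither,
  determines the basis element it belongs to. This gives disjointness of supports in
  \<open>basis_set_disjoint\<close>.\<close>

lemma basis_set_owner:
  fixes s :: "(('v, 'a) path \<times> ('v, 'a) path) \<Rightarrow>\<^sub>0 'k::field"
  assumes "s \<in> basis_set n d" "lk s k \<noteq> 0"
  obtains (unit) x where "k = triv x" "s = unit_element Q"
  | (cycle) m q i where "q \<in> R m" "k = cyc0 m ((rot Q ^^ i) q)" "s = cycN0 m q"
  | (single) "s = sg k" "\<And>x. k \<noteq> triv x" "\<And>m q. comp m q \<Longrightarrow> k \<noteq> cyc0 m q"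
  using assms(1)
proof cases
  case unit
  then show ?thesis using assms(2) that(1) by (auto simp: lookup_unit split: if_splits)
next
  case (cycle0 q m)
  then obtain i where "k = cyc0 m ((rot Q ^^ i) q)" using assms(2) lookup_cycN0_nonzero[OF reps_comp] by metis
  then show ?thesis using that(2) cycle0 by blast
next
  case (cycle1 q m)
  then have k: "k = cyc1 m q" using assms(2) by (auto simp: lookup_single when_def split: if_splits)
  have "Lsame k" using k cycle1 cyc1_props(2)[OF reps_comp] by simp
  then have "\<not> core k" using core_not_same by blast
  then have "k \<noteq> triv x" "comp m q \<Longrightarrow> k \<noteq> cyc0 m q" for x m q
    using cyc0_core[of m q] by (auto simp: triv_def core_def)
  then show ?thesis using that(3) k cycle1(1) by blast
next
  case (max_anti u w)
  then have k: "k = (u, w)" using assms(2) by (auto simp: lookup_single when_def split: if_splits)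
  have mp: "mpath False u" using max_anti(2) by (simp add: mmax_def)
  with max_anti(3) obtain y u' v' where uw: "u = (y, u')" "w = (y, v')" "good ((y, u'), (y, v'))"
    by (rule odot_pair)
  show ?thesis
  proof (cases "u' = []")
    case True
    have M: "mmax False (y, [])" using max_anti(2) uw True by simp
    have "v' = []"
    proof (rule ccontr)
      assume "v' \<noteq> []"
      then have "last v' \<in> set v'" "set v' \<subseteq> arrows Q" "source Q (last v') = y"
        using uw(3) by (auto simp: good_iff mpath_iff)
      then show False using mmax_trivial(2)[OF M, of "last v'"] by blast
    qed
    then show ?thesis using that(1)[of y] isolated_unit[OF M, where 'k = 'k] k uw True max_anti(1) by (simp add: triv_def)
  next
    case False
    \<comment> \<open>A complete anti-path can be prolonged by its own arrows, so it is never
      maximal.\<close>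
    have "k \<noteq> cyc0 m q" if "comp m q" for m q
    proof
      assume e: "k = cyc0 m q"
      then have "\<not> m" "q = u" using k uw False by (auto simp: cyc0_def split: if_splits)
      then have "link False (last u') (hd u')" using that uw by (simp add: comp_def)
      then show False using mmax_iff[of False y u'] max_anti(2) mp uw False by blast
    qed
    then show ?thesis using that(3) k uw False max_anti(1) by (auto simp: triv_def)
  qed
next
  case (max_path u)
  then have k: "k = ((psource u, []), u)" using assms(2) by (auto simp: lookup_single when_def split: if_splits)
  obtain y u' where u: "u = (y, u')" by (cases u)
  have mp: "mpath True u" using max_path(2) by (simp add: mmax_def)
  show ?thesis
  proof (cases "u' = []")
    case True
    have M: "mmax True (y, [])" using max_path(2) u True by simp
    then show ?thesis using that(1)[of y] isolated_unit[OF M, where 'k = 'k] k u True max_path(1) by (simp add: triv_def psource_def)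
  next
    case False
    have "k \<noteq> cyc0 m q" if "comp m q" for m q
    proof
      assume e: "k = cyc0 m q"
      then have "m" "q = u" using k u False that by (auto simp: cyc0_def comp_def split: if_splits)
      then have "link True (last u') (hd u')" using that u by (simp add: comp_def)
      then show False using mmax_iff[of True y u'] max_path(2) mp u False by blast
    qed
    then show ?thesis using that(3) k u False max_path(1) by (auto simp: triv_def)
  qed
next
  case (arrow \<alpha>)
  then have k: "k = arrow_pair \<alpha>" using assms(2) by (auto simp: lookup_single when_def split: if_splits)
  have "Lsame k" using k arrow_pair_props(2) arrow(2) by simp
  then have "\<not> core k" using core_not_same by blast
  then have "k \<noteq> triv x" "comp m q \<Longrightarrow> k \<noteq> cyc0 m q" for x m q
    using cyc0_core[of m q] by (auto simp: triv_def core_def)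
  then show ?thesis using that(3) k arrow(1) by blast
qed

lemma basis_set_disjoint:
  fixes s :: "(('v, 'a) path \<times> ('v, 'a) path) \<Rightarrow>\<^sub>0 'k::field"
  assumes s: "s \<in> basis_set n d" "lk s k \<noteq> 0" and s': "s' \<in> basis_set n d" "lk s' k \<noteq> 0"
  shows "s = s'"
  using s
proof (cases rule: basis_set_owner)
  case (unit x)
  from s' show ?thesis
    by (cases rule: basis_set_owner) (use unit triv_not_cyc0 comp_rot_funpow reps_comp in \<open>metis+\<close>)
next
  case (cycle m q i)
  note c = comp_rot_funpow[OF reps_comp[OF cycle(1)]]
  from s' show ?thesis
  proof (cases rule: basis_set_owner)
    case (unit x)
    then show ?thesis using cycle triv_not_cyc0[OF c] by metis
  next
    case (cycle m' q' j)
    note c' = comp_rot_funpow[OF reps_comp[OF cycle(1)]]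
    have "m = m'" "(rot Q ^^ i) q = (rot Q ^^ j) q'"
      using cyc0_inj[OF c c', of i j] cycle(2) \<open>k = cyc0 m ((rot Q ^^ i) q)\<close> by auto
    then show ?thesis using reps_unique[of q m q' i j] cycle \<open>q \<in> R m\<close> \<open>s = cycN0 m q\<close> by simp
  next
    case single
    then show ?thesis using cycle(2) c by blast
  qed
next
  case single
  from s' show ?thesis
    by (cases rule: basis_set_owner) (use single comp_rot_funpow reps_comp in \<open>metis+\<close>)
qed

end

section \<open>Linear independence modulo coboundaries\<close>

context gentle_tree begin

text \<open>Both sums of the differential produce only pairs with a common outer arrow.\<close>

lemma lookup_coboundary:
  assumes "f \<in> bardzell_coboundaries Q n d" "\<not> Lsame k" "\<not> Rsame k"
  shows "lk f k = 0"
  using assms by (cases n) (auto simp: bardzell_coboundaries_def lookup_diff)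

lemma basis_set_single:
  assumes s: "(sg k :: _ \<Rightarrow>\<^sub>0 'k::field) \<in> basis_set n d" and L: "Lsame k"
  shows "(\<exists>m. \<exists>q\<in>R m. k = cyc1 m q) \<or> (\<exists>\<alpha>\<in>arrows Q - T. k = arrow_pair \<alpha>)"
proof -
  have nc: "\<not> core k" using L core_not_same by blast
  have l: "lk (sg k :: _ \<Rightarrow>\<^sub>0 'k) k = 1" by simp
  have e: "k = j" if "sg k = (sg j :: _ \<Rightarrow>\<^sub>0 'k)" for j
    using l unfolding that by (simp add: lookup_single when_def split: if_splits)
  from s show ?thesis
  proof cases
    case unit
    then have "lk (unit_element Q :: _ \<Rightarrow>\<^sub>0 'k) k \<noteq> 0" using l by simp
    then show ?thesis using nc by (auto simp: lookup_unit triv_def core_def split: if_splits)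
  next
    case (cycle0 q m)
    then have "lk (cycN0 m q :: _ \<Rightarrow>\<^sub>0 'k) k \<noteq> 0" using l by simp
    then show ?thesis
      using lookup_cycN0_nonzero[OF reps_comp[OF cycle0(2)]] cyc0_core[OF comp_rot_funpow[OF reps_comp[OF cycle0(2)]]] nc
      by metis
  next
    case (cycle1 q m)
    then show ?thesis using e by blast
  next
    case (max_anti u w)
    have mp: "mpath False u" using max_anti(2) by (simp add: mmax_def)
    have "\<not> Lsame (u, w)" using max_anti(3) mp by (rule odot_pair)
    then show ?thesis using e[OF max_anti(1)] L by simp
  next
    case (max_path u)
    then show ?thesis using e[OF max_path(1)] L by simp
  next
    case (arrow \<alpha>)
    then show ?thesis using e by blast
  qed
qed

lemma cyc1_not_arrow_pair: "comp m q \<Longrightarrow> \<alpha> \<in> arrows Q \<Longrightarrow> cyc1 m q \<noteq> arrow_pair \<alpha>"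
  using cyc1_props(3) arrow_pair_props(4) triv_not_cyc0 by metis

lemma basis_set_cyc1:
  assumes "(sg (cyc1 m q) :: _ \<Rightarrow>\<^sub>0 'k::field) \<in> basis_set n d" "comp m q"
  shows "q \<in> R m"
  using basis_set_single[OF assms(1) cyc1_props(2)[OF assms(2)]]
proof (elim disjE exE bexE)
  fix m' q' assume "q' \<in> R m'" "cyc1 m q = cyc1 m' q'"
  then show ?thesis using cyc1_inj[OF assms(2) reps_comp] by blast
next
  fix \<alpha> assume "\<alpha> \<in> arrows Q - T" "cyc1 m q = arrow_pair \<alpha>"
  then show ?thesis using cyc1_not_arrow_pair[OF assms(2)] by blast
qed

lemma basis_set_arrow_pair:
  assumes "(sg (arrow_pair \<alpha>) :: _ \<Rightarrow>\<^sub>0 'k::field) \<in> basis_set n d" "\<alpha> \<in> arrows Q"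
  shows "\<alpha> \<notin> T"
proof -
  have "\<alpha> = \<beta>" if "arrow_pair \<alpha> = arrow_pair \<beta>" for \<beta> using that by (simp add: arrow_pair_eq)
  then show ?thesis
    using basis_set_single[OF assms(1) arrow_pair_props(2)[OF assms(2)]] cyc1_not_arrow_pair[OF reps_comp] assms(2)
    by (metis DiffE)
qed

lemma basis_sum_lookup:
  fixes c :: "_ \<Rightarrow> 'k::field"
  assumes K: "finite K" "K \<subseteq> basis_set n d" and s: "s \<in> K" "lk s k \<noteq> 0"
  shows "lk (\<Sum>t\<in>K. smult (c t) t) k = c s * lk s k"
proof -
  have "lk (\<Sum>t\<in>K. smult (c t) t) k = (\<Sum>t\<in>K. if t = s then c s * lk s k else 0)"
    unfolding lookup_sum lookup_smult
  proof (intro sum.cong refl)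
    fix t assume t: "t \<in> K"
    show "c t * lk t k = (if t = s then c s * lk s k else 0)"
      using basis_set_disjoint[of s n d k t] K(2) s t by auto
  qed
  then show ?thesis using K(1) s(1) by simp
qed

lemma basis_sum_lookup_zero:
  fixes c :: "_ \<Rightarrow> 'k::field"
  assumes K: "K \<subseteq> basis_set n d" and L: "Lsame k" and k: "sg k \<notin> K"
  shows "lk (\<Sum>t\<in>K. smult (c t) t) k = 0"
proof -
  have "lk t k = 0" if t: "t \<in> K" for t
  proof (rule ccontr)
    assume nz: "lk t k \<noteq> 0"
    have nc: "\<not> core k" using L core_not_same by blast
    have tb: "t \<in> basis_set n d" using K t by blast
    from tb nz show False
    proof (cases rule: basis_set_owner)
      case (unit x)
      then show ?thesis using nc by (simp add: triv_def core_def)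
    next
      case (cycle m q i)
      then show ?thesis using nc cyc0_core[OF comp_rot_funpow[OF reps_comp[OF cycle(1)]]] by simp
    next
      case single
      then show ?thesis using k t by simp
    qed
  qed
  then show ?thesis by (simp add: lookup_sum)
qed

text \<open>Along the edges where \<open>X\<close> vanishes, \<open>g\<close> is transported from
  vertex to vertex by the step signs. These cover the polygon except for one edge, and as the
  product of all signs is 1, the value of \<open>X\<close> at that edge vanishes too.\<close>

lemma cycle_coboundary:
  fixes X :: "(('v, 'a) path \<times> ('v, 'a) path) \<Rightarrow>\<^sub>0 'k::field"
  assumes X: "X \<in> bardzell_coboundaries Q (Suc (cyc_len m q)) (cyc_deg m q)"
    and q: "comp m q" "cyc_ok TYPE('k) m q"
    and z: "\<And>i. Suc i < period Q q \<Longrightarrow> lk X (cyc1 m ((rot Q ^^ Suc i) q)) = 0"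
  shows "lk X (cyc1 m q) = 0"
proof -
  obtain g where g: "g \<in> bardzell_cochains Q (cyc_len m q) (cyc_deg m q)"
    "X = bardzell_diff Q (cyc_len m q) (cyc_deg m q) g"
    using X by (auto simp: bardzell_coboundaries_def)
  let ?a = "\<lambda>i. lk g (cyc0 m ((rot Q ^^ i) q))"
  have X': "lk X (cyc1 m ((rot Q ^^ Suc i) q)) = (-1) powi cyc_deg m q * (-1) ^ cyc_len m q *
    (cyc_step m ((rot Q ^^ i) q) * ?a (Suc i) - ?a i)" for i
    unfolding g(2) using cocycle_cyc_step[OF g(1) comp_rot_funpow[OF q(1)], of i] by simp
  have a: "?a i = cyc_sign m q i * ?a 0" if "i < period Q q" for i
    using that
  proof (induction i)
    case (Suc i)
    have "cyc_step m ((rot Q ^^ i) q) * ?a (Suc i) = ?a i"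
      using X'[of i] z[OF Suc.prems] by simp
    then have "?a (Suc i) = cyc_step m ((rot Q ^^ i) q) * ?a i" by (metis cyc_step_square)
    moreover have "cyc_sign m q (Suc i) = (cyc_sign m q i * cyc_step m ((rot Q ^^ i) q) :: 'k)"
      using Suc.prems period_props(4)[OF q(1)] by (intro cyc_sign_Suc) simp
    ultimately show ?case using Suc by (simp add: mult_ac)
  qed simp
  obtain r where r: "period Q q = Suc r" using period_props(1)[OF q(1)] by (cases "period Q q") auto
  have per: "(rot Q ^^ Suc r) q = q" using period_props(2)[OF q(1)] r by simp
  have "cyc_sign m q (Suc r) = (cyc_sign m q r * cyc_step m ((rot Q ^^ r) q) :: 'k)"
    using r period_props(4)[OF q(1)] by (intro cyc_sign_Suc) simp
  then have s: "cyc_sign m q r * cyc_step m ((rot Q ^^ r) q) = (1 :: 'k)"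
    using cyc_sign_period[OF q] r by simp
  have "cyc_step m ((rot Q ^^ r) q) = (cyc_sign m q r :: 'k)"
    using cyc_step_square[of m "(rot Q ^^ r) q" "cyc_sign m q r :: 'k"] s by (simp add: mult.commute)
  moreover have "?a r = cyc_sign m q r * ?a 0" using a r by simp
  ultimately show ?thesis using X'[of r] unfolding per by simp
qed

text \<open>Each basis element has coefficient 1 at some pair where a combination that is a
  coboundary must vanish. For most families this pair has no common outer arrow. For edges of a
  polygon and arrows outside the tree, the combination vanishes on the other edges of the polygon,
  respectively on the tree, and this forces the vanishing there.\<close>

lemma basis_set_independent:
  fixes c :: "_ \<Rightarrow> 'k::field"
  assumes K: "finite K" "K \<subseteq> basis_set n d"
    and X: "(\<Sum>s\<in>K. smult (c s) s) \<in> bardzell_coboundaries Q n d"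
  shows "\<forall>s\<in>K. c s = 0"
proof
  fix s assume s: "s \<in> K"
  let ?X = "\<Sum>s\<in>K. smult (c s) s"
  have single: "c s = 0" if "lk s k = 1" "lk ?X k = 0" for k
    using basis_sum_lookup[OF K s, of k c] that by simp
  have core: "c s = 0" if k: "lk s k = 1" "\<not> Lsame k" "\<not> Rsame k" for k
    using single[OF k(1)] lookup_coboundary[OF X k(2,3)] .
  have "s \<in> basis_set n d" using K s by blast
  then show "c s = 0"
  proof cases
    case unit
    obtain x where "x \<in> vertices Q" using vertices_nonempty by blast
    then show ?thesis using unit core[of "triv x"] by (auto simp: lookup_unit) (auto simp: triv_def)
  next
    case (cycle0 q m)
    have q: "comp m q" using cycle0(2) by (rule reps_comp)
    have "lk s (cyc0 m q) = 1"
      unfolding cycle0(1) using lookup_cycN0_orbit[OF q, of 0] period_props(1)[OF q] by (simp add: Suc_le_eq)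
    then show ?thesis using core core_not_same[OF cyc0_core[OF q]] by blast
  next
    case (cycle1 q m)
    have q: "comp m q" using cycle1(2) by (rule reps_comp)
    have "lk ?X (cyc1 m ((rot Q ^^ Suc i) q)) = 0" if i: "Suc i < period Q q" for i
    proof (rule basis_sum_lookup_zero[OF K(2)])
      have c: "comp m ((rot Q ^^ Suc i) q)" using q by (rule comp_rot_funpow)
      show "Lsame (cyc1 m ((rot Q ^^ Suc i) q))" using cyc1_props(2)[OF c] .
      show "sg (cyc1 m ((rot Q ^^ Suc i) q)) \<notin> K"
      proof
        assume "sg (cyc1 m ((rot Q ^^ Suc i) q)) \<in> K"
        then have "(rot Q ^^ Suc i) q \<in> R m" using K(2) basis_set_cyc1[OF _ c] by blast
        then have "(rot Q ^^ Suc i) q = q" using reps_unique[OF _ cycle1(2), of _ 0 "Suc i"] by simp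
        then show False using period_props(3)[OF q, of "Suc i"] i by simp
      qed
    qed
    then have "lk ?X (cyc1 m q) = 0" using cycle_coboundary[of ?X m q] X q cycle1 by simp
    then show ?thesis using single[of "cyc1 m q"] cycle1(1) by simp
  next
    case (max_anti u w)
    have mp: "mpath False u" using max_anti(2) by (simp add: mmax_def)
    have "\<not> Lsame (u, w) \<and> \<not> Rsame (u, w)" using odot_pair[OF max_anti(3) mp] by blast
    then show ?thesis using core[of "(u, w)"] max_anti(1) by simp
  next
    case (max_path u)
    then show ?thesis using core[of "((psource u, []), u)"] by simp
  next
    case (arrow \<alpha>)
    obtain g where g: "g \<in> bardzell_cochains Q 0 0" "?X = bardzell_diff Q 0 0 g"
      using X arrow by (auto simp: bardzell_coboundaries_def)
    \<comment> \<open>No arrow of the tree contributes a basis element, so \<open>g\<close> is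
      constant along the tree and hence on all vertices.\<close>
    have "lk g (triv (source Q \<beta>)) = lk g (triv (target Q \<beta>))" if \<beta>: "\<beta> \<in> T" for \<beta>
    proof -
      have \<beta>': "\<beta> \<in> arrows Q" using \<beta> tree_arrows by blast
      have "sg (arrow_pair \<beta>) \<notin> K" using basis_set_arrow_pair[OF _ \<beta>'] \<beta> K(2) by blast
      then have "lk ?X (arrow_pair \<beta>) = 0" by (intro basis_sum_lookup_zero[OF K(2) arrow_pair_props(2)[OF \<beta>']])
      then show ?thesis using diff_arrow_pair[OF g(1) \<beta>'] g(2) by simp
    qed
    then have "lk g (triv (source Q \<alpha>)) = lk g (triv (target Q \<alpha>))"
      using arrow(2) by - (rule tree_constant[of "\<lambda>x. lk g (triv x)"], auto)
    then have "lk ?X (arrow_pair \<alpha>) = 0" using diff_arrow_pair[OF g(1), of \<alpha>] arrow(2) g(2) by simp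
    then show ?thesis using single[of "arrow_pair \<alpha>"] arrow(1) by simp
  qed
qed

end

section \<open>Spanning modulo coboundaries\<close>

context gentle_tree begin

text \<open>Coboundaries are built into the closure, so a cocycle can be decomposed piece by piece
  without coefficient functions; \<open>spanned_combination\<close> produces these in the
  end.\<close>

inductive_set spanned :: "nat \<Rightarrow> int \<Rightarrow> ((('v, 'a) path \<times> ('v, 'a) path) \<Rightarrow>\<^sub>0 'k::field) set"
  for n :: nat and d :: int where
  coboundary: "h \<in> bardzell_coboundaries Q n d \<Longrightarrow> h \<in> spanned n d"
| step: "s \<in> basis_set n d \<Longrightarrow> f \<in> spanned n d \<Longrightarrow> smult c s + f \<in> spanned n d"

lemma spanned_add: "f \<in> spanned n d \<Longrightarrow> g \<in> spanned n d \<Longrightarrow> f + g \<in> spanned n d"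
proof (induction rule: spanned.induct)
  case (coboundary h)
  from coboundary(2,1) show ?case
  proof (induction rule: spanned.induct)
    case (coboundary h')
    then show ?case by (intro spanned.coboundary bardzell_coboundaries_add)
  next
    case (step s f c)
    then have "smult c s + (h + f) \<in> spanned n d" by (intro spanned.step)
    then show ?case by (simp add: algebra_simps)
  qed
next
  case (step s f c)
  then have "smult c s + (f + g) \<in> spanned n d" by (intro spanned.step)
  then show ?case by (simp add: algebra_simps)
qed

lemma spanned_smult: "f \<in> spanned n d \<Longrightarrow> smult a f \<in> spanned n d"
proof (induction rule: spanned.induct)
  case (coboundary h)
  then show ?case by (intro spanned.coboundary bardzell_coboundaries_smult)
next
  case (step s f c)
  then have "smult (a * c) s + smult a f \<in> spanned n d" by (intro spanned.step)
  then show ?case by (simp add: smult_add)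
qed

lemma spanned_zero: "0 \<in> spanned n d"
  by (intro spanned.coboundary bardzell_coboundaries_zero)

lemma spanned_basis: "s \<in> basis_set n d \<Longrightarrow> s \<in> spanned n d"
  using spanned.step[OF _ spanned_zero, of s n d 1] by simp

lemma spanned_diff: "f \<in> spanned n d \<Longrightarrow> g \<in> spanned n d \<Longrightarrow> f - g \<in> spanned n d"
  using spanned_add[of f n d "smult (-1) g"] spanned_smult[of g n d "-1"] by (simp add: smult_minus_one)

lemma spanned_sum: "(\<And>x. x \<in> X \<Longrightarrow> f x \<in> spanned n d) \<Longrightarrow> (\<Sum>x\<in>X. f x) \<in> spanned n d"
  by (induction X rule: infinite_finite_induct) (auto intro: spanned_add spanned_zero)

lemma spanned_combination:
  "f \<in> spanned n d \<Longrightarrow>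
    \<exists>K c. finite K \<and> K \<subseteq> basis_set n d \<and> f - (\<Sum>s\<in>K. smult (c s) s) \<in> bardzell_coboundaries Q n d"
proof (induction rule: spanned.induct)
  case (coboundary h)
  then show ?case by (intro exI[of _ "{}"]) simp
next
  case (step s f c)
  then obtain K b where K: "finite K" "K \<subseteq> basis_set n d"
    "f - (\<Sum>s\<in>K. smult (b s) s) \<in> bardzell_coboundaries Q n d" by blast
  \<comment> \<open>If \<open>s\<close> already occurs in \<open>K\<close>, the new coefficient is
    added to the old one.\<close>
  let ?b = "b(s := c + (if s \<in> K then b s else 0))"
  have r: "(\<Sum>t\<in>K - {s}. smult (?b t) t) = (\<Sum>t\<in>K - {s}. smult (b t) t)" by (intro sum.cong) auto
  have "(\<Sum>t\<in>insert s K. smult (?b t) t) = smult (?b s) s + (\<Sum>t\<in>K - {s}. smult (?b t) t)"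
    using K(1) by (simp only: sum.insert_remove)
  also have "\<dots> = smult c s + (\<Sum>t\<in>K. smult (b t) t)"
    unfolding r using K(1) by (cases "s \<in> K") (simp_all add: smult_add_left sum.remove)
  finally have e: "smult c s + f - (\<Sum>t\<in>insert s K. smult (?b t) t) = f - (\<Sum>s\<in>K. smult (b s) s)" by simp
  have "smult c s + f - (\<Sum>t\<in>insert s K. smult (?b t) t) \<in> bardzell_coboundaries Q n d"
    unfolding e by (rule K(3))
  moreover have "finite (insert s K)" "insert s K \<subseteq> basis_set n d" using K step(1) by simp_all
  ultimately show ?case by blast
qed

lemma cocycle_lin:
  assumes "f \<in> bardzell_cochains Q n d" "bardzell_diff Q n d f = 0"
    "g \<in> bardzell_cochains Q n d" "bardzell_diff Q n d g = 0"
  shows "smult c f + g \<in> bardzell_cochains Q n d" "bardzell_diff Q n d (smult c f + g) = 0"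
  using bardzell_cochains_lin[OF assms(1,3)] bardzell_diff_lin[OF assms(1,3)] assms(2,4) by simp_all

lemma spanned_cocycle:
  "f \<in> spanned n d \<Longrightarrow> f \<in> bardzell_cochains Q n d \<and> bardzell_diff Q n d f = 0"
proof (induction rule: spanned.induct)
  case (coboundary h)
  then show ?case using coboundary_cocycle by blast
next
  case (step s f c)
  then show ?case using cocycle_lin basis_set_cocycle by blast
qed

lemma spanned_remove:
  assumes f: "f \<in> bardzell_cochains Q n d" "bardzell_diff Q n d f = 0" and g: "g \<in> spanned n d"
    and r: "f - g \<in> bardzell_cochains Q n d \<Longrightarrow> bardzell_diff Q n d (f - g) = 0 \<Longrightarrow> f - g \<in> spanned n d"
  shows "f \<in> spanned n d"
proof -
  have e: "f - g = smult (-1) g + f" by (simp add: smult_minus_one)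
  have "f - g \<in> spanned n d"
    unfolding e using spanned_cocycle[OF g] cocycle_lin[of g n d f "-1"] f r unfolding e by blast
  then show ?thesis using spanned_add[OF _ g, of "f - g"] by simp
qed

lemma spanned_remove_keys:
  fixes f :: "(('v, 'a) path \<times> ('v, 'a) path) \<Rightarrow>\<^sub>0 'k::field"
  assumes f: "f \<in> bardzell_cochains Q n d" "bardzell_diff Q n d f = 0"
    and P: "\<And>k. P k \<Longrightarrow> lk f k \<noteq> 0 \<Longrightarrow> (sg k :: _ \<Rightarrow>\<^sub>0 'k) \<in> spanned n d"
    and r: "\<And>g. g \<in> bardzell_cochains Q n d \<Longrightarrow> bardzell_diff Q n d g = 0 \<Longrightarrow>
      (\<And>k. lk g k = (if P k then 0 else lk f k)) \<Longrightarrow> g \<in> spanned n d"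
  shows "f \<in> spanned n d"
proof -
  let ?g = "\<Sum>k\<in>{k \<in> Poly_Mapping.keys f. P k}. smult (lk f k) (sg k)"
  have g: "?g \<in> spanned n d" using P by (intro spanned_sum spanned_smult) (auto simp: in_keys_iff)
  have "lk ?g k = (\<Sum>j\<in>{k \<in> Poly_Mapping.keys f. P k}. if j = k then lk f k else 0)" for k
    by (auto simp: lookup_sum lookup_single when_def intro!: sum.cong)
  then have "lk (f - ?g) k = (if P k then 0 else lk f k)" for k
    by (auto simp: lookup_minus in_keys_iff)
  then show ?thesis using spanned_remove[OF f g] r by blast
qed

text \<open>If \<open>u\<close> is nonempty, an arrow prolonging it as an anti-path also prolongs a
  nonempty \<open>v\<close> as a path of \<open>A\<close>: their outer arrows differ, and gentleness
  allows only one of the two products to lie in \<open>I\<close>. So for a terminal pair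
  \<open>u\<close> is maximal. If \<open>u\<close> is empty, any arrow prolonging \<open>v\<close>
  prolongs the pair, so \<open>v\<close> is maximal.\<close>

lemma terminal_basis_set:
  assumes k: "k \<in> bardzell_basis Q n d" "\<not> special k" "terminal k" "\<not> Lsame k" "\<not> Rsame k"
  shows "(sg k :: _ \<Rightarrow>\<^sub>0 'k::field) \<in> basis_set n d"
proof -
  have g: "good k" "plength (fst k) = n" "pdegree Q (snd k) - pdegree Q (fst k) = d"
    using k(1) by (auto simp: bardzell_basis_good)
  obtain y u v where kk: "k = ((y, u), (y, v))" using g(1) by (rule good_elim)
  have g': "good ((y, u), (y, v))" using g(1) kk by simp
  then have paths: "mpath False (y, u)" "mpath True (y, v)" "ptarget Q (y, u) = ptarget Q (y, v)"
    by (auto simp: good_iff)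
  have tl: "\<not> good ((y, \<alpha> # u), (y, \<alpha> # v))" for \<alpha> using k(3) unfolding kk terminal_iff by blast
  have tr: "\<not> good ((source Q \<beta>, u @ [\<beta>]), (source Q \<beta>, v @ [\<beta>]))" if "target Q \<beta> = y" for \<beta>
    using k(3) that unfolding kk terminal_iff by blast
  have hd: "hd u \<noteq> hd v" "last u \<noteq> last v" if "u \<noteq> []" "v \<noteq> []"
    using k(4,5) that unfolding kk Lsame_def Rsame_def by auto
  have hv: "hd v \<in> arrows Q" "last v \<in> arrows Q" "source Q (last v) = y" "ptarget Q (y, v) = target Q (hd v)" if "v \<noteq> []"
    using paths(2) that mpath_ends[of True "(y, v)"] by (auto simp: ptarget_def)
  have hu: "hd u \<in> arrows Q" "last u \<in> arrows Q" "source Q (last u) = y" "ptarget Q (y, u) = target Q (hd u)" if "u \<noteq> []"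
    using paths(1) that mpath_ends[of False "(y, u)"] by (auto simp: ptarget_def)
  show ?thesis
  proof (cases "u = []")
    case False
    have "\<not> link False \<alpha> (hd u)" for \<alpha>
    proof
      assume l: "link False \<alpha> (hd u)"
      have "link True \<alpha> (hd v)" if v: "v \<noteq> []"
        using link_cases[of "hd v" \<alpha> False] link_arrows[OF l] hv[OF v] hu[OF False] paths(3) link_unique(2)[OF l, of "hd v"]
          hd(1)[OF False v] by auto
      then have "good ((y, \<alpha> # u), (y, \<alpha> # v))"
        using l link_arrows[OF l] hu[OF False] g' by (simp add: good_Cons)
      then show False using tl by blast
    qed
    moreover have "\<not> link False (last u) \<beta>" for \<beta>
    proof
      assume l: "link False (last u) \<beta>"
      have t: "target Q \<beta> = y" using link_arrows[OF l] hu[OF False] by simp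
      have "link True (last v) \<beta>" if v: "v \<noteq> []"
        using link_cases[of \<beta> "last v" False] link_arrows[OF l] hv[OF v] hu[OF False] link_unique(1)[OF l, of "last v"]
          hd(2)[OF False v] by auto
      then have "good ((source Q \<beta>, u @ [\<beta>]), (source Q \<beta>, v @ [\<beta>]))"
        using l link_arrows[OF l] t g' by (simp add: good_snoc)
      then show False using tr t by blast
    qed
    ultimately have "mmax False (y, u)" unfolding mmax_iff[OF paths(1) False] by blast
    moreover have "odot Q (y, u) (y, v)"
      using paths hd by (auto simp: odot_def mpath_def parallel_def psource_def)
    ultimately show ?thesis using basis_set.max_anti[of "(y, u)" "(y, v)" n d] g kk by simp
  next
    case True
    have v: "v \<noteq> []" using k(2) kk True by (auto simp: special_def core_def)
    have y: "target Q (hd v) = y" using paths(3) hv(4)[OF v] True by simp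
    have "\<not> link True \<alpha> (hd v)" for \<alpha>
    proof
      assume l: "link True \<alpha> (hd v)"
      have "good ((y, \<alpha> # u), (y, \<alpha> # v))"
        using l link_arrows[OF l] y True g' by (simp add: good_Cons)
      then show False using tl by blast
    qed
    moreover have "\<not> link True (last v) \<beta>" for \<beta>
    proof
      assume l: "link True (last v) \<beta>"
      have t: "target Q \<beta> = y" using link_arrows[OF l] hv[OF v] by simp
      have "good ((source Q \<beta>, u @ [\<beta>]), (source Q \<beta>, v @ [\<beta>]))"
        using l link_arrows[OF l] t g' True good_snoc[of "source Q \<beta>" "[]" \<beta> v] by simp
      then show False using tr t by blast
    qed
    ultimately have "mmax True (y, v)" unfolding mmax_iff[OF paths(2) v] by blast
    then show ?thesis using basis_set.max_path[of "(y, v)" n d] g kk True paths(3)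
      by (simp add: psource_def plength_def pdegree_def)
  qed
qed

lemma arrow_spanned:
  assumes \<alpha>: "\<alpha> \<in> arrows Q"
  shows "(sg (arrow_pair \<alpha>) :: _ \<Rightarrow>\<^sub>0 'k::field) \<in> spanned 1 0"
proof (cases "\<alpha> \<in> T")
  case False
  then show ?thesis using \<alpha> by (intro spanned_basis basis_set.arrow) auto
next
  case True
  have fin: "finite (arrows Q)" "finite (vertices Q)" using gentle by (auto simp: graded_gentle_quiver_def)
  have "finite T" using fin(1) tree_arrows by (rule rev_finite_subset)
  \<comment> \<open>Up to a constant, \<open>G\<close> is the indicator of one side of the tree cut
    at \<open>\<alpha>\<close>. The differential of the combination of vertices with coefficients
    \<open>G\<close> is then \<open>(\<alpha>, \<alpha>)\<close> plus a combination of arrows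
    outside the tree.\<close>
  then have "\<exists>G. \<forall>\<beta>\<in>T. G (source Q \<beta>) - G (target Q \<beta>) = (if \<beta> = \<alpha> then 1 else 0 :: 'k)"
    using tree by (intro forest_potential[OF _ subset_refl]) (auto simp: spanning_tree_def)
  then obtain G where G: "\<And>\<beta>. \<beta> \<in> T \<Longrightarrow> G (source Q \<beta>) - G (target Q \<beta>) = (if \<beta> = \<alpha> then 1 else 0 :: 'k)"
    by blast
  define g where "g = (\<Sum>x\<in>vertices Q. Poly_Mapping.single (triv x) (G x))"
  have lg: "lk g (triv x) = G x" if "x \<in> vertices Q" for x
  proof -
    have "lk g (triv x) = (\<Sum>y\<in>vertices Q. if y = x then G x else 0)"
      by (auto simp: g_def lookup_sum lookup_single when_def triv_def intro!: sum.cong)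
    then show ?thesis using that fin by simp
  qed
  have ng: "\<exists>x\<in>vertices Q. k = triv x" if k: "lk g k \<noteq> 0" for k
  proof (rule ccontr)
    assume "\<not> ?thesis"
    then have "lk g k = (\<Sum>y\<in>vertices Q. 0)"
      unfolding g_def lookup_sum by (intro sum.cong refl) (auto simp: lookup_single when_def)
    then show False using k by simp
  qed
  have gc: "g \<in> bardzell_cochains Q 0 0"
    unfolding bardzell_cochains_iff using ng triv_basis by blast
  let ?h = "\<lambda>\<beta>. smult (G (source Q \<beta>) - G (target Q \<beta>)) (sg (arrow_pair \<beta>))"
  have dg: "bardzell_diff Q 0 0 g = (\<Sum>\<beta>\<in>arrows Q. ?h \<beta>)"
  proof (rule poly_mapping_eqI)
    fix k
    show "lk (bardzell_diff Q 0 0 g) k = lk (\<Sum>\<beta>\<in>arrows Q. ?h \<beta>) k"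
    proof (cases "\<exists>\<beta>\<in>arrows Q. k = arrow_pair \<beta>")
      case True
      then obtain \<beta> where \<beta>: "\<beta> \<in> arrows Q" "k = arrow_pair \<beta>" by blast
      have "lk (\<Sum>\<beta>\<in>arrows Q. ?h \<beta>) k = (\<Sum>\<gamma>\<in>arrows Q. if \<gamma> = \<beta> then G (source Q \<beta>) - G (target Q \<beta>) else 0)"
        unfolding lookup_sum using \<beta> by (intro sum.cong refl) (auto simp: lookup_single when_def arrow_pair_eq)
      then show ?thesis using \<beta> fin diff_arrow_pair[OF gc \<beta>(1)] lg by simp
    next
      case False
      have "lk (\<Sum>\<beta>\<in>arrows Q. ?h \<beta>) k = (\<Sum>\<gamma>\<in>arrows Q. 0)"
        unfolding lookup_sum using False by (intro sum.cong refl) (auto simp: lookup_single when_def)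
      moreover have "lk (bardzell_diff Q 0 0 g) k = 0"
        using ng False by (intro diff_graph[OF gc]) blast+
      ultimately show ?thesis by simp
    qed
  qed
  have "(\<Sum>\<beta>\<in>T. ?h \<beta>) = (\<Sum>\<beta>\<in>T. if \<beta> = \<alpha> then sg (arrow_pair \<alpha>) else 0)"
    using G by (intro sum.cong refl) auto
  then have "(\<Sum>\<beta>\<in>T. ?h \<beta>) = sg (arrow_pair \<alpha>)" using \<open>finite T\<close> True by simp
  then have e: "sg (arrow_pair \<alpha>) = bardzell_diff Q 0 0 g - (\<Sum>\<beta>\<in>arrows Q - T. ?h \<beta>)"
    unfolding dg sum.subset_diff[OF tree_arrows fin(1)] by simp
  have 1: "bardzell_diff Q 0 0 g \<in> spanned 1 0"
    using gc by (intro spanned.coboundary) (auto simp: bardzell_coboundaries_def)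
  have 2: "(\<Sum>\<beta>\<in>arrows Q - T. ?h \<beta>) \<in> spanned 1 0"
    by (intro spanned_sum spanned_smult spanned_basis basis_set.arrow) auto
  from spanned_diff[OF 1 2] show ?thesis unfolding e .
qed

text \<open>The differential of a vertex of the polygon is, up to signs, the difference of its two
  edges. All edges of an orbit are therefore cohomologous up to the accumulated sign.\<close>

lemma cyc1_orbit:
  assumes q: "comp m q"
  shows "i \<le> length (snd q) \<Longrightarrow>
    (sg (cyc1 m (rot Q ((rot Q ^^ i) q))) - smult (cyc_sign m q i) (sg (cyc1 m (rot Q q))) :: _ \<Rightarrow>\<^sub>0 'k::field)
      \<in> bardzell_coboundaries Q (Suc (cyc_len m q)) (cyc_deg m q)"
proof (induction i)
  case 0
  then show ?case by (simp add: bardzell_coboundaries_zero)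
next
  case (Suc i)
  let ?p = "(rot Q ^^ i) q"
  let ?B = "bardzell_coboundaries Q (Suc (cyc_len m q)) (cyc_deg m q) :: (_ \<Rightarrow>\<^sub>0 'k) set"
  let ?s = "cyc_step m ?p :: 'k" and ?e = "(-1) powi cyc_deg m q * (-1) ^ cyc_len m q :: 'k"
  let ?x = "\<lambda>q. sg (cyc1 m q) :: _ \<Rightarrow>\<^sub>0 'k"
  have p: "comp m ?p" using q by (rule comp_rot_funpow)
  have d: "bardzell_diff Q (cyc_len m q) (cyc_deg m q) (sg (cyc0 m (rot Q ?p))) =
      smult ?e (smult ?s (?x (rot Q ?p)) - ?x (rot Q (rot Q ?p)))"
    using cyc0_diff[OF p, where 'k = 'k] by simp
  have c: "(sg (cyc0 m (rot Q ?p)) :: _ \<Rightarrow>\<^sub>0 'k) \<in> bardzell_cochains Q (cyc_len m q) (cyc_deg m q)"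
    using sg_cochain[OF cyc0_basis[OF comp_rot[OF p]]] by simp
  have "smult ?e (smult ?s (?x (rot Q ?p)) - ?x (rot Q (rot Q ?p))) \<in> ?B"
    unfolding d[symmetric] using c by (simp add: bardzell_coboundaries_def)
  then have "smult (- ?e) (smult ?e (smult ?s (?x (rot Q ?p)) - ?x (rot Q (rot Q ?p)))) \<in> ?B"
    by (rule bardzell_coboundaries_smult)
  moreover have "- ?e * ?e = -1" by (simp add: power_int_def power_mult_distrib[symmetric] mult_ac)
  ultimately have 1: "?x (rot Q (rot Q ?p)) - smult ?s (?x (rot Q ?p)) \<in> ?B"
    by (simp add: smult_minus_one)
  have "?x (rot Q ?p) - smult (cyc_sign m q i) (?x (rot Q q)) \<in> ?B" using Suc by simp
  then have 2: "smult ?s (?x (rot Q ?p) - smult (cyc_sign m q i) (?x (rot Q q))) \<in> ?B"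
    by (rule bardzell_coboundaries_smult)
  have s: "cyc_sign m q (Suc i) = (cyc_sign m q i * ?s)" using Suc.prems by (intro cyc_sign_Suc) simp
  show ?case using bardzell_coboundaries_add[OF 1 2] unfolding s by (simp add: smult_diff mult.commute)
qed

lemma cyc1_spanned:
  assumes p: "comp m p"
  shows "(sg (cyc1 m p) :: _ \<Rightarrow>\<^sub>0 'k::field) \<in> spanned (Suc (cyc_len m p)) (cyc_deg m p)"
proof (cases "cyc_ok TYPE('k) m p")
  case True
  obtain q0 i where q0: "q0 \<in> R m" "p = (rot Q ^^ i) q0" using p by (rule reps_exists)
  have c0: "comp m q0" using q0(1) by (rule reps_comp)
  \<comment> \<open>\<open>cyc1_orbit\<close> compares with the edge of \<open>rot Q q\<close>, so
    it is started one rotation before the representative.\<close>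
  obtain q where q: "comp m q" "rot Q q = q0" using rot_inverse[OF c0] by metis
  have ok: "cyc_ok TYPE('k) m q0" using True unfolding q0(2) by (simp add: cyc_ok_def)
  let ?j = "i mod period Q q0"
  have l: "length (snd q0) = length (snd q)" unfolding q(2)[symmetric] by simp
  have "?j < period Q q0" using period_props(1)[OF c0] by simp
  then have "?j \<le> length (snd q)" using period_props(4)[OF c0] l by simp
  then have "(sg (cyc1 m (rot Q ((rot Q ^^ ?j) q))) - smult (cyc_sign m q ?j) (sg (cyc1 m (rot Q q))) :: _ \<Rightarrow>\<^sub>0 'k)
      \<in> bardzell_coboundaries Q (Suc (cyc_len m q)) (cyc_deg m q)"
    by (rule cyc1_orbit[OF q(1)])
  moreover have "rot Q ((rot Q ^^ ?j) q) = p"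
    unfolding funpow_swap1 q(2) orbit_mod[OF c0] q0(2) ..
  moreover have "cyc_len m q = cyc_len m p" "cyc_deg m q = cyc_deg m p"
    unfolding q0(2) q(2)[symmetric] by simp_all
  ultimately have B: "(sg (cyc1 m p) - smult (cyc_sign m q ?j) (sg (cyc1 m q0)) :: _ \<Rightarrow>\<^sub>0 'k) \<in> spanned (Suc (cyc_len m p)) (cyc_deg m p)"
    using q(2) by (simp add: spanned.coboundary)
  have "(sg (cyc1 m q0) :: _ \<Rightarrow>\<^sub>0 'k) \<in> spanned (Suc (cyc_len m p)) (cyc_deg m p)"
    unfolding q0(2) using ok q0(1) by (intro spanned_basis basis_set.cycle1) simp_all
  from spanned_add[OF B spanned_smult[OF this, of "cyc_sign m q ?j"]] show ?thesis by simp
next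
  case False
  obtain q where q: "comp m q" "rot Q q = p" using rot_inverse[OF p] by metis
  have e: "cyc_len m q = cyc_len m p" "cyc_deg m q = cyc_deg m p" "pdegree Q q = pdegree Q p"
    unfolding q(2)[symmetric] by simp_all
  \<comment> \<open>Transport once around the whole word turns the edge into its negative, so twice
    the edge is a coboundary; outside characteristic 2 this can be halved.\<close>
  have s: "cyc_sign m q (length (snd q)) = (-1 :: 'k)"
    using cyc_sign_length[OF q(1), where 'k = 'k] False e by (simp add: cyc_ok_def)
  have "(sg (cyc1 m p) - smult (-1) (sg (cyc1 m p)) :: _ \<Rightarrow>\<^sub>0 'k) \<in> bardzell_coboundaries Q (Suc (cyc_len m p)) (cyc_deg m p)"
    using cyc1_orbit[OF q(1) order_refl, where 'k = 'k] unfolding s e rot_length[OF q(1)] q(2) .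
  then have "smult (1 / 2) (sg (cyc1 m p) - smult (-1) (sg (cyc1 m p)) :: _ \<Rightarrow>\<^sub>0 'k) \<in> spanned (Suc (cyc_len m p)) (cyc_deg m p)"
    by (intro spanned_smult spanned.coboundary)
  moreover have "smult (1 / 2) (sg (cyc1 m p) - smult (-1) (sg (cyc1 m p)) :: _ \<Rightarrow>\<^sub>0 'k) = sg (cyc1 m p)"
    using False not_char_two[where 'k = 'k] by (simp add: smult_diff single_diff[symmetric] cyc_ok_def field_simps)
  ultimately show ?thesis by simp
qed

text \<open>Such a pair is an edge, either of the quiver itself or of a polygon.\<close>

lemma Lsame_special_spanned:
  assumes k: "k \<in> bardzell_basis Q n d" "Lsame k" "special k"
  shows "(sg k :: _ \<Rightarrow>\<^sub>0 'k::field) \<in> spanned n d"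
proof -
  have g: "good k" "plength (fst k) = n" "pdegree Q (snd k) - pdegree Q (fst k) = d"
    using k(1) by (auto simp: bardzell_basis_good)
  have "core (lstrip k)" using k(2,3) core_not_same unfolding special_def by blast
  with lstrip_good[OF g(1) k(2)] show ?thesis
  proof (cases rule: core_cases)
    case (1 x)
    then obtain \<alpha> where \<alpha>: "\<alpha> \<in> arrows Q" "k = arrow_pair \<alpha>" using strip_triv(1)[OF g(1) k(2)] by blast
    then have "n = 1" "d = 0" using g by (auto simp: arrow_pair_eq plength_def)
    then show ?thesis using arrow_spanned[OF \<alpha>(1)] \<alpha>(2) by simp
  next
    case (2 m q)
    then have kc: "k = cyc1 m q" using cyc1_unique_left[OF 2(1) g(1) k(2)] by blast
    then have "n = Suc (cyc_len m q)" "d = cyc_deg m q"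
      using g cyc1_basis[OF 2(1)] by (auto simp: bardzell_basis_good)
    then show ?thesis using cyc1_spanned[OF 2(1)] kc by simp
  qed
qed

lemma cocycle_orbit:
  fixes f :: "(('v, 'a) path \<times> ('v, 'a) path) \<Rightarrow>\<^sub>0 'k::field"
  assumes f: "f \<in> bardzell_cochains Q (cyc_len m q) (cyc_deg m q)" "bardzell_diff Q (cyc_len m q) (cyc_deg m q) f = 0"
    and q: "comp m q"
  shows "i \<le> length (snd q) \<Longrightarrow> lk f (cyc0 m ((rot Q ^^ i) q)) = cyc_sign m q i * lk f (cyc0 m q)"
proof (induction i)
  case (Suc i)
  let ?p = "(rot Q ^^ i) q"
  have "cyc_step m ?p * lk f (cyc0 m (rot Q ?p)) = lk f (cyc0 m ?p)"
    using cocycle_cyc_step[OF f(1) comp_rot_funpow[OF q], of i] f(2) by simp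
  then have "lk f (cyc0 m (rot Q ?p)) = cyc_step m ?p * lk f (cyc0 m ?p)" by (metis cyc_step_square)
  moreover have "cyc_sign m q (Suc i) = (cyc_sign m q i * cyc_step m ?p :: 'k)"
    using Suc.prems by (intro cyc_sign_Suc) simp
  ultimately show ?case using Suc by (simp add: mult_ac)
qed simp

text \<open>On the component of \<open>k\<close> a cocycle is determined by one value: it is
  constant on the vertices of the quiver by connectedness, and follows the signs of
  \<open>N\<^sup>0\<close> on a polygon. The witness \<open>b\<close> is the basis element of that
  component, and \<open>a\<close> is the factor.\<close>

lemma core_cocycle_step:
  fixes f :: "(('v, 'a) path \<times> ('v, 'a) path) \<Rightarrow>\<^sub>0 'k::field"
  assumes f: "f \<in> bardzell_cochains Q n d" "bardzell_diff Q n d f = 0"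
    and k: "lk f k \<noteq> 0" "core k"
  shows "\<exists>b\<in>basis_set n d. \<exists>a. lk b k \<noteq> 0 \<and> (\<forall>j. lk b j \<noteq> 0 \<longrightarrow> core j \<and> lk f j = a * lk b j)"
proof -
  have kb: "k \<in> bardzell_basis Q n d" using f(1) k(1) by (simp add: bardzell_cochains_iff)
  then have "good k" by (simp add: bardzell_basis_good)
  from this k(2) show ?thesis
  proof (cases rule: core_cases)
    case (1 x)
    then have nd: "n = 0" "d = 0" "x \<in> vertices Q" using kb by (simp_all add: triv_basis)
    have "lk f (triv (source Q \<alpha>)) = lk f (triv (target Q \<alpha>))" if "\<alpha> \<in> T" for \<alpha>
      using diff_arrow_pair[of f \<alpha>] f nd that tree_arrows by auto
    then have "lk f (triv y) = lk f k" if "y \<in> vertices Q" for y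
      unfolding 1 using that nd(3) by - (rule tree_constant[of "\<lambda>x. lk f (triv x)"])
    then have "\<forall>j. lk (unit_element Q :: _ \<Rightarrow>\<^sub>0 'k) j \<noteq> 0 \<longrightarrow> core j \<and> lk f j = lk f k * lk (unit_element Q) j"
      by (auto simp: lookup_unit triv_def core_def)
    moreover have "lk (unit_element Q :: _ \<Rightarrow>\<^sub>0 'k) k \<noteq> 0" using 1 nd by (auto simp: lookup_unit)
    ultimately show ?thesis using basis_set.unit[OF nd(1,2), where 'k = 'k] by blast
  next
    case (2 m q)
    have nd: "n = cyc_len m q" "d = cyc_deg m q"
      using kb cyc0_basis[OF 2(1)] 2(2) by (auto simp: bardzell_basis_good)
    obtain q0 i where q0: "q0 \<in> R m" "q = (rot Q ^^ i) q0" using 2(1) by (rule reps_exists)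
    have c0: "comp m q0" using q0(1) by (rule reps_comp)
    have e: "cyc_len m q = cyc_len m q0" "cyc_deg m q = cyc_deg m q0" "pdegree Q q = pdegree Q q0"
      unfolding q0(2) by simp_all
    have orbit: "lk f (cyc0 m ((rot Q ^^ j) q0)) = cyc_sign m q0 j * lk f (cyc0 m q0)" if "j < period Q q0" for j
      using cocycle_orbit[of f m q0 j] f c0 that period_props(4)[OF c0] unfolding nd e by simp
    have coeffs: "lk (cycN0 m q0) (cyc0 m ((rot Q ^^ j) q0)) = (cyc_sign m q0 j :: 'k)" if "j < period Q q0" for j
      using lookup_cycN0_orbit[OF c0 that] .
    \<comment> \<open>If the product of signs is -1, transport around the word gives
      \<open>lk f k = - lk f k\<close>, which excludes a nonzero value outside characteristic
      2.\<close>
    have ok: "cyc_ok TYPE('k) m q"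
    proof (rule ccontr)
      assume no: "\<not> ?thesis"
      then have "cyc_sign m q (length (snd q)) = (-1 :: 'k)"
        using cyc_sign_length[OF 2(1), where 'k = 'k] by (simp add: cyc_ok_def)
      then have "lk f k = - lk f k"
        using cocycle_orbit[of f m q "length (snd q)"] f 2 unfolding nd by simp
      then have "lk f k + lk f k = 0" by (simp only: eq_neg_iff_add_eq_0)
      then have "2 * lk f k = 0" by (simp only: mult_2)
      then show False using k(1) no not_char_two[where 'k = 'k] by (simp add: cyc_ok_def)
    qed
    have "cycN0 m q0 \<in> (basis_set n d :: (_ \<Rightarrow>\<^sub>0 'k) set)"
      using ok q0(1) unfolding nd e by (intro basis_set.cycle0) (simp_all add: cyc_ok_def e)
    moreover have "\<forall>j. lk (cycN0 m q0 :: _ \<Rightarrow>\<^sub>0 'k) j \<noteq> 0 \<longrightarrow> core j \<and> lk f j = lk f (cyc0 m q0) * lk (cycN0 m q0) j"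
    proof (intro allI impI)
      fix j assume "lk (cycN0 m q0 :: _ \<Rightarrow>\<^sub>0 'k) j \<noteq> 0"
      then obtain l where l: "l < period Q q0" "j = cyc0 m ((rot Q ^^ l) q0)"
        using lookup_cycN0_nonzero[OF c0] by metis
      then show "core j \<and> lk f j = lk f (cyc0 m q0) * lk (cycN0 m q0) j"
        using orbit coeffs[OF l(1)] cyc0_core[OF comp_rot_funpow[OF c0]] by simp
    qed
    moreover have "lk (cycN0 m q0 :: _ \<Rightarrow>\<^sub>0 'k) k \<noteq> 0"
    proof -
      let ?l = "i mod period Q q0"
      have l: "?l < period Q q0" using period_props(1)[OF c0] by simp
      have kl: "k = cyc0 m ((rot Q ^^ ?l) q0)" using 2(2) q0(2) orbit_mod[OF c0] by simp
      have "cyc_sign m q0 ?l \<noteq> (0 :: 'k)" using k(1) orbit[OF l] kl by auto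
      then show ?thesis using coeffs[OF l] kl by simp
    qed
    ultimately show ?thesis by blast
  qed
qed

text \<open>Subtracting the multiple found by \<open>core_cocycle_step\<close> removes the support
  of that basis element, which contains \<open>k\<close>, and leaves all other values
  unchanged.\<close>

lemma core_cocycle_spanned:
  fixes f :: "(('v, 'a) path \<times> ('v, 'a) path) \<Rightarrow>\<^sub>0 'k::field"
  assumes "f \<in> bardzell_cochains Q n d" "bardzell_diff Q n d f = 0" "\<And>k. lk f k \<noteq> 0 \<Longrightarrow> core k"
  shows "f \<in> spanned n d"
  using assms
proof (induction "card (Poly_Mapping.keys f)" arbitrary: f rule: less_induct)
  case less
  show ?case
  proof (cases "f = 0")
    case True
    then show ?thesis by (simp add: spanned_zero)
  next
    case False
    then obtain k where k: "lk f k \<noteq> 0" by (metis poly_mapping_eqI lookup_zero)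
    then obtain b a where b: "b \<in> basis_set n d" "lk b k \<noteq> 0" "\<And>j. lk b j \<noteq> 0 \<Longrightarrow> core j \<and> lk f j = a * lk b j"
      using core_cocycle_step[OF less.prems(1,2) k less.prems(3)[OF k]] by metis
    have l: "lk (f - smult a b) j = (if lk b j = 0 then lk f j else 0)" for j
      using b(3)[of j] by (simp add: lookup_minus)
    have "Poly_Mapping.keys (f - smult a b) \<subset> Poly_Mapping.keys f"
    proof (rule psubsetI)
      show "Poly_Mapping.keys (f - smult a b) \<subseteq> Poly_Mapping.keys f"
        by (auto simp: in_keys_iff l split: if_splits)
      have "k \<in> Poly_Mapping.keys f" "k \<notin> Poly_Mapping.keys (f - smult a b)"
        using k b(2) by (simp_all add: in_keys_iff l)
      then show "Poly_Mapping.keys (f - smult a b) \<noteq> Poly_Mapping.keys f" by blast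
    qed
    then have c: "card (Poly_Mapping.keys (f - smult a b)) < card (Poly_Mapping.keys f)"
      by (intro psubset_card_mono) simp
    show ?thesis
    proof (rule spanned_remove[OF less.prems(1,2) spanned_smult[OF spanned_basis[OF b(1)], of a]])
      assume "f - smult a b \<in> bardzell_cochains Q n d" "bardzell_diff Q n d (f - smult a b) = 0"
      then show "f - smult a b \<in> spanned n d"
        using c less.prems(3) by (intro less.hyps) (auto simp: l split: if_splits)
    qed
  qed
qed

text \<open>After correction by a coboundary, every pair in the support that is not special, and
  every special pair with a common first arrow, lies in the span by itself; what remains is
  supported on core pairs.\<close>

lemma cocycle_spanned:
  fixes f :: "(('v, 'a) path \<times> ('v, 'a) path) \<Rightarrow>\<^sub>0 'k::field"
  assumes f: "f \<in> bardzell_cochains Q n d" "bardzell_diff Q n d f = 0"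
  shows "f \<in> spanned n d"
proof -
  obtain h where h: "h \<in> bardzell_coboundaries Q n d" "\<And>k. Lsame k \<Longrightarrow> \<not> special k \<Longrightarrow> lk (f - h) k = 0"
    using kill_Lsame[OF f(1)] by blast
  show ?thesis
  proof (rule spanned_remove[OF f spanned.coboundary[OF h(1)]])
    assume f1: "f - h \<in> bardzell_cochains Q n d" "bardzell_diff Q n d (f - h) = 0"
    show "f - h \<in> spanned n d"
    proof (rule spanned_remove_keys[OF f1])
      show "(sg k :: _ \<Rightarrow>\<^sub>0 'k) \<in> spanned n d" if k: "\<not> special k \<or> Lsame k" "lk (f - h) k \<noteq> 0" for k
      proof -
        have kb: "k \<in> bardzell_basis Q n d" using f1(1) k(2) by (simp add: bardzell_cochains_iff)
        show ?thesis
        proof (cases "special k")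
          case True
          then show ?thesis using Lsame_special_spanned[OF kb] k(1) by blast
        next
          case False
          have "sg k \<in> (bardzell_coboundaries Q n d :: (_ \<Rightarrow>\<^sub>0 'k) set) \<or> terminal k \<and> \<not> Lsame k \<and> \<not> Rsame k"
            using h(2) by (rule nonspecial_key[OF f1 _ False k(2)])
          then show ?thesis
            using spanned.coboundary spanned_basis terminal_basis_set[OF kb False] by blast
        qed
      qed
    next
      fix g assume g: "g \<in> bardzell_cochains Q n d" "bardzell_diff Q n d g = 0"
        "\<And>k. lk g k = (if \<not> special k \<or> Lsame k then 0 else lk (f - h) k)"
      have "core k" if "lk g k \<noteq> 0" for k
        using that unfolding g(3) by (auto simp only: special_def split: if_splits)
      then show "g \<in> spanned n d" using core_cocycle_spanned[OF g(1,2)] by blast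
    qed
  qed
qed

lemma basis_set_HH_basis: "HH_basis Q n d (basis_set n d :: (_ \<Rightarrow>\<^sub>0 'k::field) set)"
  by (rule HH_basis_of_bardzell[OF basis_set_cocycle spanned_combination[OF cocycle_spanned] basis_set_independent])

end

section \<open>Translation to the families of the statement\<close>

theorem theorem2p18:
  fixes Q :: "('v, 'a) graded_quiver"
    and T :: "'a set"
    and Pc Qc :: "('v, 'a) path set"
  assumes "graded_gentle_quiver Q"
    and "\<not> one_vertex_loop Q"
    and "\<not> kronecker_quiver Q"
    and "spanning_tree Q T"
    and "rotation_representatives Q {p. complete_anti_path Q p} Pc"
    and "rotation_representatives Q {q. complete_path Q q} Qc"
  shows "\<forall>(n :: nat) (d :: int). HH_basis Q n d
    ((if n = 0 \<and> d = 0 then {unit_element Q} else {})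
     \<union> {N_anti Q s p | s p. p \<in> Pc \<and> s \<in> {0, 1} \<and>
          n = plength p + s \<and> d = - pdegree Q p \<and>
          (even (omega_anti Q p) \<or> CHAR('k) = 2)}
     \<union> {N_path Q s q | s q. q \<in> Qc \<and> s \<in> {0, 1} \<and>
          n = s \<and> d = pdegree Q q \<and>
          (even (omega_path Q q) \<or> CHAR('k) = 2)}
     \<union> {Poly_Mapping.single (u, w) 1 | u w. maximal_anti_path Q u \<and> odot Q u w \<and>
          n = plength u \<and> d = pdegree Q w - pdegree Q u}
     \<union> {Poly_Mapping.single (trivial (psource u), u) 1 | u. maximal_path Q u \<and>
          psource u = ptarget Q u \<and> n = 0 \<and> d = pdegree Q u}
     \<union> {Poly_Mapping.single (arrow_path Q \<alpha>, arrow_path Q \<alpha>) 1 | \<alpha>. \<alpha> \<in> arrows Q - T \<and>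
          n = 1 \<and> d = 0}
     :: ((('v, 'a) path \<times> ('v, 'a) path) \<Rightarrow>\<^sub>0 'k::field) set)"
proof (intro allI)
  fix n :: nat and d :: int
  interpret gentle Q by unfold_locales (rule assms(1))
  define R where "R = (\<lambda>m. if m then Qc else Pc)"
  interpret gentle_tree Q T R
  proof
    show "spanning_tree Q T" by (rule assms(4))
    show "rotation_representatives Q {q. comp m q} (R m)" for m
      using assms(5,6) by (cases m) (simp_all add: R_def complete_path_comp complete_anti_path_comp)
  qed
  have R: "R False = Pc" "R True = Qc" by (simp_all add: R_def)
  have anti: "N_anti Q 0 p = (cycN0 False p :: _ \<Rightarrow>\<^sub>0 'k)" "N_anti Q 1 p = (sg (cyc1 False p) :: _ \<Rightarrow>\<^sub>0 'k)"
    and path: "N_path Q 0 p = (cycN0 True p :: _ \<Rightarrow>\<^sub>0 'k)" "N_path Q 1 p = (sg (cyc1 True p) :: _ \<Rightarrow>\<^sub>0 'k)" for p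
    by (simp_all add: N_anti_def N_path_def cycN0_def cyc0_def cyc1_def cyc_sign_def cyc_len_def
        trivial_def psource_def Let_def)
  \<comment> \<open>Apart from the characteristic, the two conditions differ only in signs of length
    and degree, which do not affect parity.\<close>
  have ok: "cyc_ok TYPE('k) False p \<longleftrightarrow> even (omega_anti Q p) \<or> CHAR('k) = 2"
    "cyc_ok TYPE('k) True p \<longleftrightarrow> even (omega_path Q p) \<or> CHAR('k) = 2" for p
    by (auto simp: cyc_ok_def omega_anti_def omega_path_def cyc_len_def)
  \<comment> \<open>Turns the two separate families of cycles into one family with an index
    \<open>i \<in> {0, 1}\<close> that also shifts the length.\<close>
  have select: "(\<exists>p\<in>A. X p \<and> (s = F 0 p \<and> n = g p \<or> s = F 1 p \<and> n = Suc (g p))) \<longleftrightarrow>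
      (\<exists>i p. s = F i p \<and> p \<in> A \<and> i \<in> {0, 1} \<and> n = g p + i \<and> X p)"
    for F :: "nat \<Rightarrow> ('v, 'a) path \<Rightarrow> (('v, 'a) path \<times> ('v, 'a) path) \<Rightarrow>\<^sub>0 'k" and A X g s
  proof
    assume "\<exists>p\<in>A. X p \<and> (s = F 0 p \<and> n = g p \<or> s = F 1 p \<and> n = Suc (g p))"
    then obtain p where p: "p \<in> A" "X p" "s = F 0 p \<and> n = g p \<or> s = F 1 p \<and> n = Suc (g p)" by blast
    from p(3) show "\<exists>i p. s = F i p \<and> p \<in> A \<and> i \<in> {0, 1} \<and> n = g p + i \<and> X p"
    proof
      assume "s = F 0 p \<and> n = g p"
      then show ?thesis using p by (intro exI[of _ 0] exI[of _ p]) simp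
    next
      assume "s = F 1 p \<and> n = Suc (g p)"
      then show ?thesis using p by (intro exI[of _ 1] exI[of _ p]) simp
    qed
  qed auto
  let ?S = "(if n = 0 \<and> d = 0 then {unit_element Q} else {})
     \<union> {N_anti Q s p | s p. p \<in> Pc \<and> s \<in> {0, 1} \<and>
          n = plength p + s \<and> d = - pdegree Q p \<and>
          (even (omega_anti Q p) \<or> CHAR('k) = 2)}
     \<union> {N_path Q s q | s q. q \<in> Qc \<and> s \<in> {0, 1} \<and>
          n = s \<and> d = pdegree Q q \<and>
          (even (omega_path Q q) \<or> CHAR('k) = 2)}
     \<union> {Poly_Mapping.single (u, w) 1 | u w. maximal_anti_path Q u \<and> odot Q u w \<and>
          n = plength u \<and> d = pdegree Q w - pdegree Q u}
     \<union> {Poly_Mapping.single (trivial (psource u), u) 1 | u. maximal_path Q u \<and>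
          psource u = ptarget Q u \<and> n = 0 \<and> d = pdegree Q u}
     \<union> {Poly_Mapping.single (arrow_path Q \<alpha>, arrow_path Q \<alpha>) 1 | \<alpha>. \<alpha> \<in> arrows Q - T \<and>
          n = 1 \<and> d = 0} :: ((('v, 'a) path \<times> ('v, 'a) path) \<Rightarrow>\<^sub>0 'k::field) set"
  have "s \<in> basis_set n d \<longleftrightarrow> s \<in> ?S" for s
  proof -
    have "s \<in> basis_set n d \<longleftrightarrow> n = 0 \<and> d = 0 \<and> s = unit_element Q \<or>
      (\<exists>m. \<exists>q\<in>R m. cyc_ok TYPE('k) m q \<and> d = cyc_deg m q \<and>
        (s = cycN0 m q \<and> n = cyc_len m q \<or> s = sg (cyc1 m q) \<and> n = Suc (cyc_len m q))) \<or>
      (\<exists>u w. s = sg (u, w) \<and> mmax False u \<and> odot Q u w \<and> n = plength u \<and> d = pdegree Q w - pdegree Q u) \<or>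
      (\<exists>u. s = sg ((psource u, []), u) \<and> mmax True u \<and> psource u = ptarget Q u \<and> n = 0 \<and> d = pdegree Q u) \<or>
      (\<exists>\<alpha>. s = sg (arrow_pair \<alpha>) \<and> \<alpha> \<in> arrows Q - T \<and> n = 1 \<and> d = 0)"
      unfolding basis_set.simps[of s] by blast
    also have "(\<exists>m. \<exists>q\<in>R m. cyc_ok TYPE('k) m q \<and> d = cyc_deg m q \<and>
        (s = cycN0 m q \<and> n = cyc_len m q \<or> s = sg (cyc1 m q) \<and> n = Suc (cyc_len m q))) \<longleftrightarrow>
      (\<exists>p\<in>Pc. cyc_ok TYPE('k) False p \<and> d = cyc_deg False p \<and>
        (s = cycN0 False p \<and> n = cyc_len False p \<or> s = sg (cyc1 False p) \<and> n = Suc (cyc_len False p))) \<or>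
      (\<exists>q\<in>Qc. cyc_ok TYPE('k) True q \<and> d = cyc_deg True q \<and>
        (s = cycN0 True q \<and> n = cyc_len True q \<or> s = sg (cyc1 True q) \<and> n = Suc (cyc_len True q)))"
      unfolding ex_bool_eq R by blast
    also have "(\<exists>p\<in>Pc. cyc_ok TYPE('k) False p \<and> d = cyc_deg False p \<and>
        (s = cycN0 False p \<and> n = cyc_len False p \<or> s = sg (cyc1 False p) \<and> n = Suc (cyc_len False p))) \<longleftrightarrow>
      (\<exists>i p. s = N_anti Q i p \<and> p \<in> Pc \<and> i \<in> {0, 1} \<and> n = plength p + i \<and> d = - pdegree Q p \<and>
          (even (omega_anti Q p) \<or> CHAR('k) = 2))"
      unfolding anti[symmetric] ok cyc_len_def cyc_deg_def if_False
      using select[of Pc "\<lambda>p. (even (omega_anti Q p) \<or> CHAR('k) = 2) \<and> d = - pdegree Q p" s "N_anti Q" plength]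
      by (simp only: conj_ac)
    also have "(\<exists>q\<in>Qc. cyc_ok TYPE('k) True q \<and> d = cyc_deg True q \<and>
        (s = cycN0 True q \<and> n = cyc_len True q \<or> s = sg (cyc1 True q) \<and> n = Suc (cyc_len True q))) \<longleftrightarrow>
      (\<exists>i q. s = N_path Q i q \<and> q \<in> Qc \<and> i \<in> {0, 1} \<and> n = i \<and> d = pdegree Q q \<and>
          (even (omega_path Q q) \<or> CHAR('k) = 2))"
      unfolding path[symmetric] ok cyc_len_def cyc_deg_def if_True
      using select[of Qc "\<lambda>q. (even (omega_path Q q) \<or> CHAR('k) = 2) \<and> d = pdegree Q q" s "N_path Q" "\<lambda>_. 0"]
      by (simp only: conj_ac add_0)
    finally show ?thesis
      by (simp only: Un_iff mem_Collect_eq maximal_mmax trivial_def arrow_pair_def if_split_mem2 singleton_iff empty_iff) blast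
  qed
  then have "basis_set n d = ?S" by (intro set_eqI)
  then show "HH_basis Q n d ?S" using basis_set_HH_basis[of n d, where 'k = 'k] by metis
qed

end
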